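(* Let $\varphi\colon M\to N$ be a monoid homomorphism and $K$ a commutative ring. Then the extension $\overline\varphi\colon KM\to KN$ is a homological epimorphism if and only if $\varphi$ is a monoid epimorphism and $H_i(\mathcal B(N,M,N),K)=0$ for all $i\geq 1$.
   Context: $KM$ denotes the monoid algebra of $M$ over $K$, and $\overline\varphi$ is the $K$-linear extension of $\varphi$. An epimorphism in a category is a right cancellable arrow $f$ ($gf=hf$ implies $g=h$); a monoid epimorphism is an epimorphism in the category of monoids, and it need not be surjective. A ring homomorphism $R\to S$ is a homological epimorphism if it is an epimorphism of rings and $\mathrm{Tor}^R_i(S,S)=0$ for all $i\geq 1$. For a right $M$-set $X$ and a left $M$-set $Y$, $X\rtimes M\ltimes Y$ is the category with object set $X\times Y$ and arrow set $X\times M\times Y$, where $(x,m,y)$ is an arrow from $(xm,y)$ to $(x,my)$, with composition $(x,m,m'y)(xm,m',y)=(x,mm',y)$ and identities $(x,1,y)$. $\mathcal B(X,M,Y)$ denotes the classifying space (geometric realization of the nerve) of this category. In the statement, $N$ is viewed as both a right and a left $M$-set via $\varphi$, i.e. $n\cdot m=n\varphi(m)$ and $m\cdot n=\varphi(m)n$.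
   Formalization: The commutative ring K is assumed nonzero (1 ≠ 0); for K = 0 the claim fails, since KM = KN = 0 makes the extension a homological epimorphism and all homology vanish even when φ, e.g. 1 → Z/2, is not a monoid epimorphism. *)

theory Defs
  imports
    "HOL-Homology.Homology"
    "HOL-Algebra.Generated_Rings"
    "HOL-Algebra.Weak_Morphisms"
    "HOL-Analysis.Sum_Topology"
begin

section \<open>Epimorphisms of monoids and of rings\<close>

text \<open>
  Membership in \<^const>\<open>hom\<close> does not ask for preservation of the unit, which is not automatic
  for monoids.
\<close>

definition monoid_hom :: "('a, 'x) monoid_scheme \<Rightarrow> ('b, 'y) monoid_scheme \<Rightarrow> ('a \<Rightarrow> 'b) set"
  where "monoid_hom M N = {f \<in> hom M N. f \<one>\<^bsub>M\<^esub> = \<one>\<^bsub>N\<^esub>}"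

text \<open>
  Right cancellability has to be tested on targets living in a fixed type. If two homomorphisms out
  of \<open>N\<close> are distinct, then they are distinct into the subobject generated by their images, which
  embeds into the lists over the type of \<open>N\<close>. Hence testing on that type is the same as testing on
  monoids (rings) of arbitrary type; see \<open>monoid_epiD\<close> and \<open>ring_epiD\<close> below.
\<close>

definition monoid_epi ::
    "('a, 'x) monoid_scheme \<Rightarrow> ('b, 'y) monoid_scheme \<Rightarrow> ('a \<Rightarrow> 'b) \<Rightarrow> bool"
  where "monoid_epi M N f \<longleftrightarrow> f \<in> monoid_hom M N \<and>
    (\<forall>(T :: 'b list monoid) g h. monoid T \<and> g \<in> monoid_hom N T \<and> h \<in> monoid_hom N T \<and>
       (\<forall>x\<in>carrier M. g (f x) = h (f x)) \<longrightarrow> (\<forall>y\<in>carrier N. g y = h y))"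

definition ring_epi ::
    "('a, 'x) ring_scheme \<Rightarrow> ('b, 'y) ring_scheme \<Rightarrow> ('a \<Rightarrow> 'b) \<Rightarrow> bool"
  where "ring_epi R S f \<longleftrightarrow> f \<in> ring_hom R S \<and>
    (\<forall>(T :: 'b list ring) g h. ring T \<and> g \<in> ring_hom S T \<and> h \<in> ring_hom S T \<and>
       (\<forall>x\<in>carrier R. g (f x) = h (f x)) \<longrightarrow> (\<forall>y\<in>carrier S. g y = h y))"

lemma inj_list_list: "\<exists>e :: 'a list list \<Rightarrow> 'a list. inj e"
proof -
  define c :: "'a list list \<Rightarrow> nat"
    where "c l = prod_encode (length (concat l), to_nat (map length l))" for l
  define e :: "'a list list \<Rightarrow> 'a list"
    where "e l = concat l @ replicate (c l - length (concat l)) undefined" for l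
  have len: "length (e l) = c l" for l
    using le_prod_encode_1[of "length (concat l)" "to_nat (map length l)"]
    by (simp add: e_def c_def)
  have "l = l'" if eq: "e l = e l'" for l l'
  proof -
    have "c l = c l'"
      using eq len by metis
    then have 1: "length (concat l) = length (concat l')" and 2: "map length l = map length l'"
      by (auto simp: c_def)
    have "take (length (concat l)) (e l) = concat l" for l
      by (simp add: e_def)
    then have "concat l = concat l'"
      using eq 1 by metis
    then show ?thesis
      using 2 by (auto intro!: concat_injective dest: map_eq_imp_length_eq
          simp: set_zip dest: arg_cong[where f = "\<lambda>xs. xs ! _"])
         (metis map_eq_imp_length_eq nth_map)
  qed
  then show ?thesis
    by (blast intro: injI)
qed

lemma inj_tagged_list: "\<exists>e :: (nat \<times> 'a) list \<Rightarrow> 'a list. inj e"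
proof -
  obtain e :: "'a list list \<Rightarrow> 'a list" where e: "inj e"
    using inj_list_list by blast
  have "inj (\<lambda>(n, s). replicate (Suc n) (s :: 'a))"
    by (auto simp: inj_def)
  then have "inj (map (\<lambda>(n, s). replicate (Suc n) (s :: 'a)))"
    by (simp add: inj_mapI)
  then show ?thesis
    using inj_compose[OF e] by blast
qed

lemma monoid_epiD:
  fixes N :: "('b, 'y) monoid_scheme" and T :: "('c, 'z) monoid_scheme"
  assumes epi: "monoid_epi M N f" and N: "monoid N" and T: "monoid T"
    and g: "g \<in> monoid_hom N T" and h: "h \<in> monoid_hom N T"
    and eq: "\<And>x. x \<in> carrier M \<Longrightarrow> g (f x) = h (f x)" and y: "y \<in> carrier N"
  shows "g y = h y"
proof -
  interpret T: monoid T by (rule T)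
  define run where "run p = foldr (\<lambda>(n, s) t. (if n = 0 then g s else h s) \<otimes>\<^bsub>T\<^esub> t) p \<one>\<^bsub>T\<^esub>"
    for p :: "(nat \<times> 'b) list"
  define W where "W = {p :: (nat \<times> 'b) list. snd ` set p \<subseteq> carrier N}"
  have hom: "g s \<in> carrier T" "h s \<in> carrier T" if "s \<in> carrier N" for s
    using that g h by (auto simp: monoid_hom_def hom_def)
  have run_closed: "run p \<in> carrier T" if "p \<in> W" for p
    using that by (induction p) (auto simp: run_def W_def hom)
  have run_append: "run (p @ q) = run p \<otimes>\<^bsub>T\<^esub> run q" if "p \<in> W" "q \<in> W" for p q
    using that(1)
  proof (induction p)
    case Nil
    then show ?case using run_closed[OF that(2)] by (simp add: run_def)
  next
    case (Cons a p)
    then have p: "p \<in> W" and a: "snd a \<in> carrier N" by (auto simp: W_def)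
    have "run (a # r) = (if fst a = 0 then g (snd a) else h (snd a)) \<otimes>\<^bsub>T\<^esub> run r" for r
      by (simp add: run_def case_prod_beta)
    then show ?case
      using Cons.IH[OF p] run_closed[OF p] run_closed[OF that(2)] hom[OF a] by (simp add: T.m_assoc)
  qed
  define D where "D = run ` W"
  obtain e :: "(nat \<times> 'b) list \<Rightarrow> 'b list" where e: "inj e"
    using inj_tagged_list by blast
  define j where "j x = e (SOME p. p \<in> W \<and> run p = x)" for x
  define k where "k l = run (inv_into UNIV e l)" for l
  have kj: "k (j x) = x" if "x \<in> D" for x
  proof -
    have "\<exists>p. p \<in> W \<and> run p = x" using that by (auto simp: D_def)
    then have "run (SOME p. p \<in> W \<and> run p = x) = x" by (rule someI2_ex) simp
    then show ?thesis by (simp add: k_def j_def inv_f_f[OF e])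
  qed
  have D_carrier: "D \<subseteq> carrier T" using run_closed by (auto simp: D_def)
  have D_mult: "x \<otimes>\<^bsub>T\<^esub> z \<in> D" if xz: "x \<in> D" "z \<in> D" for x z
  proof -
    obtain p q where pq: "p \<in> W" "q \<in> W" "x = run p" "z = run q"
      using xz unfolding D_def by blast
    then have "p @ q \<in> W" by (auto simp: W_def)
    then show ?thesis using run_append[OF pq(1,2)] pq(3,4) unfolding D_def by (metis imageI)
  qed
  have D_one: "\<one>\<^bsub>T\<^esub> \<in> D"
    by (auto simp: D_def W_def run_def intro!: image_eqI[of _ _ "[]"])
  have gD: "g s \<in> D" and hD: "h s \<in> D" if "s \<in> carrier N" for s
  proof -
    have "run [(0, s)] = g s" "run [(1, s)] = h s" "[(0, s)] \<in> W" "[(1, s)] \<in> W"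
      using that hom[OF that] by (auto simp: W_def run_def)
    then show "g s \<in> D" "h s \<in> D"
      unfolding D_def by (metis imageI)+
  qed
  define T' :: "'b list monoid" where
    "T' = \<lparr>carrier = j ` D, monoid.mult = (\<lambda>x z. j (k x \<otimes>\<^bsub>T\<^esub> k z)), one = j \<one>\<^bsub>T\<^esub>\<rparr>"
  have "monoid T'"
  proof (rule monoidI)
    fix x z w assume "x \<in> carrier T'" "z \<in> carrier T'" "w \<in> carrier T'"
    then obtain a b c where abc: "a \<in> D" "b \<in> D" "c \<in> D" "x = j a" "z = j b" "w = j c"
      by (auto simp: T'_def)
    have "a \<in> carrier T" "b \<in> carrier T" "c \<in> carrier T"
      using abc(1-3) D_carrier by auto
    then show "x \<otimes>\<^bsub>T'\<^esub> z \<otimes>\<^bsub>T'\<^esub> w = x \<otimes>\<^bsub>T'\<^esub> (z \<otimes>\<^bsub>T'\<^esub> w)"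
      using abc by (simp add: T'_def kj D_mult T.m_assoc)
  qed (use D_carrier in \<open>auto simp: T'_def kj D_mult D_one subset_iff\<close>)
  moreover have "(\<lambda>s. j (u s)) \<in> monoid_hom N T'"
    if "u \<in> monoid_hom N T" "\<And>s. s \<in> carrier N \<Longrightarrow> u s \<in> D" for u
    using that by (auto simp: monoid_hom_def hom_def T'_def kj Pi_iff)
  ultimately have "monoid T'" "(\<lambda>s. j (g s)) \<in> monoid_hom N T'" "(\<lambda>s. j (h s)) \<in> monoid_hom N T'"
    using g h gD hD by auto
  moreover have "\<forall>x\<in>carrier M. j (g (f x)) = j (h (f x))"
    using eq by simp
  ultimately have "\<forall>y\<in>carrier N. j (g y) = j (h y)"
    using epi unfolding monoid_epi_def by blast
  then show ?thesis
    using y kj gD hD by metis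
qed

lemma ring_epiD:
  fixes S :: "('b, 'y) ring_scheme" and T :: "('c, 'z) ring_scheme"
  assumes epi: "ring_epi R S f" and S: "ring S" and T: "ring T"
    and g: "g \<in> ring_hom S T" and h: "h \<in> ring_hom S T"
    and eq: "\<And>x. x \<in> carrier R \<Longrightarrow> g (f x) = h (f x)" and y: "y \<in> carrier S"
  shows "g y = h y"
proof -
  interpret T: ring T by (rule T)
  \<comment> \<open>Elements of the subring generated by the two images are the values of programs for a stack
    machine, and programs are tagged lists.\<close>
  define ex :: "nat \<times> 'b \<Rightarrow> 'c list \<Rightarrow> 'c list" where
    "ex = (\<lambda>(n, s) st. if n = 0 then g s # st else if n = 1 then h s # st
       else if n = 2 then \<one>\<^bsub>T\<^esub> # st else if n = 3 then (\<ominus>\<^bsub>T\<^esub> hd st) # tl st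
       else if n = 4 then (hd st \<oplus>\<^bsub>T\<^esub> hd (tl st)) # tl (tl st)
       else (hd st \<otimes>\<^bsub>T\<^esub> hd (tl st)) # tl (tl st))"
  define val where "val p = hd (foldr ex p [])" for p
  define H where "H = g ` carrier S \<union> h ` carrier S"
  define D where "D = generate_ring T H"
  have H: "H \<subseteq> carrier T"
    using g h by (auto simp: H_def ring_hom_def)
  have "\<exists>p. \<forall>st. foldr ex p st = x # st" if "x \<in> D" for x
    using that unfolding D_def
  proof (induction rule: generate_ring.induct)
    case one
    show ?case by (rule exI[of _ "[(2, undefined)]"]) (simp add: ex_def)
  next
    case (incl x)
    then consider s where "x = g s" | s where "x = h s" by (auto simp: H_def)
    then show ?case
    proof cases
      case 1 then show ?thesis by (intro exI[of _ "[(0, s)]"]) (simp add: ex_def)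
    next
      case 2 then show ?thesis by (intro exI[of _ "[(1, s)]"]) (simp add: ex_def)
    qed
  next
    case (a_inv x)
    then obtain p where "\<forall>st. foldr ex p st = x # st" by blast
    then show ?case by (intro exI[of _ "(3, undefined) # p"]) (simp add: ex_def)
  next
    case (eng_add x z)
    then obtain p q where "\<forall>st. foldr ex p st = x # st" "\<forall>st. foldr ex q st = z # st" by blast
    then show ?case by (intro exI[of _ "(4, undefined) # p @ q"]) (simp add: ex_def)
  next
    case (eng_mult x z)
    then obtain p q where "\<forall>st. foldr ex p st = x # st" "\<forall>st. foldr ex q st = z # st" by blast
    then show ?case by (intro exI[of _ "(5, undefined) # p @ q"]) (simp add: ex_def)
  qed
  then have val: "\<exists>p. val p = x" if "x \<in> D" for x
    using that by (metis val_def list.sel(1))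
  obtain e :: "(nat \<times> 'b) list \<Rightarrow> 'b list" where e: "inj e"
    using inj_tagged_list by blast
  define j where "j x = e (SOME p. val p = x)" for x
  have kj: "val (inv_into UNIV e (j x)) = x" if "x \<in> D" for x
    using someI_ex[OF val[OF that]] by (simp add: j_def inv_f_f[OF e])
  have inj: "inj_on j D"
    by (metis inj_onI kj)
  define T0 where "T0 = T\<lparr>carrier := D\<rparr>"
  define T' where "T' = image_ring j T0"
  interpret T0: ring T0
    unfolding T0_def D_def by (rule T.generate_ring_is_ring[OF H])
  have "ring T'"
    unfolding T'_def by (rule T0.inj_imp_image_ring_is_ring) (use inj in \<open>simp add: T0_def\<close>)
  moreover have j: "j \<in> ring_hom T0 T'"
    using inj_imp_image_ring_iso[of j T0] inj by (simp add: T0_def T'_def ring_iso_def)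
  have "(\<lambda>s. j (u s)) \<in> ring_hom S T'"
    if "u \<in> ring_hom S T" "\<And>s. s \<in> carrier S \<Longrightarrow> u s \<in> D" for u
  proof -
    have "u \<in> ring_hom S T0"
      using that by (auto simp: ring_hom_def T0_def)
    from ring_hom_trans[OF this j] show ?thesis by (simp add: comp_def)
  qed
  moreover have D: "g s \<in> D" "h s \<in> D" if "s \<in> carrier S" for s
    using that by (auto simp: D_def H_def intro: generate_ring.incl)
  ultimately have "ring T'" "(\<lambda>s. j (g s)) \<in> ring_hom S T'" "(\<lambda>s. j (h s)) \<in> ring_hom S T'"
    using g h by auto
  moreover have "\<forall>x\<in>carrier R. j (g (f x)) = j (h (f x))"
    using eq by simp
  ultimately have "\<forall>y\<in>carrier S. j (g y) = j (h y)"
    using epi unfolding ring_epi_def by blast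
  then show ?thesis
    using y inj D by (meson inj_onD)
qed

section \<open>Finitely supported functions and monoid algebras\<close>

definition fin_combs :: "('k, 'x) ring_scheme \<Rightarrow> 'b set \<Rightarrow> ('b \<Rightarrow> 'k) set"
  where "fin_combs K B = {c. (\<forall>b\<in>B. c b \<in> carrier K) \<and> (\<forall>b. b \<notin> B \<longrightarrow> c b = \<zero>\<^bsub>K\<^esub>)
           \<and> finite {b. c b \<noteq> \<zero>\<^bsub>K\<^esub>}}"

definition supp :: "('k, 'x) ring_scheme \<Rightarrow> ('b \<Rightarrow> 'k) \<Rightarrow> 'b set"
  where "supp K c = {b. c b \<noteq> \<zero>\<^bsub>K\<^esub>}"

definition monoid_algebra ::
    "('k, 'x) ring_scheme \<Rightarrow> ('m, 'y) monoid_scheme \<Rightarrow> ('m \<Rightarrow> 'k) ring"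
  where "monoid_algebra K M =
    \<lparr>carrier = fin_combs K (carrier M),
     monoid.mult = (\<lambda>c d u. \<Oplus>\<^bsub>K\<^esub>p\<in>supp K c \<times> supp K d.
        if fst p \<otimes>\<^bsub>M\<^esub> snd p = u then c (fst p) \<otimes>\<^bsub>K\<^esub> d (snd p) else \<zero>\<^bsub>K\<^esub>),
     one = (\<lambda>u. if u = \<one>\<^bsub>M\<^esub> then \<one>\<^bsub>K\<^esub> else \<zero>\<^bsub>K\<^esub>),
     zero = (\<lambda>u. \<zero>\<^bsub>K\<^esub>),
     add = (\<lambda>c d u. c u \<oplus>\<^bsub>K\<^esub> d u)\<rparr>"

definition monoid_algebra_map ::
    "('k, 'x) ring_scheme \<Rightarrow> ('m \<Rightarrow> 'n) \<Rightarrow> ('m \<Rightarrow> 'k) \<Rightarrow> 'n \<Rightarrow> 'k"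
  where "monoid_algebra_map K f c = (\<lambda>v. \<Oplus>\<^bsub>K\<^esub>u\<in>supp K c. if f u = v then c u else \<zero>\<^bsub>K\<^esub>)"


section \<open>Modules over noncommutative rings and Tor\<close>

text \<open>
  Modules are records of type \<^typ>\<open>('r, 'a) module\<close>, of which only the additive group and
  \<^const>\<open>smult\<close> matter (the fields \<^const>\<open>monoid.mult\<close> and \<^const>\<open>one\<close> inherited from the type of
  rings are ignored). For a right module, \<^term>\<open>r \<odot>\<^bsub>A\<^esub> x\<close> stands for \<open>x \<cdot> r\<close>. The locale
  \<^locale>\<open>module\<close> of the library is not applicable, since it asks for a commutative ring.
\<close>

locale right_module = R?: ring R + A?: abelian_group A
  for R :: "('r, 'x) ring_scheme" (structure) and A :: "('r, 'a, 'y) module_scheme" (structure) +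
  assumes smult_closed: "r \<in> carrier R \<Longrightarrow> x \<in> carrier A \<Longrightarrow> r \<odot>\<^bsub>A\<^esub> x \<in> carrier A"
    and smult_add_scalar: "r \<in> carrier R \<Longrightarrow> s \<in> carrier R \<Longrightarrow> x \<in> carrier A \<Longrightarrow>
      (r \<oplus>\<^bsub>R\<^esub> s) \<odot>\<^bsub>A\<^esub> x = r \<odot>\<^bsub>A\<^esub> x \<oplus>\<^bsub>A\<^esub> s \<odot>\<^bsub>A\<^esub> x"
    and smult_add: "r \<in> carrier R \<Longrightarrow> x \<in> carrier A \<Longrightarrow> y \<in> carrier A \<Longrightarrow>
      r \<odot>\<^bsub>A\<^esub> (x \<oplus>\<^bsub>A\<^esub> y) = r \<odot>\<^bsub>A\<^esub> x \<oplus>\<^bsub>A\<^esub> r \<odot>\<^bsub>A\<^esub> y"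
    and smult_mult: "r \<in> carrier R \<Longrightarrow> s \<in> carrier R \<Longrightarrow> x \<in> carrier A \<Longrightarrow>
      (r \<otimes>\<^bsub>R\<^esub> s) \<odot>\<^bsub>A\<^esub> x = s \<odot>\<^bsub>A\<^esub> (r \<odot>\<^bsub>A\<^esub> x)"
    and smult_one: "x \<in> carrier A \<Longrightarrow> \<one>\<^bsub>R\<^esub> \<odot>\<^bsub>A\<^esub> x = x"

locale left_module = R?: ring R + A?: abelian_group A
  for R :: "('r, 'x) ring_scheme" (structure) and A :: "('r, 'a, 'y) module_scheme" (structure) +
  assumes smult_closed: "r \<in> carrier R \<Longrightarrow> x \<in> carrier A \<Longrightarrow> r \<odot>\<^bsub>A\<^esub> x \<in> carrier A"
    and smult_add_scalar: "r \<in> carrier R \<Longrightarrow> s \<in> carrier R \<Longrightarrow> x \<in> carrier A \<Longrightarrow>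
      (r \<oplus>\<^bsub>R\<^esub> s) \<odot>\<^bsub>A\<^esub> x = r \<odot>\<^bsub>A\<^esub> x \<oplus>\<^bsub>A\<^esub> s \<odot>\<^bsub>A\<^esub> x"
    and smult_add: "r \<in> carrier R \<Longrightarrow> x \<in> carrier A \<Longrightarrow> y \<in> carrier A \<Longrightarrow>
      r \<odot>\<^bsub>A\<^esub> (x \<oplus>\<^bsub>A\<^esub> y) = r \<odot>\<^bsub>A\<^esub> x \<oplus>\<^bsub>A\<^esub> r \<odot>\<^bsub>A\<^esub> y"
    and smult_mult: "r \<in> carrier R \<Longrightarrow> s \<in> carrier R \<Longrightarrow> x \<in> carrier A \<Longrightarrow>
      (r \<otimes>\<^bsub>R\<^esub> s) \<odot>\<^bsub>A\<^esub> x = r \<odot>\<^bsub>A\<^esub> (s \<odot>\<^bsub>A\<^esub> x)"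
    and smult_one: "x \<in> carrier A \<Longrightarrow> \<one>\<^bsub>R\<^esub> \<odot>\<^bsub>A\<^esub> x = x"

definition mod_hom ::
    "('r, 'x) ring_scheme \<Rightarrow> ('r, 'a, 'y) module_scheme \<Rightarrow> ('r, 'b, 'z) module_scheme \<Rightarrow> ('a \<Rightarrow> 'b) set"
  where "mod_hom R A B = {h \<in> carrier A \<rightarrow> carrier B.
    (\<forall>x\<in>carrier A. \<forall>y\<in>carrier A. h (x \<oplus>\<^bsub>A\<^esub> y) = h x \<oplus>\<^bsub>B\<^esub> h y) \<and>
    (\<forall>r\<in>carrier R. \<forall>x\<in>carrier A. h (r \<odot>\<^bsub>A\<^esub> x) = r \<odot>\<^bsub>B\<^esub> h x)}"

definition right_restrict ::
    "('s, 'x) ring_scheme \<Rightarrow> ('r \<Rightarrow> 's) \<Rightarrow> ('r, 's) module"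
  where "right_restrict S f = \<lparr>carrier = carrier S, monoid.mult = monoid.mult S, one = \<one>\<^bsub>S\<^esub>,
    zero = \<zero>\<^bsub>S\<^esub>, add = add S, smult = (\<lambda>r s. s \<otimes>\<^bsub>S\<^esub> f r)\<rparr>"

definition left_restrict ::
    "('s, 'x) ring_scheme \<Rightarrow> ('r \<Rightarrow> 's) \<Rightarrow> ('r, 's) module"
  where "left_restrict S f = \<lparr>carrier = carrier S, monoid.mult = monoid.mult S, one = \<one>\<^bsub>S\<^esub>,
    zero = \<zero>\<^bsub>S\<^esub>, add = add S, smult = (\<lambda>r s. f r \<otimes>\<^bsub>S\<^esub> s)\<rparr>"

lemma right_module_right_restrict:
  assumes "ring R" "ring S" "f \<in> ring_hom R S"
  shows "right_module R (right_restrict S f)"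
proof -
  interpret R: ring R by fact
  interpret S: ring S by fact
  have "abelian_group (right_restrict S f)"
    using S.abelian_group_axioms
    by (auto intro!: abelian_groupI simp: right_restrict_def S.a_ac intro: S.l_neg bexI[OF _ S.a_inv_closed])
  then show ?thesis
    using assms
    by (auto intro!: right_module.intro right_module_axioms.intro
        simp: right_restrict_def ring_hom_def Pi_iff S.l_distr S.r_distr S.m_assoc)
qed

lemma left_module_left_restrict:
  assumes "ring R" "ring S" "f \<in> ring_hom R S"
  shows "left_module R (left_restrict S f)"
proof -
  interpret R: ring R by fact
  interpret S: ring S by fact
  have "abelian_group (left_restrict S f)"
    using S.abelian_group_axioms
    by (auto intro!: abelian_groupI simp: left_restrict_def S.a_ac intro: S.l_neg bexI[OF _ S.a_inv_closed])
  then show ?thesis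
    using assms
    by (auto intro!: left_module.intro left_module_axioms.intro
        simp: left_restrict_def ring_hom_def Pi_iff S.l_distr S.r_distr S.m_assoc)
qed

definition free_right_module :: "('r, 'x) ring_scheme \<Rightarrow> 'b set \<Rightarrow> ('r, 'b \<Rightarrow> 'r) module"
  where "free_right_module R B = \<lparr>carrier = fin_combs R B, monoid.mult = undefined, one = undefined,
    zero = (\<lambda>b. \<zero>\<^bsub>R\<^esub>), add = (\<lambda>c d b. c b \<oplus>\<^bsub>R\<^esub> d b), smult = (\<lambda>r c b. c b \<otimes>\<^bsub>R\<^esub> r)\<rparr>"

text \<open>The tensor product of a right module \<open>A\<close> and a left module \<open>B\<close>, as an abelian group.\<close>

definition tensor_relations ::
    "('r, 'x) ring_scheme \<Rightarrow> ('r, 'a, 'y) module_scheme \<Rightarrow> ('r, 'b, 'z) module_scheme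
      \<Rightarrow> ('a \<times> 'b \<Rightarrow>\<^sub>0 int) set"
  where "tensor_relations R A B = generate (free_Abelian_group (carrier A \<times> carrier B))
    ({frag_of (x \<oplus>\<^bsub>A\<^esub> x', y) - frag_of (x, y) - frag_of (x', y) | x x' y.
        x \<in> carrier A \<and> x' \<in> carrier A \<and> y \<in> carrier B} \<union>
     {frag_of (x, y \<oplus>\<^bsub>B\<^esub> y') - frag_of (x, y) - frag_of (x, y') | x y y'.
        x \<in> carrier A \<and> y \<in> carrier B \<and> y' \<in> carrier B} \<union>
     {frag_of (r \<odot>\<^bsub>A\<^esub> x, y) - frag_of (x, r \<odot>\<^bsub>B\<^esub> y) | r x y.
        r \<in> carrier R \<and> x \<in> carrier A \<and> y \<in> carrier B})"

definition tensor ::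
    "('r, 'x) ring_scheme \<Rightarrow> ('r, 'a, 'y) module_scheme \<Rightarrow> ('r, 'b, 'z) module_scheme
      \<Rightarrow> ('a \<times> 'b \<Rightarrow>\<^sub>0 int) set monoid"
  where "tensor R A B =
    free_Abelian_group (carrier A \<times> carrier B) Mod tensor_relations R A B"

text \<open>The map from \<open>A \<otimes>\<^sub>R B\<close> to \<open>A' \<otimes>\<^sub>R B\<close> induced by \<open>h\<close>; the cosets in the union all coincide.\<close>

definition tensor_map ::
    "('r, 'x) ring_scheme \<Rightarrow> ('r, 'a, 'y) module_scheme \<Rightarrow> ('r, 'b, 'z) module_scheme
      \<Rightarrow> ('c \<Rightarrow> 'a) \<Rightarrow> ('c \<times> 'b \<Rightarrow>\<^sub>0 int) set \<Rightarrow> ('a \<times> 'b \<Rightarrow>\<^sub>0 int) set"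
  where "tensor_map R A' B h C = (\<Union>c\<in>C. tensor_relations R A' B
    #>\<^bsub>free_Abelian_group (carrier A' \<times> carrier B)\<^esub> frag_extend (\<lambda>(x, y). frag_of (h x, y)) c)"

text \<open>
  Homology of a complex of abelian groups in nonnegative degrees, where \<open>d n\<close> maps \<open>C n\<close> to
  \<open>C (n - 1)\<close> for positive \<open>n\<close>, and \<open>d 0\<close> is ignored.
\<close>

definition complex_cycles ::
    "(nat \<Rightarrow> 'a monoid) \<Rightarrow> (nat \<Rightarrow> 'a \<Rightarrow> 'a) \<Rightarrow> nat \<Rightarrow> 'a set"
  where "complex_cycles C d n =
    (if n = 0 then carrier (C 0) else {x \<in> carrier (C n). d n x = \<one>\<^bsub>C (n - 1)\<^esub>})"

definition complex_homology ::
    "(nat \<Rightarrow> 'a monoid) \<Rightarrow> (nat \<Rightarrow> 'a \<Rightarrow> 'a) \<Rightarrow> nat \<Rightarrow> 'a set monoid"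
  where "complex_homology C d n =
    subgroup_generated (C n) (complex_cycles C d n) Mod (d (Suc n) ` carrier (C (Suc n)))"

definition free_resolution ::
    "('r, 'x) ring_scheme \<Rightarrow> ('r, 'a, 'y) module_scheme \<Rightarrow> (nat \<Rightarrow> 'b set)
      \<Rightarrow> (nat \<Rightarrow> ('b \<Rightarrow> 'r) \<Rightarrow> 'b \<Rightarrow> 'r) \<Rightarrow> (('b \<Rightarrow> 'r) \<Rightarrow> 'a) \<Rightarrow> bool"
  where "free_resolution R A X d \<epsilon> \<longleftrightarrow>
    (let F = (\<lambda>n. free_right_module R (X n)) in
      \<epsilon> \<in> mod_hom R (F 0) A \<and> (\<forall>n. d (Suc n) \<in> mod_hom R (F (Suc n)) (F n)) \<and>
      \<epsilon> ` carrier (F 0) = carrier A \<and>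
      d 1 ` carrier (F 1) = {c \<in> carrier (F 0). \<epsilon> c = \<zero>\<^bsub>A\<^esub>} \<and>
      (\<forall>n. d (Suc (Suc n)) ` carrier (F (Suc (Suc n)))
         = {c \<in> carrier (F (Suc n)). d (Suc n) c = \<zero>\<^bsub>F n\<^esub>}))"

lemma right_module_free_right_module:
  assumes "ring R"
  shows "right_module R (free_right_module R X)"
proof -
  interpret R: ring R by fact
  let ?F = "free_right_module R X"
  have carr: "c b \<in> carrier R" if "c \<in> fin_combs R X" for c b
    using that by (cases "b \<in> X") (auto simp: fin_combs_def)
  have add: "(\<lambda>b. c b \<oplus>\<^bsub>R\<^esub> d b) \<in> fin_combs R X" if "c \<in> fin_combs R X" "d \<in> fin_combs R X" for c d
  proof -
    have "{b. c b \<oplus>\<^bsub>R\<^esub> d b \<noteq> \<zero>\<^bsub>R\<^esub>} \<subseteq> {b. c b \<noteq> \<zero>\<^bsub>R\<^esub>} \<union> {b. d b \<noteq> \<zero>\<^bsub>R\<^esub>}"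
      by auto
    then show ?thesis
      using that by (auto simp: fin_combs_def dest: finite_subset)
  qed
  have smult: "(\<lambda>b. c b \<otimes>\<^bsub>R\<^esub> r) \<in> fin_combs R X" if "c \<in> fin_combs R X" "r \<in> carrier R" for c r
  proof -
    have "{b. c b \<otimes>\<^bsub>R\<^esub> r \<noteq> \<zero>\<^bsub>R\<^esub>} \<subseteq> {b. c b \<noteq> \<zero>\<^bsub>R\<^esub>}"
      using that(2) by auto
    then show ?thesis
      using that by (auto simp: fin_combs_def dest: finite_subset)
  qed
  have minus: "\<exists>d\<in>fin_combs R X. (\<lambda>b. d b \<oplus>\<^bsub>R\<^esub> c b) = (\<lambda>b. \<zero>\<^bsub>R\<^esub>)" if c: "c \<in> fin_combs R X" for c
    by (rule bexI[OF _ smult[OF c, of "\<ominus>\<^bsub>R\<^esub> \<one>\<^bsub>R\<^esub>"]]) (auto simp: carr[OF c] R.r_minus R.r_neg R.l_neg)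
  have zero: "(\<lambda>b. \<zero>\<^bsub>R\<^esub>) \<in> fin_combs R X"
    by (simp add: fin_combs_def)
  have "abelian_group ?F"
  proof (rule abelian_groupI)
    fix c d e assume "c \<in> carrier ?F" "d \<in> carrier ?F" "e \<in> carrier ?F"
    then show "c \<oplus>\<^bsub>?F\<^esub> d \<in> carrier ?F" "c \<oplus>\<^bsub>?F\<^esub> d = d \<oplus>\<^bsub>?F\<^esub> c"
      "c \<oplus>\<^bsub>?F\<^esub> d \<oplus>\<^bsub>?F\<^esub> e = c \<oplus>\<^bsub>?F\<^esub> (d \<oplus>\<^bsub>?F\<^esub> e)"
      by (simp_all add: free_right_module_def add R.a_ac carr)
  qed (use minus in \<open>simp_all add: free_right_module_def zero carr\<close>)
  then show ?thesis
    using assms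
    by (auto intro!: right_module.intro right_module_axioms.intro
        simp: free_right_module_def smult R.l_distr R.r_distr R.m_assoc carr)
qed

context right_module
begin

lemma smult_zero_scalar: "x \<in> carrier A \<Longrightarrow> \<zero>\<^bsub>R\<^esub> \<odot>\<^bsub>A\<^esub> x = \<zero>\<^bsub>A\<^esub>"
  using smult_add_scalar[of "\<zero>\<^bsub>R\<^esub>" "\<zero>\<^bsub>R\<^esub>" x] smult_closed[of "\<zero>\<^bsub>R\<^esub>" x]
  by (metis A.add.l_cancel_one' R.zero_closed R.l_zero)

lemma smult_zero: "r \<in> carrier R \<Longrightarrow> r \<odot>\<^bsub>A\<^esub> \<zero>\<^bsub>A\<^esub> = \<zero>\<^bsub>A\<^esub>"
  using smult_add[of r "\<zero>\<^bsub>A\<^esub>" "\<zero>\<^bsub>A\<^esub>"] smult_closed[of r "\<zero>\<^bsub>A\<^esub>"]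
  by (metis A.add.l_cancel_one' A.zero_closed A.l_zero)

lemma smult_finsum:
  assumes r: "r \<in> carrier R" and f: "f \<in> I \<rightarrow> carrier A"
  shows "r \<odot>\<^bsub>A\<^esub> finsum A f I = finsum A (\<lambda>i. r \<odot>\<^bsub>A\<^esub> f i) I"
proof (cases "finite I")
  case True
  then show ?thesis
    using f
  proof (induction I)
    case (insert i I)
    then show ?case
      using r by (simp add: smult_add smult_closed Pi_iff)
  qed (simp add: smult_zero r)
qed (simp add: smult_zero r)

lemma free_cover:
  assumes K: "K \<subseteq> carrier A" "\<zero>\<^bsub>A\<^esub> \<in> K" "\<And>x y. x \<in> K \<Longrightarrow> y \<in> K \<Longrightarrow> x \<oplus>\<^bsub>A\<^esub> y \<in> K"
      "\<And>r x. r \<in> carrier R \<Longrightarrow> x \<in> K \<Longrightarrow> r \<odot>\<^bsub>A\<^esub> x \<in> K"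
    and e: "e ` X = K"
  shows "\<exists>h\<in>mod_hom R (free_right_module R X) A. h ` carrier (free_right_module R X) = K"
proof -
  have eA: "e b \<in> carrier A" if "b \<in> X" for b
    using e K(1) that by blast
  define h where "h c = (\<Oplus>\<^bsub>A\<^esub>b\<in>supp R c. c b \<odot>\<^bsub>A\<^esub> e b)" for c
  have carr: "c b \<in> carrier R" if "c \<in> fin_combs R X" for c b
    using that by (cases "b \<in> X") (auto simp: fin_combs_def)
  have supp: "finite (supp R c)" "supp R c \<subseteq> X" if "c \<in> fin_combs R X" for c
    using that by (auto simp: fin_combs_def supp_def)
  have h_eq: "h c = (\<Oplus>\<^bsub>A\<^esub>b\<in>T. c b \<odot>\<^bsub>A\<^esub> e b)"
    if c: "c \<in> fin_combs R X" and T: "finite T" "supp R c \<subseteq> T" "T \<subseteq> X" for c T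
    unfolding h_def
    by (rule A.add.finprod_mono_neutral_cong_left[OF T(1,2), folded finsum_def])
       (use T(3) in \<open>auto simp: supp_def smult_zero_scalar[OF eA] intro!: smult_closed carr[OF c] eA\<close>)
  interpret F: right_module R "free_right_module R X"
    by (rule right_module_free_right_module) (rule R.ring_axioms)
  have F: "carrier (free_right_module R X) = fin_combs R X"
    "c \<oplus>\<^bsub>free_right_module R X\<^esub> d = (\<lambda>b. c b \<oplus>\<^bsub>R\<^esub> d b)"
    "r \<odot>\<^bsub>free_right_module R X\<^esub> c = (\<lambda>b. c b \<otimes>\<^bsub>R\<^esub> r)" for c d r
    by (auto simp: free_right_module_def)
  have h_in: "h c \<in> K" if c: "c \<in> fin_combs R X" for c
  proof -
    have "(\<Oplus>\<^bsub>A\<^esub>b\<in>T. c b \<odot>\<^bsub>A\<^esub> e b) \<in> K" if "finite T" "T \<subseteq> X" for T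
      using that
    proof (induction T)
      case empty
      then show ?case using K(2) by simp
    next
      case (insert b T)
      then have "c b \<odot>\<^bsub>A\<^esub> e b \<in> K" "(\<Oplus>\<^bsub>A\<^esub>b\<in>T. c b \<odot>\<^bsub>A\<^esub> e b) \<in> K"
        using e carr[OF c] K(4) by blast+
      moreover have "(\<lambda>b. c b \<odot>\<^bsub>A\<^esub> e b) \<in> insert b T \<rightarrow> carrier A"
        using insert.prems carr[OF c] by (auto intro!: smult_closed eA)
      ultimately show ?case
        using insert.hyps K(3) by simp
    qed
    then show ?thesis
      using supp[OF c] by (simp add: h_def)
  qed
  have "h (c \<oplus>\<^bsub>free_right_module R X\<^esub> d) = h c \<oplus>\<^bsub>A\<^esub> h d"
    if c: "c \<in> fin_combs R X" and d: "d \<in> fin_combs R X" for c d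
  proof -
    define T where "T = supp R c \<union> supp R d"
    have T: "finite T" "T \<subseteq> X" "supp R c \<subseteq> T" "supp R d \<subseteq> T" "supp R (\<lambda>b. c b \<oplus>\<^bsub>R\<^esub> d b) \<subseteq> T"
      using supp[OF c] supp[OF d] by (auto simp: T_def supp_def)
    have cd: "(\<lambda>b. c b \<oplus>\<^bsub>R\<^esub> d b) \<in> fin_combs R X"
      using F.A.a_closed[of c d] c d by (simp add: F)
    have TA: "(\<lambda>b. c b \<odot>\<^bsub>A\<^esub> e b) \<in> T \<rightarrow> carrier A" "(\<lambda>b. d b \<odot>\<^bsub>A\<^esub> e b) \<in> T \<rightarrow> carrier A"
      using T(2) carr[OF c] carr[OF d] by (auto intro!: smult_closed eA)
    have "h c = (\<Oplus>\<^bsub>A\<^esub>b\<in>T. c b \<odot>\<^bsub>A\<^esub> e b)" "h d = (\<Oplus>\<^bsub>A\<^esub>b\<in>T. d b \<odot>\<^bsub>A\<^esub> e b)"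
      using T h_eq[OF c, of T] h_eq[OF d, of T] by auto
    then have "h c \<oplus>\<^bsub>A\<^esub> h d = (\<Oplus>\<^bsub>A\<^esub>b\<in>T. c b \<odot>\<^bsub>A\<^esub> e b \<oplus>\<^bsub>A\<^esub> d b \<odot>\<^bsub>A\<^esub> e b)"
      using A.finsum_addf[OF TA] by simp
    also have "\<dots> = (\<Oplus>\<^bsub>A\<^esub>b\<in>T. (c b \<oplus>\<^bsub>R\<^esub> d b) \<odot>\<^bsub>A\<^esub> e b)"
      using T(2) carr[OF c] carr[OF d]
      by (intro A.finsum_cong') (auto simp: smult_add_scalar[OF _ _ eA] intro!: smult_closed eA)
    finally show ?thesis
      using T h_eq[OF cd, of T] by (simp add: F)
  qed
  moreover have "h (r \<odot>\<^bsub>free_right_module R X\<^esub> c) = r \<odot>\<^bsub>A\<^esub> h c"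
    if r: "r \<in> carrier R" and c: "c \<in> fin_combs R X" for r c
  proof -
    have T: "finite (supp R c)" "supp R c \<subseteq> X" "supp R (\<lambda>b. c b \<otimes>\<^bsub>R\<^esub> r) \<subseteq> supp R c"
      using supp[OF c] r by (auto simp: supp_def)
    have rc: "(\<lambda>b. c b \<otimes>\<^bsub>R\<^esub> r) \<in> fin_combs R X"
      using F.smult_closed[of r c] r c by (simp add: F)
    have "r \<odot>\<^bsub>A\<^esub> h c = (\<Oplus>\<^bsub>A\<^esub>b\<in>supp R c. r \<odot>\<^bsub>A\<^esub> (c b \<odot>\<^bsub>A\<^esub> e b))"
      unfolding h_def using T(2) carr[OF c] r
      by (intro smult_finsum) (auto intro!: smult_closed eA)
    also have "\<dots> = (\<Oplus>\<^bsub>A\<^esub>b\<in>supp R c. (c b \<otimes>\<^bsub>R\<^esub> r) \<odot>\<^bsub>A\<^esub> e b)"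
      using T(2) carr[OF c] r
      by (intro A.finsum_cong') (auto simp: smult_mult[OF _ _ eA] intro!: smult_closed eA)
    finally show ?thesis
      using T h_eq[OF rc, of "supp R c"] by (simp add: F)
  qed
  moreover have "K \<subseteq> h ` fin_combs R X"
  proof
    fix x assume "x \<in> K"
    then obtain b where b: "b \<in> X" "x = e b" using e by blast
    define c where "c = (\<lambda>b'. if b' = b then \<one>\<^bsub>R\<^esub> else \<zero>\<^bsub>R\<^esub>)"
    have "{b'. c b' \<noteq> \<zero>\<^bsub>R\<^esub>} \<subseteq> {b}"
      by (auto simp: c_def)
    then have c: "c \<in> fin_combs R X" and "supp R c \<subseteq> {b}"
      using b by (auto simp: fin_combs_def c_def supp_def)
    then have "h c = (\<Oplus>\<^bsub>A\<^esub>b\<in>{b}. c b \<odot>\<^bsub>A\<^esub> e b)"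
      using b(1) by (intro h_eq) auto
    also have "\<dots> = x"
      using b eA[OF b(1)] by (simp add: c_def smult_one)
    finally have "h c = x" .
    then show "x \<in> h ` fin_combs R X"
      using c by blast
  qed
  ultimately have "h \<in> mod_hom R (free_right_module R X) A"
    "h ` carrier (free_right_module R X) = K"
    using h_in K(1) by (auto simp: mod_hom_def F(1))
  then show ?thesis
    by blast
qed

end

lemma mod_hom_kernel:
  assumes "right_module R A" "right_module R B" and h: "h \<in> mod_hom R A B"
  defines "K \<equiv> {x \<in> carrier A. h x = \<zero>\<^bsub>B\<^esub>}"
  shows "K \<subseteq> carrier A" "\<zero>\<^bsub>A\<^esub> \<in> K" "\<And>x y. x \<in> K \<Longrightarrow> y \<in> K \<Longrightarrow> x \<oplus>\<^bsub>A\<^esub> y \<in> K"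
    "\<And>r x. r \<in> carrier R \<Longrightarrow> x \<in> K \<Longrightarrow> r \<odot>\<^bsub>A\<^esub> x \<in> K"
proof -
  interpret A: right_module R A by fact
  interpret B: right_module R B by fact
  have hom: "h x \<in> carrier B" "h (x \<oplus>\<^bsub>A\<^esub> y) = h x \<oplus>\<^bsub>B\<^esub> h y" "r \<in> carrier R \<Longrightarrow> h (r \<odot>\<^bsub>A\<^esub> x) = r \<odot>\<^bsub>B\<^esub> h x"
    if "x \<in> carrier A" "y \<in> carrier A" for x y r
    using h that by (auto simp: mod_hom_def)
  have "h \<zero>\<^bsub>A\<^esub> = \<zero>\<^bsub>B\<^esub>"
    using hom(1,2)[of "\<zero>\<^bsub>A\<^esub>" "\<zero>\<^bsub>A\<^esub>"] by (metis A.A.l_zero A.A.zero_closed B.A.add.l_cancel_one')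
  then show "K \<subseteq> carrier A" "\<zero>\<^bsub>A\<^esub> \<in> K" "\<And>x y. x \<in> K \<Longrightarrow> y \<in> K \<Longrightarrow> x \<oplus>\<^bsub>A\<^esub> y \<in> K"
    "\<And>r x. r \<in> carrier R \<Longrightarrow> x \<in> K \<Longrightarrow> r \<odot>\<^bsub>A\<^esub> x \<in> K"
    by (auto simp: K_def hom A.smult_closed B.smult_zero)
qed

lemma fin_combs_decode:
  "\<exists>dec :: ('a + 'r) list \<Rightarrow> ('a + 'r) list \<Rightarrow> 'r. \<forall>X. fin_combs R X \<subseteq> range dec"
proof -
  obtain e :: "('a + 'r) list list \<Rightarrow> ('a + 'r) list" where e: "inj e"
    using inj_list_list by blast
  define pack :: "('a + 'r) list \<times> 'r \<Rightarrow> ('a + 'r) list" where "pack = (\<lambda>(u, r). u @ [Inr r])"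
  have pack: "inj pack"
    by (auto simp: inj_def pack_def)
  define dec where "dec l u = (case map_of (map (inv_into UNIV pack) (inv_into UNIV e l)) u of
      None \<Rightarrow> \<zero>\<^bsub>R\<^esub> | Some r \<Rightarrow> r)" for l and u :: "('a + 'r) list"
  have "c \<in> range dec" if c: "c \<in> fin_combs R X" for c X
  proof -
    have "finite {u. c u \<noteq> \<zero>\<^bsub>R\<^esub>}"
      using c by (simp add: fin_combs_def)
    then obtain us where us: "set us = {u. c u \<noteq> \<zero>\<^bsub>R\<^esub>}"
      using finite_list by blast
    define l where "l = e (map pack (map (\<lambda>u. (u, c u)) us))"
    have "map (inv_into UNIV pack) (inv_into UNIV e l) = map (\<lambda>u. (u, c u)) us"
      by (simp add: l_def inv_f_f[OF e] inv_f_f[OF pack] comp_def)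
    then have "dec l u = c u" for u
      using us by (simp add: dec_def map_of_map_restrict restrict_map_def set_eq_iff)
    then have "dec l = c"
      by blast
    then show ?thesis
      by (metis rangeI)
  qed
  then show ?thesis
    by blast
qed

text \<open>
  Tor is computed from a free resolution of the right module. Bases are taken in
  \<^typ>\<open>('a + 'r) list\<close>, a type which is large enough for a resolution to exist: see
  \<open>free_resolution_exists\<close> below.
\<close>

definition chosen_resolution ::
    "('r, 'x) ring_scheme \<Rightarrow> ('r, 'a, 'y) module_scheme \<Rightarrow>
      (nat \<Rightarrow> ('a + 'r) list set) \<times> (nat \<Rightarrow> (('a + 'r) list \<Rightarrow> 'r) \<Rightarrow> ('a + 'r) list \<Rightarrow> 'r)"
  where "chosen_resolution R A = (SOME (X, d). \<exists>\<epsilon>. free_resolution R A X d \<epsilon>)"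

lemma free_resolution_exists:
  fixes R :: "('r, 'x) ring_scheme" and A :: "('r, 'a, 'y) module_scheme"
  assumes A: "right_module R A"
  shows "\<exists>(X :: nat \<Rightarrow> ('a + 'r) list set) d \<epsilon>. free_resolution R A X d \<epsilon>"
proof -
  interpret A: right_module R A by fact
  have ring: "ring R" by (rule A.R.ring_axioms)
  let ?F = "\<lambda>X :: ('a + 'r) list set. free_right_module R X"
  have F: "right_module R (?F X)" for X
    by (rule right_module_free_right_module[OF ring])
  define e0 :: "('a + 'r) list \<Rightarrow> 'a" where "e0 l = projl (hd l)" for l
  have "e0 ` {l. e0 l \<in> carrier A} = carrier A"
  proof (intro equalityI subsetI)
    fix x assume "x \<in> carrier A"
    then show "x \<in> e0 ` {l. e0 l \<in> carrier A}"
      by (auto simp: e0_def intro!: image_eqI[of _ _ "[Inl x]"])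
  qed auto
  then have "\<exists>h\<in>mod_hom R (?F {l. e0 l \<in> carrier A}) A. h ` carrier (?F {l. e0 l \<in> carrier A}) = carrier A"
    by (intro A.free_cover) (simp_all add: A.smult_closed)
  then obtain X0 :: "('a + 'r) list set" and \<epsilon>
    where \<epsilon>: "\<epsilon> \<in> mod_hom R (?F X0) A" "\<epsilon> ` carrier (?F X0) = carrier A"
    by blast
  obtain dec :: "('a + 'r) list \<Rightarrow> ('a + 'r) list \<Rightarrow> 'r" where dec: "\<And>X. fin_combs R X \<subseteq> range dec"
    using fin_combs_decode by blast
  define sub where "sub X K \<longleftrightarrow> K \<subseteq> carrier (?F X) \<and> \<zero>\<^bsub>?F X\<^esub> \<in> K \<and>
    (\<forall>x\<in>K. \<forall>y\<in>K. x \<oplus>\<^bsub>?F X\<^esub> y \<in> K) \<and> (\<forall>r\<in>carrier R. \<forall>x\<in>K. r \<odot>\<^bsub>?F X\<^esub> x \<in> K)" for X K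
  have cover: "\<exists>X' h. h \<in> mod_hom R (?F X') (?F X) \<and> h ` carrier (?F X') = K" if "sub X K" for X K
  proof -
    interpret FX: right_module R "?F X" by (rule F)
    have "K \<subseteq> range dec"
      using that dec[of X] by (auto simp: sub_def free_right_module_def)
    then have "dec ` {l. dec l \<in> K} = K"
      by blast
    then have "\<exists>h\<in>mod_hom R (?F {l. dec l \<in> K}) (?F X). h ` carrier (?F {l. dec l \<in> K}) = K"
      by (intro FX.free_cover) (use that in \<open>simp_all add: sub_def\<close>)
    then show ?thesis
      by blast
  qed
  define P where "P n = (\<lambda>(X, K). sub X K \<and> (n = (0::nat) \<longrightarrow> X = X0 \<and> K = {c \<in> carrier (?F X0). \<epsilon> c = \<zero>\<^bsub>A\<^esub>}))" for n
  define Q where "Q = (\<lambda>n :: nat. \<lambda>(X, K) (X', K'). \<exists>h \<in> mod_hom R (?F X') (?F X).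
    h ` carrier (?F X') = K \<and> K' = {c \<in> carrier (?F X'). h c = \<zero>\<^bsub>?F X\<^esub>})"
  have "\<exists>s. \<forall>n. P n (s n) \<and> Q n (s n) (s (Suc n))"
  proof (rule dependent_nat_choice)
    show "\<exists>s. P 0 s"
      using mod_hom_kernel[OF F A \<epsilon>(1)]
      by (intro exI[of _ "(X0, {c \<in> carrier (?F X0). \<epsilon> c = \<zero>\<^bsub>A\<^esub>})"]) (simp add: P_def sub_def)
  next
    fix s n assume "P n s"
    then obtain X K where s: "s = (X, K)" "sub X K"
      by (auto simp: P_def)
    then obtain X' h where h: "h \<in> mod_hom R (?F X') (?F X)" "h ` carrier (?F X') = K"
      using cover by blast
    then show "\<exists>s'. P (Suc n) s' \<and> Q n s s'"
      using mod_hom_kernel[OF F F h(1)]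
      by (intro exI[of _ "(X', {c \<in> carrier (?F X'). h c = \<zero>\<^bsub>?F X\<^esub>})"])
         (simp add: P_def Q_def s sub_def, blast)
  qed
  then obtain s where s: "\<And>n. P n (s n)" "\<And>n. Q n (s n) (s (Suc n))"
    by blast
  define X where "X n = fst (s n)" for n
  define K where "K n = snd (s n)" for n
  have "\<exists>h. \<forall>n. h n \<in> mod_hom R (?F (X (Suc n))) (?F (X n)) \<and> h n ` carrier (?F (X (Suc n))) = K n \<and>
      K (Suc n) = {c \<in> carrier (?F (X (Suc n))). h n c = \<zero>\<^bsub>?F (X n)\<^esub>}"
    using s(2) unfolding X_def K_def Q_def case_prod_beta Bex_def by (intro choice allI)
  then obtain h where h: "\<And>n. h n \<in> mod_hom R (?F (X (Suc n))) (?F (X n))"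
    "\<And>n. h n ` carrier (?F (X (Suc n))) = K n"
    "\<And>n. K (Suc n) = {c \<in> carrier (?F (X (Suc n))). h n c = \<zero>\<^bsub>?F (X n)\<^esub>}"
    by blast
  have "X 0 = X0" "K 0 = {c \<in> carrier (?F X0). \<epsilon> c = \<zero>\<^bsub>A\<^esub>}"
    using s(1)[of 0] by (auto simp: P_def X_def K_def)
  then have "free_resolution R A X (\<lambda>n. h (n - 1)) \<epsilon>"
    using \<epsilon> h by (simp add: free_resolution_def Let_def)
  then show ?thesis
    by blast
qed

definition Tor ::
    "('r, 'x) ring_scheme \<Rightarrow> nat \<Rightarrow> ('r, 'a, 'y) module_scheme \<Rightarrow> ('r, 'b, 'z) module_scheme
      \<Rightarrow> ((('a + 'r) list \<Rightarrow> 'r) \<times> 'b \<Rightarrow>\<^sub>0 int) set set monoid"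
  where "Tor R i A B =
    (let (X, d) = chosen_resolution R A; F = (\<lambda>n. free_right_module R (X n)) in
      complex_homology (\<lambda>n. tensor R (F n) B) (\<lambda>n. tensor_map R (F (n - 1)) B (d n)) i)"

definition homological_epi ::
    "('r, 'x) ring_scheme \<Rightarrow> ('s, 'y) ring_scheme \<Rightarrow> ('r \<Rightarrow> 's) \<Rightarrow> bool"
  where "homological_epi R S f \<longleftrightarrow> ring_epi R S f \<and>
    (\<forall>i\<ge>1. trivial_group (Tor R i (right_restrict S f) (left_restrict S f)))"


section \<open>Classifying spaces\<close>

text \<open>
  \<open>cat_comp C a b\<close> is the composite of \<open>b\<close> followed by \<open>a\<close>, defined when \<open>cat_dom C a = cat_cod C b\<close>.
\<close>

record ('o, 'a) category =
  cat_obj :: "'o set"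
  cat_arr :: "'a set"
  cat_dom :: "'a \<Rightarrow> 'o"
  cat_cod :: "'a \<Rightarrow> 'o"
  cat_comp :: "'a \<Rightarrow> 'a \<Rightarrow> 'a"
  cat_id :: "'o \<Rightarrow> 'a"

definition two_sided_category ::
    "'x set \<Rightarrow> ('x \<Rightarrow> 'm \<Rightarrow> 'x) \<Rightarrow> ('m, 'z) monoid_scheme \<Rightarrow> ('m \<Rightarrow> 'y \<Rightarrow> 'y) \<Rightarrow> 'y set
      \<Rightarrow> ('x \<times> 'y, 'x \<times> 'm \<times> 'y) category"
  where "two_sided_category X ract M lact Y =
    \<lparr>cat_obj = X \<times> Y,
     cat_arr = X \<times> carrier M \<times> Y,
     cat_dom = (\<lambda>(x, m, y). (ract x m, y)),
     cat_cod = (\<lambda>(x, m, y). (x, lact m y)),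
     cat_comp = (\<lambda>(x, m, _) (_, m', y). (x, m \<otimes>\<^bsub>M\<^esub> m', y)),
     cat_id = (\<lambda>(x, y). (x, \<one>\<^bsub>M\<^esub>, y))\<rparr>"

text \<open>
  The \<open>n\<close>-simplices of the nerve are the functors from the poset \<open>{0 < \<dots> < n}\<close> to \<open>C\<close>. A functor is
  represented by its action on the arrows \<open>(i, j)\<close>, \<open>i \<le> j\<close>, of the poset; its action on objects is
  determined by the identities \<open>F (i, i)\<close>.
\<close>

definition poset_arrows :: "nat \<Rightarrow> (nat \<times> nat) set"
  where "poset_arrows n = {(i, j). i \<le> j \<and> j \<le> n}"

definition nerve :: "('o, 'a, 'z) category_scheme \<Rightarrow> nat \<Rightarrow> (nat \<times> nat \<Rightarrow> 'a) set"
  where "nerve C n = {F \<in> extensional (poset_arrows n).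
    \<exists>ob. (\<forall>i\<le>n. ob i \<in> cat_obj C \<and> F (i, i) = cat_id C (ob i)) \<and>
      (\<forall>(i, j)\<in>poset_arrows n. F (i, j) \<in> cat_arr C \<and>
         cat_dom C (F (i, j)) = ob i \<and> cat_cod C (F (i, j)) = ob j) \<and>
      (\<forall>i j k. i \<le> j \<and> j \<le> k \<and> k \<le> n \<longrightarrow> F (i, k) = cat_comp C (F (j, k)) (F (i, j)))}"

definition simplex_maps :: "nat \<Rightarrow> nat \<Rightarrow> (nat \<Rightarrow> nat) set"
  where "simplex_maps m n = {\<theta>. mono_on {..m} \<theta> \<and> \<theta> ` {..m} \<subseteq> {..n}}"

definition nerve_pull :: "nat \<Rightarrow> (nat \<Rightarrow> nat) \<Rightarrow> (nat \<times> nat \<Rightarrow> 'a) \<Rightarrow> nat \<times> nat \<Rightarrow> 'a"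
  where "nerve_pull m \<theta> F = (\<lambda>(i, j)\<in>poset_arrows m. F (\<theta> i, \<theta> j))"

definition simplex_push :: "nat \<Rightarrow> (nat \<Rightarrow> nat) \<Rightarrow> (nat \<Rightarrow> real) \<Rightarrow> nat \<Rightarrow> real"
  where "simplex_push m \<theta> t = (\<lambda>j. \<Sum>i | i \<le> m \<and> \<theta> i = j. t i)"

definition quotient_topology :: "'a topology \<Rightarrow> ('a \<times> 'a) set \<Rightarrow> 'a set topology"
  where "quotient_topology X r = topology (\<lambda>U. U \<subseteq> topspace X // r \<and> openin X (\<Union>U))"

lemma openin_quotient_topology:
  assumes "equiv (topspace X) r"
  shows "openin (quotient_topology X r) U \<longleftrightarrow> U \<subseteq> topspace X // r \<and> openin X (\<Union>U)"
proof -
  have "istopology (\<lambda>U. U \<subseteq> topspace X // r \<and> openin X (\<Union>U))"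
    unfolding istopology_def
  proof (intro conjI allI impI; (elim conjE)?)
    fix U V assume "U \<subseteq> topspace X // r" "openin X (\<Union>U)" "V \<subseteq> topspace X // r" "openin X (\<Union>V)"
    moreover have "\<Union>(U \<inter> V) = \<Union>U \<inter> \<Union>V"
      using calculation(1,3) quotient_disj[OF assms] by blast
    ultimately show "U \<inter> V \<subseteq> topspace X // r" "openin X (\<Union>(U \<inter> V))"
      by auto
  next
    fix \<K> assume K: "\<forall>U\<in>\<K>. U \<subseteq> topspace X // r \<and> openin X (\<Union>U)"
    then show "\<Union>\<K> \<subseteq> topspace X // r"
      by blast
    have "\<Union>(\<Union>\<K>) = (\<Union>U\<in>\<K>. \<Union>U)"
      by blast
    then show "openin X (\<Union>(\<Union>\<K>))"
      using K by (metis (no_types, lifting) imageE openin_Union)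
  qed
  then show ?thesis
    by (simp add: quotient_topology_def topology_inverse')
qed

lemma quotient_map_quotient_topology:
  assumes "equiv (topspace X) r"
  shows "quotient_map X (quotient_topology X r) (\<lambda>x. r `` {x})"
proof -
  have "openin (quotient_topology X r) (topspace X // r)"
    using assms by (simp add: openin_quotient_topology Union_quotient)
  then have top: "topspace (quotient_topology X r) = topspace X // r"
    by (metis assms openin_quotient_topology openin_subset openin_topspace subset_antisym)
  have "{x \<in> topspace X. r `` {x} \<in> U} = \<Union>U" if U: "U \<subseteq> topspace X // r" for U
  proof (intro equalityI subsetI)
    fix x assume "x \<in> {x \<in> topspace X. r `` {x} \<in> U}"
    then show "x \<in> \<Union>U"
      using equiv_class_self[OF assms] by blast
  next
    fix x assume "x \<in> \<Union>U"
    then obtain c where c: "c \<in> U" "x \<in> c" by blast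
    then have "c \<in> topspace X // r" using U by blast
    then obtain y where y: "y \<in> topspace X" "x \<in> r `` {y}" "r `` {y} \<in> U"
      using c by (auto elim!: quotientE)
    then have "r `` {x} = r `` {y}"
      using equiv_class_eq[OF assms] by blast
    then show "x \<in> {x \<in> topspace X. r `` {x} \<in> U}"
      using y assms by (auto simp: equiv_def refl_on_def)
  qed
  then show ?thesis
    unfolding quotient_map_def top using assms
    by (auto simp: openin_quotient_topology quotient_def)
qed

text \<open>
  Geometric realization of the simplicial set with \<open>n\<close>-simplices \<open>S n\<close>, on which a monotone map
  \<open>\<theta>\<close> from \<open>{0..m}\<close> to \<open>{0..n}\<close> acts by \<open>pull m \<theta>\<close>: the quotient of the disjoint union of the spaces
  \<open>S n \<times> \<Delta>\<^sup>n\<close>, where \<open>S n\<close> is discrete, by the equivalence relation generated by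
  \<open>(\<theta>\<^sup>* x, t) ~ (x, \<theta>\<^sub>* t)\<close>.
\<close>

definition simplex_space ::
    "(nat \<Rightarrow> 'x set) \<Rightarrow> ((nat \<times> 'x) \<times> (nat \<Rightarrow> real)) topology"
  where "simplex_space S = sum_topology
    (\<lambda>(n, x). subtopology (powertop_real UNIV) (standard_simplex n)) (SIGMA n:UNIV. S n)"

definition glue :: "(nat \<Rightarrow> 'x set) \<Rightarrow> (nat \<Rightarrow> (nat \<Rightarrow> nat) \<Rightarrow> 'x \<Rightarrow> 'x)
    \<Rightarrow> (nat \<times> 'x) \<times> (nat \<Rightarrow> real) \<Rightarrow> (nat \<times> 'x) \<times> (nat \<Rightarrow> real) \<Rightarrow> bool"
  where "glue S pull p q \<longleftrightarrow> (\<exists>m n \<theta> x t. \<theta> \<in> simplex_maps m n \<and> x \<in> S n \<and> t \<in> standard_simplex m \<and>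
    p = ((m, pull m \<theta> x), t) \<and> q = ((n, x), simplex_push m \<theta> t))"

definition glue_rel :: "(nat \<Rightarrow> 'x set) \<Rightarrow> (nat \<Rightarrow> (nat \<Rightarrow> nat) \<Rightarrow> 'x \<Rightarrow> 'x)
    \<Rightarrow> (((nat \<times> 'x) \<times> (nat \<Rightarrow> real)) \<times> ((nat \<times> 'x) \<times> (nat \<Rightarrow> real))) set"
  where "glue_rel S pull = {(p, q). p \<in> topspace (simplex_space S) \<and> q \<in> topspace (simplex_space S) \<and>
    equivclp (glue S pull) p q}"

lemma equiv_glue_rel: "equiv (topspace (simplex_space S)) (glue_rel S pull)"
  by (rule equivI)
     (auto simp: glue_rel_def refl_on_def sym_def trans_def
       intro: equivclp_sym transpD[OF transp_equivclp] reflpD[OF reflp_equivclp])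

definition geometric_realization :: "(nat \<Rightarrow> 'x set) \<Rightarrow> (nat \<Rightarrow> (nat \<Rightarrow> nat) \<Rightarrow> 'x \<Rightarrow> 'x)
    \<Rightarrow> ((nat \<times> 'x) \<times> (nat \<Rightarrow> real)) set topology"
  where "geometric_realization S pull = quotient_topology (simplex_space S) (glue_rel S pull)"

definition classifying_space ::
    "('o, 'a, 'z) category_scheme \<Rightarrow> ((nat \<times> (nat \<times> nat \<Rightarrow> 'a)) \<times> (nat \<Rightarrow> real)) set topology"
  where "classifying_space C = geometric_realization (nerve C) nerve_pull"

definition two_sided_bar ::
    "'x set \<Rightarrow> ('x \<Rightarrow> 'm \<Rightarrow> 'x) \<Rightarrow> ('m, 'z) monoid_scheme \<Rightarrow> ('m \<Rightarrow> 'y \<Rightarrow> 'y) \<Rightarrow> 'y set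
      \<Rightarrow> ((nat \<times> (nat \<times> nat \<Rightarrow> 'x \<times> 'm \<times> 'y)) \<times> (nat \<Rightarrow> real)) set topology"
  where "two_sided_bar X ract M lact Y = classifying_space (two_sided_category X ract M lact Y)"


section \<open>Singular homology with coefficients\<close>

text \<open>
  The library has singular homology with integer coefficients only. Here a chain is a
  finitely supported function from singular simplices to the ring \<open>K\<close>.
\<close>

definition singular_chains ::
    "('k, 'x) ring_scheme \<Rightarrow> 'a topology \<Rightarrow> nat \<Rightarrow> (((nat \<Rightarrow> real) \<Rightarrow> 'a) \<Rightarrow> 'k) monoid"
  where "singular_chains K X p =
    \<lparr>carrier = fin_combs K (singular_simplex_set p X),
     monoid.mult = (\<lambda>c d s. c s \<oplus>\<^bsub>K\<^esub> d s),
     one = (\<lambda>s. \<zero>\<^bsub>K\<^esub>)\<rparr>"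

definition singular_boundary ::
    "('k, 'x) ring_scheme \<Rightarrow> nat \<Rightarrow> (((nat \<Rightarrow> real) \<Rightarrow> 'a) \<Rightarrow> 'k) \<Rightarrow> ((nat \<Rightarrow> real) \<Rightarrow> 'a) \<Rightarrow> 'k"
  where "singular_boundary K p c = (\<lambda>s. \<Oplus>\<^bsub>K\<^esub>u\<in>supp K c \<times> {..p}.
    if singular_face p (snd u) (fst u) = s then (\<ominus>\<^bsub>K\<^esub> \<one>\<^bsub>K\<^esub>) [^]\<^bsub>K\<^esub> snd u \<otimes>\<^bsub>K\<^esub> c (fst u) else \<zero>\<^bsub>K\<^esub>)"

definition singular_homology ::
    "('k, 'x) ring_scheme \<Rightarrow> nat \<Rightarrow> 'a topology \<Rightarrow> (((nat \<Rightarrow> real) \<Rightarrow> 'a) \<Rightarrow> 'k) set monoid"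
  where "singular_homology K i X = complex_homology (singular_chains K X) (singular_boundary K) i"

end

theory Submission
  imports Defs "HOL-Analysis.Abstract_Topological_Spaces"
begin

text \<open>
  Tensoring a free resolution of the right module \<open>KN\<close> over \<open>KM\<close> with \<open>KN\<close> computes Tor. In the bar
  resolution, the basis in degree \<open>n\<close> consists of the \<open>n\<close>-simplices of the nerve of
  \<open>N \<rtimes> M \<ltimes> {*}\<close>. An \<open>n\<close>-simplex of the nerve of \<open>N \<rtimes> M \<ltimes> Y\<close> is such a basis element together
  with the position in \<open>Y\<close> of its initial object, so that \<open>K\<close>-combinations of these simplices are
  combinations of basis elements with coefficients in \<open>KY\<close>. For \<open>Y = M\<close> the alternating sum of faces
  is the differential of the resolution, which is exact because prepending an object is an extra
  degeneracy; for \<open>Y = N\<close> it is the differential of the complex defining Tor. It remains to see that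
  the alternating sums of faces compute the singular homology of a geometric realization: a singular
  chain whose boundary consists of cells is, up to a boundary, itself a combination of cells. By
  compactness it lives on a finite subcomplex, where excision, one top cell at a time, reduces the
  claim to a simplex modulo its boundary. As to epimorphisms, distinct homomorphisms out of \<open>N\<close>
  induce distinct maps of monoid algebras, and a ring homomorphism out of \<open>KN\<close> is determined by its
  restrictions to \<open>N\<close> and to \<open>K\<close>.
\<close>

section \<open>Monotone maps and simplicial sets\<close>

text \<open>The bar complex is not normalized, so the cells of the topological claim are all
  simplices, degenerate ones included. The claim is kept at the level of chains, where it contains
  surjectivity and injectivity on homology together and passes through the attachment of a cell
  without exact sequences. The obstacle is that attaching an \<open>n\<close>-cell needs the claim
  for the \<open>n\<close>-simplex relative to its boundary, and that boundary is itself a complex;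
  strong induction on \<open>n\<close> breaks the circle, because the cells of the boundary have
  smaller dimension. Coefficients enter late: the integral claim yields a retraction and a homotopy
  with integer matrices, and \<open>zext\<close> lets integer matrices act on combinations over
  \<open>K\<close>. On the algebraic side, the resolution chosen inside \<open>Tor\<close> and the
  bar resolution have bases of different types, so the comparison of resolutions is proved for bases
  of arbitrary types.\<close>

lemma simplex_maps_iff:
  "\<theta> \<in> simplex_maps m n \<longleftrightarrow> (\<forall>i\<le>m. \<theta> i \<le> n) \<and> (\<forall>i j. i \<le> j \<longrightarrow> j \<le> m \<longrightarrow> \<theta> i \<le> \<theta> j)"
  unfolding simplex_maps_def mono_on_def by (auto dest: order_trans)

lemma simplex_maps_comp:
  "\<lbrakk>\<theta> \<in> simplex_maps m n; \<eta> \<in> simplex_maps l m\<rbrakk> \<Longrightarrow> \<theta> \<circ> \<eta> \<in> simplex_maps l n"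
  by (simp add: simplex_maps_iff)

lemma simplex_maps_id: "id \<in> simplex_maps n n"
  by (simp add: simplex_maps_iff)

lemma simplex_maps_inj_le:
  assumes "\<theta> \<in> simplex_maps m n" "inj_on \<theta> {..m}"
  shows "m \<le> n"
proof -
  have "\<theta> ` {..m} \<subseteq> {..n}" using assms(1) by (auto simp: simplex_maps_iff)
  then have "card {..m} \<le> card {..n}" by (intro card_inj_on_le[OF assms(2)]) auto
  then show ?thesis by (simp)
qed

text \<open>A strictly increasing self map of an initial segment moves no point down (induction from
  \<open>0\<close>) and no point up (induction from \<open>n\<close>).\<close>

lemma simplex_maps_inj_self:
  assumes "\<theta> \<in> simplex_maps n n" "inj_on \<theta> {..n}" "i \<le> n"
  shows "\<theta> i = i"
proof -
  have less: "\<theta> j < \<theta> k" if "j < k" "k \<le> n" for j k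
  proof -
    have "\<theta> j \<noteq> \<theta> k" using inj_onD[OF assms(2), of j k] that by auto
    moreover have "\<theta> j \<le> \<theta> k" using assms(1) that by (simp add: simplex_maps_iff)
    ultimately show ?thesis by simp
  qed
  have "j \<le> n \<Longrightarrow> j \<le> \<theta> j" for j
    by (induction j) (use less in \<open>auto simp: Suc_le_eq intro: le_less_trans\<close>)
  moreover have "\<theta> (n - j) \<le> n - j" if "j \<le> n" for j
    using that
  proof (induction j)
    case 0 then show ?case using assms(1) by (simp add: simplex_maps_iff)
  next
    case (Suc j)
    then have "\<theta> (n - Suc j) < \<theta> (n - j)" by (intro less) auto
    then show ?case using Suc by simp
  qed
  from this[of "n - i"] have "\<theta> i \<le> i" using assms(3) by simp
  ultimately show ?thesis using assms(3) by (simp add: antisym)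
qed

text \<open>Any choice of preimages is monotone, since a pair in the wrong order would contradict
  monotonicity of \<open>\<sigma>\<close>. Prescribing one value,
  \<open>\<delta> (\<sigma> i) = i\<close>, lets later arguments reach every \<open>i\<close> by
  some section.\<close>

lemma simplex_maps_section:
  assumes s: "\<sigma> \<in> simplex_maps n k" "\<sigma> ` {..n} = {..k}" and i: "i \<le> n"
  shows "\<exists>\<delta>\<in>simplex_maps k n. (\<forall>j\<le>k. \<sigma> (\<delta> j) = j) \<and> \<delta> (\<sigma> i) = i"
proof -
  define \<delta> where "\<delta> j = (if j = \<sigma> i then i else (SOME l. l \<le> n \<and> \<sigma> l = j))" for j
  have d: "\<delta> j \<le> n \<and> \<sigma> (\<delta> j) = j" if "j \<le> k" for j
  proof -
    have "\<exists>l. l \<le> n \<and> \<sigma> l = j" using s(2) that by (metis atMost_iff imageE)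
    from someI_ex[OF this] show ?thesis using i by (simp add: \<delta>_def)
  qed
  have "\<delta> j \<le> \<delta> j'" if "j \<le> j'" "j' \<le> k" for j j'
  proof (rule ccontr)
    assume a: "\<not> \<delta> j \<le> \<delta> j'"
    then have "\<delta> j' \<le> \<delta> j" by simp
    moreover have "\<delta> j \<le> n" using d that by simp
    ultimately have "\<sigma> (\<delta> j') \<le> \<sigma> (\<delta> j)" using s(1) unfolding simplex_maps_iff by blast
    then have "j = j'" using d[of j] d[of j'] that by simp
    with a show False by simp
  qed
  then show ?thesis using d by (intro bexI[of _ \<delta>]) (auto simp: simplex_maps_iff \<delta>_def)
qed

text \<open>Epi-mono factorization in the simplex category: \<open>\<sigma> i\<close> counts the
  image points below \<open>\<theta> i\<close>, and \<open>\<delta>\<close> is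
  \<open>\<theta>\<close> along a section of \<open>\<sigma>\<close>. The cardinality clause
  measures the drop in dimension in \<open>nondeg_core\<close>.\<close>

lemma simplex_maps_factor:
  assumes "\<theta> \<in> simplex_maps m n"
  shows "\<exists>k \<sigma> \<delta>. \<sigma> \<in> simplex_maps m k \<and> \<delta> \<in> simplex_maps k n \<and> \<sigma> ` {..m} = {..k} \<and>
    inj_on \<delta> {..k} \<and> (\<forall>i\<le>m. \<theta> i = \<delta> (\<sigma> i)) \<and> Suc k = card (\<theta> ` {..m})"
proof -
  define I where "I = \<theta> ` {..m}"
  define k where "k = card I - 1"
  define \<sigma> where "\<sigma> i = card {j\<in>I. j < \<theta> i}" for i
  have I: "finite I" "\<theta> 0 \<in> I" by (auto simp: I_def)
  then have k: "Suc k = card I" unfolding k_def by (metis Suc_diff_1 card_gt_0_iff empty_iff)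
  have less: "\<sigma> i < \<sigma> i'" if "\<theta> i < \<theta> i'" "i \<le> m" for i i'
    unfolding \<sigma>_def using that I by (intro psubset_card_mono) (auto simp: I_def)
  have eq: "\<sigma> i = \<sigma> i'" if "\<theta> i = \<theta> i'" for i i' using that by (simp add: \<sigma>_def)
  have bound: "\<sigma> i \<le> k" if "i \<le> m" for i
  proof -
    have "\<sigma> i < card I" unfolding \<sigma>_def using that I by (intro psubset_card_mono) (auto simp: I_def)
    then show ?thesis using k by simp
  qed
  have iff: "\<sigma> i = \<sigma> i' \<longleftrightarrow> \<theta> i = \<theta> i'" if "i \<le> m" "i' \<le> m" for i i'
    using that less[of i i'] less[of i' i] eq[of i i'] by (metis linorder_neqE_nat less_irrefl)
  have mono: "\<sigma> \<in> simplex_maps m k"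
    unfolding simplex_maps_iff
  proof (intro conjI allI impI)
    fix i j assume ij: "i \<le> j" "j \<le> m"
    then have "\<theta> i \<le> \<theta> j" using assms by (simp add: simplex_maps_iff)
    then show "\<sigma> i \<le> \<sigma> j" using less[of i j] eq[of i j] ij by (cases "\<theta> i = \<theta> j") auto
  qed (rule bound)
  have "card (\<sigma> ` {..m}) = card I"
  proof -
    define f where "f x = card {j\<in>I. j < x}" for x
    have "inj_on f I" using iff by (auto simp: inj_on_def I_def f_def \<sigma>_def)
    moreover have "\<sigma> ` {..m} = f ` I" by (auto simp: I_def f_def \<sigma>_def image_image)
    ultimately show ?thesis by (simp add: card_image)
  qed
  then have surj: "\<sigma> ` {..m} = {..k}"
    using bound k by (intro card_subset_eq) auto
  from simplex_maps_section[OF mono this, of 0] obtain \<tau>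
    where \<tau>: "\<tau> \<in> simplex_maps k m" "\<And>j. j \<le> k \<Longrightarrow> \<sigma> (\<tau> j) = j" by auto
  define \<delta> where "\<delta> = \<theta> \<circ> \<tau>"
  have le: "\<tau> j \<le> m" if "j \<le> k" for j using \<tau>(1) that by (simp add: simplex_maps_iff)
  have "inj_on \<delta> {..k}"
    by (rule inj_onI) (metis \<tau>(2) \<delta>_def atMost_iff comp_apply iff le)
  moreover have "\<theta> i = \<delta> (\<sigma> i)" if "i \<le> m" for i
    unfolding \<delta>_def comp_apply using iff[of i "\<tau> (\<sigma> i)"] \<tau>(2)[OF bound[OF that]] le[OF bound[OF that]] that by simp
  moreover have "\<delta> \<in> simplex_maps k n" unfolding \<delta>_def by (rule simplex_maps_comp[OF assms \<tau>(1)])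
  ultimately show ?thesis using mono surj k unfolding I_def by blast
qed

text \<open>Round down into \<open>I\<close>, or up to its least element when nothing of
  \<open>I\<close> lies below. Being an idempotent of full degree \<open>n\<close>, \<open>r\<close>
  replaces a simplex by its \<open>I\<close>-face without changing the degree, so points supported
  on \<open>I\<close> keep their coordinates.\<close>

lemma simplex_maps_retract:
  assumes "I \<subseteq> {..n}" "I \<noteq> {}"
  shows "\<exists>r\<in>simplex_maps n n. (\<forall>i. r i \<in> I) \<and> (\<forall>i\<in>I. r i = i)"
proof -
  define r where "r i = (if \<exists>j\<in>I. j \<le> i then Max {j\<in>I. j \<le> i} else Min I)" for i
  have fin: "finite I" using assms(1) finite_subset by blast
  have 1: "Max {j\<in>I. j \<le> i} \<in> I \<and> Max {j\<in>I. j \<le> i} \<le> i" if "\<exists>j\<in>I. j \<le> i" for i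
  proof -
    have "Max {j\<in>I. j \<le> i} \<in> {j\<in>I. j \<le> i}" using fin that by (intro Max_in) auto
    then show ?thesis by (simp)
  qed
  have in_I: "r i \<in> I" for i
    using 1[of i] Min_in[OF fin assms(2)] by (auto simp: r_def)
  have "r i \<le> r i'" if "i \<le> i'" for i i'
  proof (cases "\<exists>j\<in>I. j \<le> i")
    case True
    then have "\<exists>j\<in>I. j \<le> i'" using that order_trans by blast
    moreover have "Max {j\<in>I. j \<le> i} \<le> Max {j\<in>I. j \<le> i'}"
      using True that fin by (intro Max_mono) auto
    ultimately show ?thesis using True by (simp add: r_def)
  next
    case False
    then show ?thesis using Min_le[OF fin in_I[of i']] by (simp add: r_def)
  qed
  moreover have "r i = i" if "i \<in> I" for i
    using that fin by (auto simp: r_def intro!: Max_eqI)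
  moreover have "r i \<le> n" for i using in_I assms(1) by blast
  ultimately show ?thesis using in_I
    by (intro bexI[of _ r]) (auto simp: simplex_maps_iff)
qed

text \<open>\<open>pull_cong\<close> is needed because operators are total functions on
  \<open>nat\<close>, of which only the values up to \<open>m\<close> count.\<close>

locale simplicial_set =
  fixes S :: "nat \<Rightarrow> 'x set" and pull :: "nat \<Rightarrow> (nat \<Rightarrow> nat) \<Rightarrow> 'x \<Rightarrow> 'x"
  assumes pull_closed: "\<theta> \<in> simplex_maps m n \<Longrightarrow> x \<in> S n \<Longrightarrow> pull m \<theta> x \<in> S m"
    and pull_pull: "\<theta> \<in> simplex_maps m n \<Longrightarrow> \<eta> \<in> simplex_maps l m \<Longrightarrow> x \<in> S n \<Longrightarrow>
      pull l \<eta> (pull m \<theta> x) = pull l (\<theta> \<circ> \<eta>) x"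
    and pull_id: "x \<in> S n \<Longrightarrow> pull n id x = x"
    and pull_cong: "(\<And>i. i \<le> m \<Longrightarrow> \<theta> i = \<eta> i) \<Longrightarrow> pull m \<theta> x = pull m \<eta> x"
begin

text \<open>Equivalent to the usual notion, but with one quantifier over endomorphisms: if
  \<open>x\<close> is the pullback of some \<open>z\<close> along a surjection
  \<open>\<sigma>\<close> that is not injective, then a section \<open>\<delta>\<close> makes
  \<open>\<delta> \<circ> \<sigma>\<close> an endomorphism that fixes \<open>x\<close> and is not
  onto; conversely, such an endomorphism factors through a lower dimension.\<close>

definition nondeg :: "nat \<Rightarrow> 'x set" where
  "nondeg n = {x \<in> S n. \<forall>a\<in>simplex_maps n n. pull n a x = x \<longrightarrow> a ` {..n} = {..n}}"

lemma nondegD: "x \<in> nondeg n \<Longrightarrow> x \<in> S n"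
  by (simp add: nondeg_def)

text \<open>Write \<open>\<theta>\<close> as \<open>\<delta> \<circ> \<sigma>\<close> and take a
  section \<open>\<tau>\<close> of \<open>\<sigma>\<close>. Then
  \<open>\<tau> \<circ> \<sigma>\<close> fixes the simplex, so it is onto, hence injective, and
  therefore \<open>\<sigma>\<close> is injective.\<close>

lemma nondeg_pull_inj:
  assumes x: "pull n \<theta> y \<in> nondeg n" and \<theta>: "\<theta> \<in> simplex_maps n m" and y: "y \<in> S m"
  shows "inj_on \<theta> {..n}"
proof -
  obtain k \<sigma> \<delta> where f: "\<sigma> \<in> simplex_maps n k" "\<delta> \<in> simplex_maps k m" "\<sigma> ` {..n} = {..k}"
      "\<forall>i\<le>n. \<theta> i = \<delta> (\<sigma> i)" "inj_on \<delta> {..k}"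
    using simplex_maps_factor[OF \<theta>] by blast
  from simplex_maps_section[OF f(1,3), of 0] obtain \<tau>
    where \<tau>: "\<tau> \<in> simplex_maps k n" "\<forall>j\<le>k. \<sigma> (\<tau> j) = j" by auto
  have sk: "\<sigma> i \<le> k" if "i \<le> n" for i using f(1) that by (simp add: simplex_maps_iff)
  have tn: "\<tau> j \<le> n" if "j \<le> k" for j using \<tau>(1) that by (simp add: simplex_maps_iff)
  have "pull n (\<tau> \<circ> \<sigma>) (pull n \<theta> y) = pull n (\<theta> \<circ> (\<tau> \<circ> \<sigma>)) y"
    by (rule pull_pull[OF \<theta> simplex_maps_comp[OF \<tau>(1) f(1)] y])
  also have "\<dots> = pull n \<theta> y"
    using \<tau>(2) f(4) sk tn by (intro pull_cong) simp
  finally have "(\<tau> \<circ> \<sigma>) ` {..n} = {..n}"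
    using x simplex_maps_comp[OF \<tau>(1) f(1)] unfolding nondeg_def by blast
  then have "inj_on (\<tau> \<circ> \<sigma>) {..n}" by (simp add: eq_card_imp_inj_on)
  then have "inj_on \<sigma> {..n}" by (rule inj_on_imageI2)
  then have "inj_on (\<delta> \<circ> \<sigma>) {..n}"
    using f(3,5) by (simp add: comp_inj_on)
  then show ?thesis using f(4) by (simp add: inj_on_def)
qed

text \<open>Existence half of the Eilenberg-Zilber lemma: an endomorphism that fixes
  \<open>x\<close> and is not onto factors through some \<open>k < n\<close>, and the induction
  hypothesis applies to the pullback of \<open>x\<close> to dimension \<open>k\<close>.\<close>

lemma nondeg_core:
  "x \<in> S n \<Longrightarrow> \<exists>k z \<sigma>. z \<in> nondeg k \<and> \<sigma> \<in> simplex_maps n k \<and> \<sigma> ` {..n} = {..k} \<and> x = pull n \<sigma> z"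
proof (induction n arbitrary: x rule: less_induct)
  case (less n)
  show ?case
  proof (cases "x \<in> nondeg n")
    case True
    then show ?thesis using pull_id[OF less.prems] simplex_maps_id[of n]
      by (metis image_id id_apply)
  next
    case False
    then obtain a where a: "a \<in> simplex_maps n n" "pull n a x = x" "a ` {..n} \<noteq> {..n}"
      using less.prems by (auto simp: nondeg_def)
    obtain k \<sigma> \<delta> where f: "\<sigma> \<in> simplex_maps n k" "\<delta> \<in> simplex_maps k n" "\<sigma> ` {..n} = {..k}"
        "\<forall>i\<le>n. a i = \<delta> (\<sigma> i)" "Suc k = card (a ` {..n})"
      using simplex_maps_factor[OF a(1)] by blast
    have "a ` {..n} \<subset> {..n}" using a(1,3) by (auto simp: simplex_maps_iff)
    then have "card (a ` {..n}) < card {..n}" by (intro psubset_card_mono) auto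
    then have "k < n" using f(5) by simp
    then obtain l z \<tau> where z: "z \<in> nondeg l" "\<tau> \<in> simplex_maps k l" "\<tau> ` {..k} = {..l}"
        "pull k \<delta> x = pull k \<tau> z"
      using less.IH pull_closed[OF f(2) less.prems] by blast
    have "x = pull n (\<delta> \<circ> \<sigma>) x" using a(2) f(4) pull_cong[of n a "\<delta> \<circ> \<sigma>" x] by simp
    also have "\<dots> = pull n \<sigma> (pull k \<tau> z)" using pull_pull[OF f(2,1) less.prems] z(4) by simp
    also have "\<dots> = pull n (\<tau> \<circ> \<sigma>) z" by (rule pull_pull[OF z(2) f(1) nondegD[OF z(1)]])
    finally have "x = pull n (\<tau> \<circ> \<sigma>) z" .
    moreover have "(\<tau> \<circ> \<sigma>) ` {..n} = {..l}" using z(3) f(3) by (simp only: image_comp[symmetric])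
    ultimately show ?thesis using z(1) simplex_maps_comp[OF z(2) f(1)] by blast
  qed
qed

text \<open>Uniqueness half of the Eilenberg-Zilber lemma. A section \<open>\<delta>\<close> of
  \<open>\<sigma>\<close> exhibits \<open>z\<close> as the pullback of \<open>w\<close> along
  \<open>\<tau> \<circ> \<delta>\<close>, which is injective because \<open>z\<close> is
  nondegenerate. By symmetry \<open>k = l\<close>, so \<open>\<tau> \<circ> \<delta>\<close> is the
  identity.\<close>

lemma nondeg_core_unique:
  assumes z: "z \<in> nondeg k" "\<sigma> \<in> simplex_maps n k" "\<sigma> ` {..n} = {..k}"
    and w: "w \<in> nondeg l" "\<tau> \<in> simplex_maps n l" "\<tau> ` {..n} = {..l}"
    and eq: "pull n \<sigma> z = pull n \<tau> w"
  shows "k = l \<and> z = w \<and> (\<forall>i\<le>n. \<sigma> i = \<tau> i)"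
proof -
  have *: "z = pull k (\<tau> \<circ> \<delta>) w \<and> inj_on (\<tau> \<circ> \<delta>) {..k} \<and> \<tau> \<circ> \<delta> \<in> simplex_maps k l"
    if z: "z \<in> nondeg k" "\<sigma> \<in> simplex_maps n k" "\<sigma> ` {..n} = {..k}"
      and w: "w \<in> nondeg l" "\<tau> \<in> simplex_maps n l" "\<tau> ` {..n} = {..l}"
      and eq: "pull n \<sigma> z = pull n \<tau> w"
      and \<delta>: "\<delta> \<in> simplex_maps k n" "\<forall>j\<le>k. \<sigma> (\<delta> j) = j" for z w k l \<sigma> \<tau> \<delta>
  proof -
    have "z = pull k id z" using z(1) by (simp add: pull_id nondegD)
    also have "\<dots> = pull k (\<sigma> \<circ> \<delta>) z" using \<delta> by (intro pull_cong) simp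
    also have "\<dots> = pull k \<delta> (pull n \<tau> w)" using pull_pull[OF z(2) \<delta>(1) nondegD[OF z(1)]] eq by simp
    also have "\<dots> = pull k (\<tau> \<circ> \<delta>) w" by (rule pull_pull[OF w(2) \<delta>(1) nondegD[OF w(1)]])
    finally show ?thesis
      using nondeg_pull_inj[of k "\<tau> \<circ> \<delta>" w l] z(1) simplex_maps_comp[OF w(2) \<delta>(1)] nondegD[OF w(1)] by metis
  qed
  obtain \<delta> where d: "\<delta> \<in> simplex_maps k n" "\<forall>j\<le>k. \<sigma> (\<delta> j) = j"
    using simplex_maps_section[OF z(2,3), of 0] by auto
  obtain \<epsilon> where e: "\<epsilon> \<in> simplex_maps l n" "\<forall>j\<le>l. \<tau> (\<epsilon> j) = j"
    using simplex_maps_section[OF w(2,3), of 0] by auto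
  have "k \<le> l" using *[OF z w eq d] simplex_maps_inj_le by blast
  moreover have "l \<le> k" using *[OF w z eq[symmetric] e] simplex_maps_inj_le by blast
  ultimately have kl: "k = l" by simp
  \<comment> \<open>A section through \<open>i\<close> turns the identity
    \<open>\<tau> (\<delta> (\<sigma> i)) = \<sigma> i\<close> into
    \<open>\<tau> i = \<sigma> i\<close>.\<close>
  have "\<sigma> i = \<tau> i" if i: "i \<le> n" for i
  proof -
    obtain \<delta> where \<delta>: "\<delta> \<in> simplex_maps k n" "\<forall>j\<le>k. \<sigma> (\<delta> j) = j" "\<delta> (\<sigma> i) = i"
      using simplex_maps_section[OF z(2,3) i] by blast
    have "(\<tau> \<circ> \<delta>) (\<sigma> i) = \<sigma> i"
      using conjunct2[OF *[OF z w eq \<delta>(1,2)]] z(2) i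
      by (intro simplex_maps_inj_self[of _ k]) (auto simp: kl simplex_maps_iff simp del: comp_apply)
    then show ?thesis using \<delta>(3) by simp
  qed
  moreover have "z = w"
  proof -
    have "z = pull k (\<tau> \<circ> \<delta>) w" using *[OF z w eq d] by blast
    also have "\<dots> = pull k id w"
      using conjunct2[OF *[OF z w eq d]] unfolding kl by (intro pull_cong) (metis id_apply simplex_maps_inj_self)
    finally show ?thesis using kl w(1) by (simp add: pull_id nondegD)
  qed
  ultimately show ?thesis using kl by blast
qed

end

section \<open>Simplices and their affine maps\<close>

abbreviation simplex_top :: "nat \<Rightarrow> (nat \<Rightarrow> real) topology" where
  "simplex_top n \<equiv> subtopology (powertop_real UNIV) (standard_simplex n)"

definition interior_pt :: "nat \<Rightarrow> (nat \<Rightarrow> real) \<Rightarrow> bool" where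
  "interior_pt n t \<longleftrightarrow> t \<in> standard_simplex n \<and> (\<forall>i\<le>n. 0 < t i)"

lemma standard_simplexD:
  assumes "t \<in> standard_simplex n"
  shows "0 \<le> t i" "n < i \<Longrightarrow> t i = 0" "(\<Sum>i\<le>n. t i) = 1"
  using assms by (auto simp: standard_simplex_def)

lemma standard_simplexI:
  assumes "\<And>i. 0 \<le> t i" "\<And>i. n < i \<Longrightarrow> t i = 0" "(\<Sum>i\<le>n. t i) = 1"
  shows "t \<in> standard_simplex n"
proof -
  have "t i \<le> 1" for i
  proof (cases "i \<le> n")
    case True
    then have "t i \<le> (\<Sum>i\<le>n. t i)" using assms(1) by (intro member_le_sum) auto
    then show ?thesis using assms(3) by simp
  qed (simp add: assms(2))
  then show ?thesis using assms by (simp add: standard_simplex_def)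
qed

lemma innerD: "interior_pt n t \<Longrightarrow> t \<in> standard_simplex n"
  by (simp add: interior_pt_def)

lemma simplex_push_if: "simplex_push m \<theta> t j = (\<Sum>i\<le>m. if \<theta> i = j then t i else 0)"
proof -
  have "{i. i \<le> m \<and> \<theta> i = j} = {i\<in>{..m}. \<theta> i = j}" by auto
  then show ?thesis by (simp add: simplex_push_def sum.inter_filter[symmetric])
qed

lemma simplex_push_cong:
  "(\<And>i. i \<le> m \<Longrightarrow> t i \<noteq> 0 \<Longrightarrow> \<theta> i = \<eta> i) \<Longrightarrow> simplex_push m \<theta> t = simplex_push m \<eta> t"
proof
  fix j assume a: "\<And>i. i \<le> m \<Longrightarrow> t i \<noteq> 0 \<Longrightarrow> \<theta> i = \<eta> i"
  have "(if \<theta> i = j then t i else 0) = (if \<eta> i = j then t i else 0)" if "i \<le> m" for i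
    using a[OF that] by (cases "t i = 0") auto
  then show "simplex_push m \<theta> t j = simplex_push m \<eta> t j"
    unfolding simplex_push_if by (intro sum.cong) auto
qed

lemma simplex_push_retract:
  assumes "t \<in> standard_simplex n" "\<And>i. t i \<noteq> 0 \<Longrightarrow> r i = i"
  shows "simplex_push n r t = t"
proof
  fix j
  have "simplex_push n r t j = (\<Sum>i\<le>n. if i = j then t i else 0)"
    unfolding simplex_push_if
  proof (intro sum.cong refl)
    fix i show "(if r i = j then t i else 0) = (if i = j then t i else 0)"
      using assms(2)[of i] by (cases "t i = 0") auto
  qed
  then show "simplex_push n r t j = t j" using assms(1) by (auto simp: standard_simplex_def)
qed

lemma simplex_push_in:
  assumes "\<theta> \<in> simplex_maps m n" "t \<in> standard_simplex m"
  shows "simplex_push m \<theta> t \<in> standard_simplex n"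
proof (rule standard_simplexI)
  note t = standard_simplexD[OF assms(2)]
  have \<theta>: "\<theta> i \<le> n" if "i \<le> m" for i using assms(1) that by (simp add: simplex_maps_iff)
  show "0 \<le> simplex_push m \<theta> t i" for i using t by (simp add: simplex_push_if sum_nonneg)
  show "simplex_push m \<theta> t i = 0" if "n < i" for i
    using \<theta> that by (force simp: simplex_push_if intro!: sum.neutral)
  have "(\<Sum>j\<le>n. simplex_push m \<theta> t j) = (\<Sum>i\<le>m. \<Sum>j\<le>n. if \<theta> i = j then t i else 0)"
    unfolding simplex_push_if by (rule sum.swap)
  also have "\<dots> = (\<Sum>i\<le>m. t i)" using \<theta> by (intro sum.cong) auto
  finally show "(\<Sum>j\<le>n. simplex_push m \<theta> t j) = 1" using t(3) by simp
qed

lemma simplex_push_push: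
  assumes "\<eta> \<in> simplex_maps l m"
  shows "simplex_push m \<theta> (simplex_push l \<eta> t) = simplex_push l (\<theta> \<circ> \<eta>) t"
proof
  fix j
  have \<eta>: "\<eta> i \<le> m" if "i \<le> l" for i using assms that by (simp add: simplex_maps_iff)
  have "simplex_push m \<theta> (simplex_push l \<eta> t) j
      = (\<Sum>i\<le>m. \<Sum>k\<le>l. if \<eta> k = i then (if \<theta> (\<eta> k) = j then t k else 0) else 0)"
    unfolding simplex_push_if by (intro sum.cong) (auto intro!: sum.neutral sum.cong)
  also have "\<dots> = (\<Sum>k\<le>l. \<Sum>i\<le>m. if \<eta> k = i then (if \<theta> (\<eta> k) = j then t k else 0) else 0)"
    by (rule sum.swap)
  also have "\<dots> = simplex_push l (\<theta> \<circ> \<eta>) t j"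
    unfolding simplex_push_if using \<eta> by (intro sum.cong) auto
  finally show "simplex_push m \<theta> (simplex_push l \<eta> t) j = simplex_push l (\<theta> \<circ> \<eta>) t j" .
qed

lemma simplex_push_nonzero:
  assumes "t \<in> standard_simplex m"
  shows "simplex_push m \<theta> t j \<noteq> 0 \<longleftrightarrow> (\<exists>i\<le>m. \<theta> i = j \<and> t i \<noteq> 0)"
  using standard_simplexD(1)[OF assms]
  by (subst simplex_push_if, subst sum_nonneg_eq_0_iff) auto

lemma inner_push:
  assumes "\<theta> \<in> simplex_maps m n" "t \<in> standard_simplex m" "\<theta> ` {i. t i \<noteq> 0} = {..n}"
  shows "interior_pt n (simplex_push m \<theta> t)"
proof -
  have p: "simplex_push m \<theta> t \<in> standard_simplex n" by (rule simplex_push_in[OF assms(1,2)])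
  have "0 < simplex_push m \<theta> t j" if "j \<le> n" for j
  proof -
    have "j \<in> \<theta> ` {i. t i \<noteq> 0}" using that assms(3) by simp
    then obtain i where "t i \<noteq> 0" "\<theta> i = j" by blast
    moreover then have "i \<le> m" using standard_simplexD(2)[OF assms(2)] not_less by blast
    ultimately have "simplex_push m \<theta> t j \<noteq> 0" using simplex_push_nonzero[OF assms(2)] by blast
    then show ?thesis using standard_simplexD(1)[OF p, of j] by simp
  qed
  then show ?thesis using p by (simp add: interior_pt_def)
qed

lemma continuous_map_coord [continuous_intros]:
  "continuous_map (simplex_top n) euclideanreal (\<lambda>t. t i)"
  by (rule continuous_map_from_subtopology) (use continuous_map_product_projection[of i UNIV "\<lambda>_. euclideanreal"] in simp)

lemma continuous_map_to_simplex_top: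
  "continuous_map X (simplex_top n) f \<longleftrightarrow>
    (\<forall>i. continuous_map X euclideanreal (\<lambda>x. f x i)) \<and> f \<in> topspace X \<rightarrow> standard_simplex n"
  by (auto simp: continuous_map_in_subtopology continuous_map_componentwise_UNIV)

lemma continuous_map_simplex_push:
  assumes "\<theta> \<in> simplex_maps m n"
  shows "continuous_map (simplex_top m) (simplex_top n) (simplex_push m \<theta>)"
  unfolding continuous_map_to_simplex_top simplex_push_def
  using simplex_push_in[OF assms] by (auto intro!: continuous_intros simp: simplex_push_def)

lemma compact_space_simplex_top: "compact_space (simplex_top n)"
  by (simp add: compactin_standard_simplex compact_space_subtopology)

lemma Hausdorff_space_simplex_top: "Hausdorff_space (simplex_top n)"
  by (intro Hausdorff_space_subtopology) (simp add: Hausdorff_space_product_topology)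

text \<open>Coordinates are nonnegative, so being supported on \<open>I\<close> is the vanishing of
  one continuous function, the sum of the coordinates outside \<open>I\<close>.\<close>

lemma closedin_simplex_face:
  "closedin (simplex_top n) {t \<in> standard_simplex n. \<forall>i. t i \<noteq> 0 \<longrightarrow> i \<in> I}"
proof -
  have "{t \<in> standard_simplex n. \<forall>i. t i \<noteq> 0 \<longrightarrow> i \<in> I}
      = {t \<in> topspace (simplex_top n). (\<Sum>i\<in>{..n} - I. t i) \<in> {0}}"
  proof -
    have "(\<forall>i. t i \<noteq> 0 \<longrightarrow> i \<in> I) \<longleftrightarrow> (\<Sum>i\<in>{..n} - I. t i) = 0" if t: "t \<in> standard_simplex n" for t
    proof -
      have "(\<Sum>i\<in>{..n} - I. t i) = 0 \<longleftrightarrow> (\<forall>i\<in>{..n} - I. t i = 0)"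
        using standard_simplexD(1)[OF t] by (intro sum_nonneg_eq_0_iff) auto
      then show ?thesis using standard_simplexD(2)[OF t] by (metis DiffI DiffD2 atMost_iff not_le)
    qed
    then show ?thesis by auto
  qed
  moreover have "continuous_map (simplex_top n) euclideanreal (\<lambda>t. \<Sum>i\<in>{..n} - I. t i)"
    by (intro continuous_intros) auto
  ultimately show ?thesis
    using closedin_continuous_map_preimage[of "simplex_top n" euclideanreal _ "{0}"] by simp
qed

lemma support_nonempty: "t \<in> standard_simplex n \<Longrightarrow> {i. t i \<noteq> 0} \<noteq> {} \<and> {i. t i \<noteq> 0} \<subseteq> {..n}"
proof
  assume t: "t \<in> standard_simplex n"
  show "{i. t i \<noteq> 0} \<noteq> {}"
  proof
    assume "{i. t i \<noteq> 0} = {}"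
    then have "(\<Sum>i\<le>n. t i) = 0" by (intro sum.neutral) auto
    then show False using standard_simplexD(3)[OF t] by simp
  qed
  show "{i. t i \<noteq> 0} \<subseteq> {..n}" using standard_simplexD(2)[OF t] not_le by auto
qed

section \<open>Spaces glued from simplices\<close>

text \<open>The structure on which the homology argument rests; it is instantiated by geometric
  realizations and by single standard simplices. \<open>chi\<close> is given on all simplices, but
  only the nondegenerate ones yield open cells, which \<open>chi_unique\<close> keeps apart.
  \<open>weak_closedin\<close> is the colimit topology.\<close>

locale cell_space = simplicial_set S pull
  for S :: "nat \<Rightarrow> 'x set" and pull :: "nat \<Rightarrow> (nat \<Rightarrow> nat) \<Rightarrow> 'x \<Rightarrow> 'x" +
  fixes X :: "'p topology" and chi :: "nat \<Rightarrow> 'x \<Rightarrow> (nat \<Rightarrow> real) \<Rightarrow> 'p"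
  assumes chi_simplex: "x \<in> S n \<Longrightarrow> singular_simplex n X (chi n x)"
    and chi_pull: "\<theta> \<in> simplex_maps m n \<Longrightarrow> x \<in> S n \<Longrightarrow> t \<in> standard_simplex m \<Longrightarrow>
      chi m (pull m \<theta> x) t = chi n x (simplex_push m \<theta> t)"
    and chi_covers: "p \<in> topspace X \<Longrightarrow> \<exists>n. \<exists>x\<in>S n. \<exists>t\<in>standard_simplex n. chi n x t = p"
    and chi_unique: "x \<in> nondeg n \<Longrightarrow> y \<in> nondeg m \<Longrightarrow> interior_pt n t \<Longrightarrow> interior_pt m u \<Longrightarrow>
      chi n x t = chi m y u \<Longrightarrow> n = m \<and> x = y \<and> t = u"
    and weak_closedin: "C \<subseteq> topspace X \<Longrightarrow>
      (\<And>n x. x \<in> S n \<Longrightarrow> closedin (simplex_top n) {t \<in> standard_simplex n. chi n x t \<in> C}) \<Longrightarrow>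
      closedin X C"
begin

lemma chi_continuous: "x \<in> S n \<Longrightarrow> continuous_map (simplex_top n) X (chi n x)"
  using chi_simplex by (simp add: singular_simplex_def)

lemma chi_in: "x \<in> S n \<Longrightarrow> t \<in> standard_simplex n \<Longrightarrow> chi n x t \<in> topspace X"
  using continuous_map_image_subset_topspace[OF chi_continuous] by fastforce

text \<open>\<open>z\<close> is the core of \<open>pull n r x\<close>, where \<open>r\<close> is the
  retraction onto \<open>I\<close>. If \<open>\<sigma>\<close> did not map \<open>I\<close> onto
  \<open>{..k}\<close>, the endomorphism \<open>\<sigma> \<circ> r \<circ> \<delta>\<close> would
  fix \<open>z\<close> without being onto. Hence a point with support exactly \<open>I\<close> is
  pushed to an interior point of the cell of \<open>z\<close>.\<close>

lemma face:
  assumes x: "x \<in> S n" and I: "I \<subseteq> {..n}" "I \<noteq> {}"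
  shows "\<exists>k z \<sigma>. z \<in> nondeg k \<and> \<sigma> \<in> simplex_maps n k \<and> \<sigma> ` I = {..k} \<and>
    (\<exists>\<delta>\<in>simplex_maps k n. z = pull k \<delta> x) \<and>
    (\<forall>t\<in>standard_simplex n. {i. t i \<noteq> 0} \<subseteq> I \<longrightarrow> chi n x t = chi k z (simplex_push n \<sigma> t))"
proof -
  obtain r where r: "r \<in> simplex_maps n n" "\<And>i. r i \<in> I" "\<And>i. i \<in> I \<Longrightarrow> r i = i"
    using simplex_maps_retract[OF I] by blast
  obtain k z \<sigma> where z: "z \<in> nondeg k" "\<sigma> \<in> simplex_maps n k" "\<sigma> ` {..n} = {..k}"
      and w: "pull n r x = pull n \<sigma> z"
    using nondeg_core[OF pull_closed[OF r(1) x]] by blast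
  obtain \<delta> where \<delta>: "\<delta> \<in> simplex_maps k n" "\<And>j. j \<le> k \<Longrightarrow> \<sigma> (\<delta> j) = j"
    using simplex_maps_section[OF z(2,3), of 0] by auto
  have zS: "z \<in> S k" by (rule nondegD[OF z(1)])
  have "pull n (\<sigma> \<circ> r) z = pull n r (pull n r x)" using pull_pull[OF z(2) r(1) zS] w by simp
  also have "\<dots> = pull n r x" using pull_pull[OF r(1) r(1) x] pull_cong[of n "r \<circ> r" r x] r(2,3) by simp
  finally have "pull n (\<sigma> \<circ> r) z = pull n \<sigma> z" using w by simp
  then have "pull k (\<sigma> \<circ> r \<circ> \<delta>) z = pull k (\<sigma> \<circ> \<delta>) z"
    using pull_pull[OF simplex_maps_comp[OF z(2) r(1)] \<delta>(1) zS] pull_pull[OF z(2) \<delta>(1) zS] by simp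
  also have "\<dots> = z" using pull_cong[of k "\<sigma> \<circ> \<delta>" id z] \<delta>(2) pull_id[OF zS] by simp
  finally have "(\<sigma> \<circ> r \<circ> \<delta>) ` {..k} = {..k}"
    using z(1) simplex_maps_comp[OF simplex_maps_comp[OF z(2) r(1)] \<delta>(1)] unfolding nondeg_def by blast
  moreover have "(\<sigma> \<circ> r \<circ> \<delta>) ` {..k} \<subseteq> \<sigma> ` I" using r(2) by auto
  moreover have "\<sigma> ` I \<subseteq> {..k}" using z(3) I(1) by blast
  ultimately have "\<sigma> ` I = {..k}" by blast
  moreover have "z = pull k (r \<circ> \<delta>) x"
  proof -
    have "z = pull k (\<sigma> \<circ> \<delta>) z" using pull_cong[of k "\<sigma> \<circ> \<delta>" id z] \<delta>(2) pull_id[OF zS] by simp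
    also have "\<dots> = pull k \<delta> (pull n r x)" using pull_pull[OF z(2) \<delta>(1) zS] w by simp
    also have "\<dots> = pull k (r \<circ> \<delta>) x" by (rule pull_pull[OF r(1) \<delta>(1) x])
    finally show ?thesis .
  qed
  moreover have "chi n x t = chi k z (simplex_push n \<sigma> t)"
    if t: "t \<in> standard_simplex n" "{i. t i \<noteq> 0} \<subseteq> I" for t
  proof -
    have "simplex_push n r t = t" by (rule simplex_push_retract[OF t(1)]) (use r(3) t(2) in blast)
    then have "chi n x t = chi n x (simplex_push n r t)" by simp
    also have "\<dots> = chi n (pull n \<sigma> z) t" using chi_pull[OF r(1) x t(1)] w by simp
    also have "\<dots> = chi k z (simplex_push n \<sigma> t)" by (rule chi_pull[OF z(2) zS t(1)])
    finally show ?thesis .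
  qed
  ultimately show ?thesis using z(1,2) simplex_maps_comp[OF r(1) \<delta>(1)] by blast
qed

text \<open>Take \<open>face\<close> for the support of \<open>t\<close>; the pushed coordinates are
  then all positive.\<close>

lemma normal_form:
  assumes x: "x \<in> S n" and t: "t \<in> standard_simplex n"
  shows "\<exists>k z u. z \<in> nondeg k \<and> interior_pt k u \<and> chi n x t = chi k z u \<and> (\<exists>\<delta>\<in>simplex_maps k n. z = pull k \<delta> x)"
proof -
  have I: "{i. t i \<noteq> 0} \<subseteq> {..n}" "{i. t i \<noteq> 0} \<noteq> {}" using support_nonempty[OF t] by auto
  from face[OF x I] obtain k z \<sigma> where z: "z \<in> nondeg k" "\<sigma> \<in> simplex_maps n k" "\<sigma> ` {i. t i \<noteq> 0} = {..k}"
    "\<exists>\<delta>\<in>simplex_maps k n. z = pull k \<delta> x" "chi n x t = chi k z (simplex_push n \<sigma> t)"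
    using t by blast
  then show ?thesis using inner_push[OF z(2) t z(3)] by blast
qed

text \<open>Two points of two simplices coincide in \<open>X\<close> exactly when the faces spanned
  by their supports have the same core and the pushed coordinates agree. There are finitely many
  pairs of faces, and for each pair the condition is the preimage, under a continuous map, of a
  compact image of a closed set.\<close>

lemma closedin_coincidence:
  assumes x: "x \<in> S n" and y: "y \<in> S m" and C: "closedin (simplex_top m) C"
  shows "closedin (simplex_top n) {t \<in> standard_simplex n. \<exists>u\<in>C. chi n x t = chi m y u}"
proof -
  have CS: "C \<subseteq> standard_simplex m" using closedin_subset[OF C] by simp
  define FF where "FF n x I k z \<sigma> \<longleftrightarrow> z \<in> nondeg k \<and> \<sigma> \<in> simplex_maps n k \<and> \<sigma> ` I = {..k} \<and>
    (\<forall>t\<in>standard_simplex n. {i. t i \<noteq> 0} \<subseteq> I \<longrightarrow> chi n x t = chi k z (simplex_push n \<sigma> t))" for n x I k z \<sigma>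
  have ex: "\<exists>f. \<forall>I. I \<subseteq> {..n} \<and> I \<noteq> {} \<longrightarrow> FF n x I (fst (f I)) (fst (snd (f I))) (snd (snd (f I)))"
    if "x \<in> S n" for n x
  proof -
    have "\<forall>I. \<exists>f. I \<subseteq> {..n} \<and> I \<noteq> {} \<longrightarrow> FF n x I (fst f) (fst (snd f)) (snd (snd f))"
      using face[OF that] unfolding FF_def by (metis fst_conv snd_conv)
    then show ?thesis by (rule choice)
  qed
  obtain f where f: "\<And>I. I \<subseteq> {..n} \<Longrightarrow> I \<noteq> {} \<Longrightarrow> FF n x I (fst (f I)) (fst (snd (f I))) (snd (snd (f I)))"
    using ex[OF x] by blast
  obtain g where g: "\<And>I. I \<subseteq> {..m} \<Longrightarrow> I \<noteq> {} \<Longrightarrow> FF m y I (fst (g I)) (fst (snd (g I))) (snd (snd (g I)))"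
    using ex[OF y] by blast
  \<comment> \<open>Supports are only asked to be contained in \<open>I\<close> and
    \<open>J\<close>; asking for equality would destroy closedness.\<close>
  define A where "A I J = {t \<in> standard_simplex n. (\<forall>i. t i \<noteq> 0 \<longrightarrow> i \<in> I) \<and>
      simplex_push n (snd (snd (f I))) t \<in> simplex_push m (snd (snd (g J))) ` {u \<in> C. \<forall>i. u i \<noteq> 0 \<longrightarrow> i \<in> J}}" for I J
  define Q where "Q = {(I, J). I \<subseteq> {..n} \<and> I \<noteq> {} \<and> J \<subseteq> {..m} \<and> J \<noteq> {} \<and>
      fst (f I) = fst (g J) \<and> fst (snd (f I)) = fst (snd (g J))}"
  have "Q \<subseteq> Pow {..n} \<times> Pow {..m}" by (auto simp: Q_def)
  then have finQ: "finite Q" by (rule finite_subset) simp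
  have "closedin (simplex_top n) (A I J)" if "(I, J) \<in> Q" for I J
  proof -
    have Q: "I \<subseteq> {..n}" "I \<noteq> {}" "J \<subseteq> {..m}" "J \<noteq> {}" "fst (f I) = fst (g J)"
      using that by (auto simp: Q_def)
    let ?k = "fst (f I)"
    have s: "snd (snd (f I)) \<in> simplex_maps n ?k" "snd (snd (g J)) \<in> simplex_maps m ?k"
      using f[OF Q(1,2)] g[OF Q(3,4)] Q(5) by (auto simp: FF_def)
    have "closedin (simplex_top m) (C \<inter> {u \<in> standard_simplex m. \<forall>i. u i \<noteq> 0 \<longrightarrow> i \<in> J})"
      by (intro closedin_Int C closedin_simplex_face)
    moreover have "C \<inter> {u \<in> standard_simplex m. \<forall>i. u i \<noteq> 0 \<longrightarrow> i \<in> J} = {u \<in> C. \<forall>i. u i \<noteq> 0 \<longrightarrow> i \<in> J}"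
      using CS by auto
    ultimately have "closedin (simplex_top ?k)
        (simplex_push m (snd (snd (g J))) ` {u \<in> C. \<forall>i. u i \<noteq> 0 \<longrightarrow> i \<in> J})"
      using T1_Spaces.continuous_imp_closed_map[OF continuous_map_simplex_push[OF s(2)]
          compact_space_simplex_top Hausdorff_space_simplex_top]
      by (simp add: closed_map_def)
    from closedin_continuous_map_preimage[OF continuous_map_simplex_push[OF s(1)] this]
    have "closedin (simplex_top n) ({t \<in> standard_simplex n. \<forall>i. t i \<noteq> 0 \<longrightarrow> i \<in> I} \<inter>
        {t \<in> topspace (simplex_top n). simplex_push n (snd (snd (f I))) t \<in>
          simplex_push m (snd (snd (g J))) ` {u \<in> C. \<forall>i. u i \<noteq> 0 \<longrightarrow> i \<in> J}})"
      by (intro closedin_Int closedin_simplex_face)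
    then show ?thesis unfolding A_def by (rule back_subst[of "closedin (simplex_top n)"]) auto
  qed
  then have "closedin (simplex_top n) (\<Union>(I,J)\<in>Q. A I J)" using finQ by (intro closedin_Union) auto
  moreover have "(\<Union>(I,J)\<in>Q. A I J) = {t \<in> standard_simplex n. \<exists>u\<in>C. chi n x t = chi m y u}"
  proof (intro equalityI subsetI)
    fix t assume "t \<in> (\<Union>(I,J)\<in>Q. A I J)"
    then obtain I J where IJ: "(I, J) \<in> Q" "t \<in> A I J" by blast
    then have Q: "I \<subseteq> {..n}" "I \<noteq> {}" "J \<subseteq> {..m}" "J \<noteq> {}" "fst (f I) = fst (g J)" "fst (snd (f I)) = fst (snd (g J))"
      by (auto simp: Q_def)
    obtain u where u: "u \<in> C" "{i. u i \<noteq> 0} \<subseteq> J" and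
        tu: "simplex_push n (snd (snd (f I))) t = simplex_push m (snd (snd (g J))) u"
      using IJ(2) unfolding A_def by blast
    have t: "t \<in> standard_simplex n" "{i. t i \<noteq> 0} \<subseteq> I" using IJ(2) by (auto simp: A_def)
    have "chi n x t = chi (fst (f I)) (fst (snd (f I))) (simplex_push n (snd (snd (f I))) t)"
      using f[OF Q(1,2)] t unfolding FF_def by blast
    also have "\<dots> = chi (fst (g J)) (fst (snd (g J))) (simplex_push m (snd (snd (g J))) u)"
      using Q tu by simp
    also have "\<dots> = chi m y u"
      using g[OF Q(3,4)] u CS unfolding FF_def by (metis subsetD)
    finally show "t \<in> {t \<in> standard_simplex n. \<exists>u\<in>C. chi n x t = chi m y u}" using t(1) u(1) by blast
  next
    fix t assume "t \<in> {t \<in> standard_simplex n. \<exists>u\<in>C. chi n x t = chi m y u}"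
    then obtain u where t: "t \<in> standard_simplex n" and u: "u \<in> C" and tu: "chi n x t = chi m y u" by blast
    have uS: "u \<in> standard_simplex m" using u CS by blast
    define I where "I = {i. t i \<noteq> 0}"
    define J where "J = {i. u i \<noteq> 0}"
    have I: "I \<subseteq> {..n}" "I \<noteq> {}" using support_nonempty[OF t] by (auto simp: I_def)
    have J: "J \<subseteq> {..m}" "J \<noteq> {}" using support_nonempty[OF uS] by (auto simp: J_def)
    note fI = f[OF I, unfolded FF_def] and gJ = g[OF J, unfolded FF_def]
    have "chi (fst (f I)) (fst (snd (f I))) (simplex_push n (snd (snd (f I))) t) = chi n x t"
      using fI t by (simp add: I_def)
    also have "\<dots> = chi (fst (g J)) (fst (snd (g J))) (simplex_push m (snd (snd (g J))) u)"
      using gJ uS tu by (simp add: J_def)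
    finally have eq: "chi (fst (f I)) (fst (snd (f I))) (simplex_push n (snd (snd (f I))) t) =
        chi (fst (g J)) (fst (snd (g J))) (simplex_push m (snd (snd (g J))) u)" .
    have "interior_pt (fst (f I)) (simplex_push n (snd (snd (f I))) t)"
      using fI t by (intro inner_push) (auto simp: I_def)
    moreover have "interior_pt (fst (g J)) (simplex_push m (snd (snd (g J))) u)"
      using gJ uS by (intro inner_push) (auto simp: J_def)
    ultimately have *: "fst (f I) = fst (g J) \<and> fst (snd (f I)) = fst (snd (g J)) \<and>
        simplex_push n (snd (snd (f I))) t = simplex_push m (snd (snd (g J))) u"
      using chi_unique[OF _ _ _ _ eq] fI gJ by blast
    then have "(I, J) \<in> Q" using I J by (simp add: Q_def)
    moreover have "t \<in> A I J" using t u * by (auto simp: A_def I_def J_def)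
    ultimately show "t \<in> (\<Union>(I,J)\<in>Q. A I J)" by blast
  qed
  ultimately show ?thesis by simp
qed

text \<open>The weak topology tests closedness inside each simplex, and there the preimage of an
  image is a coincidence set.\<close>

lemma chi_closed_map: "x \<in> S n \<Longrightarrow> closed_map (simplex_top n) X (chi n x)"
  unfolding closed_map_def
proof (intro allI impI)
  fix C assume x: "x \<in> S n" and C: "closedin (simplex_top n) C"
  have CS: "C \<subseteq> standard_simplex n" using closedin_subset[OF C] by simp
  show "closedin X (chi n x ` C)"
  proof (rule weak_closedin)
    show "chi n x ` C \<subseteq> topspace X" using chi_in[OF x] CS by blast
  next
    fix m y assume y: "y \<in> S m"
    have "{t \<in> standard_simplex m. chi m y t \<in> chi n x ` C} = {t \<in> standard_simplex m. \<exists>u\<in>C. chi m y t = chi n x u}"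
      by blast
    then show "closedin (simplex_top m) {t \<in> standard_simplex m. chi m y t \<in> chi n x ` C}"
      using closedin_coincidence[OF y x C] by simp
  qed
qed

text \<open>Pick one interior point in every open cell that meets \<open>K\<close>. A set of picked
  points meets each closed simplex in finitely many points, so it is closed by the weak topology; an
  infinite set of them would have a limit point in \<open>K\<close>, which is then
  impossible.\<close>

lemma finite_cells:
  assumes K: "compactin X K"
  shows "finite {(n, x). x \<in> nondeg n \<and> (\<exists>t. interior_pt n t \<and> chi n x t \<in> K)}" (is "finite ?Q")
proof -
  have "\<forall>c. \<exists>t. c \<in> ?Q \<longrightarrow> interior_pt (fst c) t \<and> chi (fst c) (snd c) t \<in> K" by auto
  then obtain tt where tt: "\<And>c. c \<in> ?Q \<Longrightarrow> interior_pt (fst c) (tt c) \<and> chi (fst c) (snd c) (tt c) \<in> K"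
    using choice[of "\<lambda>c t. c \<in> ?Q \<longrightarrow> interior_pt (fst c) t \<and> chi (fst c) (snd c) t \<in> K"] by blast
  define p where "p c = chi (fst c) (snd c) (tt c)" for c
  have nd: "snd c \<in> nondeg (fst c)" if "c \<in> ?Q" for c using that by auto
  have inj: "inj_on p ?Q"
  proof (rule inj_onI)
    fix c d assume cd: "c \<in> ?Q" "d \<in> ?Q" "p c = p d"
    then show "c = d"
      using chi_unique[OF nd[OF cd(1)] nd[OF cd(2)], of "tt c" "tt d"] tt[OF cd(1)] tt[OF cd(2)]
      unfolding p_def prod_eq_iff by blast
  qed
  have pK: "p ` ?Q \<subseteq> K" using tt by (auto simp: p_def)
  have KX: "K \<subseteq> topspace X" by (rule compactin_subset_topspace[OF K])
  have closed: "closedin X E" if E: "E \<subseteq> p ` ?Q" for E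
  proof (rule weak_closedin)
    show "E \<subseteq> topspace X" using E pK KX by blast
  next
    fix n x assume x: "x \<in> S n"
    define G where "G = E \<inter> chi n x ` standard_simplex n"
    have "\<forall>I. \<exists>c. I \<subseteq> {..n} \<and> I \<noteq> {} \<longrightarrow> (\<exists>\<sigma>. snd c \<in> nondeg (fst c) \<and> \<sigma> \<in> simplex_maps n (fst c) \<and> \<sigma> ` I = {..fst c} \<and>
      (\<forall>t\<in>standard_simplex n. {i. t i \<noteq> 0} \<subseteq> I \<longrightarrow> chi n x t = chi (fst c) (snd c) (simplex_push n \<sigma> t)))"
      using face[OF x] by (metis fst_conv snd_conv)
    then obtain c where c: "\<And>I. I \<subseteq> {..n} \<Longrightarrow> I \<noteq> {} \<Longrightarrow> \<exists>\<sigma>. snd (c I) \<in> nondeg (fst (c I)) \<and> \<sigma> \<in> simplex_maps n (fst (c I)) \<and> \<sigma> ` I = {..fst (c I)} \<and>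
      (\<forall>t\<in>standard_simplex n. {i. t i \<noteq> 0} \<subseteq> I \<longrightarrow> chi n x t = chi (fst (c I)) (snd (c I)) (simplex_push n \<sigma> t))"
      by metis
    \<comment> \<open>A picked point in the image of \<open>x\<close> lies in the open cell of the
      core of some face of \<open>x\<close>, and \<open>x\<close> has finitely many faces.\<close>
    have "G \<subseteq> p ` c ` Pow {..n}"
    proof
      fix e assume "e \<in> G"
      then obtain t where t: "t \<in> standard_simplex n" "e = chi n x t" unfolding G_def by blast
      have "e \<in> E" using \<open>e \<in> G\<close> unfolding G_def by (rule IntD1)
      then have "e \<in> p ` ?Q" by (rule subsetD[OF E])
      then obtain d where d: "e = p d" "d \<in> ?Q" by (rule imageE)
      then have d: "d \<in> ?Q" "e = p d" by simp_all
      define I where "I = {i. t i \<noteq> 0}"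
      have I: "I \<subseteq> {..n}" "I \<noteq> {}" using support_nonempty[OF t(1)] by (auto simp: I_def)
      obtain \<sigma> where \<sigma>: "snd (c I) \<in> nondeg (fst (c I))" "\<sigma> \<in> simplex_maps n (fst (c I))" "\<sigma> ` I = {..fst (c I)}"
          "chi n x t = chi (fst (c I)) (snd (c I)) (simplex_push n \<sigma> t)"
        using c[OF I] t(1) unfolding I_def by blast
      have "interior_pt (fst (c I)) (simplex_push n \<sigma> t)"
        using \<sigma> t(1) by (intro inner_push) (auto simp: I_def)
      then have "fst (c I) = fst d \<and> snd (c I) = snd d"
        using chi_unique[OF \<sigma>(1) nd[OF d(1)], of "simplex_push n \<sigma> t" "tt d"] tt[OF d(1)] t(2) d(2) \<sigma>(4)
        unfolding p_def by metis
      then have "d = c I" by (simp add: prod_eq_iff)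
      then show "e \<in> p ` c ` Pow {..n}" using d(2) I(1) by blast
    qed
    then have "finite G" by (rule finite_subset) simp
    moreover have "closedin (simplex_top n) {t \<in> standard_simplex n. chi n x t = e}" if "e \<in> G" for e
    proof -
      obtain u where u: "u \<in> standard_simplex n" "e = chi n x u" using \<open>e \<in> G\<close> by (auto simp: G_def)
      have "closedin (simplex_top n) {u}"
        using u(1) by (intro closedin_Hausdorff_singleton Hausdorff_space_simplex_top) simp
      from closedin_coincidence[OF x x this] show ?thesis using u(2) by simp
    qed
    ultimately have "closedin (simplex_top n) (\<Union>e\<in>G. {t \<in> standard_simplex n. chi n x t = e})"
      by (intro closedin_Union) auto
    moreover have "(\<Union>e\<in>G. {t \<in> standard_simplex n. chi n x t = e}) = {t \<in> standard_simplex n. chi n x t \<in> E}"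
      by (auto simp: G_def)
    ultimately show "closedin (simplex_top n) {t \<in> standard_simplex n. chi n x t \<in> E}" by simp
  qed
  have "finite (p ` ?Q)"
  proof (rule ccontr)
    assume "infinite (p ` ?Q)"
    then have "K \<inter> X derived_set_of (p ` ?Q) \<noteq> {}"
      using compactin_imp_Bolzano_Weierstrass[OF K] pK by blast
    then obtain a where a: "a \<in> X derived_set_of (p ` ?Q)" by blast
    \<comment> \<open>Deleting \<open>a\<close> leaves a closed set, so its complement is a
      neighbourhood of the limit point \<open>a\<close> that meets the set at most in
      \<open>a\<close>.\<close>
    let ?U = "topspace X - (p ` ?Q - {a})"
    have "openin X ?U" using closed[of "p ` ?Q - {a}"] by blast
    moreover have "a \<in> ?U" using a by (auto simp: in_derived_set_of)
    moreover have "\<forall>T. a \<in> T \<and> openin X T \<longrightarrow> (\<exists>y. y \<noteq> a \<and> y \<in> p ` ?Q \<and> y \<in> T)"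
      using a unfolding in_derived_set_of by (rule conjunct2)
    ultimately have "\<exists>y. y \<noteq> a \<and> y \<in> p ` ?Q \<and> y \<in> ?U" by (elim allE[of _ ?U] impE) (rule conjI)
    then show False by (elim exE conjE) simp
  qed
  then show ?thesis by (rule finite_imageD[OF _ inj])
qed

end

section \<open>Attaching a cell\<close>

text \<open>A recursion instead of \<open>Min\<close>, so that continuity follows by induction from
  that of the binary minimum.\<close>

primrec min_coord :: "nat \<Rightarrow> (nat \<Rightarrow> real) \<Rightarrow> real" where
  "min_coord 0 t = t 0"
| "min_coord (Suc n) t = min (min_coord n t) (t (Suc n))"

lemma min_coord_le: "i \<le> n \<Longrightarrow> min_coord n t \<le> t i"
  by (induction n) (auto simp: le_Suc_eq min_def)

lemma min_coord_attained: "\<exists>i\<le>n. min_coord n t = t i"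
  by (induction n) (auto simp: min_def le_Suc_eq)

lemma min_coord_ge: "(\<And>i. i \<le> n \<Longrightarrow> c \<le> t i) \<Longrightarrow> c \<le> min_coord n t"
  using min_coord_attained[of n t] by auto

text \<open>The gauge of the simplex about its barycenter: \<open>0\<close> at the barycenter,
  \<open>1\<close> exactly on the boundary, and divided by \<open>r\<close> whenever the
  displacement from the barycenter is divided by \<open>r\<close>.\<close>

definition radius :: "nat \<Rightarrow> (nat \<Rightarrow> real) \<Rightarrow> real" where
  "radius n t = 1 - (real n + 1) * min_coord n t"

text \<open>The radial expansion from the barycenter, which moves the points of radius at least
  \<open>1/2\<close> to the boundary as \<open>s\<close> goes from \<open>0\<close> to \<open>1\<close> and fixes the boundary.\<close>

definition expand :: "nat \<Rightarrow> real \<Rightarrow> (nat \<Rightarrow> real) \<Rightarrow> nat \<Rightarrow> real" where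
  "expand n s t = (\<lambda>i. if i \<le> n
     then 1 / (real n + 1) + (t i - 1 / (real n + 1)) / max (1 - s / 2) (radius n t) else 0)"

definition simplex_bd :: "nat \<Rightarrow> (nat \<Rightarrow> real) set" where
  "simplex_bd n = {t \<in> standard_simplex n. \<not> interior_pt n t}"

context
  fixes n :: nat and t :: "nat \<Rightarrow> real"
  assumes t: "t \<in> standard_simplex n"
begin

lemma min_coord_nonneg: "0 \<le> min_coord n t"
  using standard_simplexD(1)[OF t] by (intro min_coord_ge) auto

lemma radius_le_1: "radius n t \<le> 1"
  using min_coord_nonneg by (simp add: radius_def)

lemma radius_nonneg: "0 \<le> radius n t"
proof -
  have "(\<Sum>i\<le>n. min_coord n t) \<le> (\<Sum>i\<le>n. t i)" by (intro sum_mono min_coord_le) simp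
  then show ?thesis using standard_simplexD(3)[OF t] by (simp add: radius_def algebra_simps)
qed

lemma inner_iff_radius: "interior_pt n t \<longleftrightarrow> radius n t < 1"
proof -
  have "interior_pt n t \<longleftrightarrow> 0 < min_coord n t"
    using min_coord_attained[of n t] min_coord_le[of _ n t] t unfolding interior_pt_def
    by (metis less_le_trans)
  then show ?thesis using min_coord_nonneg by (simp add: radius_def zero_less_mult_iff)
qed

text \<open>The expansion applies the same increasing affine map to all coordinates, so the minimum
  stays at the same index.\<close>

lemma expand_min_coord:
  assumes "0 \<le> s" "s \<le> 1"
  shows "min_coord n (expand n s t) =
    1 / (real n + 1) - radius n t / max (1 - s / 2) (radius n t) / (real n + 1)"
proof -
  let ?l = "max (1 - s / 2) (radius n t)" and ?b = "1 / (real n + 1)"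
  have l: "0 < ?l" using assms by linarith
  have b: "min_coord n t - ?b = - radius n t * ?b"
    by (simp add: radius_def field_simps)
  obtain i where i: "i \<le> n" "min_coord n t = t i" using min_coord_attained by blast
  have "?b + (min_coord n t - ?b) / ?l \<le> min_coord n (expand n s t)"
  proof (rule min_coord_ge)
    fix j assume j: "j \<le> n"
    have "(min_coord n t - ?b) / ?l \<le> (t j - ?b) / ?l"
      using l min_coord_le[OF j, of t] by (intro divide_right_mono) auto
    then show "?b + (min_coord n t - ?b) / ?l \<le> expand n s t j" using j by (simp add: expand_def)
  qed
  moreover have "min_coord n (expand n s t) \<le> ?b + (min_coord n t - ?b) / ?l"
    using min_coord_le[OF i(1), of "expand n s t"] i by (simp add: expand_def)
  ultimately have "min_coord n (expand n s t) = ?b + (min_coord n t - ?b) / ?l" by simp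
  also have "\<dots> = ?b - radius n t / ?l / (real n + 1)" unfolding b by simp
  finally show ?thesis .
qed

lemma expand_in:
  assumes "0 \<le> s" "s \<le> 1"
  shows "expand n s t \<in> standard_simplex n"
proof (rule standard_simplexI)
  let ?l = "max (1 - s / 2) (radius n t)" and ?b = "1 / (real n + 1)"
  have l: "0 < ?l" using assms by linarith
  have "radius n t / ?l \<le> 1" using l by simp
  then have "radius n t / ?l / (real n + 1) \<le> ?b" by (intro divide_right_mono) auto
  then have m: "0 \<le> min_coord n (expand n s t)"
    unfolding expand_min_coord[OF assms] by simp
  show "0 \<le> expand n s t i" for i
    using m min_coord_le[of i n "expand n s t"] by (cases "i \<le> n") (auto simp: expand_def)
  show "expand n s t i = 0" if "n < i" for i using that by (simp add: expand_def)
  have "(\<Sum>i\<le>n. expand n s t i) = (\<Sum>i\<le>n. ?b) + ((\<Sum>i\<le>n. t i) - (\<Sum>i\<le>n. ?b)) / ?l"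
    unfolding sum_subtractf[symmetric] sum_divide_distrib sum.distrib[symmetric]
    by (intro sum.cong) (auto simp: expand_def)
  also have "(\<Sum>i\<le>n. ?b) = 1" by simp
  finally show "(\<Sum>i\<le>n. expand n s t i) = 1" using standard_simplexD(3)[OF t] by simp
qed

lemma expand_radius:
  assumes "0 \<le> s" "s \<le> 1"
  shows "radius n (expand n s t) = radius n t / max (1 - s / 2) (radius n t)"
proof -
  have *: "1 - c * (1 / c - x / c) = x" if "c \<noteq> 0" for x c :: real using that by (simp add: field_simps)
  show ?thesis unfolding radius_def[of n "expand n s t"] expand_min_coord[OF assms] by (rule *) linarith
qed

lemma expand_fixed:
  assumes "0 \<le> s" "max (1 - s / 2) (radius n t) = 1"
  shows "expand n s t = t"
  using assms(2) standard_simplexD(2)[OF t] by (auto simp: expand_def fun_eq_iff)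

lemma expand_0: "expand n 0 t = t"
  using radius_le_1 by (intro expand_fixed) auto

lemma expand_bd: "\<lbrakk>0 \<le> s; \<not> interior_pt n t\<rbrakk> \<Longrightarrow> expand n s t = t"
  using radius_le_1 by (intro expand_fixed) (auto simp: inner_iff_radius)

text \<open>This keeps the collar of an attached cell stable during the whole deformation.\<close>

lemma expand_radius_ge:
  assumes "0 \<le> s" "s \<le> 1"
  shows "radius n t \<le> radius n (expand n s t)"
proof -
  let ?l = "max (1 - s / 2) (radius n t)"
  have "0 < ?l" "?l \<le> 1" using assms radius_le_1 by linarith+
  then show ?thesis unfolding expand_radius[OF assms] using radius_nonneg
    by (simp add: field_simps mult_left_le)
qed

text \<open>From radius 1/2 on, the divisor of the expansion at \<open>s = 1\<close> equals the
  radius itself, so the new radius is \<open>1\<close>.\<close>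

lemma expand_1_bd:
  assumes "1/2 \<le> radius n t"
  shows "expand n 1 t \<in> simplex_bd n"
proof -
  have "radius n (expand n 1 t) = 1" using expand_radius[of 1] assms by simp
  then obtain i where "i \<le> n" "expand n 1 t i = 0"
    using min_coord_attained[of n "expand n 1 t"] by (auto simp: radius_def)
  then have "\<not> interior_pt n (expand n 1 t)" unfolding interior_pt_def by (metis less_irrefl)
  then show ?thesis unfolding simplex_bd_def using expand_in[of 1] by simp
qed

end

lemma continuous_map_min_coord: "continuous_map (simplex_top m) euclideanreal (min_coord n)"
  by (induction n) (auto intro!: continuous_intros)

lemma continuous_map_radius: "continuous_map (simplex_top n) euclideanreal (radius n)"
  unfolding radius_def by (intro continuous_intros continuous_map_min_coord)

lemma continuous_map_expand:
  "continuous_map (prod_topology (top_of_set {0..1}) (simplex_top n)) (simplex_top n) (\<lambda>(s, t). expand n s t)"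
proof -
  let ?P = "prod_topology (top_of_set {0..1::real}) (simplex_top n)"
  have 1: "continuous_map ?P euclideanreal fst"
    using continuous_map_fst[of "top_of_set {0..1::real}" "simplex_top n"]
    by (rule continuous_map_into_fulltopology)
  have 2: "continuous_map ?P (simplex_top n) snd" by (rule continuous_map_snd)
  have 3: "continuous_map ?P euclideanreal (\<lambda>p. radius n (snd p))"
    using continuous_map_compose[OF 2 continuous_map_radius] by (simp add: o_def)
  have 4: "continuous_map ?P euclideanreal (\<lambda>p. snd p i)" for i
    using continuous_map_compose[OF 2 continuous_map_coord] by (simp add: o_def)
  have "continuous_map ?P euclideanreal (\<lambda>p. expand n (fst p) (snd p) i)" for i
    unfolding expand_def
    by (cases "i \<le> n") (auto intro!: continuous_intros 1 3 4)
  moreover have "(\<lambda>p. expand n (fst p) (snd p)) \<in> topspace ?P \<rightarrow> standard_simplex n"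
    using expand_in by auto
  ultimately have "continuous_map ?P (simplex_top n) (\<lambda>p. expand n (fst p) (snd p))"
    by (simp add: continuous_map_to_simplex_top)
  then show ?thesis by (simp add: case_prod_unfold)
qed

text \<open>Two closed maps that jointly cover \<open>Z\<close> present its closed sets as images,
  so continuity can be checked after composing with each of them.\<close>

lemma continuous_map_paste_closed:
  assumes g: "closed_map U Z g" and h: "closed_map V Z h"
    and cover: "topspace Z \<subseteq> g ` topspace U \<union> h ` topspace V"
    and fg: "continuous_map U Y (f \<circ> g)" and fh: "continuous_map V Y (f \<circ> h)"
  shows "continuous_map Z Y f"
  unfolding continuous_map_closedin
proof (intro conjI ballI allI impI)
  have gZ: "g ` topspace U \<subseteq> topspace Z" and hZ: "h ` topspace V \<subseteq> topspace Z"
    using g h closed_map_imp_subset_topspace by blast+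
  show "f \<in> topspace Z \<rightarrow> topspace Y"
    using cover fg fh by (fastforce simp: continuous_map_def)
  fix C assume C: "closedin Y C"
  have "closedin Z (g ` {x \<in> topspace U. (f \<circ> g) x \<in> C})"
    using g closedin_continuous_map_preimage[OF fg C] by (simp add: closed_map_def)
  moreover have "closedin Z (h ` {x \<in> topspace V. (f \<circ> h) x \<in> C})"
    using h closedin_continuous_map_preimage[OF fh C] by (simp add: closed_map_def)
  moreover have "{x \<in> topspace Z. f x \<in> C} =
      g ` {x \<in> topspace U. (f \<circ> g) x \<in> C} \<union> h ` {x \<in> topspace V. (f \<circ> h) x \<in> C}"
  proof (intro equalityI subsetI)
    fix z assume z: "z \<in> {x \<in> topspace Z. f x \<in> C}"
    then have "z \<in> g ` topspace U \<or> z \<in> h ` topspace V" using cover by blast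
    with z show "z \<in> g ` {x \<in> topspace U. (f \<circ> g) x \<in> C} \<union> h ` {x \<in> topspace V. (f \<circ> h) x \<in> C}"
      by auto
  qed (use gZ hZ in auto)
  ultimately show "closedin Z {x \<in> topspace Z. f x \<in> C}" by (simp only: closedin_Un)
qed

text \<open>A relative homeomorphism from the simplex and its boundary to \<open>Y\<close> and
  \<open>A\<close>. That \<open>chi\<close> is a closed map replaces the pushout topology.\<close>

locale cell_attachment =
  fixes Y :: "'p topology" and A :: "'p set" and n :: nat and chi :: "(nat \<Rightarrow> real) \<Rightarrow> 'p"
  assumes closed_A: "closedin Y A"
    and cont: "continuous_map (simplex_top n) Y chi"
    and closed: "closed_map (simplex_top n) Y chi"
    and bd: "t \<in> simplex_bd n \<Longrightarrow> chi t \<in> A"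
    and int: "interior_pt n t \<Longrightarrow> chi t \<notin> A"
    and inj: "\<lbrakk>interior_pt n t; interior_pt n u; chi t = chi u\<rbrakk> \<Longrightarrow> t = u"
    and cover: "y \<in> topspace Y \<Longrightarrow> y \<notin> A \<Longrightarrow> \<exists>t. interior_pt n t \<and> chi t = y"
begin

lemma AY: "A \<subseteq> topspace Y"
  by (rule closedin_subset[OF closed_A])

lemma chi_topspace: "t \<in> standard_simplex n \<Longrightarrow> chi t \<in> topspace Y"
  using continuous_map_image_subset_topspace[OF cont] by fastforce

definition ch_inv where "ch_inv y = (THE t. interior_pt n t \<and> chi t = y)"

lemma ch_inv_chi: "interior_pt n t \<Longrightarrow> ch_inv (chi t) = t"
  unfolding ch_inv_def using inj by (intro the_equality) auto

text \<open>The expansion carried to \<open>Y\<close> by \<open>chi\<close> and constant on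
  \<open>A\<close>. Points outside \<open>topspace Y\<close> stay fixed so that \<open>Psi_0\<close>
  is an equality of total functions, as the definition of a homotopy demands.\<close>

definition Psi where "Psi s y = (if y \<in> A \<or> y \<notin> topspace Y then y else chi (expand n s (ch_inv y)))"

lemma Psi_chi: "\<lbrakk>t \<in> standard_simplex n; 0 \<le> s\<rbrakk> \<Longrightarrow> Psi s (chi t) = chi (expand n s t)"
proof (cases "interior_pt n t")
  case True
  assume "t \<in> standard_simplex n"
  then show ?thesis using True int ch_inv_chi chi_topspace by (simp add: Psi_def)
next
  case False
  assume t: "t \<in> standard_simplex n" and s: "0 \<le> s"
  then have "chi t \<in> A" using False by (intro bd) (simp add: simplex_bd_def)
  then show ?thesis using expand_bd[OF t s False] by (simp add: Psi_def)
qed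

lemma Psi_0: "Psi 0 = id"
proof
  fix y show "Psi 0 y = id y"
    using cover[of y] ch_inv_chi expand_0 innerD by (auto simp: Psi_def)
qed

text \<open>The threshold 1/2 belongs to \<open>expand\<close>: at time \<open>1\<close> exactly the
  points of radius at least 1/2 have reached the boundary.\<close>

definition collar where "collar = topspace Y - chi ` {t \<in> standard_simplex n. radius n t \<le> 1/2}"

text \<open>A point of radius at most 1/2 is interior, so injectivity on the interior prevents its
  image from being hit by a point of larger radius.\<close>

lemma chi_in_collar:
  assumes t: "t \<in> standard_simplex n"
  shows "chi t \<in> collar \<longleftrightarrow> 1/2 < radius n t"
proof
  show "chi t \<in> collar \<Longrightarrow> 1/2 < radius n t" using t by (force simp: collar_def)
  assume r: "1/2 < radius n t"
  have "chi t \<noteq> chi u" if u: "u \<in> standard_simplex n" "radius n u \<le> 1/2" for u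
  proof
    assume eq: "chi t = chi u"
    have iu: "interior_pt n u" using u by (simp add: inner_iff_radius)
    then have "chi t \<notin> A" using int eq by simp
    then have "interior_pt n t" using bd t by (auto simp: simplex_bd_def)
    then have "t = u" using inj iu eq by blast
    then show False using r u by simp
  qed
  then show "chi t \<in> collar" using chi_topspace[OF t] by (auto simp: collar_def)
qed

lemma A_collar: "A \<subseteq> collar"
proof
  fix y assume y: "y \<in> A"
  have "chi t \<noteq> y" if "t \<in> standard_simplex n" "radius n t \<le> 1/2" for t
    using int[of t] inner_iff_radius[OF that(1)] that y by auto
  then show "y \<in> collar" using y AY by (auto simp: collar_def)
qed

lemma openin_collar: "openin Y collar"
proof -
  have "closedin (simplex_top n) {t \<in> topspace (simplex_top n). radius n t \<in> {..1/2}}"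
    by (rule closedin_continuous_map_preimage[OF continuous_map_radius]) simp
  then have "closedin Y (chi ` {t \<in> standard_simplex n. radius n t \<le> 1/2})"
    using closed by (simp add: closed_map_def)
  then show ?thesis unfolding collar_def by blast
qed

lemma continuous_map_Psi:
  "continuous_map (prod_topology (top_of_set {0..1}) Y) Y (\<lambda>(s, y). Psi s y)"
proof (rule continuous_map_paste_closed)
  let ?I = "top_of_set {0..1::real}"
  \<comment> \<open>A product of closed maps need not be closed. Closedness of \<open>chi\<close> is
    therefore strengthened to properness, which the product with the interval preserves.\<close>
  have "proper_map (simplex_top n) Y chi" unfolding proper_map_def
  proof (intro conjI ballI closed)
    fix y assume y: "y \<in> topspace Y"
    have "closedin (simplex_top n) {t \<in> topspace (simplex_top n). chi t = y}"
    proof (cases "\<exists>t\<in>standard_simplex n. chi t = y")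
      case True
      then obtain t where t: "t \<in> standard_simplex n" "chi t = y" by blast
      have "closedin (simplex_top n) {t}"
        using t(1) by (intro closedin_Hausdorff_singleton Hausdorff_space_simplex_top) simp
      then have "closedin Y {y}" using closed t(2) by (auto simp: closed_map_def)
      from closedin_continuous_map_preimage[OF cont this] show ?thesis by simp
    next
      case False
      then have "{t \<in> topspace (simplex_top n). chi t = y} = {}" by auto
      then show ?thesis by (simp only: closedin_empty)
    qed
    then show "compactin (simplex_top n) {t \<in> topspace (simplex_top n). chi t = y}"
      by (intro closedin_compact_space compact_space_simplex_top)
  qed
  then have "proper_map (prod_topology ?I (simplex_top n)) (prod_topology ?I Y) (\<lambda>(s, t). (id s, chi t))"
    by (simp only: proper_map_prod proper_map_id simp_thms)
  then show "closed_map (prod_topology ?I (simplex_top n)) (prod_topology ?I Y) (\<lambda>(s, t). (s, chi t))"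
    by (intro proper_imp_closed_map) simp
  have "proper_map (subtopology Y A) Y id"
    using closed_A by (intro closed_injective_imp_proper_map closed_map_inclusion) auto
  then have "proper_map (prod_topology ?I (subtopology Y A)) (prod_topology ?I Y) (\<lambda>(s, t). (id s, id t))"
    by (simp only: proper_map_prod proper_map_id simp_thms)
  then show "closed_map (prod_topology ?I (subtopology Y A)) (prod_topology ?I Y) id"
    by (intro proper_imp_closed_map) (simp add: case_prod_beta id_def)
  show "topspace (prod_topology ?I Y) \<subseteq> (\<lambda>(s, t). (s, chi t)) ` topspace (prod_topology ?I (simplex_top n)) \<union>
      id ` topspace (prod_topology ?I (subtopology Y A))"
  proof
    fix p assume "p \<in> topspace (prod_topology ?I Y)"
    then obtain s y where p: "p = (s, y)" "s \<in> {0..1}" "y \<in> topspace Y" by auto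
    show "p \<in> (\<lambda>(s, t). (s, chi t)) ` topspace (prod_topology ?I (simplex_top n)) \<union>
        id ` topspace (prod_topology ?I (subtopology Y A))"
    proof (cases "y \<in> A")
      case True then show ?thesis using p by auto
    next
      case False
      then obtain t where "interior_pt n t" "chi t = y" using cover p by blast
      then have "p = (\<lambda>(s, t). (s, chi t)) (s, t)" "(s, t) \<in> topspace (prod_topology ?I (simplex_top n))"
        using p innerD by auto
      then show ?thesis by blast
    qed
  qed
  have "continuous_map (prod_topology ?I (subtopology Y A)) Y snd"
    using continuous_map_snd[of ?I "subtopology Y A"] by (rule continuous_map_into_fulltopology)
  then show "continuous_map (prod_topology ?I (subtopology Y A)) Y ((\<lambda>(s, y). Psi s y) \<circ> id)"
    by (rule continuous_map_eq) (auto simp: Psi_def)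
  have "continuous_map (prod_topology ?I (simplex_top n)) Y (chi \<circ> (\<lambda>(s, t). expand n s t))"
    by (rule continuous_map_compose[OF continuous_map_expand cont])
  then show "continuous_map (prod_topology ?I (simplex_top n)) Y ((\<lambda>(s, y). Psi s y) \<circ> (\<lambda>(s, t). (s, chi t)))"
    by (rule continuous_map_eq) (auto simp: Psi_chi)
qed

lemma Psi_collar:
  assumes "y \<in> collar" "0 \<le> s" "s \<le> 1"
  shows "Psi s y \<in> collar" "Psi 1 y \<in> A"
proof -
  have "Psi s y \<in> collar \<and> Psi 1 y \<in> A"
  proof (cases "y \<in> A")
    case True then show ?thesis using A_collar by (auto simp: Psi_def)
  next
    case False
    have "y \<in> topspace Y" using assms(1) by (simp add: collar_def)
    then obtain t where t: "interior_pt n t" "chi t = y" using cover False by blast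
    note tS = innerD[OF t(1)]
    have r: "1/2 < radius n t" using chi_in_collar[OF tS] t assms(1) by simp
    have "Psi s y = chi (expand n s t)" "Psi 1 y = chi (expand n 1 t)"
      using Psi_chi[OF tS] t(2) assms(2) by auto
    moreover have "chi (expand n s t) \<in> collar"
      using chi_in_collar[OF expand_in[OF tS assms(2,3)]] expand_radius_ge[OF tS assms(2,3)] r by simp
    moreover have "chi (expand n 1 t) \<in> A" using bd[OF expand_1_bd[OF tS]] r by simp
    ultimately show ?thesis by simp
  qed
  then show "Psi s y \<in> collar" "Psi 1 y \<in> A" by auto
qed

text \<open>\<open>Psi 1\<close> maps the collar into \<open>A\<close> and is homotopy inverse to
  the inclusion of pairs, because the deformation preserves both \<open>A\<close> and the
  collar.\<close>

lemma iso_collar: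
  "hom_induced p Y A Y collar id \<in> iso (relative_homology_group p Y A) (relative_homology_group p Y collar)"
proof (rule homotopy_equivalence_relative_homology_group_isomorphism)
  have A: "Psi s \<in> A \<rightarrow> A" for s by (auto simp: Psi_def)
  show "continuous_map Y Y (Psi 1)"
  proof -
    have "continuous_map Y (prod_topology (top_of_set {0..1::real}) Y) (\<lambda>y. (1, y))"
      by (simp add: continuous_map_pairwise o_def)
    from continuous_map_compose[OF this continuous_map_Psi] show ?thesis by (simp add: o_def)
  qed
  show "Psi 1 \<in> collar \<rightarrow> A" using Psi_collar(2)[of _ 1] by simp
  have *: "homotopic_with P Y Y (Psi 1) id" if "\<And>s. 0 \<le> s \<Longrightarrow> s \<le> 1 \<Longrightarrow> P (Psi s)" for P
  proof -
    have "homotopic_with P Y Y id (Psi 1)"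
      unfolding homotopic_with_def
    proof (intro exI[of _ "\<lambda>(s, y). Psi s y"] conjI ballI)
      fix s :: real assume "s \<in> {0..1}"
      then show "P (\<lambda>x. case (s, x) of (s, y) \<Rightarrow> Psi s y)" using that[of s] by simp
    qed (use continuous_map_Psi in \<open>auto simp: Psi_0\<close>)
    then show ?thesis by (rule homotopic_with_symD)
  qed
  show "homotopic_with (\<lambda>h. h \<in> A \<rightarrow> A) Y Y (Psi 1 \<circ> id) id"
    "homotopic_with (\<lambda>h. h \<in> collar \<rightarrow> collar) Y Y (id \<circ> Psi 1) id"
    using A Psi_collar(1) by (auto intro!: *)
qed (use A_collar in auto)

lemma iso_excision:
  "hom_induced p (subtopology Y (topspace Y - A)) (collar - A) Y collar id \<in>
    iso (relative_homology_group p (subtopology Y (topspace Y - A)) (collar - A)) (relative_homology_group p Y collar)"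
proof -
  have "Y closure_of A \<subseteq> Y interior_of collar"
    using A_collar closure_of_closedin[OF closed_A] interior_of_openin[OF openin_collar] by simp
  from homology_excision_axiom[OF this openin_subset[OF openin_collar]] show ?thesis by simp
qed

end

text \<open>The simplex arises from its own boundary by attaching one cell, so the collar and
  excision lemmas also apply to the source of \<open>chi\<close>.\<close>

lemma cell_attachment_simplex: "cell_attachment (simplex_top n) (simplex_bd n) n id"
proof
  have "simplex_bd n = {t \<in> topspace (simplex_top n). radius n t \<in> {1..}}"
    using inner_iff_radius[of _ n] by (auto simp: simplex_bd_def)
  moreover have "closedin (simplex_top n) {t \<in> topspace (simplex_top n). radius n t \<in> {1..}}"
    by (rule closedin_continuous_map_preimage[OF continuous_map_radius]) simp
  ultimately show "closedin (simplex_top n) (simplex_bd n)" by simp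
qed (auto simp: simplex_bd_def innerD closed_map_id)

context cell_attachment
begin

lemma homeomorphic_interior:
  "homeomorphic_map (subtopology (simplex_top n) (topspace (simplex_top n) - simplex_bd n))
    (subtopology Y (topspace Y - A)) chi"
proof (rule bijective_closed_imp_homeomorphic_map)
  let ?D = "simplex_top n"
  have eq: "{x \<in> topspace ?D. chi x \<in> topspace Y - A} = topspace ?D - simplex_bd n"
    using bd int chi_topspace by (auto simp: simplex_bd_def)
  show "closed_map (subtopology ?D (topspace ?D - simplex_bd n)) (subtopology Y (topspace Y - A)) chi"
    by (rule closed_map_restriction[OF closed eq])
  show "continuous_map (subtopology ?D (topspace ?D - simplex_bd n)) (subtopology Y (topspace Y - A)) chi"
    using eq by (auto simp: continuous_map_in_subtopology intro!: continuous_map_from_subtopology cont)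
  show "chi ` topspace (subtopology ?D (topspace ?D - simplex_bd n)) = topspace (subtopology Y (topspace Y - A))"
  proof (intro equalityI subsetI)
    fix y assume "y \<in> topspace (subtopology Y (topspace Y - A))"
    then obtain t where "interior_pt n t" "chi t = y" using cover by auto
    then show "y \<in> chi ` topspace (subtopology ?D (topspace ?D - simplex_bd n))"
      by (auto simp: simplex_bd_def innerD)
  qed (use eq in auto)
  show "inj_on chi (topspace (subtopology ?D (topspace ?D - simplex_bd n)))"
    using inj by (auto simp: inj_on_def simplex_bd_def)
qed

text \<open>Thicken \<open>A\<close> to the collar and then excise \<open>A\<close>: on both sides
  the open cell remains with its part of the collar, and there \<open>chi\<close> is a
  homeomorphism. Two commuting squares carry this isomorphism back to the original pairs.\<close>

lemma bij_hom_induced: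
  "bij_betw (hom_induced p (simplex_top n) (simplex_bd n) Y A chi)
    (carrier (relative_homology_group p (simplex_top n) (simplex_bd n))) (carrier (relative_homology_group p Y A))"
proof -
  interpret D: cell_attachment "simplex_top n" "simplex_bd n" n id by (rule cell_attachment_simplex)
  let ?D = "simplex_top n" and ?B = "simplex_bd n"
  let ?D' = "subtopology ?D (topspace ?D - ?B)" and ?Y' = "subtopology Y (topspace Y - A)"
  let ?H = "\<lambda>Z C. carrier (relative_homology_group p Z C)"
  have sub: "?B \<subseteq> standard_simplex n" by (auto simp: simplex_bd_def)
  \<comment> \<open>Both collars are cut out by the same condition on the radius.\<close>
  have coll: "chi t \<in> collar \<longleftrightarrow> t \<in> D.collar" if "t \<in> standard_simplex n" for t
    using chi_in_collar[OF that] D.chi_in_collar[OF that] by simp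
  have Dc: "D.collar \<subseteq> standard_simplex n" by (auto simp: D.collar_def)
  have c1: "chi \<in> D.collar \<rightarrow> collar" using coll Dc by auto
  have c2: "chi \<in> D.collar - ?B \<rightarrow> collar - A"
    using coll Dc int by (auto simp: simplex_bd_def)
  have im: "chi ` (D.collar - ?B) = collar - A"
  proof (intro equalityI subsetI)
    fix y assume y: "y \<in> collar - A"
    then have "y \<in> topspace Y" by (simp add: collar_def)
    then obtain t where t: "interior_pt n t" "chi t = y" using cover y by blast
    then have "t \<in> D.collar - ?B" using coll y innerD[OF t(1)] by (auto simp: simplex_bd_def)
    then show "y \<in> chi ` (D.collar - ?B)" using t by blast
  qed (use c2 in auto)
  have b1: "bij_betw (hom_induced p ?D' (D.collar - ?B) ?Y' (collar - A) chi) (?H ?D' (D.collar - ?B)) (?H ?Y' (collar - A))"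
  proof -
    have "D.collar - ?B \<subseteq> topspace ?D'" using Dc by auto
    from homeomorphic_map_relative_homology_iso[OF homeomorphic_interior this im]
    show ?thesis by (simp add: iso_def)
  qed
  have b2: "bij_betw (hom_induced p ?Y' (collar - A) Y collar id) (?H ?Y' (collar - A)) (?H Y collar)"
    using iso_excision by (simp add: iso_def)
  have b3: "bij_betw (hom_induced p ?D' (D.collar - ?B) ?D D.collar id) (?H ?D' (D.collar - ?B)) (?H ?D D.collar)"
    using D.iso_excision by (simp add: iso_def)
  have b4: "bij_betw (hom_induced p Y A Y collar id) (?H Y A) (?H Y collar)"
    using iso_collar by (simp add: iso_def)
  have b5: "bij_betw (hom_induced p ?D ?B ?D D.collar id) (?H ?D ?B) (?H ?D D.collar)"
    using D.iso_collar by (simp add: iso_def)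
  have sq1: "hom_induced p ?Y' (collar - A) Y collar id \<circ> hom_induced p ?D' (D.collar - ?B) ?Y' (collar - A) chi
      = hom_induced p ?D D.collar Y collar chi \<circ> hom_induced p ?D' (D.collar - ?B) ?D D.collar id"
  proof -
    have 1: "continuous_map ?D' ?Y' chi" using homeomorphic_interior by (rule homeomorphic_imp_continuous_map)
    have 2: "continuous_map ?Y' Y id" "continuous_map ?D' ?D id" by (simp_all add: continuous_map_from_subtopology)
    have 3: "id \<in> collar - A \<rightarrow> collar" "id \<in> D.collar - ?B \<rightarrow> D.collar" by auto
    show ?thesis
      unfolding hom_induced_compose[OF 1 c2 2(1) 3(1), symmetric] hom_induced_compose[OF 2(2) 3(2) cont c1, symmetric] by simp
  qed
  have b6: "bij_betw (hom_induced p ?D D.collar Y collar chi) (?H ?D D.collar) (?H Y collar)"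
    using bij_betw_comp_iff[OF b3, of "hom_induced p ?D D.collar Y collar chi" "?H Y collar"]
      bij_betw_trans[OF b1 b2] sq1 by simp
  have sq2: "hom_induced p ?D D.collar Y collar chi \<circ> hom_induced p ?D ?B ?D D.collar id
      = hom_induced p Y A Y collar id \<circ> hom_induced p ?D ?B Y A chi"
  proof -
    have 1: "continuous_map ?D ?D id" "continuous_map Y Y id" by simp_all
    have 2: "id \<in> ?B \<rightarrow> D.collar" "id \<in> A \<rightarrow> collar" "chi \<in> ?B \<rightarrow> A"
      using D.A_collar A_collar bd by auto
    show ?thesis
      unfolding hom_induced_compose[OF 1(1) 2(1) cont c1, symmetric] hom_induced_compose[OF cont 2(3) 1(2) 2(2), symmetric] by simp
  qed
  have "hom_induced p ?D ?B Y A chi ` ?H ?D ?B \<subseteq> ?H Y A"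
    using hom_induced_carrier by blast
  from bij_betw_comp_iff2[OF b4 this] show ?thesis
    using bij_betw_trans[OF b5 b6] sq2 by simp
qed

text \<open>Surjectivity in \<open>bij_hom_induced\<close>, spelled out for chains; injectivity
  becomes \<open>relboundary_inj\<close>.\<close>

lemma relcycle_surj:
  assumes "singular_relcycle q Y A c"
  shows "\<exists>m. singular_relcycle q (simplex_top n) (simplex_bd n) m \<and> homologous_rel q Y A c (chain_map q chi m)"
proof -
  let ?D = "simplex_top n" and ?B = "simplex_bd n"
  have "homologous_rel_set q Y A c \<in> hom_induced q ?D ?B Y A chi ` carrier (relative_homology_group q ?D ?B)"
    using bij_hom_induced[of q] assms unfolding bij_betw_def by (auto simp: carrier_relative_homology_group)
  then obtain m where m: "singular_relcycle q ?D ?B m"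
      "homologous_rel_set q Y A c = hom_induced q ?D ?B Y A chi (homologous_rel_set q ?D ?B m)"
    by (auto simp: carrier_relative_homology_group)
  have "chi \<in> ?B \<rightarrow> A" using bd by auto
  from hom_induced_chain_map[OF cont this m(1)] have "homologous_rel_set q Y A c = homologous_rel_set q Y A (chain_map q chi m)"
    using m(2) by simp
  then show ?thesis using m(1) homologous_rel_set_eq by blast
qed

lemma relboundary_inj:
  assumes a: "singular_relcycle q (simplex_top n) (simplex_bd n) a"
    and b: "singular_relboundary q Y A (chain_map q chi a)"
  shows "singular_relboundary q (simplex_top n) (simplex_bd n) a"
proof -
  let ?D = "simplex_top n" and ?B = "simplex_bd n"
  have chi: "chi \<in> ?B \<rightarrow> A" using bd by auto
  have 0: "singular_relcycle q ?D ?B 0" by simp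
  have "homologous_rel_set q Y A (chain_map q chi a) = homologous_rel_set q Y A (chain_map q chi 0)"
    unfolding homologous_rel_set_eq using b by (simp add: homologous_rel_def)
  then have "hom_induced q ?D ?B Y A chi (homologous_rel_set q ?D ?B a) = hom_induced q ?D ?B Y A chi (homologous_rel_set q ?D ?B 0)"
    using hom_induced_chain_map[OF cont chi a] hom_induced_chain_map[OF cont chi 0] by simp
  then have "homologous_rel_set q ?D ?B a = homologous_rel_set q ?D ?B 0"
    using bij_hom_induced[of q] a 0 unfolding bij_betw_def
    by (intro inj_onD[of "hom_induced q ?D ?B Y A chi" "carrier (relative_homology_group q ?D ?B)"])
      (auto simp: carrier_relative_homology_group simp del: singular_relcycle_0)
  then show ?thesis unfolding homologous_rel_set_eq by (simp add: homologous_rel_def)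
qed

end

section \<open>Subcomplexes and the removal of a top-dimensional cell\<close>

context cell_space
begin

definition subcomplex :: "(nat \<Rightarrow> 'x set) \<Rightarrow> bool" where
  "subcomplex T \<longleftrightarrow> (\<forall>n. T n \<subseteq> S n) \<and> (\<forall>m n. \<forall>\<theta>\<in>simplex_maps m n. \<forall>x\<in>T n. pull m \<theta> x \<in> T m)"

definition pts :: "(nat \<Rightarrow> 'x set) \<Rightarrow> 'p set" where
  "pts T = (\<Union>n. \<Union>x\<in>T n. chi n x ` standard_simplex n)"

definition cells :: "(nat \<Rightarrow> 'x set) \<Rightarrow> (nat \<times> 'x) set" where
  "cells T = {(n, x). x \<in> T n \<and> x \<in> nondeg n}"

lemma subcomplexD:
  assumes "subcomplex T"
  shows "x \<in> T n \<Longrightarrow> x \<in> S n" "\<theta> \<in> simplex_maps m n \<Longrightarrow> x \<in> T n \<Longrightarrow> pull m \<theta> x \<in> T m"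
  using assms unfolding subcomplex_def by blast+

lemma subcomplex_S: "subcomplex S"
  by (simp add: subcomplex_def pull_closed)

text \<open>The core of a face of \<open>x\<close> is a pullback of \<open>x\<close>, so it does not
  leave \<open>T\<close>.\<close>

lemma pts_normal_form:
  assumes T: "subcomplex T" and p: "p \<in> pts T"
  shows "\<exists>k z u. (k, z) \<in> cells T \<and> interior_pt k u \<and> p = chi k z u"
proof -
  obtain n x t where x: "x \<in> T n" "t \<in> standard_simplex n" "p = chi n x t"
    using p by (auto simp: pts_def)
  from normal_form[OF subcomplexD(1)[OF T x(1)] x(2)] obtain k z u \<delta> where
    "z \<in> nondeg k" "interior_pt k u" "chi n x t = chi k z u" "\<delta> \<in> simplex_maps k n" "z = pull k \<delta> x"
    by blast
  then show ?thesis using subcomplexD(2)[OF T _ x(1)] x(3) unfolding cells_def by blast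
qed

lemma pts_cells: "subcomplex T \<Longrightarrow> pts T = (\<Union>(n, x)\<in>cells T. chi n x ` standard_simplex n)"
proof (intro equalityI subsetI)
  fix p assume "subcomplex T" "p \<in> pts T"
  then obtain k z u where "(k, z) \<in> cells T" "interior_pt k u" "p = chi k z u"
    using pts_normal_form by blast
  then show "p \<in> (\<Union>(n, x)\<in>cells T. chi n x ` standard_simplex n)" using innerD by blast
qed (auto simp: pts_def cells_def)

lemma pts_subset: "subcomplex T \<Longrightarrow> pts T \<subseteq> topspace X"
  using chi_in subcomplexD(1) by (fastforce simp: pts_def)

lemma pts_S: "pts S = topspace X"
  using pts_subset[OF subcomplex_S] chi_covers by (fastforce simp: pts_def)

lemma closedin_pts:
  assumes T: "subcomplex T" and fin: "finite (cells T)"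
  shows "closedin X (pts T)"
proof -
  have "closedin X (chi n x ` standard_simplex n)" if "(n, x) \<in> cells T" for n x
  proof -
    have "x \<in> S n" using that subcomplexD(1)[OF T] by (simp add: cells_def)
    from chi_closed_map[OF this] show ?thesis unfolding closed_map_def
      by (metis closedin_topspace topspace_standard_simplex)
  qed
  then show ?thesis unfolding pts_cells[OF T] using fin by (intro closedin_Union) auto
qed

text \<open>The point is interior to the cell of the core of \<open>y\<close> and also to some cell
  of \<open>T\<close>. Uniqueness of cells identifies the two, and \<open>y\<close> is a pullback of
  its core.\<close>

lemma pts_interior:
  assumes T: "subcomplex T" and y: "y \<in> S n" "interior_pt n t" and p: "chi n y t \<in> pts T"
  shows "y \<in> T n"
proof -
  obtain k z \<sigma> where z: "z \<in> nondeg k" "\<sigma> \<in> simplex_maps n k" "\<sigma> ` {..n} = {..k}" "y = pull n \<sigma> z"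
    using nondeg_core[OF y(1)] by blast
  have tS: "t \<in> standard_simplex n" by (rule innerD[OF y(2)])
  have "{i. t i \<noteq> 0} = {..n}" using y(2) support_nonempty[OF tS] by (force simp: interior_pt_def)
  then have "interior_pt k (simplex_push n \<sigma> t)" using z tS by (intro inner_push) auto
  moreover have "chi n y t = chi k z (simplex_push n \<sigma> t)"
    using chi_pull[OF z(2) nondegD[OF z(1)] tS] z(4) by simp
  moreover obtain l w u where "(l, w) \<in> cells T" "interior_pt l u" "chi n y t = chi l w u"
    using pts_normal_form[OF T p] by blast
  ultimately have "z \<in> T k" using chi_unique[OF z(1), of w l "simplex_push n \<sigma> t" u] by (simp add: cells_def)
  then show ?thesis using subcomplexD(2)[OF T z(2)] z(4) by blast
qed

definition barycenter :: "nat \<Rightarrow> nat \<Rightarrow> real" where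
  "barycenter n = (\<lambda>i. if i \<le> n then 1 / (real n + 1) else 0)"

lemma interior_barycenter: "interior_pt n (barycenter n)"
  by (auto simp: interior_pt_def barycenter_def intro!: standard_simplexI)

text \<open>Turns containment of images, which is what singular chains know, into membership of
  simplices; the barycenter serves as test point.\<close>

lemma pts_image:
  assumes T: "subcomplex T" and y: "y \<in> S n"
  shows "chi n y ` standard_simplex n \<subseteq> pts T \<longleftrightarrow> y \<in> T n"
proof
  assume "chi n y ` standard_simplex n \<subseteq> pts T"
  then show "y \<in> T n" using pts_interior[OF T y interior_barycenter] innerD[OF interior_barycenter] by blast
qed (unfold pts_def, blast)

text \<open>\<open>x\<close> has to go together with all its degeneracies; otherwise pulling these
  back would return \<open>x\<close>.\<close>

definition remove :: "nat \<Rightarrow> 'x \<Rightarrow> (nat \<Rightarrow> 'x set) \<Rightarrow> nat \<Rightarrow> 'x set" where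
  "remove n x T m = {y \<in> T m. \<not> (\<exists>\<sigma>\<in>simplex_maps m n. \<sigma> ` {..m} = {..n} \<and> y = pull m \<sigma> x)}"

context
  fixes T n x
  assumes T: "subcomplex T" and x: "(n, x) \<in> cells T" and top: "fst ` cells T \<subseteq> {..n}"
begin

lemma xS: "x \<in> S n" "x \<in> nondeg n" "x \<in> T n"
  using x nondegD by (auto simp: cells_def)

text \<open>If a pullback of \<open>y\<close> is a degeneracy of \<open>x\<close>, then
  \<open>x\<close> is a pullback of the core \<open>z\<close> of \<open>y\<close> along an injective
  operator. As \<open>n\<close> is the top dimension, \<open>z\<close> cannot be larger than
  \<open>x\<close>; so \<open>z = x\<close>, and \<open>y\<close> was itself removed.\<close>

lemma subcomplex_remove: "subcomplex (remove n x T)"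
  unfolding subcomplex_def
proof (intro conjI allI ballI subsetI)
  fix m y assume "y \<in> remove n x T m"
  then show "y \<in> S m" using subcomplexD(1)[OF T] by (simp add: remove_def)
next
  fix m l \<theta> y assume \<theta>: "\<theta> \<in> simplex_maps m l" and y: "y \<in> remove n x T l"
  then have yT: "y \<in> T l" by (simp add: remove_def)
  have yS: "y \<in> S l" by (rule subcomplexD(1)[OF T yT])
  have "\<not> (\<sigma> \<in> simplex_maps m n \<and> \<sigma> ` {..m} = {..n} \<and> pull m \<theta> y = pull m \<sigma> x)" for \<sigma>
  proof
    assume \<sigma>: "\<sigma> \<in> simplex_maps m n \<and> \<sigma> ` {..m} = {..n} \<and> pull m \<theta> y = pull m \<sigma> x"
    then obtain \<delta> where \<delta>: "\<delta> \<in> simplex_maps n m" "\<And>j. j \<le> n \<Longrightarrow> \<sigma> (\<delta> j) = j"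
      using simplex_maps_section[of \<sigma> m n 0] by auto
    have id: "\<theta> \<circ> \<delta> \<in> simplex_maps n l" by (rule simplex_maps_comp[OF \<theta> \<delta>(1)])
    have "x = pull n (\<sigma> \<circ> \<delta>) x" using pull_cong[of n "\<sigma> \<circ> \<delta>" id x] \<delta>(2) pull_id[OF xS(1)] by simp
    also have "\<dots> = pull n \<delta> (pull m \<theta> y)" using pull_pull[OF _ \<delta>(1) xS(1)] \<sigma> by metis
    also have "\<dots> = pull n (\<theta> \<circ> \<delta>) y" by (rule pull_pull[OF \<theta> \<delta>(1) yS])
    finally have x1: "x = pull n (\<theta> \<circ> \<delta>) y" .
    from nondeg_core[OF yS] obtain k z \<tau> where z: "z \<in> nondeg k" "\<tau> \<in> simplex_maps l k" "\<tau> ` {..l} = {..k}" "y = pull l \<tau> z"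
      by blast
    obtain \<epsilon> where \<epsilon>: "\<epsilon> \<in> simplex_maps k l" "\<And>j. j \<le> k \<Longrightarrow> \<tau> (\<epsilon> j) = j"
      using simplex_maps_section[OF z(2,3), of 0] by auto
    have "z = pull k (\<tau> \<circ> \<epsilon>) z"
      using pull_cong[of k "\<tau> \<circ> \<epsilon>" id z] \<epsilon>(2) pull_id[OF nondegD[OF z(1)]] by simp
    also have "\<dots> = pull k \<epsilon> y" using pull_pull[OF z(2) \<epsilon>(1) nondegD[OF z(1)]] z(4) by simp
    finally have "z \<in> T k" using subcomplexD(2)[OF T \<epsilon>(1) yT] by simp
    then have "k \<le> n" using top z(1) by (force simp: cells_def)
    have x2: "x = pull n (\<tau> \<circ> (\<theta> \<circ> \<delta>)) z"
      using x1 pull_pull[OF z(2) id nondegD[OF z(1)]] z(4) by simp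
    note mp = simplex_maps_comp[OF z(2) id]
    have inj: "inj_on (\<tau> \<circ> (\<theta> \<circ> \<delta>)) {..n}"
      using nondeg_pull_inj[of n "\<tau> \<circ> (\<theta> \<circ> \<delta>)" z k] xS(2) x2 mp nondegD[OF z(1)] by metis
    then have "n = k" using simplex_maps_inj_le[OF mp] \<open>k \<le> n\<close> by simp
    have "pull n (\<tau> \<circ> (\<theta> \<circ> \<delta>)) z = pull n id z"
      using simplex_maps_inj_self[of "\<tau> \<circ> (\<theta> \<circ> \<delta>)" n] mp inj \<open>n = k\<close> by (intro pull_cong) (metis id_apply)
    then have "x = z" using x2 pull_id[OF nondegD[OF z(1)]] \<open>n = k\<close> by simp
    then have "y \<notin> remove n x T l" using z \<open>n = k\<close> by (auto simp: remove_def)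
    then show False using y by simp
  qed
  then show "pull m \<theta> y \<in> remove n x T m"
    using subcomplexD(2)[OF T \<theta> yT] by (auto simp: remove_def)
qed

text \<open>Among the degeneracies of \<open>x\<close> only \<open>x\<close> itself is
  nondegenerate.\<close>

lemma cells_remove: "cells (remove n x T) = cells T - {(n, x)}"
proof -
  have "z \<in> remove n x T k \<longleftrightarrow> z \<in> T k \<and> (k, z) \<noteq> (n, x)" if z: "z \<in> nondeg k" for k z
  proof -
    have "(\<exists>\<sigma>\<in>simplex_maps k n. \<sigma> ` {..k} = {..n} \<and> z = pull k \<sigma> x) \<longleftrightarrow> (k, z) = (n, x)"
    proof
      assume "\<exists>\<sigma>\<in>simplex_maps k n. \<sigma> ` {..k} = {..n} \<and> z = pull k \<sigma> x"
      then obtain \<sigma> where \<sigma>: "\<sigma> \<in> simplex_maps k n" "\<sigma> ` {..k} = {..n}" "z = pull k \<sigma> x" by blast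
      have inj: "inj_on \<sigma> {..k}" using nondeg_pull_inj[of k \<sigma> x n] z \<sigma> xS by simp
      then have "card {..k} = card {..n}" using \<sigma>(2) card_image by metis
      then have kn: "k = n" by simp
      have "pull n \<sigma> x = pull n id x"
        using simplex_maps_inj_self[of \<sigma> n] \<sigma>(1) inj kn by (intro pull_cong) (metis id_apply)
      then show "(k, z) = (n, x)" using \<sigma>(3) kn pull_id[OF xS(1)] by simp
    next
      assume "(k, z) = (n, x)"
      then show "\<exists>\<sigma>\<in>simplex_maps k n. \<sigma> ` {..k} = {..n} \<and> z = pull k \<sigma> x"
        using simplex_maps_id[of n] pull_id[OF xS(1)] by (metis Pair_inject image_id id_apply)
    qed
    then show ?thesis unfolding remove_def by blast
  qed
  then show ?thesis by (auto simp: cells_def)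
qed

lemma remove_split:
  "y \<in> T m \<longleftrightarrow> y \<in> remove n x T m \<or> (\<exists>\<sigma>\<in>simplex_maps m n. \<sigma> ` {..m} = {..n} \<and> y = pull m \<sigma> x)"
  using subcomplexD(2)[OF T _ xS(3)] by (auto simp: remove_def)

lemma cell_attachment_remove:
  assumes fin: "finite (cells T)"
  shows "cell_attachment (subtopology X (pts T)) (pts (remove n x T)) n (chi n x)"
proof
  let ?T' = "remove n x T"
  note T' = subcomplex_remove
  have sub: "pts ?T' \<subseteq> pts T" by (auto simp: pts_def remove_def)
  have "closedin X (pts ?T')" using fin by (intro closedin_pts T') (simp add: cells_remove)
  then show "closedin (subtopology X (pts T)) (pts ?T')"
    using sub by (simp add: closedin_subset_topspace)
  have img: "chi n x ` standard_simplex n \<subseteq> pts T" using xS by (auto simp: pts_def)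
  show "continuous_map (simplex_top n) (subtopology X (pts T)) (chi n x)"
    using img chi_continuous[OF xS(1)] by (auto simp: continuous_map_in_subtopology)
  show "closed_map (simplex_top n) (subtopology X (pts T)) (chi n x)"
    using img by (intro closed_map_into_subtopology chi_closed_map xS) auto
  have "x \<notin> ?T' n" using simplex_maps_id[of n] pull_id[OF xS(1)] unfolding remove_def
    by (metis (mono_tags, lifting) image_id id_apply mem_Collect_eq)
  then show "chi n x t \<notin> pts ?T'" if "interior_pt n t" for t
    using pts_interior[OF T' xS(1) that] by blast
  \<comment> \<open>The support of a boundary point spans a proper face, whose core has dimension at
    most \<open>card I - 1\<close>, hence below \<open>n\<close>. So that core is not
    \<open>x\<close> and survives the removal.\<close>
  show "chi n x t \<in> pts ?T'" if "t \<in> simplex_bd n" for t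
  proof -
    have t: "t \<in> standard_simplex n" "\<not> interior_pt n t" using that by (auto simp: simplex_bd_def)
    define I where "I = {i. t i \<noteq> 0}"
    have I: "I \<subseteq> {..n}" "I \<noteq> {}" using support_nonempty[OF t(1)] by (auto simp: I_def)
    have "I \<noteq> {..n}" using t standard_simplexD(1)[OF t(1)]
      by (auto simp: I_def interior_pt_def less_le)
    then have card: "card I < Suc n" using psubset_card_mono[of "{..n}" I] I by auto
    obtain k z \<sigma> \<delta> where z: "z \<in> nondeg k" "\<sigma> ` I = {..k}" "\<delta> \<in> simplex_maps k n" "z = pull k \<delta> x"
      "chi n x t = chi k z (simplex_push n \<sigma> t)" "\<sigma> \<in> simplex_maps n k"
      using face[OF xS(1) I] t(1) unfolding I_def by blast
    have "card {..k} \<le> card I" using card_image_le[of I \<sigma>] z(2) finite_subset[OF I(1)] by simp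
    then have "k < n" using card by simp
    moreover have "z \<in> T k" using subcomplexD(2)[OF T z(3) xS(3)] z(4) by simp
    ultimately have "(k, z) \<in> cells ?T'" using z(1) by (simp add: cells_remove) (simp add: cells_def)
    then show ?thesis using z(5) simplex_push_in[OF z(6) t(1)] unfolding pts_cells[OF T'] by blast
  qed
  show "t = u" if "interior_pt n t" "interior_pt n u" "chi n x t = chi n x u" for t u
    using chi_unique[OF xS(2) xS(2) that] by blast
  show "\<exists>t. interior_pt n t \<and> chi n x t = p"
    if p: "p \<in> topspace (subtopology X (pts T))" "p \<notin> pts ?T'" for p
  proof -
    obtain k z u where z: "(k, z) \<in> cells T" "interior_pt k u" "p = chi k z u"
      using pts_normal_form[OF T, of p] p(1) by (auto simp del: Product_Type.split_paired_Ex)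
    have "(k, z) \<notin> cells ?T'" using z p(2) innerD[OF z(2)] unfolding pts_cells[OF T'] by blast
    then show ?thesis using z by (auto simp: cells_remove)
  qed
qed

end

end

section \<open>Affine singular simplices and supports of integral chains\<close>

definition aff :: "nat \<Rightarrow> (nat \<Rightarrow> nat) \<Rightarrow> (nat \<Rightarrow> real) \<Rightarrow> nat \<Rightarrow> real" where
  "aff q \<theta> = restrict (simplex_push q \<theta>) (standard_simplex q)"

abbreviation keys where "keys \<equiv> Poly_Mapping.keys"

definition face_map :: "nat \<Rightarrow> nat \<Rightarrow> nat" where
  "face_map k i = (if i < k then i else Suc i)"

lemma face_map_in: "k \<le> Suc q \<Longrightarrow> face_map k \<in> simplex_maps q (Suc q)"
  by (auto simp: simplex_maps_iff face_map_def)

lemma simplical_face_push: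
  assumes "t \<in> standard_simplex q"
  shows "simplical_face k t = simplex_push q (face_map k) t"
proof
  fix j
  have t: "t i = 0" if "q < i" for i using standard_simplexD(2)[OF assms that] .
  have "simplex_push q (face_map k) t j = (\<Sum>i\<le>q. if i = (if j < k then j else j - 1) then (if j = k then 0 else t i) else 0)"
    unfolding simplex_push_if by (intro sum.cong) (auto simp: face_map_def)
  also have "\<dots> = simplical_face k t j"
    using t by (auto simp: simplical_face_def not_le)
  finally show "simplical_face k t j = simplex_push q (face_map k) t j" by simp
qed

lemma singular_simplex_aff: "\<theta> \<in> simplex_maps q n \<Longrightarrow> singular_simplex q (simplex_top n) (aff q \<theta>)"
  using continuous_map_simplex_push[of \<theta> q n]
  by (auto simp: singular_simplex_def aff_def intro: continuous_map_eq)

lemma singular_face_aff: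
  assumes "\<theta> \<in> simplex_maps (Suc q) n" "k \<le> Suc q"
  shows "singular_face (Suc q) k (aff (Suc q) \<theta>) = aff q (\<theta> \<circ> face_map k)"
proof
  fix t show "singular_face (Suc q) k (aff (Suc q) \<theta>) t = aff q (\<theta> \<circ> face_map k) t"
    using simplex_push_in[OF face_map_in[OF assms(2)], of t] simplex_push_push[OF face_map_in[OF assms(2)], of \<theta> t]
    by (auto simp: singular_face_def aff_def simplical_face_push)
qed

text \<open>Vertex \<open>i\<close> need not be interior, but the midpoint \<open>t\<close> between
  it and the barycenter \<open>b\<close> is. Comparing the images of \<open>t\<close> and
  \<open>b\<close> isolates the image of the vertex.\<close>

lemma simplex_push_determines:
  assumes eq: "\<And>t. interior_pt q t \<Longrightarrow> simplex_push q \<theta> t = simplex_push q \<eta> t" and i: "i \<le> q"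
  shows "\<theta> i = \<eta> i"
proof -
  define b where "b = (\<lambda>i. if i \<le> q then 1 / (real q + 1) else 0)"
  define t where "t = (\<lambda>k. b k / 2 + (if k = i then 1/2 else 0))"
  have b: "interior_pt q b" by (auto simp: interior_pt_def b_def intro!: standard_simplexI)
  have bs: "(\<Sum>i\<le>q. b i) = 1" "0 \<le> b i" for i by (auto simp: b_def)
  have t: "interior_pt q t"
    unfolding interior_pt_def
  proof (intro conjI allI impI standard_simplexI)
    show "(\<Sum>i\<le>q. t i) = 1"
      using bs(1) i by (simp add: t_def sum.distrib sum_divide_distrib[symmetric])
  qed (use i in \<open>auto simp: t_def b_def intro!: add_pos_pos\<close>)
  have "simplex_push q \<zeta> t j = simplex_push q \<zeta> b j / 2 + (if \<zeta> i = j then 1/2 else 0)" for \<zeta> j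
  proof -
    have "simplex_push q \<zeta> t j = (\<Sum>k\<le>q. (if \<zeta> k = j then b k else 0) / 2 + (if k = i then if \<zeta> i = j then 1/2 else 0 else 0))"
      unfolding simplex_push_if by (intro sum.cong) (auto simp: t_def)
    then show ?thesis using i by (simp add: simplex_push_if sum.distrib sum_divide_distrib[symmetric])
  qed
  from this[of \<theta> "\<theta> i"] this[of \<eta> "\<theta> i"] show ?thesis
    using eq[OF b] eq[OF t] by (auto split: if_splits)
qed

lemma frag_extend_lift:
  assumes "keys c \<subseteq> f ` P"
  shows "\<exists>a. keys a \<subseteq> P \<and> frag_extend (frag_of \<circ> f) a = c"
  using assms
proof (induction rule: frag_induction)
  case zero then show ?case by (intro exI[of _ 0]) simp
next
  case (one y)
  then obtain p where "p \<in> P" "y = f p" by blast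
  then show ?case by (intro exI[of _ "frag_of p"]) (simp)
next
  case (diff a b)
  then obtain a' b' where "keys a' \<subseteq> P" "frag_extend (frag_of \<circ> f) a' = a"
    "keys b' \<subseteq> P" "frag_extend (frag_of \<circ> f) b' = b" by blast
  then have "keys (a' - b') \<subseteq> P \<and> frag_extend (frag_of \<circ> f) (a' - b') = a - b"
    using keys_diff[of a' b'] unfolding frag_extend_diff by blast
  then show ?case by blast
qed

text \<open>The partial inverse \<open>g\<close> of \<open>f\<close> undoes the pushforward of
  combinations of \<open>P\<close>, yet it kills a pushforward that has no key in the image of
  \<open>P\<close>.\<close>

lemma frag_extend_inj_zero:
  assumes "keys a \<subseteq> P" "inj_on f P"
    and "keys (frag_extend (frag_of \<circ> f) a) \<inter> f ` P = {}"
  shows "a = 0"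
proof -
  define g where "g y = (if y \<in> f ` P then frag_of (inv_into P f y) else 0)" for y
  have "a = frag_extend frag_of a" by (rule frag_expansion)
  also have "\<dots> = frag_extend (g \<circ> f) a"
    using assms(1,2) by (intro frag_extend_eq) (simp add: g_def subset_iff)
  also have "\<dots> = frag_extend g (frag_extend (frag_of \<circ> f) a)" by (simp only: frag_extend_compose)
  also have "\<dots> = 0" using assms(3) by (intro frag_extend_eq_0) (auto simp: g_def)
  finally show ?thesis .
qed

lemma keys_frag_extend_subset:
  "(\<And>x. x \<in> keys c \<Longrightarrow> keys (f x) \<subseteq> B) \<Longrightarrow> keys (frag_extend f c) \<subseteq> B"
  using keys_frag_extend[of f c] by blast

lemma keys_chain_boundary:
  assumes "\<And>f k. f \<in> keys c \<Longrightarrow> k \<le> Suc q \<Longrightarrow> singular_face (Suc q) k f \<in> B"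
  shows "keys (chain_boundary (Suc q) c) \<subseteq> B"
proof -
  have "keys (\<Sum>k\<le>Suc q. frag_cmul ((-1) ^ k) (frag_of (singular_face (Suc q) k f))) \<subseteq> B"
    if "f \<in> keys c" for f
  proof -
    have "keys (\<Sum>k\<le>Suc q. frag_cmul ((-1) ^ k) (frag_of (singular_face (Suc q) k f)))
        \<subseteq> (\<Union>k\<in>{..Suc q}. keys (frag_cmul ((-1) ^ k) (frag_of (singular_face (Suc q) k f))))"
      by (rule keys_sum)
    also have "\<dots> \<subseteq> B" using assms[OF that] by auto
    finally show ?thesis .
  qed
  then show ?thesis unfolding chain_boundary_def
    by (simp only: Zero_not_Suc nat.distinct if_False) (intro keys_frag_extend_subset)
qed

text \<open>The claim for the simplex modulo its boundary; \<open>e\<close> and \<open>e'\<close>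
  are the error terms in the boundary. In degree 0 the truncated \<open>q - 1\<close> does no harm,
  since \<open>chain_boundary 0\<close> vanishes and \<open>l = e = 0\<close> can be taken.\<close>

definition simplex_resolved :: "nat \<Rightarrow> bool" where
  "simplex_resolved n \<longleftrightarrow> (\<forall>q m l e. singular_chain q (simplex_top n) m \<longrightarrow>
    keys l \<subseteq> aff (q - 1) ` simplex_maps (q - 1) n \<longrightarrow>
    singular_chain (q - 1) (subtopology (simplex_top n) (simplex_bd n)) e \<longrightarrow>
    chain_boundary q m = l + e \<longrightarrow>
    (\<exists>l' e' d. keys l' \<subseteq> aff q ` simplex_maps q n \<and>
      singular_chain q (subtopology (simplex_top n) (simplex_bd n)) e' \<and>
      singular_chain (Suc q) (simplex_top n) d \<and> m = l' + e' + chain_boundary (Suc q) d))"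

lemma aff_bd:
  assumes "\<theta> \<in> simplex_maps q n" "\<theta> ` {..q} \<noteq> {..n}"
  shows "singular_simplex q (subtopology (simplex_top n) (simplex_bd n)) (aff q \<theta>)"
proof -
  have "\<theta> ` {..q} \<subseteq> {..n}" using assms(1) by (auto simp: simplex_maps_iff)
  then obtain j where j: "j \<le> n" "j \<notin> \<theta> ` {..q}" using assms(2) by auto
  have "aff q \<theta> t \<in> simplex_bd n" if t: "t \<in> standard_simplex q" for t
  proof -
    have "simplex_push q \<theta> t j = 0" using simplex_push_nonzero[OF t, of \<theta> j] j(2) by auto
    then have "\<not> interior_pt n (simplex_push q \<theta> t)" using j(1) by (auto simp: interior_pt_def)
    then show ?thesis using simplex_push_in[OF assms(1) t] t by (simp add: simplex_bd_def aff_def)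
  qed
  then show ?thesis using singular_simplex_aff[OF assms(1)]
    by (subst singular_simplex_subtopology) auto
qed

section \<open>Singular chains with cellular boundary\<close>

context cell_space
begin

text \<open>For a cycle \<open>c\<close> this is surjectivity on homology. Since \<open>l\<close>
  has the same boundary as \<open>c\<close>, it also contains injectivity: a cellular cycle that
  bounds \<open>c\<close> bounds the cellular chain \<open>l\<close>.\<close>

definition resolved :: "(nat \<Rightarrow> 'x set) \<Rightarrow> bool" where
  "resolved T \<longleftrightarrow> (\<forall>q c. singular_chain q (subtopology X (pts T)) c \<longrightarrow>
    keys (chain_boundary q c) \<subseteq> chi (q - 1) ` T (q - 1) \<longrightarrow>
    (\<exists>l d. keys l \<subseteq> chi q ` T q \<and> singular_chain (Suc q) (subtopology X (pts T)) d \<and>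
      c = l + chain_boundary (Suc q) d))"

lemma singular_face_chi:
  assumes "y \<in> S (Suc q)" "k \<le> Suc q"
  shows "singular_face (Suc q) k (chi (Suc q) y) = chi q (pull q (face_map k) y)"
proof (rule extensionalityI)
  show "singular_face (Suc q) k (chi (Suc q) y) \<in> extensional (standard_simplex q)"
    by (simp add: singular_face_def)
  show "chi q (pull q (face_map k) y) \<in> extensional (standard_simplex q)"
    using chi_simplex[OF pull_closed[OF face_map_in[OF assms(2)] assms(1)]] by (simp add: singular_simplex_def)
  show "singular_face (Suc q) k (chi (Suc q) y) t = chi q (pull q (face_map k) y) t"
    if "t \<in> standard_simplex q" for t
    using that chi_pull[OF face_map_in[OF assms(2)] assms(1) that]
    by (simp add: singular_face_def simplical_face_push)
qed

lemma simplex_map_chi: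
  assumes "x \<in> S n" "\<theta> \<in> simplex_maps q n"
  shows "simplex_map q (chi n x) (aff q \<theta>) = chi q (pull q \<theta> x)"
proof (rule extensionalityI)
  show "simplex_map q (chi n x) (aff q \<theta>) \<in> extensional (standard_simplex q)"
    by (simp add: simplex_map_def)
  show "chi q (pull q \<theta> x) \<in> extensional (standard_simplex q)"
    using chi_simplex[OF pull_closed[OF assms(2,1)]] by (simp add: singular_simplex_def)
  show "simplex_map q (chi n x) (aff q \<theta>) t = chi q (pull q \<theta> x) t"
    if "t \<in> standard_simplex q" for t
    using that chi_pull[OF assms(2,1) that] by (simp add: simplex_map_def aff_def)
qed

text \<open>Agreement at interior points identifies the nondegenerate cores and the pushed
  coordinates, and \<open>simplex_push_determines\<close> recovers the operators. Hence chains
  spanned by values of \<open>chi\<close> are the same as combinations of simplices, degenerate ones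
  included.\<close>

lemma chi_inj:
  assumes x: "x \<in> S q" and y: "y \<in> S q" and eq: "\<And>t. t \<in> standard_simplex q \<Longrightarrow> chi q x t = chi q y t"
  shows "x = y"
proof -
  obtain k z \<sigma> where z: "z \<in> nondeg k" "\<sigma> \<in> simplex_maps q k" "\<sigma> ` {..q} = {..k}" "x = pull q \<sigma> z"
    using nondeg_core[OF x] by blast
  obtain l w \<tau> where w: "w \<in> nondeg l" "\<tau> \<in> simplex_maps q l" "\<tau> ` {..q} = {..l}" "y = pull q \<tau> w"
    using nondeg_core[OF y] by blast
  have *: "k = l \<and> z = w \<and> simplex_push q \<sigma> t = simplex_push q \<tau> t" if t: "interior_pt q t" for t
  proof -
    have tS: "t \<in> standard_simplex q" by (rule innerD[OF t])
    have "{i. t i \<noteq> 0} = {..q}" using t support_nonempty[OF tS] by (force simp: interior_pt_def)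
    then have "interior_pt k (simplex_push q \<sigma> t)" "interior_pt l (simplex_push q \<tau> t)"
      using z w tS by (auto intro!: inner_push)
    moreover have "chi k z (simplex_push q \<sigma> t) = chi l w (simplex_push q \<tau> t)"
      using chi_pull[OF z(2) nondegD[OF z(1)] tS] chi_pull[OF w(2) nondegD[OF w(1)] tS] eq[OF tS] z(4) w(4) by simp
    ultimately show ?thesis using chi_unique[OF z(1) w(1)] by blast
  qed
  have "\<sigma> i = \<tau> i" if "i \<le> q" for i
    using simplex_push_determines[of q \<sigma> \<tau> i] * that by blast
  then show ?thesis using *[OF interior_barycenter] z(4) w(4) pull_cong[of q \<sigma> \<tau> z] by simp
qed

lemma keys_boundary_chi:
  assumes "subcomplex T" "keys l \<subseteq> chi q ` T q"
  shows "keys (chain_boundary q l) \<subseteq> chi (q - 1) ` T (q - 1)"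
proof (cases q)
  case 0 then show ?thesis by (simp add: chain_boundary_def)
next
  case (Suc p)
  have "singular_face (Suc p) k f \<in> chi p ` T p" if f: "f \<in> keys l" and k: "k \<le> Suc p" for f k
  proof -
    obtain y where y: "y \<in> T (Suc p)" "f = chi (Suc p) y" using f assms(2) Suc by blast
    show ?thesis using singular_face_chi[OF subcomplexD(1)[OF assms(1) y(1)] k] y
        subcomplexD(2)[OF assms(1) face_map_in[OF k] y(1)] by simp
  qed
  then show ?thesis unfolding Suc by (simp add: keys_chain_boundary)
qed

lemma singular_chain_chi:
  assumes "subcomplex T" "keys l \<subseteq> chi q ` T q"
  shows "singular_chain q (subtopology X (pts T)) l"
proof -
  have "singular_simplex q (subtopology X (pts T)) (chi q y)" if "y \<in> T q" for y
    using chi_simplex[OF subcomplexD(1)[OF assms(1) that]] that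
    unfolding singular_simplex_subtopology by (auto simp: pts_def)
  then show ?thesis using assms(2) by (auto simp: singular_chain_def)
qed

lemma keys_chi_pts:
  assumes T: "subcomplex T" and U: "subcomplex U"
    and l: "keys l \<subseteq> chi q ` T q" "singular_chain q (subtopology X (pts U)) l"
  shows "keys l \<subseteq> chi q ` U q"
proof
  fix f assume f: "f \<in> keys l"
  then obtain y where y: "y \<in> T q" "f = chi q y" using l(1) by blast
  have "chi q y ` standard_simplex q \<subseteq> pts U"
    using l(2) f y(2) unfolding singular_chain_def by (simp add: subset_iff singular_simplex_subtopology image_subset_iff)
  then show "f \<in> chi q ` U q" using pts_image[OF U subcomplexD(1)[OF T y(1)]] y(2) by blast
qed

end

context cell_space
begin

lemma chain_map_aff:
  assumes "subcomplex T" "x \<in> T n" "keys l \<subseteq> aff q ` simplex_maps q n"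
  shows "keys (chain_map q (chi n x) l) \<subseteq> chi q ` T q"
  unfolding chain_map_def
proof (rule keys_frag_extend_subset)
  fix f assume "f \<in> keys l"
  then obtain \<theta> where "\<theta> \<in> simplex_maps q n" "f = aff q \<theta>" using assms(3) by blast
  then show "keys ((frag_of \<circ> simplex_map q (chi n x)) f) \<subseteq> chi q ` T q"
    using simplex_map_chi[OF subcomplexD(1)[OF assms(1,2)]] subcomplexD(2)[OF assms(1) _ assms(2)] by simp
qed

text \<open>Modulo the smaller complex, \<open>c\<close> is homologous to the image of a relative
  cycle \<open>m\<close> of the simplex, which \<open>R\<close> makes affine up to a boundary. The
  rest \<open>c''\<close> lives in the smaller complex and still has cellular boundary, so
  \<open>T'R\<close> applies to it.\<close>

lemma resolved_relcycle:
  assumes T: "subcomplex T" and x: "(n, x) \<in> cells T" and top: "fst ` cells T \<subseteq> {..n}"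
    and fin: "finite (cells T)" and R: "simplex_resolved n" and T'R: "resolved (remove n x T)"
    and c: "singular_relcycle q (subtopology X (pts T)) (pts (remove n x T)) c"
    and dc: "keys (chain_boundary q c) \<subseteq> chi (q - 1) ` T (q - 1)"
  shows "\<exists>l d. keys l \<subseteq> chi q ` T q \<and> singular_chain (Suc q) (subtopology X (pts T)) d \<and>
      c = l + chain_boundary (Suc q) d"
proof -
  let ?T' = "remove n x T" and ?Y = "subtopology X (pts T)" and ?D = "simplex_top n" and ?B = "simplex_bd n"
  interpret C: cell_attachment ?Y "pts ?T'" n "chi n x"
    by (rule cell_attachment_remove[OF T x top fin])
  have T': "subcomplex ?T'" by (rule subcomplex_remove[OF T x top])
  have TT': "?T' k \<subseteq> T k" for k by (auto simp: remove_def)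
  have sub: "pts ?T' \<subseteq> pts T" using TT' by (force simp: pts_def)
  have YA: "subtopology ?Y (pts ?T') = subtopology X (pts ?T')"
    using sub by (simp add: subtopology_subtopology inf_absorb2)
  have xT: "x \<in> T n" using x by (simp add: cells_def)
  have chiB: "chi n x \<in> ?B \<rightarrow> pts ?T'" using C.bd by auto
  have contB: "continuous_map (subtopology ?D ?B) (subtopology X (pts ?T')) (chi n x)"
    unfolding YA[symmetric] using chiB C.cont
    by (auto simp: continuous_map_in_subtopology intro: continuous_map_from_subtopology)
  obtain m where m: "singular_relcycle q ?D ?B m" and "homologous_rel q ?Y (pts ?T') c (chain_map q (chi n x) m)"
    using C.relcycle_surj[OF c] by blast
  then obtain d e where d: "singular_chain (Suc q) ?Y d" and e: "singular_chain q (subtopology X (pts ?T')) e"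
      and de: "chain_boundary (Suc q) d + e = c - chain_map q (chi n x) m"
    unfolding homologous_rel_def singular_relboundary YA by blast
  have "singular_chain q ?D m" "singular_chain (q - 1) (subtopology ?D ?B) (chain_boundary q m)"
    using m by (auto simp: singular_relcycle)
  \<comment> \<open>As \<open>m\<close> is a relative cycle, \<open>simplex_resolved\<close> is used
    with \<open>l = 0\<close> and with \<open>e\<close> the boundary of \<open>m\<close>.\<close>
  with R obtain l0 e0 d0 where l0: "keys l0 \<subseteq> aff q ` simplex_maps q n"
      and e0: "singular_chain q (subtopology ?D ?B) e0" and d0: "singular_chain (Suc q) ?D d0"
      and m_eq: "m = l0 + e0 + chain_boundary (Suc q) d0"
    unfolding simplex_resolved_def
    by (metis add_0 empty_subsetI keys_zero)
  let ?f = "\<lambda>p. chain_map p (chi n x)"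
  define c'' where "c'' = ?f q e0 + e"
  have fl0: "keys (?f q l0) \<subseteq> chi q ` T q" by (rule chain_map_aff[OF T xT l0])
  have fd0: "singular_chain (Suc q) ?Y (?f (Suc q) d0)" by (rule singular_chain_chain_map[OF d0 C.cont])
  have fd: "chain_boundary (Suc q) (?f (Suc q) d0) = ?f q (chain_boundary (Suc q) d0)"
    using chain_boundary_chain_map[OF d0, of "chi n x"] by simp
  have c_eq: "c = ?f q l0 + c'' + chain_boundary (Suc q) (?f (Suc q) d0 + d)"
    using de unfolding c''_def m_eq chain_map_add chain_boundary_add fd by (simp add: algebra_simps)
  have c''A: "singular_chain q (subtopology X (pts ?T')) c''"
    unfolding c''_def using e singular_chain_chain_map[OF e0 contB] by (intro singular_chain_add)
  have "chain_boundary q (chain_boundary (Suc q) (?f (Suc q) d0 + d)) = 0"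
    using fd0 d by (intro chain_boundary_boundary_alt[of _ ?Y] singular_chain_add)
  then have dc'': "chain_boundary q c'' = chain_boundary q c - chain_boundary q (?f q l0)"
    unfolding c_eq chain_boundary_add by simp
  have "keys (chain_boundary q c'') \<subseteq> chi (q - 1) ` T (q - 1)"
    unfolding dc'' using keys_diff[of "chain_boundary q c" "chain_boundary q (?f q l0)"] dc
      keys_boundary_chi[OF T fl0] by blast
  moreover have "singular_chain (q - 1) (subtopology X (pts ?T')) (chain_boundary q c'')"
    using singular_chain_boundary[OF c''A] by simp
  \<comment> \<open>Simplices of \<open>T\<close> whose image lies in the smaller space belong to
    the smaller complex.\<close>
  ultimately have "keys (chain_boundary q c'') \<subseteq> chi (q - 1) ` ?T' (q - 1)"
    by (rule keys_chi_pts[OF T T'])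
  then obtain l1 d1 where l1: "keys l1 \<subseteq> chi q ` ?T' q"
      "singular_chain (Suc q) (subtopology X (pts ?T')) d1" "c'' = l1 + chain_boundary (Suc q) d1"
    using T'R c''A unfolding resolved_def by blast
  have "keys (?f q l0 + l1) \<subseteq> chi q ` T q"
    using fl0 l1(1) TT' keys_add[of "?f q l0" l1] by blast
  moreover have "singular_chain (Suc q) ?Y (?f (Suc q) d0 + d + d1)"
    by (intro singular_chain_add fd0 d singular_chain_mono[OF l1(2) sub])
  moreover have "c = (?f q l0 + l1) + chain_boundary (Suc q) (?f (Suc q) d0 + d + d1)"
    unfolding chain_boundary_add using c_eq l1(3) by (simp add: chain_boundary_add algebra_simps)
  ultimately show ?thesis by blast
qed

text \<open>The boundary of \<open>a\<close> splits into a combination \<open>e1\<close> of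
  surjective operators and one of operators into the boundary of the simplex. Distinct surjective
  operators give distinct degeneracies of \<open>x\<close>, none of which is in the smaller complex,
  whereas the image of \<open>e1\<close> lies in the smaller space; hence
  \<open>e1 = 0\<close>.\<close>

lemma aff_surj_cycle:
  assumes T: "subcomplex T" and x: "(n, x) \<in> cells T" and top: "fst ` cells T \<subseteq> {..n}"
    and fin: "finite (cells T)"
    and a: "keys a \<subseteq> aff p ` {\<sigma> \<in> simplex_maps p n. \<sigma> ` {..p} = {..n}}"
    and da: "singular_chain (p - 1) (subtopology X (pts (remove n x T))) (chain_map (p - 1) (chi n x) (chain_boundary p a))"
  shows "singular_relcycle p (simplex_top n) (simplex_bd n) a"
proof -
  let ?T' = "remove n x T" and ?Y = "subtopology X (pts T)" and ?D = "simplex_top n" and ?B = "simplex_bd n"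
  interpret C: cell_attachment ?Y "pts ?T'" n "chi n x"
    by (rule cell_attachment_remove[OF T x top fin])
  have T': "subcomplex ?T'" by (rule subcomplex_remove[OF T x top])
  have xT: "x \<in> T n" "x \<in> nondeg n" "x \<in> S n" using x by (auto simp: cells_def nondegD)
  have aD: "singular_chain p ?D a"
    using a singular_simplex_aff by (fastforce simp: singular_chain_def)
  have "singular_chain (p - 1) (subtopology ?D ?B) (chain_boundary p a)"
  proof (cases p)
    case 0 then show ?thesis by (simp add: chain_boundary_def)
  next
    case (Suc r)
    let ?P = "{\<sigma> \<in> simplex_maps r n. \<sigma> ` {..r} = {..n}}" and ?Q = "{\<sigma> \<in> simplex_maps r n. \<sigma> ` {..r} \<noteq> {..n}}"
    let ?f = "simplex_map r (chi n x)"
    have "keys (chain_boundary (Suc r) a) \<subseteq> aff r ` simplex_maps r n"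
    proof (rule keys_chain_boundary)
      fix f k assume "f \<in> keys a" and k: "k \<le> Suc r"
      then obtain \<theta> where "\<theta> \<in> simplex_maps (Suc r) n" "f = aff (Suc r) \<theta>" using a Suc by blast
      then show "singular_face (Suc r) k f \<in> aff r ` simplex_maps r n"
        using singular_face_aff[OF _ k] simplex_maps_comp[OF _ face_map_in[OF k]] by simp
    qed
    also have "simplex_maps r n = ?P \<union> ?Q" by blast
    finally have "keys (chain_boundary (Suc r) a) \<subseteq> aff r ` ?P \<union> aff r ` ?Q"
      by (simp add: image_Un)
    then obtain e1 e2 where e: "keys e1 \<subseteq> aff r ` ?P" "keys e2 \<subseteq> aff r ` ?Q"
        "e1 + e2 = chain_boundary (Suc r) a"
      by (rule frag_split)
    have e2: "singular_chain r (subtopology ?D ?B) e2"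
      using e(2) aff_bd by (fastforce simp: singular_chain_def)
    have contB: "continuous_map (subtopology ?D ?B) (subtopology X (pts ?T')) (chi n x)"
      using C.bd C.cont C.AY
      by (auto simp: continuous_map_in_subtopology intro: continuous_map_from_subtopology)
    have "chain_map r (chi n x) e1 = chain_map r (chi n x) (chain_boundary (Suc r) a) - chain_map r (chi n x) e2"
      unfolding e(3)[symmetric] chain_map_add by simp
    then have e1: "singular_chain r (subtopology X (pts ?T')) (chain_map r (chi n x) e1)"
      using da Suc singular_chain_chain_map[OF e2 contB] by (simp add: singular_chain_diff)
    have f_aff: "?f (aff r \<sigma>) = chi r (pull r \<sigma> x)" if "\<sigma> \<in> simplex_maps r n" for \<sigma>
      by (rule simplex_map_chi[OF xT(3) that])
    have "inj_on ?f (aff r ` ?P)"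
    proof (rule inj_onI, elim imageE, clarify)
      fix \<sigma> \<tau> assume \<sigma>: "\<sigma> \<in> simplex_maps r n" "\<sigma> ` {..r} = {..n}" and \<tau>: "\<tau> \<in> simplex_maps r n" "\<tau> ` {..r} = {..n}"
        and eq: "?f (aff r \<sigma>) = ?f (aff r \<tau>)"
      have "chi r (pull r \<sigma> x) = chi r (pull r \<tau> x)" using eq f_aff \<sigma>(1) \<tau>(1) by simp
      then have "pull r \<sigma> x = pull r \<tau> x"
        using chi_inj[OF pull_closed[OF \<sigma>(1) xT(3)] pull_closed[OF \<tau>(1) xT(3)]] by simp
      then have "\<forall>i\<le>r. \<sigma> i = \<tau> i" using nondeg_core_unique[OF xT(2) \<sigma> xT(2) \<tau>] by blast
      then show "aff r \<sigma> = aff r \<tau>" unfolding aff_def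
        using simplex_push_cong[of r _ \<sigma> \<tau>] by (simp add: fun_eq_iff restrict_def)
    qed
    moreover have "keys (frag_extend (frag_of \<circ> ?f) e1) \<inter> ?f ` aff r ` ?P = {}"
    proof (rule ccontr)
      assume "keys (frag_extend (frag_of \<circ> ?f) e1) \<inter> ?f ` aff r ` ?P \<noteq> {}"
      then obtain \<sigma> where \<sigma>: "\<sigma> \<in> simplex_maps r n" "\<sigma> ` {..r} = {..n}"
          and f: "?f (aff r \<sigma>) \<in> keys (frag_extend (frag_of \<circ> ?f) e1)" by blast
      have "chi r (pull r \<sigma> x) ` standard_simplex r \<subseteq> pts ?T'"
        using e1 f f_aff[OF \<sigma>(1)]
        unfolding singular_chain_def chain_map_def by (simp add: subset_iff singular_simplex_subtopology image_subset_iff)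
      then have "pull r \<sigma> x \<in> ?T' r" using pts_image[OF T' pull_closed[OF \<sigma>(1) xT(3)]] by simp
      then show False using \<sigma> by (auto simp: remove_def)
    qed
    ultimately have "e1 = 0" by (rule frag_extend_inj_zero[OF e(1)])
    then show ?thesis using e2 e(3) Suc by simp
  qed
  then show ?thesis using aD by (simp add: singular_relcycle)
qed

text \<open>The boundary of \<open>c\<close> consists of a part \<open>l1\<close> in the smaller
  complex and of degeneracies of \<open>x\<close>, the image of an affine chain \<open>a\<close>.
  This \<open>a\<close> is a relative cycle whose image bounds modulo the smaller complex, so by
  \<open>relboundary_inj\<close> it bounds some \<open>m\<close> relative to the boundary of the
  simplex. Making \<open>m\<close> affine and subtracting its image from \<open>c\<close> leaves a
  relative cycle.\<close>

lemma resolved_attach: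
  assumes T: "subcomplex T" and x: "(n, x) \<in> cells T" and top: "fst ` cells T \<subseteq> {..n}"
    and fin: "finite (cells T)" and R: "simplex_resolved n" and T'R: "resolved (remove n x T)"
  shows "resolved T"
  unfolding resolved_def
proof (intro allI impI)
  fix q c
  let ?T' = "remove n x T" and ?Y = "subtopology X (pts T)" and ?D = "simplex_top n" and ?B = "simplex_bd n"
  assume c: "singular_chain q ?Y c" and dc: "keys (chain_boundary q c) \<subseteq> chi (q - 1) ` T (q - 1)"
  note relcycle = resolved_relcycle[OF T x top fin R T'R]
  show "\<exists>l d. keys l \<subseteq> chi q ` T q \<and> singular_chain (Suc q) ?Y d \<and> c = l + chain_boundary (Suc q) d"
  proof (cases q)
    case 0
    then have "singular_relcycle q ?Y (pts ?T') c"
      using c by (simp add: singular_relcycle chain_boundary_def)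
    then show ?thesis using dc by (rule relcycle)
  next
    case (Suc p)
    interpret C: cell_attachment ?Y "pts ?T'" n "chi n x"
      by (rule cell_attachment_remove[OF T x top fin])
    have T': "subcomplex ?T'" by (rule subcomplex_remove[OF T x top])
    have sub: "pts ?T' \<subseteq> pts T" by (auto simp: pts_def remove_def)
    have YA: "subtopology ?Y (pts ?T') = subtopology X (pts ?T')"
      using sub by (simp add: subtopology_subtopology inf_absorb2)
    have xT: "x \<in> T n" "x \<in> S n" using x nondegD by (auto simp: cells_def)
    have contB: "continuous_map (subtopology ?D ?B) (subtopology X (pts ?T')) (chi n x)"
      unfolding YA[symmetric] using C.bd C.cont
      by (auto simp: continuous_map_in_subtopology intro: continuous_map_from_subtopology)
    let ?f = "\<lambda>p. chain_map p (chi n x)"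
    let ?P = "{\<sigma> \<in> simplex_maps p n. \<sigma> ` {..p} = {..n}}"
    have "T p \<subseteq> ?T' p \<union> (\<lambda>\<sigma>. pull p \<sigma> x) ` ?P" using remove_split[OF T x top] by blast
    then have "chi p ` T p \<subseteq> chi p ` ?T' p \<union> (\<lambda>\<sigma>. chi p (pull p \<sigma> x)) ` ?P" by blast
    also have "(\<lambda>\<sigma>. chi p (pull p \<sigma> x)) ` ?P = simplex_map p (chi n x) ` aff p ` ?P"
      unfolding image_image using simplex_map_chi[OF xT(2)] by (intro image_cong) auto
    finally have "keys (chain_boundary q c) \<subseteq> chi p ` ?T' p \<union> simplex_map p (chi n x) ` aff p ` ?P"
      using dc Suc by auto
    then obtain l1 l2 where l: "keys l1 \<subseteq> chi p ` ?T' p"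
        "keys l2 \<subseteq> simplex_map p (chi n x) ` aff p ` ?P" "l1 + l2 = chain_boundary q c"
      by (rule frag_split)
    obtain a where a: "keys a \<subseteq> aff p ` ?P" "?f p a = l2"
      using frag_extend_lift[OF l(2)] unfolding chain_map_def by blast
    have aD: "singular_chain p ?D a" using a(1) singular_simplex_aff by (fastforce simp: singular_chain_def)
    have l1A: "singular_chain p (subtopology X (pts ?T')) l1" by (rule singular_chain_chi[OF T' l(1)])
    have "chain_boundary p (l1 + l2) = 0"
      unfolding l(3) Suc using c Suc by (intro chain_boundary_boundary_alt[of _ ?Y]) simp
    \<comment> \<open>The boundary of \<open>c\<close> is a cycle, so the image of the boundary of
      \<open>a\<close> cancels the boundary of \<open>l1\<close> and lies in the smaller
      space.\<close>
    then have "?f (p - 1) (chain_boundary p a) = - chain_boundary p l1"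
      using chain_boundary_chain_map[OF aD, of "chi n x"] a(2)
      by (simp add: chain_boundary_add eq_neg_iff_add_eq_0 add.commute)
    then have "singular_chain (p - 1) (subtopology X (pts ?T')) (?f (p - 1) (chain_boundary p a))"
      using singular_chain_boundary[OF l1A] by (simp add: singular_chain_minus)
    then have acyc: "singular_relcycle p ?D ?B a" by (rule aff_surj_cycle[OF T x top fin a(1)])
    have "singular_relboundary p ?Y (pts ?T') (?f p a)"
      unfolding singular_relboundary YA
    proof (intro exI conjI)
      show "singular_chain (Suc p) ?Y c" using c Suc by simp
      show "singular_chain p (subtopology X (pts ?T')) (- l1)" using l1A by (simp add: singular_chain_minus)
      show "chain_boundary (Suc p) c + - l1 = ?f p a" using l(3) a(2) Suc by (simp add: algebra_simps)
    qed
    from C.relboundary_inj[OF acyc this] obtain m e' where m: "singular_chain (Suc p) ?D m"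
        and e': "singular_chain p (subtopology ?D ?B) e'" and me: "chain_boundary (Suc p) m + e' = a"
      unfolding singular_relboundary by blast
    have "keys a \<subseteq> aff p ` simplex_maps p n" using a(1) by blast
    moreover have "chain_boundary (Suc p) m = a + - e'" using me by (simp add: algebra_simps)
    moreover have "singular_chain p (subtopology ?D ?B) (- e')" using e' by (simp add: singular_chain_minus)
    ultimately have "\<exists>l' e' d. keys l' \<subseteq> aff (Suc p) ` simplex_maps (Suc p) n \<and>
      singular_chain (Suc p) (subtopology ?D ?B) e' \<and>
      singular_chain (Suc (Suc p)) ?D d \<and> m = l' + e' + chain_boundary (Suc (Suc p)) d"
      using R[unfolded simplex_resolved_def, rule_format, of "Suc p" m a "- e'"] m by simp
    then obtain l0 e0 d0 where l0: "keys l0 \<subseteq> aff (Suc p) ` simplex_maps (Suc p) n"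
        and e0: "singular_chain (Suc p) (subtopology ?D ?B) e0" and d0: "singular_chain (Suc (Suc p)) ?D d0"
        and m_eq: "m = l0 + e0 + chain_boundary (Suc (Suc p)) d0" by blast
    have l0D: "singular_chain (Suc p) ?D l0" using l0 singular_simplex_aff by (fastforce simp: singular_chain_def)
    have fl0: "keys (?f (Suc p) l0) \<subseteq> chi (Suc p) ` T (Suc p)" by (rule chain_map_aff[OF T xT(1) l0])
    have dm: "chain_boundary (Suc p) m = chain_boundary (Suc p) l0 + chain_boundary (Suc p) e0"
      unfolding m_eq chain_boundary_add using chain_boundary_boundary_alt[OF d0] by simp
    \<comment> \<open>Up to chains in the boundary of the simplex, \<open>l0\<close> has boundary
      \<open>a\<close>; subtracting its image removes the degeneracies of \<open>x\<close> from the
      boundary of \<open>c\<close>.\<close>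
    define c' where "c' = c - ?f (Suc p) l0"
    have fl0b: "chain_boundary (Suc p) (?f (Suc p) l0) = ?f p (chain_boundary (Suc p) l0)"
      using chain_boundary_chain_map[OF l0D, of "chi n x"] by simp
    have "chain_boundary (Suc p) c' = l1 + ?f p (a - chain_boundary (Suc p) l0)"
      unfolding c'_def chain_boundary_diff fl0b chain_map_diff using l(3) a(2) Suc by simp
    also have "a - chain_boundary (Suc p) l0 = chain_boundary (Suc p) e0 + e'"
      using me dm by (simp add: algebra_simps)
    finally have dc'_eq: "chain_boundary (Suc p) c' = l1 + ?f p (chain_boundary (Suc p) e0 + e')" .
    have "singular_chain p (subtopology X (pts ?T')) (chain_boundary (Suc p) c')"
      unfolding dc'_eq
      by (intro singular_chain_add l1A singular_chain_chain_map[OF _ contB] e' singular_chain_boundary_alt e0)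
    moreover have "singular_chain q ?Y c'"
      unfolding c'_def using c singular_chain_chain_map[OF l0D C.cont] Suc by (simp add: singular_chain_diff)
    ultimately have "singular_relcycle q ?Y (pts ?T') c'"
      unfolding singular_relcycle YA using Suc by simp
    moreover have "keys (chain_boundary q c') \<subseteq> chi (q - 1) ` T (q - 1)"
      unfolding c'_def chain_boundary_diff
      using keys_diff[of "chain_boundary q c" "chain_boundary q (?f (Suc p) l0)"] dc
        keys_boundary_chi[OF T fl0] Suc by auto
    ultimately have "\<exists>l d. keys l \<subseteq> chi q ` T q \<and> singular_chain (Suc q) ?Y d \<and>
        c' = l + chain_boundary (Suc q) d" by (rule relcycle)
    then obtain l2 d2 where l2: "keys l2 \<subseteq> chi q ` T q" "singular_chain (Suc q) ?Y d2"
        "c' = l2 + chain_boundary (Suc q) d2" by blast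
    have "keys (?f (Suc p) l0 + l2) \<subseteq> chi q ` T q"
      using keys_add[of "?f (Suc p) l0" l2] fl0 l2(1) Suc by blast
    moreover have "c = (?f (Suc p) l0 + l2) + chain_boundary (Suc q) d2"
      using l2(3) by (simp add: c'_def algebra_simps)
    ultimately show ?thesis using l2(2) by blast
  qed
qed

text \<open>Cells are removed starting from the highest dimension. Only the dimensions that occur in
  \<open>T\<close> are asked to be resolved, which permits the use inside the induction on the
  dimension of the simplex.\<close>

lemma resolved_finite:
  assumes "finite (cells T)" "subcomplex T" "\<And>k z. (k, z) \<in> cells T \<Longrightarrow> simplex_resolved k"
  shows "resolved T"
  using assms
proof (induction "card (cells T)" arbitrary: T)
  case 0
  then have "cells T = {}" by simp
  then have "pts T = {}" using pts_cells[OF "0.prems"(2)] by simp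
  then have "singular_chain q (subtopology X (pts T)) c \<Longrightarrow> c = 0" for q c
    using singular_chain_empty[of "subtopology X (pts T)" q c] by simp
  then have "\<exists>l d. keys l \<subseteq> chi q ` T q \<and> singular_chain (Suc q) (subtopology X (pts T)) d \<and>
      c = l + chain_boundary (Suc q) d" if "singular_chain q (subtopology X (pts T)) c" for q c
    using that by (intro exI[of _ 0]) simp
  then show ?case unfolding resolved_def by blast
next
  case (Suc N)
  then have ne: "cells T \<noteq> {}" by auto
  then have "Max (fst ` cells T) \<in> fst ` cells T" using Suc.prems(1) by (intro Max_in) auto
  then obtain n x where nx: "(n, x) \<in> cells T" "n = Max (fst ` cells T)" by auto
  have top: "fst ` cells T \<subseteq> {..n}"
    unfolding nx(2) using Suc.prems(1) Max_ge[of "fst ` cells T"] by blast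
  note cr = cells_remove[OF Suc.prems(2) nx(1) top]
  show ?case
  proof (rule resolved_attach[OF Suc.prems(2) nx(1) top Suc.prems(1) Suc.prems(3)[OF nx(1)]])
    show "resolved (remove n x T)"
    proof (rule Suc.hyps(1))
      show "N = card (cells (remove n x T))" using Suc.hyps(2) nx(1) Suc.prems(1) cr by simp
      show "subcomplex (remove n x T)" by (rule subcomplex_remove[OF Suc.prems(2) nx(1) top])
    qed (use cr Suc.prems in auto)
  qed
qed

end

section \<open>The standard simplex\<close>

text \<open>The representable simplicial set. Operators are restricted to \<open>{..k}\<close> so
  that equality of functions is equality of operators.\<close>

definition simplex_set :: "nat \<Rightarrow> nat \<Rightarrow> (nat \<Rightarrow> nat) set" where
  "simplex_set n k = simplex_maps k n \<inter> extensional {..k}"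

definition simplex_pull :: "nat \<Rightarrow> (nat \<Rightarrow> nat) \<Rightarrow> (nat \<Rightarrow> nat) \<Rightarrow> nat \<Rightarrow> nat" where
  "simplex_pull m \<eta> x = restrict (x \<circ> \<eta>) {..m}"

lemma simplex_maps_restrict [simp]: "restrict \<theta> {..k} \<in> simplex_maps k n \<longleftrightarrow> \<theta> \<in> simplex_maps k n"
  by (auto simp: simplex_maps_iff)

lemma aff_restrict: "aff k (restrict \<theta> {..k}) = aff k \<theta>"
  unfolding aff_def using simplex_push_cong[of k _ "restrict \<theta> {..k}" \<theta>] by (simp add: restrict_def fun_eq_iff)

lemma aff_simplex_set: "aff k ` simplex_set n k = aff k ` simplex_maps k n"
proof (intro equalityI subsetI)
  fix f assume "f \<in> aff k ` simplex_maps k n"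
  then obtain \<theta> where "\<theta> \<in> simplex_maps k n" "f = aff k (restrict \<theta> {..k})" by (auto simp: aff_restrict)
  then show "f \<in> aff k ` simplex_set n k" by (simp add: simplex_set_def)
qed (auto simp: simplex_set_def)

lemma simplicial_set_simplex: "simplicial_set (simplex_set n) simplex_pull"
proof
  show "simplex_pull m \<theta> x \<in> simplex_set n m" if "\<theta> \<in> simplex_maps m k" "x \<in> simplex_set n k" for \<theta> m k x
    using that simplex_maps_comp[of x k n \<theta> m] by (simp add: simplex_pull_def simplex_set_def)
  show "simplex_pull l \<eta> (simplex_pull m \<theta> x) = simplex_pull l (\<theta> \<circ> \<eta>) x" if "\<eta> \<in> simplex_maps l m" for \<theta> \<eta> l m x
    using that by (auto simp: simplex_pull_def simplex_maps_iff fun_eq_iff restrict_def)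
  show "simplex_pull k id x = x" if "x \<in> simplex_set n k" for k x
    using that by (simp add: simplex_pull_def simplex_set_def extensional_restrict)
  show "simplex_pull m \<theta> x = simplex_pull m \<eta> x" if "\<And>i. i \<le> m \<Longrightarrow> \<theta> i = \<eta> i" for m \<theta> \<eta> x
    using that by (auto simp: simplex_pull_def)
qed

text \<open>The transition map \<open>\<theta>\<close> from \<open>x\<close> to \<open>y\<close> is
  monotone and injective on \<open>{..k}\<close>, so \<open>simplex_maps_inj_self\<close> makes it
  the identity.\<close>

lemma simplex_maps_inj_image_eq:
  assumes x: "x \<in> simplex_maps k n" "inj_on x {..k}" and y: "y \<in> simplex_maps m n" "inj_on y {..m}"
    and eq: "x ` {..k} = y ` {..m}"
  shows "k = m \<and> (\<forall>i\<le>k. x i = y i)"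
proof -
  have "card {..k} = card {..m}" using card_image[OF x(2)] card_image[OF y(2)] eq by simp
  then have km: "k = m" by simp
  define \<theta> where "\<theta> i = inv_into {..m} y (x i)" for i
  have th: "\<theta> i \<le> m \<and> y (\<theta> i) = x i" if "i \<le> k" for i
  proof -
    have "x i \<in> y ` {..m}" using eq that by blast
    then show ?thesis unfolding \<theta>_def using inv_into_into[of "x i" y "{..m}"] f_inv_into_f[of "x i" y "{..m}"] by simp
  qed
  have "\<theta> i \<le> \<theta> j" if ij: "i \<le> j" "j \<le> k" for i j
  proof (rule ccontr)
    assume lt: "\<not> \<theta> i \<le> \<theta> j"
    then have "y (\<theta> j) \<le> y (\<theta> i)" using y(1) th[of i] ij unfolding simplex_maps_iff by (meson le_trans nat_le_linear)
    then have "x j \<le> x i" using th[of i] th[of j] ij by simp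
    moreover have "x i \<le> x j" using ij x(1) unfolding simplex_maps_iff by blast
    ultimately have "x i = x j" by simp
    then have "i = j" using x(2) ij by (auto simp: inj_on_def)
    then show False using lt by simp
  qed
  then have "\<theta> \<in> simplex_maps k k" using th km by (simp add: simplex_maps_iff)
  moreover have "inj_on \<theta> {..k}"
  proof (rule inj_onI)
    fix i j assume ij: "i \<in> {..k}" "j \<in> {..k}" "\<theta> i = \<theta> j"
    then have "x i = x j" using th[of i] th[of j] by simp
    then show "i = j" using inj_onD[OF x(2)] ij by blast
  qed
  ultimately show ?thesis using simplex_maps_inj_self[of \<theta> k] th km by metis
qed

lemma aff_id: "t \<in> standard_simplex n \<Longrightarrow> aff n (restrict id {..n}) t = t"
  using simplex_push_retract[of t n id] unfolding aff_restrict by (simp add: aff_def)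

interpretation std: simplicial_set "simplex_set n" simplex_pull for n
  by (rule simplicial_set_simplex)

lemma simplex_set_id: "restrict id {..n} \<in> simplex_set n n"
  using simplex_maps_id by (simp add: simplex_set_def)

text \<open>Every operator is the pullback of the identity simplex along itself, so
  \<open>nondeg_pull_inj\<close> applies.\<close>

lemma nondeg_simplex_inj:
  assumes "x \<in> std.nondeg n k"
  shows "inj_on x {..k}" "x \<in> simplex_maps k n" "x \<in> extensional {..k}"
proof -
  have x: "x \<in> simplex_set n k" using assms by (rule std.nondegD)
  then show 1: "x \<in> simplex_maps k n" and "x \<in> extensional {..k}" by (auto simp: simplex_set_def)
  then have "simplex_pull k x (restrict id {..n}) = x"
    by (auto simp: simplex_pull_def simplex_maps_iff restrict_def extensional_def fun_eq_iff)
  then show "inj_on x {..k}" using std.nondeg_pull_inj[OF _ 1 simplex_set_id] assms by simp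
qed

lemma aff_pull:
  assumes "\<theta> \<in> simplex_maps m k" "t \<in> standard_simplex m"
  shows "aff m (simplex_pull m \<theta> x) t = aff k x (simplex_push m \<theta> t)"
  unfolding simplex_pull_def aff_restrict
  using simplex_push_in[OF assms] simplex_push_push[OF assms(1)] assms(2) by (simp add: aff_def)

text \<open>Nondegenerate simplices are injective operators. A point determines its support, the
  support determines the operator, and the operator determines the coordinates. Closedness is tested
  by the identity simplex alone.\<close>

lemma cell_space_simplex: "cell_space (simplex_set n) simplex_pull (simplex_top n) aff"
proof (intro cell_space.intro cell_space_axioms.intro simplicial_set_simplex)
  show "singular_simplex k (simplex_top n) (aff k x)" if "x \<in> simplex_set n k" for k x
    using that by (intro singular_simplex_aff) (simp add: simplex_set_def)
  show "aff m (simplex_pull m \<theta> x) t = aff k x (simplex_push m \<theta> t)"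
    if "\<theta> \<in> simplex_maps m k" "t \<in> standard_simplex m" for \<theta> m k x t
    using that by (rule aff_pull)
  show "\<exists>k. \<exists>x\<in>simplex_set n k. \<exists>t\<in>standard_simplex k. aff k x t = p" if "p \<in> topspace (simplex_top n)" for p
    using that aff_id simplex_set_id by (intro exI[of _ n]) auto
  show "k = m \<and> x = y \<and> t = u" if x: "x \<in> std.nondeg n k" and y: "y \<in> std.nondeg n m"
    and t: "interior_pt k t" and u: "interior_pt m u" and eq: "aff k x t = aff m y u" for k m x y t u
  proof -
    note x' = nondeg_simplex_inj[OF x] and y' = nondeg_simplex_inj[OF y]
    have eq: "simplex_push k x t = simplex_push m y u"
      using eq innerD[OF t] innerD[OF u] by (simp add: aff_def)
    have supp: "z ` {..l} = {j. simplex_push l z v j \<noteq> 0}" if "interior_pt l v" for l z v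
      using simplex_push_nonzero[OF innerD[OF that], of z] that by (force simp: interior_pt_def)
    have "x ` {..k} = y ` {..m}" using supp[OF t, of x] supp[OF u, of y] eq by simp
    then have km: "k = m" and xy: "\<And>i. i \<le> k \<Longrightarrow> x i = y i"
      using simplex_maps_inj_image_eq[OF x'(2,1) y'(2,1)] by auto
    have coord: "simplex_push l z v (z i) = v i" if "inj_on z {..l}" "i \<le> l" for l z i and v :: "nat \<Rightarrow> real"
    proof -
      have "simplex_push l z v (z i) = (\<Sum>j\<le>l. if j = i then v j else 0)"
        unfolding simplex_push_if using that by (intro sum.cong) (auto simp: inj_on_def)
      then show ?thesis using that by simp
    qed
    have "x = y" using x'(3) y'(3) xy km by (intro extensionalityI[of _ "{..k}"]) auto
    moreover have "t i = u i" for i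
      using coord[OF x'(1), of i t] coord[OF y'(1), of i u] eq km xy[of i]
        standard_simplexD(2)[OF innerD[OF t], of i] standard_simplexD(2)[OF innerD[OF u], of i]
      by (cases "i \<le> k") auto
    ultimately show ?thesis using km by auto
  qed
  show "closedin (simplex_top n) C" if C: "C \<subseteq> topspace (simplex_top n)"
    "\<And>k x. x \<in> simplex_set n k \<Longrightarrow> closedin (simplex_top k) {t \<in> standard_simplex k. aff k x t \<in> C}" for C
  proof -
    have "{t \<in> standard_simplex n. aff n (restrict id {..n}) t \<in> C} = C" using C(1) aff_id by auto
    then show ?thesis using C(2)[OF simplex_set_id] by simp
  qed
qed

text \<open>Makes the cone construction for oriented simplices available.\<close>

lemma aff_oriented: "aff p \<theta> = oriented_simplex p (\<lambda>j i. if i = \<theta> j then 1 else 0)"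
  unfolding aff_def oriented_simplex_def
  by (auto simp: fun_eq_iff restrict_def simplex_push_if intro!: sum.cong)

lemma contractible_simplex: "contractible_space (simplex_top n)"
proof -
  define a where "a = (\<lambda>j. if j = (0::nat) then 1 else (0::real))"
  have a: "a \<in> standard_simplex n" by (simp add: a_def)
  let ?P = "prod_topology (top_of_set {0..1::real}) (simplex_top n)"
  have 1: "continuous_map ?P euclideanreal fst"
    using continuous_map_fst[of "top_of_set {0..1::real}" "simplex_top n"]
    by (rule continuous_map_into_fulltopology)
  have 2: "continuous_map ?P euclideanreal (\<lambda>p. snd p i)" for i
    using continuous_map_compose[OF continuous_map_snd[of _ "simplex_top n"] continuous_map_coord] by (simp add: o_def)
  have "continuous_map ?P (simplex_top n) (\<lambda>p i. (1 - fst p) * snd p i + fst p * a i)"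
    unfolding continuous_map_to_simplex_top
    using convex_standard_simplex[OF _ a] by (auto intro!: continuous_intros 1 2)
  then have "homotopic_with (\<lambda>x. True) (simplex_top n) (simplex_top n) id (\<lambda>x. a)"
    unfolding homotopic_with_def
    by (intro exI[of _ "\<lambda>p i. (1 - fst p) * snd p i + fst p * a i"]) auto
  then show ?thesis unfolding contractible_space_def by blast
qed

lemma simplex_cycle_boundary:
  assumes "singular_chain (Suc p) (simplex_top n) c" "chain_boundary (Suc p) c = 0"
  shows "\<exists>d. singular_chain (Suc (Suc p)) (simplex_top n) d \<and> c = chain_boundary (Suc (Suc p)) d"
proof -
  let ?H = "homology_group (int (Suc p)) (simplex_top n)"
  have "trivial_group ?H"
    using trivial_reduced_homology_group_contractible_space[OF contractible_simplex, of "int (Suc p)" n]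
    by (simp add: un_reduced_homology_group)
  moreover have c: "singular_relcycle (Suc p) (simplex_top n) {} c" using assms by (simp add: singular_cycle)
  then have "homologous_rel_set (Suc p) (simplex_top n) {} c \<in> carrier ?H"
    unfolding carrier_relative_homology_group by blast
  ultimately have "homologous_rel_set (Suc p) (simplex_top n) {} c \<in> {singular_relboundary_set (Suc p) (simplex_top n) {}}"
    unfolding trivial_group_def one_relative_homology_group by (metis (no_types))
  then have "c \<in> singular_relboundary_set (Suc p) (simplex_top n) {}"
    using homologous_rel_refl[of "Suc p" "simplex_top n" "{}" c] by (metis mem_Collect_eq singletonD)
  then have "singular_relboundary (Suc p) (simplex_top n) {} c" by (rule CollectD)
  then show ?thesis by (auto simp: singular_boundary)
qed

text \<open>The coefficients of the boundary of a 1-chain sum to zero. This removes the contribution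
  of the apex from the boundary of a cone over 0-chains.\<close>

lemma frag_extend_const_boundary:
  "frag_extend (\<lambda>_. v) (chain_boundary (Suc 0) c) = 0"
proof -
  have "keys c \<subseteq> UNIV" by simp
  then show ?thesis
  proof (induction rule: frag_induction)
    case (one f) then show ?case by (simp add: chain_boundary_of frag_extend_diff)
  qed (auto simp: chain_boundary_diff frag_extend_diff)
qed

text \<open>In degree 0 every point is joined by a path to vertex \<open>0\<close>. In positive
  degree the cone over the boundary of \<open>c\<close> with apex vertex \<open>0\<close> is affine
  and has the same boundary as \<open>c\<close>; the difference is a cycle in a contractible
  space.\<close>

lemma resolved_simplex: "cell_space.resolved (simplex_top n) aff (simplex_set n)"
proof -
  interpret D: cell_space "simplex_set n" simplex_pull "simplex_top n" aff by (rule cell_space_simplex)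
  let ?D = "simplex_top n"
  have top: "subtopology ?D (D.pts (simplex_set n)) = ?D"
    unfolding D.pts_S by (rule subtopology_topspace)
  have const: "(\<lambda>_. 0) \<in> simplex_maps k n" for k by (simp add: simplex_maps_iff)
  show ?thesis unfolding D.resolved_def top aff_simplex_set
  proof (intro allI impI)
    fix q c assume c: "singular_chain q ?D c"
      and dc: "keys (chain_boundary q c) \<subseteq> aff (q - 1) ` simplex_maps (q - 1) n"
    show "\<exists>l d. keys l \<subseteq> aff q ` simplex_maps q n \<and> singular_chain (Suc q) ?D d \<and>
      c = l + chain_boundary (Suc q) d"
    proof (cases q)
      case 0
      have pc: "path_connected_space ?D"
        by (rule contractible_imp_path_connected_space[OF contractible_simplex])
      have "keys c \<subseteq> singular_simplex_set 0 ?D" using c 0 by (simp add: singular_chain_def)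
      then have "\<exists>l d. keys l \<subseteq> aff 0 ` simplex_maps 0 n \<and> singular_chain (Suc 0) ?D d \<and>
        c = l + chain_boundary (Suc 0) d"
      proof (induction rule: frag_induction)
        case zero show ?case by (intro exI[of _ 0]) simp
      next
        case (one f)
        have "homologous_rel 0 ?D {} (frag_of f) (frag_of (aff 0 (\<lambda>_. 0)))"
          using one singular_simplex_aff[OF const] by (intro iso_integer_zeroth_homology_group_aux[OF pc]) auto
        then obtain d where "singular_chain (Suc 0) ?D d" "chain_boundary (Suc 0) d = frag_of f - frag_of (aff 0 (\<lambda>_. 0))"
          unfolding homologous_rel_def singular_boundary by blast
        then show ?case using const[of 0]
          by (intro exI[of _ "frag_of (aff 0 (\<lambda>_. 0))"] exI[of _ d]) simp
      next
        case (diff a b)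
        then obtain l d l' d' where "keys l \<subseteq> aff 0 ` simplex_maps 0 n" "singular_chain (Suc 0) ?D d"
          "a = l + chain_boundary (Suc 0) d" "keys l' \<subseteq> aff 0 ` simplex_maps 0 n" "singular_chain (Suc 0) ?D d'"
          "b = l' + chain_boundary (Suc 0) d'" by blast
        then show ?case using keys_diff[of l l']
          by (intro exI[of _ "l - l'"] exI[of _ "d - d'"])
            (auto simp: chain_boundary_diff singular_chain_diff)
      qed
      then show ?thesis using 0 by simp
    next
      case (Suc p)
      define v where "v = (\<lambda>i. if i = (0::nat) then 1 else (0::real))"
      let ?l = "chain_boundary q c"
      have l: "keys ?l \<subseteq> aff p ` simplex_maps p n" using dc Suc by simp
      \<comment> \<open>With the least vertex as apex, the coned operator is again monotone.\<close>
      have cone: "simplex_cone p v (aff p \<theta>) = aff (Suc p) (\<lambda>i. if i = 0 then 0 else \<theta> (i - 1))" for \<theta>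
      proof -
        have "simplex_cone p v (aff p \<theta>) =
            oriented_simplex (Suc p) (\<lambda>i. if i = 0 then v else (\<lambda>k. if k = \<theta> (i - 1) then 1 else 0))"
          unfolding aff_oriented simplex_cone by (simp add: v_def)
        also have "\<dots> = aff (Suc p) (\<lambda>i. if i = 0 then 0 else \<theta> (i - 1))"
          unfolding aff_oriented v_def by (rule arg_cong[where f = "oriented_simplex (Suc p)"]) (auto simp: fun_eq_iff)
        finally show ?thesis .
      qed
      define m where "m = simplicial_cone p v ?l"
      have mk: "keys m \<subseteq> aff q ` simplex_maps q n"
        unfolding m_def simplicial_cone_def
      proof (rule keys_frag_extend_subset)
        fix f assume "f \<in> keys ?l"
        then obtain \<theta> where \<theta>: "\<theta> \<in> simplex_maps p n" "f = aff p \<theta>" using l by blast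
        have "(\<lambda>i. if i = 0 then 0 else \<theta> (i - 1)) \<in> simplex_maps q n"
          using \<theta>(1) Suc by (auto simp: simplex_maps_iff)
        then show "keys ((frag_of \<circ> simplex_cone p v) f) \<subseteq> aff q ` simplex_maps q n"
          using \<theta>(2) Suc cone[of \<theta>] by auto
      qed
      have "simplicial_chain p UNIV ?l"
        unfolding simplicial_chain_def simplicial_simplex using l aff_oriented by blast
      from chain_boundary_simplicial_cone[OF this, of v]
      have dm: "chain_boundary q m = ?l"
      proof (cases "p = 0")
        case True
        then show ?thesis
          using chain_boundary_simplicial_cone[OF \<open>simplicial_chain p UNIV ?l\<close>, of v] Suc frag_extend_const_boundary
          by (simp add: m_def)
      next
        case False
        have "chain_boundary p ?l = 0" unfolding Suc using c Suc by (intro chain_boundary_boundary_alt[of _ ?D]) simp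
        then show ?thesis
          using False chain_boundary_simplicial_cone[OF \<open>simplicial_chain p UNIV ?l\<close>, of v] Suc
          by (simp add: m_def simplicial_cone_def)
      qed
      have mD: "singular_chain q ?D m" using mk singular_simplex_aff by (fastforce simp: singular_chain_def)
      have "\<exists>d. singular_chain (Suc (Suc p)) ?D d \<and> c - m = chain_boundary (Suc (Suc p)) d"
      proof (rule simplex_cycle_boundary)
        show "singular_chain (Suc p) ?D (c - m)" using c mD Suc by (simp add: singular_chain_diff)
        show "chain_boundary (Suc p) (c - m) = 0" using dm Suc by (simp add: chain_boundary_diff)
      qed
      then obtain d where "singular_chain (Suc q) ?D d" "c - m = chain_boundary (Suc q) d" using Suc by blast
      then show ?thesis using mk by (intro exI[of _ m] exI[of _ d]) (simp add: algebra_simps)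
    qed
  qed
qed

text \<open>The operators that are not onto form a subcomplex \<open>B\<close> with cells of
  dimension below \<open>n\<close> and with the boundary of the simplex as its space, so the
  induction hypothesis resolves it. This turns the error \<open>e\<close> into cells up to the
  boundary of a chain \<open>f\<close> in that space; then \<open>m - f\<close> has affine boundary
  and \<open>resolved_simplex\<close> applies.\<close>

lemma simplex_resolved_all: "simplex_resolved n"
proof (induction n rule: less_induct)
  case (less n)
  interpret D: cell_space "simplex_set n" simplex_pull "simplex_top n" aff by (rule cell_space_simplex)
  let ?D = "simplex_top n"
  define B where "B k = {x \<in> simplex_set n k. x ` {..k} \<noteq> {..n}}" for k
  have B: "D.subcomplex B"
    unfolding D.subcomplex_def
  proof (intro conjI allI ballI)
    fix k show "B k \<subseteq> simplex_set n k" by (auto simp: B_def)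
  next
    fix m k \<theta> x assume \<theta>: "\<theta> \<in> simplex_maps m k" and x: "x \<in> B k"
    have "simplex_pull m \<theta> x ` {..m} \<subseteq> x ` {..k}"
      using \<theta> by (auto simp: simplex_pull_def simplex_maps_iff)
    moreover have "x ` {..k} \<subset> {..n}" using x by (auto simp: B_def simplex_set_def simplex_maps_iff)
    ultimately have "simplex_pull m \<theta> x ` {..m} \<noteq> {..n}" by blast
    then show "simplex_pull m \<theta> x \<in> B m" using std.pull_closed[OF \<theta>] x by (simp add: B_def)
  qed
  have dim: "k < n" if "(k, z) \<in> D.cells B" for k z
  proof -
    have z: "z \<in> std.nondeg n k" "z ` {..k} \<noteq> {..n}" using that by (auto simp: D.cells_def B_def)
    note z' = nondeg_simplex_inj[OF z(1)]
    have "z ` {..k} \<subset> {..n}" using z(2) z'(2) by (auto simp: simplex_maps_iff)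
    then have "card (z ` {..k}) < card {..n}" by (intro psubset_card_mono) auto
    then show ?thesis using card_image[OF z'(1)] by simp
  qed
  have "finite (simplex_set n k)" for k
  proof -
    have "simplex_set n k \<subseteq> {..k} \<rightarrow>\<^sub>E {..n}"
      by (auto simp: simplex_set_def simplex_maps_iff PiE_def)
    then show ?thesis by (rule finite_subset) (simp add: finite_PiE)
  qed
  then have "finite (SIGMA k:{..n}. simplex_set n k)" by simp
  moreover have "D.cells B \<subseteq> (SIGMA k:{..n}. simplex_set n k)"
    using dim by (fastforce simp: D.cells_def B_def)
  ultimately have "finite (D.cells B)" by (rule finite_subset[rotated])
  then have BR: "D.resolved B" using less.IH dim by (intro D.resolved_finite[OF _ B]) auto
  have ptsB: "D.pts B = simplex_bd n"
  proof (intro equalityI subsetI)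
    fix p assume "p \<in> D.pts B"
    then obtain k x t where x: "x \<in> B k" "t \<in> standard_simplex k" "p = aff k x t" by (auto simp: D.pts_def)
    then have "singular_simplex k (subtopology ?D (simplex_bd n)) (aff k x)"
      by (intro aff_bd) (auto simp: B_def simplex_set_def)
    then show "p \<in> simplex_bd n" using x by (auto simp: singular_simplex_subtopology)
  next
    fix p assume p: "p \<in> simplex_bd n"
    then have "p \<in> D.pts (simplex_set n)" unfolding D.pts_S by (simp add: simplex_bd_def)
    from D.pts_normal_form[OF D.subcomplex_S this] obtain k z u
      where z: "(k, z) \<in> D.cells (simplex_set n)" "interior_pt k u" "p = aff k z u" by blast
    note uS = innerD[OF z(2)]
    have zm: "z \<in> simplex_set n k" "z \<in> simplex_maps k n" using z(1) by (auto simp: D.cells_def simplex_set_def)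
    have "{i. u i \<noteq> 0} = {..k}" using z(2) support_nonempty[OF uS] by (force simp: interior_pt_def)
    then have "z ` {..k} \<noteq> {..n}"
      using inner_push[OF zm(2) uS] z(3) uS p by (auto simp: aff_def simplex_bd_def)
    then show "p \<in> D.pts B" using zm z(3) uS unfolding D.pts_def B_def by blast
  qed
  have top: "subtopology ?D (D.pts (simplex_set n)) = ?D" unfolding D.pts_S by (rule subtopology_topspace)
  show ?case unfolding simplex_resolved_def
  proof (intro allI impI)
    fix q m l e
    assume m: "singular_chain q ?D m" and l: "keys l \<subseteq> aff (q - 1) ` simplex_maps (q - 1) n"
      and e: "singular_chain (q - 1) (subtopology ?D (simplex_bd n)) e" and eq: "chain_boundary q m = l + e"
    have l': "keys l \<subseteq> aff (q - 1) ` simplex_set n (q - 1)" using l aff_simplex_set by simp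
    have "\<exists>f l1. singular_chain q (subtopology ?D (simplex_bd n)) f \<and>
        keys l1 \<subseteq> aff (q - 1) ` simplex_set n (q - 1) \<and> chain_boundary q (m - f) = l1"
    proof (cases q)
      case 0 then show ?thesis by (intro exI[of _ 0]) (simp add: chain_boundary_def)
    next
      case (Suc p)
      have "chain_boundary p (l + e) = 0"
        unfolding eq[symmetric] Suc using m Suc by (intro chain_boundary_boundary_alt[of _ ?D]) simp
      then have de: "chain_boundary p e = - chain_boundary p l"
        by (simp add: chain_boundary_add eq_neg_iff_add_eq_0 add.commute)
      have eB: "singular_chain p (subtopology ?D (D.pts B)) e" using e Suc ptsB by simp
      have "keys (chain_boundary p e) \<subseteq> aff (p - 1) ` simplex_set n (p - 1)"
        unfolding de using D.keys_boundary_chi[OF D.subcomplex_S, of l p] l' Suc by simp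
      then have "keys (chain_boundary p e) \<subseteq> aff (p - 1) ` B (p - 1)"
        using singular_chain_boundary[OF eB] by (intro D.keys_chi_pts[OF D.subcomplex_S B]) auto
      then obtain l1 f where f: "keys l1 \<subseteq> aff p ` B p" "singular_chain (Suc p) (subtopology ?D (D.pts B)) f"
          "e = l1 + chain_boundary (Suc p) f"
        using BR eB unfolding D.resolved_def by blast
      have "chain_boundary q (m - f) = l + l1" using eq f(3) Suc by (simp add: chain_boundary_diff)
      moreover have "keys (l + l1) \<subseteq> aff (q - 1) ` simplex_set n (q - 1)"
        using l' f(1) Suc keys_add[of l l1] by (force simp: B_def)
      ultimately show ?thesis using f(2) unfolding Suc ptsB by blast
    qed
    then obtain f where f: "singular_chain q (subtopology ?D (simplex_bd n)) f"
        "keys (chain_boundary q (m - f)) \<subseteq> aff (q - 1) ` simplex_set n (q - 1)" by blast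
    have "singular_chain q ?D (m - f)"
      using f(1) by (intro singular_chain_diff m) (simp only: singular_chain_subtopology[of q ?D "simplex_bd n"])
    then have "\<exists>l d. keys l \<subseteq> aff q ` simplex_set n q \<and> singular_chain (Suc q) ?D d \<and>
        m - f = l + chain_boundary (Suc q) d"
      using resolved_simplex[of n, unfolded D.resolved_def top] f(2) by blast
    then obtain l2 d where "keys l2 \<subseteq> aff q ` simplex_maps q n" "singular_chain (Suc q) ?D d"
        "m - f = l2 + chain_boundary (Suc q) d" unfolding aff_simplex_set by blast
    then show "\<exists>l' e' d. keys l' \<subseteq> aff q ` simplex_maps q n \<and>
      singular_chain q (subtopology ?D (simplex_bd n)) e' \<and>
      singular_chain (Suc q) ?D d \<and> m = l' + e' + chain_boundary (Suc q) d"
      using f(1) by (intro exI[of _ l2] exI[of _ f] exI[of _ d]) (simp add: algebra_simps)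
  qed
qed

lemma finite_simplex_set: "finite (simplex_set n k)"
proof -
  have "simplex_set n k \<subseteq> {..k} \<rightarrow>\<^sub>E {..n}"
    by (auto simp: simplex_set_def simplex_maps_iff PiE_def)
  then show ?thesis by (rule finite_subset) (simp add: finite_PiE)
qed

context cell_space
begin

text \<open>\<open>T\<close> is generated by the finitely many cells that meet the compact support
  of \<open>c\<close>. Its nondegenerate simplices are pullbacks of these along injective operators,
  so they are finite in number too.\<close>

lemma singular_resolution:
  assumes c: "singular_chain q X c" and dc: "keys (chain_boundary q c) \<subseteq> chi (q - 1) ` S (q - 1)"
  shows "\<exists>l d. keys l \<subseteq> chi q ` S q \<and> singular_chain (Suc q) X d \<and> c = l + chain_boundary (Suc q) d"
proof -
  define K where "K = (\<Union>f\<in>keys c. f ` standard_simplex q)"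
  have K: "compactin X K" unfolding K_def
  proof (rule compactin_Union)
    fix L assume "L \<in> (\<lambda>f. f ` standard_simplex q) ` keys c"
    then obtain f where f: "f \<in> keys c" "L = f ` standard_simplex q" by blast
    then have "continuous_map (simplex_top q) X f" using c by (auto simp: singular_chain_def singular_simplex_def)
    moreover have "compactin (simplex_top q) (standard_simplex q)"
      using compact_space_simplex_top[of q] by (simp add: compact_space_def)
    ultimately show "compactin X L" unfolding f(2) by (rule image_compactin[rotated])
  qed simp
  define Q where "Q = {(n, x). x \<in> nondeg n \<and> (\<exists>t. interior_pt n t \<and> chi n x t \<in> K)}"
  have Q: "finite Q" unfolding Q_def by (rule finite_cells[OF K])
  define T where "T m = {pull m \<theta> x | \<theta> n x. \<theta> \<in> simplex_maps m n \<and> (n, x) \<in> Q}" for m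
  have QS: "x \<in> S n" if "(n, x) \<in> Q" for n x using that nondegD by (auto simp: Q_def)
  have T: "subcomplex T"
    unfolding subcomplex_def
  proof (intro conjI allI ballI subsetI)
    fix m y assume "y \<in> T m"
    then show "y \<in> S m" using QS pull_closed unfolding T_def by blast
  next
    fix l m \<eta> y assume \<eta>: "\<eta> \<in> simplex_maps l m" and "y \<in> T m"
    then obtain \<theta> n x where x: "\<theta> \<in> simplex_maps m n" "(n, x) \<in> Q" "y = pull m \<theta> x" unfolding T_def by blast
    then have "pull l \<eta> y = pull l (\<theta> \<circ> \<eta>) x" using pull_pull[OF x(1) \<eta> QS[OF x(2)]] by simp
    then show "pull l \<eta> y \<in> T l" using x(2) simplex_maps_comp[OF x(1) \<eta>] unfolding T_def by blast
  qed
  have "cells T \<subseteq> (\<Union>(n, x)\<in>Q. \<Union>m\<in>{..n}. (\<lambda>\<theta>. (m, pull m \<theta> x)) ` simplex_set n m)"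
  proof clarify
    fix m z assume "(m, z) \<in> cells T"
    then obtain \<theta> n x where x: "\<theta> \<in> simplex_maps m n" "(n, x) \<in> Q" "z = pull m \<theta> x" and z: "z \<in> nondeg m"
      unfolding cells_def T_def by blast
    have "inj_on \<theta> {..m}" using nondeg_pull_inj[OF _ x(1) QS[OF x(2)]] z x(3) by simp
    then have "m \<le> n" using simplex_maps_inj_le[OF x(1)] by simp
    moreover have "restrict \<theta> {..m} \<in> simplex_set n m" using x(1) by (simp add: simplex_set_def)
    moreover have "z = pull m (restrict \<theta> {..m}) x" unfolding x(3) by (intro pull_cong) simp
    ultimately show "(m, z) \<in> (\<Union>(n, x)\<in>Q. \<Union>m\<in>{..n}. (\<lambda>\<theta>. (m, pull m \<theta> x)) ` simplex_set n m)"
      using x(2) by blast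
  qed
  moreover have "finite (\<Union>(n, x)\<in>Q. \<Union>m\<in>{..n}. (\<lambda>\<theta>. (m, pull m \<theta> x)) ` simplex_set n m)"
    using Q finite_simplex_set by auto
  ultimately have "finite (cells T)" by (rule finite_subset)
  then have R: "resolved T" using simplex_resolved_all by (intro resolved_finite T)
  have "K \<subseteq> pts T"
  proof
    fix p assume p: "p \<in> K"
    then have "p \<in> pts S" using compactin_subset_topspace[OF K] pts_S by blast
    from pts_normal_form[OF subcomplex_S this] obtain k z u
      where z: "(k, z) \<in> cells S" "interior_pt k u" "p = chi k z u" by blast
    then have "(k, z) \<in> Q" using p by (auto simp: cells_def Q_def)
    then have "pull k id z \<in> T k" using simplex_maps_id unfolding T_def by blast
    then have "z \<in> T k" using pull_id[OF QS[OF \<open>(k, z) \<in> Q\<close>]] by simp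
    then show "p \<in> pts T" using z(3) innerD[OF z(2)] unfolding pts_def by blast
  qed
  then have cT: "singular_chain q (subtopology X (pts T)) c"
    using c unfolding singular_chain_subtopology K_def by blast
  have "keys (chain_boundary q c) \<subseteq> chi (q - 1) ` T (q - 1)"
    using singular_chain_boundary[OF cT] by (intro keys_chi_pts[OF subcomplex_S T dc]) simp
  then obtain l d where l: "keys l \<subseteq> chi q ` T q" "singular_chain (Suc q) (subtopology X (pts T)) d"
      "c = l + chain_boundary (Suc q) d"
    using R cT unfolding resolved_def by blast
  have "chi q ` T q \<subseteq> chi q ` S q" using subcomplexD(1)[OF T] by blast
  then have "keys l \<subseteq> chi q ` S q" using l(1) by (rule order_trans[rotated])
  moreover have "singular_chain (Suc q) X d" using l(2) by (simp only: singular_chain_subtopology)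
  ultimately show ?thesis using l(3) by blast
qed

end

section \<open>Geometric realizations\<close>

context simplicial_set
begin

text \<open>\<open>\<delta>\<close> spans the face whose interior contains the point,
  \<open>s\<close> gives the coordinates there, and \<open>z\<close> with \<open>u\<close> is the
  nondegenerate simplex and interior point to which the point reduces. A relation is enough:
  existence, uniqueness and invariance under gluing let it separate the points of the
  quotient.\<close>

definition nf :: "(nat \<times> 'x) \<times> (nat \<Rightarrow> real) \<Rightarrow> nat \<Rightarrow> 'x \<Rightarrow> (nat \<Rightarrow> real) \<Rightarrow> bool" where
  "nf p k z u \<longleftrightarrow> (\<exists>n x l \<delta> \<sigma> s. p = ((n, x), simplex_push l \<delta> s) \<and> x \<in> S n \<and>
    \<delta> \<in> simplex_maps l n \<and> inj_on \<delta> {..l} \<and> interior_pt l s \<and>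
    z \<in> nondeg k \<and> \<sigma> \<in> simplex_maps l k \<and> \<sigma> ` {..l} = {..k} \<and> pull l \<delta> x = pull l \<sigma> z \<and> u = simplex_push l \<sigma> s)"

lemma interior_support: "interior_pt l s \<Longrightarrow> {i. s i \<noteq> 0} = {..l}"
  using support_nonempty[OF innerD, of l s] by (force simp: interior_pt_def)

lemma interior_push:
  "\<lbrakk>interior_pt l s; \<sigma> \<in> simplex_maps l k; \<sigma> ` {..l} = {..k}\<rbrakk> \<Longrightarrow> interior_pt k (simplex_push l \<sigma> s)"
  by (intro inner_push innerD) (auto simp: interior_support)

lemma push_image:
  assumes "interior_pt l s"
  shows "{j. simplex_push l \<delta> s j \<noteq> 0} = \<delta> ` {..l}"
  using simplex_push_nonzero[OF innerD[OF assms], of \<delta>] assms by (force simp: interior_pt_def)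

lemma push_coord:
  assumes "inj_on \<delta> {..l}" "i \<le> l"
  shows "simplex_push l \<delta> s (\<delta> i) = s i"
proof -
  have "simplex_push l \<delta> s (\<delta> i) = (\<Sum>j\<le>l. if j = i then s j else 0)"
    unfolding simplex_push_if using assms by (intro sum.cong) (auto simp: inj_on_def)
  then show ?thesis using assms by simp
qed

text \<open>The point determines its support and with it \<open>\<delta>\<close> and
  \<open>s\<close>; uniqueness of cores then determines \<open>z\<close> and
  \<open>\<sigma>\<close>.\<close>

lemma nf_unique:
  assumes "nf p k z u" "nf p k' z' u'"
  shows "k = k' \<and> z = z' \<and> u = u'"
proof -
  obtain n x l \<delta> \<sigma> s where 1: "p = ((n, x), simplex_push l \<delta> s)" "x \<in> S n" "\<delta> \<in> simplex_maps l n"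
    "inj_on \<delta> {..l}" "interior_pt l s" "z \<in> nondeg k" "\<sigma> \<in> simplex_maps l k" "\<sigma> ` {..l} = {..k}"
    "pull l \<delta> x = pull l \<sigma> z" "u = simplex_push l \<sigma> s"
    using assms(1) unfolding nf_def by blast
  obtain n' x' l' \<delta>' \<sigma>' s' where 2: "p = ((n', x'), simplex_push l' \<delta>' s')" "x' \<in> S n'" "\<delta>' \<in> simplex_maps l' n'"
    "inj_on \<delta>' {..l'}" "interior_pt l' s'" "z' \<in> nondeg k'" "\<sigma>' \<in> simplex_maps l' k'" "\<sigma>' ` {..l'} = {..k'}"
    "pull l' \<delta>' x' = pull l' \<sigma>' z'" "u' = simplex_push l' \<sigma>' s'"
    using assms(2) unfolding nf_def by blast
  have eq: "n = n'" "x = x'" "simplex_push l \<delta> s = simplex_push l' \<delta>' s'" using 1(1) 2(1) by auto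
  have "\<delta> ` {..l} = \<delta>' ` {..l'}" using push_image[OF 1(5)] push_image[OF 2(5)] eq(3) by metis
  then have d: "l = l'" "\<And>i. i \<le> l \<Longrightarrow> \<delta> i = \<delta>' i"
    using simplex_maps_inj_image_eq[OF 1(3,4)] 2(3,4) eq(1) by auto
  have "s i = s' i" for i
    using push_coord[OF 1(4), of i s] push_coord[OF 2(4), of i s'] eq(3) d
      standard_simplexD(2)[OF innerD[OF 1(5)], of i] standard_simplexD(2)[OF innerD[OF 2(5)], of i]
    by (cases "i \<le> l") auto
  then have s: "s = s'" by blast
  have "pull l \<sigma> z = pull l \<sigma>' z'" using pull_cong[of l \<delta> \<delta>' x] d eq 1(9) 2(9) by simp
  then have "k = k' \<and> z = z' \<and> (\<forall>i\<le>l. \<sigma> i = \<sigma>' i)"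
    using nondeg_core_unique[OF 1(6-8)] 2(6-8) d(1) by blast
  then show ?thesis using 1(10) 2(10) s d(1) simplex_push_cong[of l s \<sigma> \<sigma>'] by auto
qed

text \<open>Retract onto the support of \<open>t\<close> and factor the retraction as
  \<open>\<delta> \<circ> \<rho>\<close>; pushing \<open>t\<close> along \<open>\<rho>\<close> gives
  the interior coordinates \<open>s\<close>.\<close>

lemma nf_exists:
  assumes x: "x \<in> S n" and t: "t \<in> standard_simplex n"
  shows "\<exists>k z u. nf ((n, x), t) k z u"
proof -
  define I where "I = {i. t i \<noteq> 0}"
  have I: "I \<subseteq> {..n}" "I \<noteq> {}" using support_nonempty[OF t] by (auto simp: I_def)
  obtain r where r: "r \<in> simplex_maps n n" "\<And>i. r i \<in> I" "\<And>i. i \<in> I \<Longrightarrow> r i = i"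
    using simplex_maps_retract[OF I] by blast
  obtain l \<rho> \<delta> where f: "\<rho> \<in> simplex_maps n l" "\<delta> \<in> simplex_maps l n" "\<rho> ` {..n} = {..l}" "inj_on \<delta> {..l}"
      "\<And>i. i \<le> n \<Longrightarrow> r i = \<delta> (\<rho> i)"
    using simplex_maps_factor[OF r(1)] by blast
  define s where "s = simplex_push n \<rho> t"
  have "simplex_push l \<delta> s = simplex_push n (\<delta> \<circ> \<rho>) t" unfolding s_def by (rule simplex_push_push[OF f(1)])
  also have "\<dots> = simplex_push n r t" using f(5) by (intro simplex_push_cong) simp
  also have "\<dots> = t" by (rule simplex_push_retract[OF t]) (use r(3) I_def in blast)
  finally have ts: "t = simplex_push l \<delta> s" ..
  \<comment> \<open>\<open>r i\<close> lies in \<open>I\<close> and has the same value under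
    \<open>\<rho>\<close> as \<open>i\<close>, because \<open>\<delta>\<close> is injective.\<close>
  have "\<rho> ` I = {..l}"
  proof (intro equalityI subsetI)
    fix j assume "j \<in> {..l}"
    then obtain i where i: "i \<le> n" "j = \<rho> i" using f(3) by (metis atMost_iff imageE)
    have ri: "r i \<in> I" "r i \<le> n" using r(2)[of i] I(1) by auto
    have "\<delta> (\<rho> (r i)) = \<delta> (\<rho> i)" using f(5)[OF i(1)] f(5)[OF ri(2)] r(3)[OF ri(1)] by simp
    moreover have "\<rho> (r i) \<le> l" "\<rho> i \<le> l" using f(1) i(1) ri(2) unfolding simplex_maps_iff by blast+
    ultimately have "\<rho> (r i) = \<rho> i" using inj_onD[OF f(4)] by simp
    then show "j \<in> \<rho> ` I" using i(2) ri(1) by (metis imageI)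
  qed (use f(1) I(1) in \<open>auto simp: simplex_maps_iff\<close>)
  then have s: "interior_pt l s" unfolding s_def I_def by (intro inner_push f(1) t)
  obtain k z \<sigma> where "z \<in> nondeg k" "\<sigma> \<in> simplex_maps l k" "\<sigma> ` {..l} = {..k}" "pull l \<delta> x = pull l \<sigma> z"
    using nondeg_core[OF pull_closed[OF f(2) x]] by blast
  then show ?thesis unfolding nf_def ts using x f(2,4) s by blast
qed

text \<open>After gluing along \<open>\<theta>\<close>, the operator
  \<open>\<theta> \<circ> \<delta>\<close> may fail to be injective. Factor it as
  \<open>\<epsilon> \<circ> \<tau>\<close>: the core of the \<open>\<epsilon>\<close>-face of
  \<open>y\<close>, pulled back along \<open>\<tau>\<close>, is by uniqueness the core of the
  \<open>\<delta>\<close>-face of the pullback of \<open>y\<close>.\<close>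

lemma nf_glue:
  assumes g: "glue S pull p q" and p: "nf p k z u"
  shows "nf q k z u"
proof -
  obtain m n \<theta> y t where \<theta>: "\<theta> \<in> simplex_maps m n" and y: "y \<in> S n" and t: "t \<in> standard_simplex m"
    and pe: "p = ((m, pull m \<theta> y), t)" and qe: "q = ((n, y), simplex_push m \<theta> t)"
    using g unfolding glue_def by blast
  obtain l \<delta> \<sigma> s where 1: "t = simplex_push l \<delta> s" "\<delta> \<in> simplex_maps l m"
    "interior_pt l s" "z \<in> nondeg k" "\<sigma> \<in> simplex_maps l k" "\<sigma> ` {..l} = {..k}"
    "pull l \<delta> (pull m \<theta> y) = pull l \<sigma> z" "u = simplex_push l \<sigma> s"
    using p unfolding nf_def pe by blast
  have td: "\<theta> \<circ> \<delta> \<in> simplex_maps l n" by (rule simplex_maps_comp[OF \<theta> 1(2)])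
  obtain l' \<tau> \<epsilon> where f: "\<tau> \<in> simplex_maps l l'" "\<epsilon> \<in> simplex_maps l' n" "\<tau> ` {..l} = {..l'}" "inj_on \<epsilon> {..l'}"
      "\<And>i. i \<le> l \<Longrightarrow> (\<theta> \<circ> \<delta>) i = \<epsilon> (\<tau> i)"
    using simplex_maps_factor[OF td] by blast
  obtain k' w \<rho> where w: "w \<in> nondeg k'" "\<rho> \<in> simplex_maps l' k'" "\<rho> ` {..l'} = {..k'}" "pull l' \<epsilon> y = pull l' \<rho> w"
    using nondeg_core[OF pull_closed[OF f(2) y]] by blast
  have "pull l \<sigma> z = pull l (\<theta> \<circ> \<delta>) y" using pull_pull[OF \<theta> 1(2) y] 1(7) by simp
  also have "\<dots> = pull l (\<epsilon> \<circ> \<tau>) y" using f(5) by (intro pull_cong) simp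
  also have "\<dots> = pull l \<tau> (pull l' \<rho> w)" using pull_pull[OF f(2,1) y] w(4) by simp
  also have "\<dots> = pull l (\<rho> \<circ> \<tau>) w" by (rule pull_pull[OF w(2) f(1) nondegD[OF w(1)]])
  finally have eq: "pull l \<sigma> z = pull l (\<rho> \<circ> \<tau>) w" .
  have surj: "(\<rho> \<circ> \<tau>) ` {..l} = {..k'}" using f(3) w(3) by (simp only: image_comp[symmetric])
  have *: "k = k' \<and> z = w \<and> (\<forall>i\<le>l. \<sigma> i = (\<rho> \<circ> \<tau>) i)"
    by (rule nondeg_core_unique[OF 1(4-6) w(1) simplex_maps_comp[OF w(2) f(1)] surj eq])
  have "simplex_push m \<theta> t = simplex_push l (\<theta> \<circ> \<delta>) s" unfolding 1(1) by (rule simplex_push_push[OF 1(2)])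
  also have "\<dots> = simplex_push l (\<epsilon> \<circ> \<tau>) s" using f(5) by (intro simplex_push_cong) simp
  also have "\<dots> = simplex_push l' \<epsilon> (simplex_push l \<tau> s)" by (rule simplex_push_push[OF f(1), symmetric])
  finally have 2: "q = ((n, y), simplex_push l' \<epsilon> (simplex_push l \<tau> s))" using qe by simp
  have "u = simplex_push l (\<rho> \<circ> \<tau>) s" unfolding 1(8) using * by (intro simplex_push_cong) simp
  then have 3: "u = simplex_push l' \<rho> (simplex_push l \<tau> s)" using simplex_push_push[OF f(1)] by simp
  show ?thesis unfolding nf_def 2
    using y f(2,4) interior_push[OF 1(3) f(1,3)] w 3 *
    by (intro exI[of _ n] exI[of _ y] exI[of _ l'] exI[of _ \<epsilon>] exI[of _ \<rho>] exI[of _ "simplex_push l \<tau> s"] conjI)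
      simp_all
qed

lemma nf_self: "z \<in> nondeg k \<Longrightarrow> interior_pt k u \<Longrightarrow> nf ((k, z), u) k z u"
  unfolding nf_def
proof (intro exI conjI)
  show "((k, z), u) = ((k, z), simplex_push k id u)" "u = simplex_push k id u" if "interior_pt k u"
    using simplex_push_retract[OF innerD[OF that], of id] by simp_all
qed (auto simp: nondegD simplex_maps_id)

lemma glue_domain:
  assumes "glue S pull p q"
  shows "\<exists>m x t. p = ((m, x), t) \<and> x \<in> S m \<and> t \<in> standard_simplex m"
proof -
  obtain m n \<theta> x t where "\<theta> \<in> simplex_maps m n" "x \<in> S n" "t \<in> standard_simplex m" "p = ((m, pull m \<theta> x), t)"
    using assms unfolding glue_def by blast
  then show ?thesis using pull_closed by blast
qed

lemma nf_equivclp: "equivclp (glue S pull) p q \<Longrightarrow> nf p k z u \<longleftrightarrow> nf q k z u"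
proof (induction rule: equivclp_induct)
  case (step q r)
  \<comment> \<open>\<open>nf_glue\<close> only goes in the direction of \<open>glue\<close>;
    existence and uniqueness of normal forms give the way back.\<close>
  have *: "nf a k z u \<longleftrightarrow> nf b k z u" if g: "glue S pull a b" for a b
  proof
    assume b: "nf b k z u"
    obtain k' z' u' where a: "nf a k' z' u'" using glue_domain[OF g] nf_exists by blast
    then have "k' = k \<and> z' = z \<and> u' = u" using nf_unique[OF nf_glue[OF g a] b] by simp
    then show "nf a k z u" using a by simp
  qed (rule nf_glue[OF g])
  then have "nf q k z u \<longleftrightarrow> nf r k z u" using step by blast
  then show ?case using step by simp
qed simp

definition realization_simplex :: "nat \<Rightarrow> 'x \<Rightarrow> (nat \<Rightarrow> real) \<Rightarrow> ((nat \<times> 'x) \<times> (nat \<Rightarrow> real)) set" where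
  "realization_simplex n x = restrict (\<lambda>t. glue_rel S pull `` {((n, x), t)}) (standard_simplex n)"

lemma topspace_simplex_space: "topspace (simplex_space S) = {((n, x), t). x \<in> S n \<and> t \<in> standard_simplex n}"
  by (auto simp: simplex_space_def)

lemma realization_simplex_eq:
  assumes "x \<in> S n" "t \<in> standard_simplex n" "y \<in> S m" "u \<in> standard_simplex m"
  shows "realization_simplex n x t = realization_simplex m y u \<longleftrightarrow> equivclp (glue S pull) ((n, x), t) ((m, y), u)"
proof -
  have "realization_simplex n x t = realization_simplex m y u \<longleftrightarrow> (((n, x), t), ((m, y), u)) \<in> glue_rel S pull"
    using eq_equiv_class_iff[OF equiv_glue_rel[of S pull], of "((n, x), t)" "((m, y), u)"] assms
    by (simp add: realization_simplex_def topspace_simplex_space)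
  then show ?thesis using assms by (simp add: glue_rel_def topspace_simplex_space)
qed

lemma quotient_map_realization:
  "quotient_map (simplex_space S) (geometric_realization S pull) (\<lambda>p. glue_rel S pull `` {p})"
  unfolding geometric_realization_def by (rule quotient_map_quotient_topology[OF equiv_glue_rel])

text \<open>Normal forms keep the open cells apart, and the quotient topology of a disjoint sum of
  simplices is the weak topology.\<close>

lemma cell_space_realization: "cell_space S pull (geometric_realization S pull) realization_simplex"
proof
  let ?G = "geometric_realization S pull" and ?q = "\<lambda>p. glue_rel S pull `` {p}"
  show "singular_simplex n ?G (realization_simplex n x)" if x: "x \<in> S n" for n x
  proof -
    have "continuous_map (simplex_top n) (simplex_space S) (\<lambda>t. ((n, x), t))"
      unfolding simplex_space_def
      using continuous_map_component_injection[of "(n, x)" "SIGMA n:UNIV. S n" "\<lambda>(n, x). simplex_top n"] x by simp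
    from continuous_map_compose[OF this quotient_imp_continuous_map[OF quotient_map_realization]]
    have "continuous_map (simplex_top n) ?G (realization_simplex n x)"
      by (rule continuous_map_eq) (simp add: realization_simplex_def)
    then show ?thesis by (simp add: singular_simplex_def realization_simplex_def)
  qed
  show "realization_simplex m (pull m \<theta> x) t = realization_simplex n x (simplex_push m \<theta> t)"
    if "\<theta> \<in> simplex_maps m n" "x \<in> S n" "t \<in> standard_simplex m" for \<theta> m n x t
  proof -
    have "glue S pull ((m, pull m \<theta> x), t) ((n, x), simplex_push m \<theta> t)"
      using that unfolding glue_def by blast
    then show ?thesis
      using realization_simplex_eq[OF pull_closed[OF that(1,2)] that(3) that(2) simplex_push_in[OF that(1,3)]] by blast
  qed
  show "\<exists>n. \<exists>x\<in>S n. \<exists>t\<in>standard_simplex n. realization_simplex n x t = p" if "p \<in> topspace ?G" for p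
  proof -
    have "p \<in> ?q ` topspace (simplex_space S)"
      using that quotient_imp_surjective_map[OF quotient_map_realization] by simp
    then show ?thesis unfolding topspace_simplex_space realization_simplex_def by force
  qed
  show "n = m \<and> x = y \<and> t = u" if x: "x \<in> nondeg n" "y \<in> nondeg m" and t: "interior_pt n t" "interior_pt m u"
    and eq: "realization_simplex n x t = realization_simplex m y u" for n m x y t u
  proof -
    have "equivclp (glue S pull) ((n, x), t) ((m, y), u)"
      using eq realization_simplex_eq x t by (simp add: nondegD innerD)
    then show ?thesis
      using nf_equivclp nf_self[OF x(1) t(1)] nf_self[OF x(2) t(2)] nf_unique by blast
  qed
  show "closedin ?G C" if C: "C \<subseteq> topspace ?G"
    "\<And>n x. x \<in> S n \<Longrightarrow> closedin (simplex_top n) {t \<in> standard_simplex n. realization_simplex n x t \<in> C}" for C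
  proof -
    have "closedin (simplex_space S) {p \<in> topspace (simplex_space S). ?q p \<in> C}"
      unfolding simplex_space_def closedin_sum_topology
    proof (intro conjI ballI, goal_cases)
      case (2 i)
      obtain n x where i: "i = (n, x)" "x \<in> S n" using 2 by blast
      have "{t. (i, t) \<in> {p \<in> topspace (simplex_space S). ?q p \<in> C}} = {t \<in> standard_simplex n. realization_simplex n x t \<in> C}"
        using i by (auto simp: topspace_simplex_space realization_simplex_def)
      then show ?case using C(2)[OF i(2)] i(1) unfolding simplex_space_def by simp
    qed auto
    then show ?thesis using quotient_map_realization C(1) unfolding quotient_map_closedin by blast
  qed
qed

end

section \<open>Finitely supported functions\<close>

definition comb_group :: "('k, 'x) ring_scheme \<Rightarrow> 'b set \<Rightarrow> ('b \<Rightarrow> 'k) monoid" where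
  "comb_group K X = \<lparr>carrier = fin_combs K X, monoid.mult = (\<lambda>c d s. c s \<oplus>\<^bsub>K\<^esub> d s), one = (\<lambda>s. \<zero>\<^bsub>K\<^esub>)\<rparr>"

definition single :: "('k, 'x) ring_scheme \<Rightarrow> 'b \<Rightarrow> 'k \<Rightarrow> 'b \<Rightarrow> 'k" where
  "single K a r = (\<lambda>s. if s = a then r else \<zero>\<^bsub>K\<^esub>)"

text \<open>\<open>e\<close> need only be additive in the coefficient, so the same device serves
  coefficients in a ring and in a module; \<open>K\<close> enters only through its zero.\<close>

definition comb_ext :: "('g, 'y) monoid_scheme \<Rightarrow> ('k, 'x) ring_scheme \<Rightarrow> ('b \<Rightarrow> 'k \<Rightarrow> 'g) \<Rightarrow> ('b \<Rightarrow> 'k) \<Rightarrow> 'g" where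
  "comb_ext G K e c = finprod G (\<lambda>a. e a (c a)) (supp K c)"

lemma carrier_comb_group [simp]: "carrier (comb_group K X) = fin_combs K X"
  and one_comb_group [simp]: "\<one>\<^bsub>comb_group K X\<^esub> = (\<lambda>s. \<zero>\<^bsub>K\<^esub>)"
  and mult_comb_group [simp]: "c \<otimes>\<^bsub>comb_group K X\<^esub> d = (\<lambda>s. c s \<oplus>\<^bsub>K\<^esub> d s)"
  by (simp_all add: comb_group_def)

lemma fin_combs_supp: "c \<in> fin_combs K X \<Longrightarrow> finite (supp K c) \<and> supp K c \<subseteq> X"
  by (auto simp: fin_combs_def supp_def)

lemma fin_combs_outside: "c \<in> fin_combs K X \<Longrightarrow> a \<notin> X \<Longrightarrow> c a = \<zero>\<^bsub>K\<^esub>"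
  by (simp add: fin_combs_def)

text \<open>\<open>zact K p r\<close> is the image of \<open>p \<otimes> r\<close> under the identification of \<open>\<int>[B] \<otimes> K\<close> with the finitely
  supported functions from \<open>B\<close> to \<open>K\<close>, and \<open>zext K Y w\<close> is the linear map with integer matrix \<open>w\<close>.\<close>

definition zact :: "('k, 'x) ring_scheme \<Rightarrow> ('b \<Rightarrow>\<^sub>0 int) \<Rightarrow> 'k \<Rightarrow> 'b \<Rightarrow> 'k" where
  "zact K p r = (\<lambda>s. [poly_mapping.lookup p s] \<cdot>\<^bsub>K\<^esub> r)"

definition zext :: "('k, 'x) ring_scheme \<Rightarrow> 'c set \<Rightarrow> ('b \<Rightarrow> ('c \<Rightarrow>\<^sub>0 int)) \<Rightarrow> ('b \<Rightarrow> 'k) \<Rightarrow> 'c \<Rightarrow> 'k" where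
  "zext K Y w = comb_ext (comb_group K Y) K (\<lambda>a r. zact K (w a) r)"

context abelian_group
begin

lemma fin_combs_closed: "c \<in> fin_combs G X \<Longrightarrow> c a \<in> carrier G"
  by (cases "a \<in> X") (auto simp: fin_combs_def)

lemma fin_combsI:
  "\<lbrakk>\<And>b. b \<in> X \<Longrightarrow> c b \<in> carrier G; \<And>b. b \<notin> X \<Longrightarrow> c b = \<zero>; finite T; \<And>b. b \<notin> T \<Longrightarrow> c b = \<zero>\<rbrakk> \<Longrightarrow> c \<in> fin_combs G X"
  unfolding fin_combs_def by (auto intro: finite_subset[of _ T])

lemma zero_fin_combs: "(\<lambda>s. \<zero>) \<in> fin_combs G X"
  by (rule fin_combsI[of _ _ "{}"]) auto

lemma add_fin_combs:
  assumes "c \<in> fin_combs G X" "d \<in> fin_combs G X"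
  shows "(\<lambda>s. c s \<oplus> d s) \<in> fin_combs G X"
proof (rule fin_combsI)
  show "finite (supp G c \<union> supp G d)" using assms fin_combs_supp by blast
qed (use fin_combs_closed[OF assms(1)] fin_combs_closed[OF assms(2)]
    fin_combs_outside[OF assms(1)] fin_combs_outside[OF assms(2)] in \<open>auto simp: supp_def\<close>)

lemma single_fin_combs: "a \<in> X \<Longrightarrow> r \<in> carrier G \<Longrightarrow> single G a r \<in> fin_combs G X"
  by (rule fin_combsI[of _ _ "{a}"]) (auto simp: single_def)

lemma single_add: "\<lbrakk>r \<in> carrier G; s \<in> carrier G\<rbrakk> \<Longrightarrow> single G a (r \<oplus> s) = (\<lambda>b. single G a r b \<oplus> single G a s b)"
  by (auto simp: single_def)

lemma comm_group_comb: "comm_group (comb_group G X)"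
proof (rule comm_groupI)
  fix c assume "c \<in> carrier (comb_group G X)"
  then have c: "c \<in> fin_combs G X" by simp
  have "(\<lambda>s. \<ominus> c s) \<in> fin_combs G X"
  proof (rule fin_combsI)
    show "finite (supp G c)" using c fin_combs_supp by auto
  qed (use fin_combs_closed[OF c] fin_combs_outside[OF c] in \<open>auto simp: supp_def\<close>)
  then show "\<exists>d\<in>carrier (comb_group G X). d \<otimes>\<^bsub>comb_group G X\<^esub> c = \<one>\<^bsub>comb_group G X\<^esub>"
    using fin_combs_closed[OF c] by (intro bexI[of _ "\<lambda>s. \<ominus> c s"]) (auto simp: l_neg)
next
  fix c d e assume "c \<in> carrier (comb_group G X)" "d \<in> carrier (comb_group G X)" "e \<in> carrier (comb_group G X)"
  then have "c s \<in> carrier G" "d s \<in> carrier G" "e s \<in> carrier G" for s by (auto intro: fin_combs_closed)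
  then show "c \<otimes>\<^bsub>comb_group G X\<^esub> d \<otimes>\<^bsub>comb_group G X\<^esub> e = c \<otimes>\<^bsub>comb_group G X\<^esub> (d \<otimes>\<^bsub>comb_group G X\<^esub> e)"
    "c \<otimes>\<^bsub>comb_group G X\<^esub> d = d \<otimes>\<^bsub>comb_group G X\<^esub> c"
    by (simp_all add: a_ac)
next
  fix c assume "c \<in> carrier (comb_group G X)"
  then have "c s \<in> carrier G" for s by (auto intro: fin_combs_closed)
  then show "\<one>\<^bsub>comb_group G X\<^esub> \<otimes>\<^bsub>comb_group G X\<^esub> c = c" by simp
qed (use add_fin_combs zero_fin_combs in auto)

lemma fin_combs_induct [consumes 1, case_names zero single add]:
  assumes c: "c \<in> fin_combs G X"
    and zero: "P (\<lambda>s. \<zero>)"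
    and single: "\<And>a r. a \<in> X \<Longrightarrow> r \<in> carrier G \<Longrightarrow> P (single G a r)"
    and add: "\<And>c d. c \<in> fin_combs G X \<Longrightarrow> d \<in> fin_combs G X \<Longrightarrow> P c \<Longrightarrow> P d \<Longrightarrow> P (\<lambda>s. c s \<oplus> d s)"
  shows "P c"
proof -
  have "\<forall>c\<in>fin_combs G X. supp G c \<subseteq> T \<longrightarrow> P c" if "finite T" for T
    using that
  proof (induction T rule: finite_induct)
    case empty
    show ?case
    proof (intro ballI impI)
      fix c assume "c \<in> fin_combs G X" "supp G c \<subseteq> {}"
      then have "c = (\<lambda>s. \<zero>)" by (auto simp: supp_def)
      then show "P c" using zero by simp
    qed
  next
    case (insert a T)
    show ?case
    proof (intro ballI impI)
      fix c assume c: "c \<in> fin_combs G X" and s: "supp G c \<subseteq> insert a T"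
      define d where "d = (\<lambda>s. if s = a then \<zero> else c s)"
      have d: "d \<in> fin_combs G X"
        by (rule fin_combsI[of _ _ "supp G c"])
          (use c fin_combs_closed[OF c] fin_combs_outside[OF c] fin_combs_supp[OF c] in \<open>auto simp: d_def supp_def\<close>)
      have "supp G d \<subseteq> T" using s by (auto simp: supp_def d_def)
      then have Pd: "P d" using insert.IH d by blast
      have c_eq: "c = (\<lambda>s. single G a (c a) s \<oplus> d s)"
        using fin_combs_closed[OF c] by (simp add: single_def d_def fun_eq_iff)
      show "P c"
      proof (cases "a \<in> X")
        case True
        have "P (\<lambda>s. single G a (c a) s \<oplus> d s)"
          using True c d Pd fin_combs_closed by (intro add single single_fin_combs)
        then show ?thesis using c_eq by simp
      next
        case False
        then have "c = d" using fin_combs_outside[OF c] by (auto simp: d_def)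
        then show ?thesis using Pd by simp
      qed
    qed
  qed
  then show ?thesis using c fin_combs_supp[OF c] by blast
qed

text \<open>The main device for identities below: only additivity is involved, so maps over
  \<open>K\<close>, over a monoid algebra and into tensor groups are all compared on one-point
  combinations.\<close>

lemma comb_hom_eq:
  assumes H: "group H" and f: "f \<in> hom (comb_group G X) H" and g: "g \<in> hom (comb_group G X) H"
    and eq: "\<And>a r. a \<in> X \<Longrightarrow> r \<in> carrier G \<Longrightarrow> f (single G a r) = g (single G a r)" and c: "c \<in> fin_combs G X"
  shows "f c = g c"
proof -
  interpret C: comm_group "comb_group G X" by (rule comm_group_comb)
  interpret H: group H by fact
  interpret f: group_hom "comb_group G X" H f using f by unfold_locales
  interpret g: group_hom "comb_group G X" H g using g by unfold_locales
  show ?thesis using c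
  proof (induction rule: fin_combs_induct)
    case zero show ?case using f.hom_one g.hom_one by simp
  next
    case (add c d) then show ?case using f.hom_mult[of c d] g.hom_mult[of c d] by simp
  qed (rule eq)
qed

context
  fixes H :: "('hh, 'hy) monoid_scheme" and e :: "'xx \<Rightarrow> 'a \<Rightarrow> 'hh" and X :: "'xx set"
  assumes H: "comm_group H"
    and e: "\<And>a r. a \<in> X \<Longrightarrow> r \<in> carrier G \<Longrightarrow> e a r \<in> carrier H"
      "\<And>a r s. a \<in> X \<Longrightarrow> r \<in> carrier G \<Longrightarrow> s \<in> carrier G \<Longrightarrow> e a (r \<oplus> s) = e a r \<otimes>\<^bsub>H\<^esub> e a s"
begin

interpretation H: comm_group H by (rule H)

lemma comb_ext_zero: "a \<in> X \<Longrightarrow> e a \<zero> = \<one>\<^bsub>H\<^esub>"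
  using e(2)[of a \<zero> \<zero>] e(1)[of a \<zero>] by simp

lemma comb_ext_superset:
  assumes c: "c \<in> fin_combs G X" and T: "finite T" "supp G c \<subseteq> T" "T \<subseteq> X"
  shows "comb_ext H G e c = finprod H (\<lambda>a. e a (c a)) T"
  unfolding comb_ext_def
  by (rule H.finprod_mono_neutral_cong_left[OF T(1,2)])
    (use T(3) comb_ext_zero fin_combs_closed[OF c] in \<open>auto simp: supp_def intro!: e(1)\<close>)

lemma comb_ext_hom: "comb_ext H G e \<in> hom (comb_group G X) H"
proof (rule homI)
  fix c assume "c \<in> carrier (comb_group G X)"
  then have c: "c \<in> fin_combs G X" by simp
  show "comb_ext H G e c \<in> carrier H"
    unfolding comb_ext_def using fin_combs_supp[OF c] fin_combs_closed[OF c]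
    by (intro H.finprod_closed) (auto intro!: e(1))
next
  fix c d assume "c \<in> carrier (comb_group G X)" "d \<in> carrier (comb_group G X)"
  then have c: "c \<in> fin_combs G X" and d: "d \<in> fin_combs G X" by simp_all
  define T where "T = supp G c \<union> supp G d"
  have T: "finite T" "T \<subseteq> X" "supp G c \<subseteq> T" "supp G d \<subseteq> T" "supp G (\<lambda>s. c s \<oplus> d s) \<subseteq> T"
    using fin_combs_supp[OF c] fin_combs_supp[OF d] by (auto simp: T_def supp_def)
  have cl: "(\<lambda>a. e a (c a)) \<in> T \<rightarrow> carrier H" "(\<lambda>a. e a (d a)) \<in> T \<rightarrow> carrier H"
    using T(2) fin_combs_closed[OF c] fin_combs_closed[OF d] by (auto intro!: e(1))
  have "comb_ext H G e (\<lambda>s. c s \<oplus> d s) = finprod H (\<lambda>a. e a (c a \<oplus> d a)) T"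
    by (rule comb_ext_superset[OF add_fin_combs[OF c d] T(1,5,2)])
  also have "\<dots> = finprod H (\<lambda>a. e a (c a) \<otimes>\<^bsub>H\<^esub> e a (d a)) T"
    using T(2) fin_combs_closed[OF c] fin_combs_closed[OF d]
    by (intro H.finprod_cong') (auto intro!: e)
  also have "\<dots> = comb_ext H G e c \<otimes>\<^bsub>H\<^esub> comb_ext H G e d"
    using comb_ext_superset[OF c T(1,3,2)] comb_ext_superset[OF d T(1,4,2)] H.finprod_multf[OF cl] by simp
  finally show "comb_ext H G e (c \<otimes>\<^bsub>comb_group G X\<^esub> d) = comb_ext H G e c \<otimes>\<^bsub>H\<^esub> comb_ext H G e d" by simp
qed

lemma comb_ext_single:
  assumes "a \<in> X" "r \<in> carrier G"
  shows "comb_ext H G e (single G a r) = e a r"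
proof -
  have "comb_ext H G e (single G a r) = finprod H (\<lambda>b. e b (single G a r b)) {a}"
    using assms by (intro comb_ext_superset single_fin_combs) (auto simp: supp_def single_def)
  also have "\<dots> = e a r" using assms e(1) by (simp add: single_def)
  finally show ?thesis .
qed

end

lemma finprod_comb_group:
  assumes "finite A" "f \<in> A \<rightarrow> fin_combs G X"
  shows "finprod (comb_group G X) f A = (\<lambda>s. \<Oplus>a\<in>A. f a s)"
  using assms
proof (induction A rule: finite_induct)
  case empty
  interpret C: comm_group "comb_group G X" by (rule comm_group_comb)
  show ?case by simp
next
  case (insert a A)
  interpret C: comm_group "comb_group G X" by (rule comm_group_comb)
  have "f b s \<in> carrier G" if "b \<in> insert a A" for b s
    using insert.prems that by (intro fin_combs_closed[of "f b" X]) auto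
  then show ?case using insert by (simp add: Pi_iff)
qed

lemma zact_fin_combs:
  assumes "keys p \<subseteq> Y" "r \<in> carrier G"
  shows "zact G p r \<in> fin_combs G Y"
proof (rule fin_combsI)
  show "finite (keys p)" by simp
  show "zact G p r b = \<zero>" if "b \<notin> keys p" for b
    using that by (simp add: zact_def in_keys_iff add_pow_def)
  then show "zact G p r b = \<zero>" if "b \<notin> Y" for b using that assms(1) by blast
qed (use assms(2) in \<open>simp add: zact_def\<close>)

lemma zact_add: "\<lbrakk>r \<in> carrier G; s \<in> carrier G\<rbrakk> \<Longrightarrow> zact G p (r \<oplus> s) = (\<lambda>b. zact G p r b \<oplus> zact G p s b)"
  by (simp add: zact_def add.int_pow_distrib)

lemma zact_diff:
  assumes "r \<in> carrier G"
  shows "zact G (p - q) r = (\<lambda>b. zact G p r b \<ominus> zact G q r b)"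
proof
  fix b
  have "add_pow G (i - j) r = add_pow G i r \<ominus> add_pow G j r" for i j :: int
    using assms add.int_pow_diff[of r i j] by (simp add: a_minus_def add_pow_def a_inv_def)
  then show "zact G (p - q) r b = zact G p r b \<ominus> zact G q r b" by (simp add: zact_def lookup_minus)
qed

lemma zact_0: "zact G 0 r = (\<lambda>b. \<zero>)"
  by (simp add: zact_def add_pow_def)

lemma zact_plus:
  assumes "r \<in> carrier G"
  shows "zact G (p + q) r = (\<lambda>b. zact G p r b \<oplus> zact G q r b)"
  using assms by (simp add: zact_def lookup_add add.int_pow_mult)

lemma zact_frag_of: "r \<in> carrier G \<Longrightarrow> zact G (frag_of a) r = single G a r"
  by (auto simp: zact_def single_def fun_eq_iff add_pow_int_ge)

lemma zact_cmul_frag_of: "r \<in> carrier G \<Longrightarrow> zact G (frag_cmul k (frag_of a)) r = single G a ([k] \<cdot> r)"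
  by (auto simp: zact_def single_def fun_eq_iff add_pow_int_ge)

lemma zext_hom:
  "(\<And>a. a \<in> X \<Longrightarrow> keys (w a) \<subseteq> Y) \<Longrightarrow> zext G Y w \<in> hom (comb_group G X) (comb_group G Y)"
  unfolding zext_def by (rule comb_ext_hom[OF comm_group_comb]) (auto simp: zact_fin_combs zact_add)

lemma zext_single:
  "\<lbrakk>\<And>a. a \<in> X \<Longrightarrow> keys (w a) \<subseteq> Y; a \<in> X; r \<in> carrier G\<rbrakk> \<Longrightarrow> zext G Y w (single G a r) = zact G (w a) r"
  unfolding zext_def by (rule comb_ext_single[OF comm_group_comb, of X]) (auto simp: zact_fin_combs zact_add)

lemma zext_zact:
  assumes w: "\<And>a. a \<in> X \<Longrightarrow> keys (w a) \<subseteq> Y" and p: "keys p \<subseteq> X" and r: "r \<in> carrier G"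
  shows "zext G Y w (zact G p r) = zact G (frag_extend w p) r"
proof -
  interpret C: comm_group "comb_group G X" by (rule comm_group_comb)
  interpret D: comm_group "comb_group G Y" by (rule comm_group_comb)
  interpret f: group_hom "comb_group G X" "comb_group G Y" "zext G Y w"
    using zext_hom[OF w] by unfold_locales
  have "keys p \<subseteq> X \<and> zext G Y w (zact G p r) = zact G (frag_extend w p) r"
    using p
  proof (induction rule: frag_induction)
    case zero
    then show ?case using f.hom_one by (simp add: zact_0)
  next
    case (one a)
    then show ?case using zext_single[OF w _ r] r by (simp add: zact_frag_of)
  next
    case (diff a b)
    have keys: "keys (a - b) \<subseteq> X" using diff keys_diff[of a b] by blast
    \<comment> \<open>Only additivity of \<open>zext\<close> is available, so the value on
      \<open>a - b\<close> is solved for from the values on \<open>a\<close> and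
      \<open>b\<close>.\<close>
    have "zext G Y w (zact G a r) = zext G Y w (\<lambda>s. zact G (a - b) r s \<oplus> zact G b r s)"
      using zact_plus[OF r, of "a - b" b] by simp
    also have "\<dots> = (\<lambda>s. zext G Y w (zact G (a - b) r) s \<oplus> zext G Y w (zact G b r) s)"
      using f.hom_mult[of "zact G (a - b) r" "zact G b r"] zact_fin_combs[OF keys r] zact_fin_combs[of b X r] diff r by simp
    finally have 1: "zact G (frag_extend w a) r = (\<lambda>s. zext G Y w (zact G (a - b) r) s \<oplus> zact G (frag_extend w b) r s)"
      using diff by simp
    have "zext G Y w (zact G (a - b) r) = zact G (frag_extend w (a - b)) r"
    proof
      fix s
      have c: "zext G Y w (zact G (a - b) r) s \<in> carrier G" "zact G (frag_extend w b) r s \<in> carrier G"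
        using f.hom_closed[of "zact G (a - b) r"] zact_fin_combs[OF keys r] fin_combs_closed r by (auto simp: zact_def)
      show "zext G Y w (zact G (a - b) r) s = zact G (frag_extend w (a - b)) r s"
        unfolding frag_extend_diff zact_diff[OF r, of "frag_extend w a"] 1 using c
        by (simp only: a_minus_def a_assoc r_neg a_inv_closed r_zero)
    qed
    then show ?case using keys by simp
  qed
  then show ?thesis ..
qed

text \<open>Composition of integer matrices. Through it, identities between integral chain maps and
  homotopies carry over to coefficients in \<open>K\<close>.\<close>

lemma zext_compose:
  assumes v: "\<And>a. a \<in> X \<Longrightarrow> keys (v a) \<subseteq> Y" and w: "\<And>a. a \<in> Y \<Longrightarrow> keys (w a) \<subseteq> Z"
    and c: "c \<in> fin_combs G X"
  shows "zext G Z w (zext G Y v c) = zext G Z (\<lambda>a. frag_extend w (v a)) c"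
proof -
  have k: "\<And>a. a \<in> X \<Longrightarrow> keys (frag_extend w (v a)) \<subseteq> Z"
    using v w by (intro keys_frag_extend_subset) blast
  interpret Z: comm_group "comb_group G Z" by (rule comm_group_comb)
  have "(zext G Z w \<circ> zext G Y v) c = zext G Z (\<lambda>a. frag_extend w (v a)) c"
  proof (rule comb_hom_eq[OF Z.is_group _ zext_hom[OF k] _ c])
    show "zext G Z w \<circ> zext G Y v \<in> hom (comb_group G X) (comb_group G Z)"
      by (rule hom_compose[OF zext_hom[OF v] zext_hom[OF w]])
    fix a r assume a: "a \<in> X" and r: "r \<in> carrier G"
    show "(zext G Z w \<circ> zext G Y v) (single G a r) = zext G Z (\<lambda>a. frag_extend w (v a)) (single G a r)"
      using zext_single[OF v a r] zext_single[OF k a r] zext_zact[OF w v[OF a] r] by simp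
  qed
  then show ?thesis by simp
qed

lemma zext_cong:
  assumes eq: "\<And>a. a \<in> X \<Longrightarrow> v a = w a" and w: "\<And>a. a \<in> X \<Longrightarrow> keys (w a) \<subseteq> Y"
    and c: "c \<in> fin_combs G X"
  shows "zext G Y v c = zext G Y w c"
proof -
  interpret Y: comm_group "comb_group G Y" by (rule comm_group_comb)
  show ?thesis unfolding zext_def comb_ext_def
    using fin_combs_supp[OF c] eq w fin_combs_closed[OF c]
    by (intro Y.finprod_cong') (auto intro!: zact_fin_combs)
qed

lemma zext_add:
  assumes v: "\<And>a. a \<in> X \<Longrightarrow> keys (v a) \<subseteq> Y" and w: "\<And>a. a \<in> X \<Longrightarrow> keys (w a) \<subseteq> Y"
    and c: "c \<in> fin_combs G X"
  shows "zext G Y (\<lambda>a. v a + w a) c = (\<lambda>s. zext G Y v c s \<oplus> zext G Y w c s)"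
proof -
  interpret Y: comm_group "comb_group G Y" by (rule comm_group_comb)
  have k: "\<And>a. a \<in> X \<Longrightarrow> keys (v a + w a) \<subseteq> Y"
    using v w by (meson keys_add order_trans Un_least)
  have "zext G Y (\<lambda>a. v a + w a) c = (\<lambda>c. zext G Y v c \<otimes>\<^bsub>comb_group G Y\<^esub> zext G Y w c) c"
  proof (rule comb_hom_eq[OF Y.is_group zext_hom[OF k] _ _ c])
    show "(\<lambda>c. zext G Y v c \<otimes>\<^bsub>comb_group G Y\<^esub> zext G Y w c) \<in> hom (comb_group G X) (comb_group G Y)"
    proof (rule homI)
      fix c d assume cd: "c \<in> carrier (comb_group G X)" "d \<in> carrier (comb_group G X)"
      have "f (c \<otimes>\<^bsub>comb_group G X\<^esub> d) = f c \<otimes>\<^bsub>comb_group G Y\<^esub> f d" "f c \<in> carrier (comb_group G Y)" "f d \<in> carrier (comb_group G Y)"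
        if "f \<in> hom (comb_group G X) (comb_group G Y)" for f using hom_mult[OF that cd] hom_in_carrier[OF that] cd by auto
      from this[OF zext_hom[OF v]] this[OF zext_hom[OF w]]
      show "zext G Y v (c \<otimes>\<^bsub>comb_group G X\<^esub> d) \<otimes>\<^bsub>comb_group G Y\<^esub> zext G Y w (c \<otimes>\<^bsub>comb_group G X\<^esub> d) =
        zext G Y v c \<otimes>\<^bsub>comb_group G Y\<^esub> zext G Y w c \<otimes>\<^bsub>comb_group G Y\<^esub> (zext G Y v d \<otimes>\<^bsub>comb_group G Y\<^esub> zext G Y w d)"
        by (simp only: Y.m_ac Y.m_closed)
    next
      fix c assume c: "c \<in> carrier (comb_group G X)"
      show "zext G Y v c \<otimes>\<^bsub>comb_group G Y\<^esub> zext G Y w c \<in> carrier (comb_group G Y)"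
        using hom_in_carrier[OF zext_hom[OF v] c] hom_in_carrier[OF zext_hom[OF w] c] by (rule Y.m_closed)
    qed
    fix a r assume a: "a \<in> X" and r: "r \<in> carrier G"
    show "zext G Y (\<lambda>a. v a + w a) (single G a r) = zext G Y v (single G a r) \<otimes>\<^bsub>comb_group G Y\<^esub> zext G Y w (single G a r)"
      using zext_single[OF v a r] zext_single[OF w a r] zext_single[OF k a r] zact_plus[OF r] by simp
  qed
  then show ?thesis by simp
qed

lemma zext_id: "c \<in> fin_combs G X \<Longrightarrow> zext G X frag_of c = c"
proof -
  assume c: "c \<in> fin_combs G X"
  interpret X: comm_group "comb_group G X" by (rule comm_group_comb)
  have "zext G X frag_of c = (\<lambda>c. c) c"
  proof (rule comb_hom_eq[OF X.is_group zext_hom _ _ c])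
    show "(\<lambda>c. c) \<in> hom (comb_group G X) (comb_group G X)" by (simp add: hom_def)
    show "zext G X frag_of (single G a r) = single G a r" if "a \<in> X" "r \<in> carrier G" for a r
      using zext_single[of X frag_of X a r] that by (simp add: zact_frag_of)
  qed simp
  then show ?thesis by simp
qed

lemma zext_zero: "c \<in> fin_combs G X \<Longrightarrow> zext G Y (\<lambda>_. 0) c = (\<lambda>s. \<zero>)"
proof -
  assume c: "c \<in> fin_combs G X"
  interpret Y: comm_group "comb_group G Y" by (rule comm_group_comb)
  have "zext G Y (\<lambda>_. 0) c = (\<lambda>c s. \<zero>) c"
  proof (rule comb_hom_eq[OF Y.is_group zext_hom _ _ c])
    show "(\<lambda>c s. \<zero>) \<in> hom (comb_group G X) (comb_group G Y)" by (simp add: hom_def zero_fin_combs)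
    show "zext G Y (\<lambda>_. 0) (single G a r) = (\<lambda>s. \<zero>)" if "a \<in> X" "r \<in> carrier G" for a r
      using zext_single[of X "\<lambda>_. 0" Y a r] that by (simp add: zact_0)
  qed simp
  then show ?thesis by simp
qed

end

section \<open>Complexes of abelian groups\<close>

lemma trivial_complex_homology_iff:
  assumes C: "comm_group (C (Suc n))" "comm_group (C n)" "comm_group (C (Suc (Suc n)))"
    and d: "d (Suc n) \<in> hom (C (Suc n)) (C n)" "d (Suc (Suc n)) \<in> hom (C (Suc (Suc n))) (C (Suc n))"
    and dd: "\<And>x. x \<in> carrier (C (Suc (Suc n))) \<Longrightarrow> d (Suc n) (d (Suc (Suc n)) x) = \<one>\<^bsub>C n\<^esub>"
  shows "trivial_group (complex_homology C d (Suc n)) \<longleftrightarrow>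
    (\<forall>x\<in>carrier (C (Suc n)). d (Suc n) x = \<one>\<^bsub>C n\<^esub> \<longrightarrow> x \<in> d (Suc (Suc n)) ` carrier (C (Suc (Suc n))))"
proof -
  interpret G: comm_group "C (Suc n)" by fact
  interpret H: comm_group "C n" by fact
  interpret P: comm_group "C (Suc (Suc n))" by fact
  interpret dG: group_hom "C (Suc n)" "C n" "d (Suc n)" using d by unfold_locales
  interpret dP: group_hom "C (Suc (Suc n))" "C (Suc n)" "d (Suc (Suc n))" using d by unfold_locales
  define Z where "Z = complex_cycles C d (Suc n)"
  define B where "B = d (Suc (Suc n)) ` carrier (C (Suc (Suc n)))"
  define GZ where "GZ = subgroup_generated (C (Suc n)) Z"
  have Z_eq: "Z = {x \<in> carrier (C (Suc n)). d (Suc n) x = \<one>\<^bsub>C n\<^esub>}" by (simp add: Z_def complex_cycles_def)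
  have Z: "subgroup Z (C (Suc n))"
    using dG.subgroup_kernel unfolding kernel_def Z_eq by simp
  have cZ: "carrier GZ = Z" unfolding GZ_def by (rule subgroup.carrier_subgroup_generated_subgroup[OF Z])
  interpret GZ: comm_group GZ
    unfolding GZ_def by (rule G.abelian_subgroup_generated[OF C(1)])
  have BZ: "B \<subseteq> Z" unfolding B_def Z_eq using dd dP.hom_closed by auto
  have "subgroup B (C (Suc n))" unfolding B_def by (rule dP.img_is_subgroup)
  then have B: "subgroup B GZ"
    using BZ cZ unfolding GZ_def by (simp add: G.subgroup_subgroup_generated_iff)
  then have nB: "B \<lhd> GZ" by (simp add: GZ.normal_iff_subgroup)
  have H_eq: "complex_homology C d (Suc n) = GZ Mod B"
    by (simp add: complex_homology_def GZ_def Z_def B_def)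
  have grp: "group (GZ Mod B)" by (rule normal.factorgroup_is_group[OF nB])
  have car: "carrier (GZ Mod B) = (\<lambda>x. B #>\<^bsub>GZ\<^esub> x) ` Z"
    by (auto simp: FactGroup_def RCOSETS_def cZ)
  have one: "\<one>\<^bsub>GZ Mod B\<^esub> = B" by (simp add: FactGroup_def)
  have "trivial_group (GZ Mod B) \<longleftrightarrow> Z \<subseteq> B"
  proof
    assume "trivial_group (GZ Mod B)"
    then have *: "(\<lambda>x. B #>\<^bsub>GZ\<^esub> x) ` Z = {B}" by (simp add: trivial_group_def car one)
    show "Z \<subseteq> B"
    proof
      fix x assume x: "x \<in> Z"
      then have "x \<in> B #>\<^bsub>GZ\<^esub> x" using GZ.rcos_self[OF _ B] cZ by simp
      then show "x \<in> B" using * x by blast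
    qed
  next
    assume ZB: "Z \<subseteq> B"
    have "B #>\<^bsub>GZ\<^esub> x = B" if "x \<in> Z" for x
      using GZ.coset_join2[OF _ B] that ZB cZ by auto
    moreover have "Z \<noteq> {}" using subgroup.one_closed[OF Z] by blast
    ultimately have "(\<lambda>x. B #>\<^bsub>GZ\<^esub> x) ` Z = {B}" by auto
    then show "trivial_group (GZ Mod B)" by (simp add: trivial_group_def car one grp)
  qed
  then show ?thesis unfolding H_eq Z_eq B_def by blast
qed

section \<open>Singular homology of a cell space\<close>

lemma frag_extend_unique:
  assumes "F 0 = 0" "\<And>a b. F (a - b) = F a - F b"
  shows "F c = frag_extend (\<lambda>x. F (frag_of x)) c"
proof -
  have "keys c \<subseteq> UNIV" by simp
  then show ?thesis
    by (induction rule: frag_induction) (auto simp: assms frag_extend_diff)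
qed

definition (in simplicial_set) face_sum :: "nat \<Rightarrow> 'x \<Rightarrow> ('x \<Rightarrow>\<^sub>0 int)" where
  "face_sum q x = (\<Sum>k\<le>q. frag_cmul ((-1) ^ k) (frag_of (pull (q - 1) (face_map k) x)))"

lemma (in simplicial_set) keys_face_sum: "x \<in> S (Suc q) \<Longrightarrow> keys (face_sum (Suc q) x) \<subseteq> S q"
proof -
  assume x: "x \<in> S (Suc q)"
  have "keys (face_sum (Suc q) x) \<subseteq>
    (\<Union>k\<in>{..Suc q}. keys (frag_cmul ((-1) ^ k) (frag_of (pull q (face_map k) x))))"
    unfolding face_sum_def diff_Suc_1 by (rule keys_sum)
  also have "\<dots> \<subseteq> S q" using pull_closed[OF face_map_in x] by auto
  finally show ?thesis .
qed

context cell_space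
begin

abbreviation "sing q \<equiv> singular_simplex_set q X"

lemma chi_sing: "chi q ` S q \<subseteq> sing q"
  using chi_simplex by auto

lemma inj_chi: "inj_on (chi q) (S q)"
  by (rule inj_onI) (metis chi_inj)

text \<open>\<open>h q \<sigma>\<close> fills the chain that is left of \<open>\<sigma>\<close>
  after subtracting \<open>h\<close> of its boundary: that chain has cellular boundary, so
  \<open>singular_resolution\<close> fills it up to cells. Putting \<open>h = 0\<close> on cells
  makes the resulting retraction the identity there.\<close>

lemma exists_deformation:
  "\<exists>h. \<forall>q. (\<forall>\<sigma>\<in>sing q. singular_chain (Suc q) X (h q \<sigma>)) \<and> (\<forall>\<sigma>\<in>chi q ` S q. h q \<sigma> = 0) \<and>
    (\<forall>\<sigma>\<in>sing q. keys (frag_of \<sigma> - chain_boundary (Suc q) (h q \<sigma>) -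
      frag_extend (h (q - 1)) (chain_boundary q (frag_of \<sigma>))) \<subseteq> chi q ` S q)"
proof -
  let ?L = "\<lambda>q. chi q ` S q"
  \<comment> \<open>The clause about cycles drives the recursion: it is applied to the boundary of a
    singular simplex of the next degree.\<close>
  define P where "P q f \<longleftrightarrow> (\<forall>\<sigma>\<in>sing q. singular_chain (Suc q) X (f \<sigma>)) \<and> (\<forall>\<sigma>\<in>?L q. f \<sigma> = 0) \<and>
    (\<forall>z. singular_chain q X z \<longrightarrow> chain_boundary q z = 0 \<longrightarrow>
      keys (z - chain_boundary (Suc q) (frag_extend f z)) \<subseteq> ?L q)" for q f
  define Q where "Q q f g \<longleftrightarrow> (\<forall>\<sigma>\<in>sing (Suc q). keys (frag_of \<sigma> - chain_boundary (Suc (Suc q)) (g \<sigma>) -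
      frag_extend f (chain_boundary (Suc q) (frag_of \<sigma>))) \<subseteq> ?L (Suc q))" for q f g
  have P0: "P 0 f \<and> (\<forall>\<sigma>\<in>sing 0. keys (frag_of \<sigma> - chain_boundary (Suc 0) (f \<sigma>)) \<subseteq> ?L 0)"
    if f: "\<And>\<sigma>. \<sigma> \<in> sing 0 \<Longrightarrow> singular_chain (Suc 0) X (f \<sigma>)" "\<And>\<sigma>. \<sigma> \<in> ?L 0 \<Longrightarrow> f \<sigma> = 0"
      "\<And>\<sigma>. \<sigma> \<in> sing 0 \<Longrightarrow> keys (frag_of \<sigma> - chain_boundary (Suc 0) (f \<sigma>)) \<subseteq> ?L 0" for f
  proof -
    have "keys (z - chain_boundary (Suc 0) (frag_extend f z)) \<subseteq> ?L 0" if "singular_chain 0 X z" for z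
    proof -
      have "z - chain_boundary (Suc 0) (frag_extend f z) = frag_extend (\<lambda>\<sigma>. frag_of \<sigma> - chain_boundary (Suc 0) (f \<sigma>)) z"
        using frag_extend_unique[of "\<lambda>z. z - chain_boundary (Suc 0) (frag_extend f z)" z]
        by (simp add: frag_extend_diff chain_boundary_diff)
      also have "keys \<dots> \<subseteq> ?L 0"
        using that f(3) by (intro keys_frag_extend_subset) (auto simp: singular_chain_def)
      finally show ?thesis .
    qed
    then show ?thesis using f by (simp add: P_def)
  qed
  have fill: "\<exists>d. singular_chain (Suc q) X d \<and> keys (c - chain_boundary (Suc q) d) \<subseteq> ?L q"
    if c: "singular_chain q X c" "keys (chain_boundary q c) \<subseteq> ?L (q - 1)" for q c
  proof -
    obtain l d where "keys l \<subseteq> ?L q" "singular_chain (Suc q) X d" "c = l + chain_boundary (Suc q) d"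
      using singular_resolution[OF c] by blast
    then show ?thesis by (intro exI[of _ d]) simp
  qed
  have "\<forall>\<sigma>. \<exists>d. \<sigma> \<in> sing 0 \<longrightarrow> singular_chain (Suc 0) X d \<and> (\<sigma> \<in> ?L 0 \<longrightarrow> d = 0) \<and>
      keys (frag_of \<sigma> - chain_boundary (Suc 0) d) \<subseteq> ?L 0"
  proof
    fix \<sigma>
    show "\<exists>d. \<sigma> \<in> sing 0 \<longrightarrow> singular_chain (Suc 0) X d \<and> (\<sigma> \<in> ?L 0 \<longrightarrow> d = 0) \<and>
      keys (frag_of \<sigma> - chain_boundary (Suc 0) d) \<subseteq> ?L 0"
    proof (cases "\<sigma> \<in> ?L 0")
      case True then show ?thesis by (intro exI[of _ 0]) simp
    next
      case False
      then show ?thesis using fill[of 0 "frag_of \<sigma>"]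
        by (auto simp: singular_chain_of chain_boundary_def)
    qed
  qed
  from choice[OF this] obtain f0 where f0: "\<And>\<sigma>. \<sigma> \<in> sing 0 \<Longrightarrow> singular_chain (Suc 0) X (f0 \<sigma>) \<and> (\<sigma> \<in> ?L 0 \<longrightarrow> f0 \<sigma> = 0) \<and>
      keys (frag_of \<sigma> - chain_boundary (Suc 0) (f0 \<sigma>)) \<subseteq> ?L 0" by blast
  have f0': "P 0 f0 \<and> (\<forall>\<sigma>\<in>sing 0. keys (frag_of \<sigma> - chain_boundary (Suc 0) (f0 \<sigma>)) \<subseteq> ?L 0)"
    using f0 chi_sing by (intro P0) blast+
  \<comment> \<open>Dependent choice forgets its first value, so \<open>f0\<close> is recorded; its
    property in degree 0 is used after the recursion.\<close>
  define P' where "P' q f \<longleftrightarrow> P q f \<and> (q = 0 \<longrightarrow> f = f0)" for q f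
  have "\<exists>h. \<forall>q. P' q (h q) \<and> Q q (h q) (h (Suc q))"
  proof (rule dependent_nat_choice)
    show "\<exists>f. P' 0 f" using f0' by (auto simp: P'_def)
  next
    fix f q assume "P' q f"
    then have f: "\<And>\<sigma>. \<sigma> \<in> sing q \<Longrightarrow> singular_chain (Suc q) X (f \<sigma>)" "\<And>\<sigma>. \<sigma> \<in> ?L q \<Longrightarrow> f \<sigma> = 0"
      "\<And>z. singular_chain q X z \<Longrightarrow> chain_boundary q z = 0 \<Longrightarrow>
        keys (z - chain_boundary (Suc q) (frag_extend f z)) \<subseteq> ?L q"
      by (auto simp: P'_def P_def)
    have "\<forall>\<sigma>. \<exists>d. \<sigma> \<in> sing (Suc q) \<longrightarrow> singular_chain (Suc (Suc q)) X d \<and> (\<sigma> \<in> ?L (Suc q) \<longrightarrow> d = 0) \<and>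
      keys (frag_of \<sigma> - chain_boundary (Suc (Suc q)) d - frag_extend f (chain_boundary (Suc q) (frag_of \<sigma>))) \<subseteq> ?L (Suc q)"
    proof
      fix \<sigma> :: "(nat \<Rightarrow> real) \<Rightarrow> 'p"
      let ?b = "chain_boundary (Suc q) (frag_of \<sigma>)"
      show "\<exists>d. \<sigma> \<in> sing (Suc q) \<longrightarrow> singular_chain (Suc (Suc q)) X d \<and> (\<sigma> \<in> ?L (Suc q) \<longrightarrow> d = 0) \<and>
        keys (frag_of \<sigma> - chain_boundary (Suc (Suc q)) d - frag_extend f ?b) \<subseteq> ?L (Suc q)"
      proof (cases "\<sigma> \<in> ?L (Suc q)")
        \<comment> \<open>For a cell nothing has to be filled: its boundary consists of cells, where
          \<open>f\<close> vanishes.\<close>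
        case True
        then have "keys ?b \<subseteq> ?L q"
          using keys_boundary_chi[OF subcomplex_S, of "frag_of \<sigma>" "Suc q"] by simp
        then have "frag_extend f ?b = 0" using f(2) by (intro frag_extend_eq_0) blast
        then show ?thesis using True by (intro exI[of _ 0]) simp
      next
        case False
        show ?thesis
        proof (cases "\<sigma> \<in> sing (Suc q)")
          case True
          then have \<sigma>: "singular_chain (Suc q) X (frag_of \<sigma>)" by (simp add: singular_chain_of)
          have b: "singular_chain q X ?b" "chain_boundary q ?b = 0"
            using singular_chain_boundary_alt[OF \<sigma>] chain_boundary_boundary_alt[OF \<sigma>] by auto
          have "singular_chain (Suc q) X (frag_extend f ?b)"
            using b(1) f(1) by (intro singular_chain_extend) (auto simp: singular_chain_def)
          then have "singular_chain (Suc q) X (frag_of \<sigma> - frag_extend f ?b)" using \<sigma> by (rule singular_chain_diff[rotated])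
          moreover have "keys (chain_boundary (Suc q) (frag_of \<sigma> - frag_extend f ?b)) \<subseteq> ?L (Suc q - 1)"
            unfolding chain_boundary_diff using f(3)[OF b] by simp
          ultimately obtain d where "singular_chain (Suc (Suc q)) X d"
            "keys (frag_of \<sigma> - frag_extend f ?b - chain_boundary (Suc (Suc q)) d) \<subseteq> ?L (Suc q)"
            using fill by blast
          then show ?thesis using False by (intro exI[of _ d]) (simp add: algebra_simps)
        qed simp
      qed
    qed
    from choice[OF this] obtain g where g: "\<And>\<sigma>. \<sigma> \<in> sing (Suc q) \<Longrightarrow> singular_chain (Suc (Suc q)) X (g \<sigma>)"
      "\<And>\<sigma>. \<sigma> \<in> sing (Suc q) \<Longrightarrow> \<sigma> \<in> ?L (Suc q) \<Longrightarrow> g \<sigma> = 0"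
      "\<And>\<sigma>. \<sigma> \<in> sing (Suc q) \<Longrightarrow> keys (frag_of \<sigma> - chain_boundary (Suc (Suc q)) (g \<sigma>) - frag_extend f (chain_boundary (Suc q) (frag_of \<sigma>))) \<subseteq> ?L (Suc q)"
      by blast
    have "keys (z - chain_boundary (Suc (Suc q)) (frag_extend g z)) \<subseteq> ?L (Suc q)"
      if z: "singular_chain (Suc q) X z" "chain_boundary (Suc q) z = 0" for z
    proof -
      have "z - chain_boundary (Suc (Suc q)) (frag_extend g z) =
          z - chain_boundary (Suc (Suc q)) (frag_extend g z) - frag_extend f (chain_boundary (Suc q) z)"
        using z(2) by simp
      also have "\<dots> = frag_extend (\<lambda>\<sigma>. frag_of \<sigma> - chain_boundary (Suc (Suc q)) (g \<sigma>) - frag_extend f (chain_boundary (Suc q) (frag_of \<sigma>))) z"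
        using frag_extend_unique[of "\<lambda>z. z - chain_boundary (Suc (Suc q)) (frag_extend g z) - frag_extend f (chain_boundary (Suc q) z)" z]
        by (simp add: frag_extend_diff chain_boundary_diff)
      also have "keys \<dots> \<subseteq> ?L (Suc q)"
        using z(1) g(3) by (intro keys_frag_extend_subset) (auto simp: singular_chain_def)
      finally show ?thesis .
    qed
    then have "P (Suc q) g" using g(1,2) chi_sing[of "Suc q"] unfolding P_def by blast
    then show "\<exists>g. P' (Suc q) g \<and> Q q f g" using g(3) unfolding P'_def Q_def by blast
  qed
  then obtain h where h: "\<And>q. P' q (h q)" "\<And>q. Q q (h q) (h (Suc q))" by blast
  have "keys (frag_of \<sigma> - chain_boundary (Suc q) (h q \<sigma>) -
      frag_extend (h (q - 1)) (chain_boundary q (frag_of \<sigma>))) \<subseteq> ?L q" if "\<sigma> \<in> sing q" for q \<sigma>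
  proof (cases q)
    case 0
    then show ?thesis using that f0' h(1)[of 0] by (simp add: P'_def chain_boundary_def[of 0])
  next
    case (Suc p)
    then show ?thesis using that h(2)[of p] by (simp add: Q_def)
  qed
  moreover have "(\<forall>\<sigma>\<in>sing q. singular_chain (Suc q) X (h q \<sigma>)) \<and> (\<forall>\<sigma>\<in>?L q. h q \<sigma> = 0)" for q
    using h(1)[of q] unfolding P'_def P_def by (elim conjE) (intro conjI)
  ultimately show ?thesis by (intro exI[of _ h] allI conjI ballI) auto
qed

end

lemma (in abelian_group) zext_0: "zext G Y w (\<lambda>s. \<zero>) = (\<lambda>s. \<zero>)"
proof -
  interpret Y: comm_group "comb_group G Y" by (rule comm_group_comb)
  show ?thesis by (simp add: zext_def comb_ext_def supp_def)
qed

context cell_space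
begin

text \<open>\<open>\<rho>\<close> is the identity minus the two homotopy terms, read as a
  combination of simplices through the inverse of the injective \<open>chi\<close>.\<close>

lemma exists_retraction:
  "\<exists>h \<rho>. (\<forall>q. \<forall>\<sigma>\<in>sing q. keys (h q \<sigma>) \<subseteq> sing (Suc q)) \<and>
    (\<forall>q. \<forall>\<sigma>\<in>sing q. keys (\<rho> q \<sigma>) \<subseteq> S q) \<and>
    (\<forall>q. \<forall>\<sigma>\<in>sing q. frag_of \<sigma> = frag_extend (frag_of \<circ> chi q) (\<rho> q \<sigma>) + chain_boundary (Suc q) (h q \<sigma>)
      + frag_extend (h (q - 1)) (chain_boundary q (frag_of \<sigma>))) \<and>
    (\<forall>q. \<forall>x\<in>S q. \<rho> q (chi q x) = frag_of x)"
proof -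
  obtain h where h: "\<And>q \<sigma>. \<sigma> \<in> sing q \<Longrightarrow> singular_chain (Suc q) X (h q \<sigma>)" "\<And>q \<sigma>. \<sigma> \<in> chi q ` S q \<Longrightarrow> h q \<sigma> = 0"
    "\<And>q \<sigma>. \<sigma> \<in> sing q \<Longrightarrow> keys (frag_of \<sigma> - chain_boundary (Suc q) (h q \<sigma>) -
      frag_extend (h (q - 1)) (chain_boundary q (frag_of \<sigma>))) \<subseteq> chi q ` S q"
    using exists_deformation by metis
  define r where "r q \<sigma> = frag_of \<sigma> - chain_boundary (Suc q) (h q \<sigma>) -
      frag_extend (h (q - 1)) (chain_boundary q (frag_of \<sigma>))" for q \<sigma>
  define \<rho> where "\<rho> q \<sigma> = frag_extend (frag_of \<circ> inv_into (S q) (chi q)) (r q \<sigma>)" for q \<sigma>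
  have r: "keys (r q \<sigma>) \<subseteq> chi q ` S q" if "\<sigma> \<in> sing q" for q \<sigma>
    unfolding r_def by (rule h(3)[OF that])
  have 1: "keys (h q \<sigma>) \<subseteq> sing (Suc q)" if "\<sigma> \<in> sing q" for q \<sigma>
    using h(1)[OF that] by (simp add: singular_chain_def)
  have 2: "keys (\<rho> q \<sigma>) \<subseteq> S q" if "\<sigma> \<in> sing q" for q \<sigma>
    unfolding \<rho>_def
  proof (rule keys_frag_extend_subset)
    fix x assume "x \<in> keys (r q \<sigma>)"
    then have "x \<in> chi q ` S q" using r[OF that] by blast
    then show "keys ((frag_of \<circ> inv_into (S q) (chi q)) x) \<subseteq> S q" by (auto intro: inv_into_into)
  qed
  have 3: "frag_of \<sigma> = frag_extend (frag_of \<circ> chi q) (\<rho> q \<sigma>) + chain_boundary (Suc q) (h q \<sigma>)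
      + frag_extend (h (q - 1)) (chain_boundary q (frag_of \<sigma>))" if "\<sigma> \<in> sing q" for q \<sigma>
  proof -
    have "frag_extend (frag_of \<circ> chi q) (\<rho> q \<sigma>) = frag_extend ((frag_of \<circ> chi q) \<circ> inv_into (S q) (chi q)) (r q \<sigma>)"
      unfolding \<rho>_def by (rule frag_extend_compose)
    also have "\<dots> = frag_extend frag_of (r q \<sigma>)"
      using r[OF that] by (intro frag_extend_eq) (auto simp: f_inv_into_f)
    also have "\<dots> = r q \<sigma>" by (rule frag_expansion[symmetric])
    finally show ?thesis by (simp add: r_def)
  qed
  have 4: "\<rho> q (chi q x) = frag_of x" if x: "x \<in> S q" for q x
  proof -
    have "keys (chain_boundary q (frag_of (chi q x))) \<subseteq> chi (q - 1) ` S (q - 1)"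
      using keys_boundary_chi[OF subcomplex_S, of "frag_of (chi q x)" q] x by simp
    then have "frag_extend (h (q - 1)) (chain_boundary q (frag_of (chi q x))) = 0"
      using h(2) by (intro frag_extend_eq_0) blast
    then have "r q (chi q x) = frag_of (chi q x)" using h(2)[of "chi q x" q] x by (simp add: r_def)
    then show ?thesis using inj_chi x by (simp add: \<rho>_def)
  qed
  show ?thesis using 1 2 3 4 by (intro exI[of _ h] exI[of _ \<rho>]) blast
qed

lemma boundary_chi:
  assumes "x \<in> S (Suc p)"
  shows "chain_boundary (Suc p) (frag_of (chi (Suc p) x)) = frag_extend (frag_of \<circ> chi p) (face_sum (Suc p) x)"
  unfolding face_sum_def
  by (simp add: chain_boundary_of frag_extend_sum frag_extend_cmul singular_face_chi[OF assms] del: sum.atMost_Suc)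

lemma keys_boundary_sing: "\<sigma> \<in> sing q \<Longrightarrow> keys (chain_boundary q (frag_of \<sigma>)) \<subseteq> sing (q - 1)"
  using singular_chain_boundary[of q X "frag_of \<sigma>"] by (simp add: singular_chain_of singular_chain_def)

text \<open>\<open>XX\<close> and \<open>R\<close> are the chain maps induced by \<open>chi\<close>
  and \<open>\<rho>\<close>. \<open>R\<close> is a left inverse of \<open>XX\<close>, and
  \<open>XX\<close> after \<open>R\<close> is homotopic to the identity by \<open>h\<close>, so
  exactness in positive degree passes in both directions.\<close>

lemma exact_iff:
  assumes K: "abelian_group K"
  shows "(\<forall>c\<in>fin_combs K (sing (Suc p)). zext K (sing p) (\<lambda>\<sigma>. chain_boundary (Suc p) (frag_of \<sigma>)) c = (\<lambda>s. \<zero>\<^bsub>K\<^esub>) \<longrightarrow>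
      c \<in> zext K (sing (Suc p)) (\<lambda>\<sigma>. chain_boundary (Suc (Suc p)) (frag_of \<sigma>)) ` fin_combs K (sing (Suc (Suc p)))) \<longleftrightarrow>
    (\<forall>c\<in>fin_combs K (S (Suc p)). zext K (S p) (face_sum (Suc p)) c = (\<lambda>s. \<zero>\<^bsub>K\<^esub>) \<longrightarrow>
      c \<in> zext K (S (Suc p)) (face_sum (Suc (Suc p))) ` fin_combs K (S (Suc (Suc p))))"
proof -
  interpret K: abelian_group K by (rule K)
  obtain h \<rho> where h: "\<And>q \<sigma>. \<sigma> \<in> sing q \<Longrightarrow> keys (h q \<sigma>) \<subseteq> sing (Suc q)"
    and \<rho>: "\<And>q \<sigma>. \<sigma> \<in> sing q \<Longrightarrow> keys (\<rho> q \<sigma>) \<subseteq> S q"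
    and E1: "\<And>q \<sigma>. \<sigma> \<in> sing q \<Longrightarrow> frag_of \<sigma> = frag_extend (frag_of \<circ> chi q) (\<rho> q \<sigma>) + chain_boundary (Suc q) (h q \<sigma>)
      + frag_extend (h (q - 1)) (chain_boundary q (frag_of \<sigma>))"
    and E2: "\<And>q x. x \<in> S q \<Longrightarrow> \<rho> q (chi q x) = frag_of x"
    using exists_retraction by metis
  let ?X = "\<lambda>q. frag_of \<circ> chi q" and ?d = "\<lambda>q \<sigma>. chain_boundary q (frag_of \<sigma>)"
  have dd: "frag_extend (?d q) c = chain_boundary q c" for q c
    using frag_extend_unique[of "chain_boundary q" c] by (simp add: chain_boundary_diff)
  have Xk: "keys (?X q x) \<subseteq> sing q" if "x \<in> S q" for q x using chi_sing[of q] that by auto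
  have dk: "keys (?d (Suc q) \<sigma>) \<subseteq> sing q" if "\<sigma> \<in> sing (Suc q)" for q \<sigma>
    using keys_boundary_sing[OF that] by simp
  have E3: "?d (Suc q) (chi (Suc q) x) = frag_extend (?X q) (face_sum (Suc q) x)" if "x \<in> S (Suc q)" for q x
    using that by (rule boundary_chi)
  have E1': "c = frag_extend (?X q) (frag_extend (\<rho> q) c) + chain_boundary (Suc q) (frag_extend (h q) c)
      + frag_extend (h (q - 1)) (chain_boundary q c)" if c: "keys c \<subseteq> sing q" for q c
  proof -
    let ?F = "\<lambda>c. frag_extend (?X q) (frag_extend (\<rho> q) c) + chain_boundary (Suc q) (frag_extend (h q) c)
      + frag_extend (h (q - 1)) (chain_boundary q c)"
    have "?F c = frag_extend (\<lambda>x. ?F (frag_of x)) c"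
      using frag_extend_unique[of ?F c] by (simp add: frag_extend_diff chain_boundary_diff)
    also have "\<dots> = frag_extend frag_of c"
      using c E1 by (intro frag_extend_eq) (auto simp: subset_iff)
    also have "\<dots> = c" by (rule frag_expansion[symmetric])
    finally show ?thesis by (rule sym)
  qed
  have rX: "frag_extend (\<rho> q) (frag_extend (?X q) c) = c" if "keys c \<subseteq> S q" for q c
  proof -
    have "frag_extend (\<rho> q) (frag_extend (?X q) c) = frag_extend (\<rho> q \<circ> chi q) c" by (rule frag_extend_compose)
    also have "\<dots> = frag_extend frag_of c" using that E2 by (intro frag_extend_eq) auto
    also have "\<dots> = c" by (rule frag_expansion[symmetric])
    finally show ?thesis .
  qed
  \<comment> \<open>\<open>\<rho>\<close> is a chain map. Comparing the homotopy identity of the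
    boundary of \<open>\<sigma>\<close> with the boundary of the homotopy identity of
    \<open>\<sigma>\<close>, the terms with \<open>h\<close> cancel and both sides agree after
    \<open>chi\<close>, which \<open>\<rho>\<close> undoes.\<close>
  have E4: "frag_extend (\<rho> q) (?d (Suc q) \<sigma>) = frag_extend (face_sum (Suc q)) (\<rho> (Suc q) \<sigma>)"
    if s: "\<sigma> \<in> sing (Suc q)" for q \<sigma>
  proof -
    let ?b = "?d (Suc q) \<sigma>"
    have bk: "keys ?b \<subseteq> sing q" by (rule dk[OF s])
    have cs: "singular_chain (Suc q) X (frag_of \<sigma>)" using s by (simp add: singular_chain_of)
    have bb: "chain_boundary q ?b = 0" by (rule chain_boundary_boundary_alt[OF cs])
    have hk: "singular_chain (Suc (Suc q)) X (h (Suc q) \<sigma>)" using h[OF s] by (simp add: singular_chain_def)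
    have bh: "chain_boundary (Suc q) (chain_boundary (Suc (Suc q)) (h (Suc q) \<sigma>)) = 0"
      by (rule chain_boundary_boundary_alt[OF hk])
    have 1: "?b = frag_extend (?X q) (frag_extend (\<rho> q) ?b) + chain_boundary (Suc q) (frag_extend (h q) ?b)"
      using E1'[OF bk] unfolding bb frag_extend_0 by simp
    have 2: "?b = chain_boundary (Suc q) (frag_extend (?X (Suc q)) (\<rho> (Suc q) \<sigma>)) + chain_boundary (Suc q) (frag_extend (h q) ?b)"
      using arg_cong[OF E1[OF s], of "chain_boundary (Suc q)"] unfolding chain_boundary_add bh diff_Suc_1 by simp
    have "frag_extend (?X q) (frag_extend (\<rho> q) ?b) = chain_boundary (Suc q) (frag_extend (?X (Suc q)) (\<rho> (Suc q) \<sigma>))"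
      using trans[OF 1[symmetric] 2] by (rule add_right_imp_eq)
    also have "chain_boundary (Suc q) (frag_extend (?X (Suc q)) (\<rho> (Suc q) \<sigma>)) = frag_extend (?d (Suc q) \<circ> chi (Suc q)) (\<rho> (Suc q) \<sigma>)"
      by (rule trans[OF dd[symmetric] frag_extend_compose])
    also have "\<dots> = frag_extend (\<lambda>x. frag_extend (?X q) (face_sum (Suc q) x)) (\<rho> (Suc q) \<sigma>)"
      using \<rho>[OF s] E3 by (intro frag_extend_eq) auto
    also have "\<dots> = frag_extend (?X q) (frag_extend (face_sum (Suc q)) (\<rho> (Suc q) \<sigma>))"
      using frag_extend_unique[of "\<lambda>c. frag_extend (?X q) (frag_extend (face_sum (Suc q)) c)"]
      by (simp add: frag_extend_diff)
    finally have "frag_extend (?X q) (frag_extend (\<rho> q) ?b) = frag_extend (?X q) (frag_extend (face_sum (Suc q)) (\<rho> (Suc q) \<sigma>))"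
      by simp
    moreover have "keys (frag_extend (\<rho> q) ?b) \<subseteq> S q"
      using bk \<rho> by (intro keys_frag_extend_subset) blast
    moreover have "keys (frag_extend (face_sum (Suc q)) (\<rho> (Suc q) \<sigma>)) \<subseteq> S q"
      using \<rho>[OF s] keys_face_sum by (intro keys_frag_extend_subset) blast
    ultimately show ?thesis using rX by metis
  qed
  \<comment> \<open>From here on the integer matrices act on combinations over
    \<open>K\<close>.\<close>
  define D where "D q = zext K (sing q) (?d (Suc q))" for q
  define B where "B q = zext K (S q) (face_sum (Suc q))" for q
  define XX where "XX q = zext K (sing q) (?X q)" for q
  define R where "R q = zext K (S q) (\<rho> q)" for q
  have hom: "D q \<in> hom (comb_group K (sing (Suc q))) (comb_group K (sing q))"
    "B q \<in> hom (comb_group K (S (Suc q))) (comb_group K (S q))"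
    "XX q \<in> hom (comb_group K (S q)) (comb_group K (sing q))"
    "R q \<in> hom (comb_group K (sing q)) (comb_group K (S q))" for q
    unfolding D_def B_def XX_def R_def by (rule K.zext_hom; use dk keys_face_sum Xk \<rho> in blast)+
  have R_D: "R q (D q c) = B q (R (Suc q) c)" if c: "c \<in> fin_combs K (sing (Suc q))" for q c
  proof -
    have "R q (D q c) = zext K (S q) (\<lambda>\<sigma>. frag_extend (\<rho> q) (?d (Suc q) \<sigma>)) c"
      unfolding R_def D_def by (rule K.zext_compose[OF dk \<rho> c])
    also have "\<dots> = zext K (S q) (\<lambda>\<sigma>. frag_extend (face_sum (Suc q)) (\<rho> (Suc q) \<sigma>)) c"
    proof (rule K.zext_cong[OF E4 _ c])
      show "keys (frag_extend (face_sum (Suc q)) (\<rho> (Suc q) \<sigma>)) \<subseteq> S q" if "\<sigma> \<in> sing (Suc q)" for \<sigma>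
        using \<rho>[OF that] keys_face_sum by (intro keys_frag_extend_subset) blast
    qed
    also have "\<dots> = B q (R (Suc q) c)"
      unfolding R_def B_def by (rule K.zext_compose[OF \<rho> keys_face_sum c, symmetric])
    finally show ?thesis .
  qed
  have X_B: "XX q (B q c) = D q (XX (Suc q) c)" if c: "c \<in> fin_combs K (S (Suc q))" for q c
  proof -
    have "D q (XX (Suc q) c) = zext K (sing q) (\<lambda>x. frag_extend (?d (Suc q)) (?X (Suc q) x)) c"
      unfolding XX_def D_def by (rule K.zext_compose[OF Xk dk c])
    also have "\<dots> = zext K (sing q) (\<lambda>x. frag_extend (?X q) (face_sum (Suc q) x)) c"
      using E3 c by (intro K.zext_cong keys_frag_extend_subset Xk) (use keys_face_sum in \<open>auto simp: subset_iff\<close>)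
    also have "\<dots> = XX q (B q c)"
      unfolding XX_def B_def by (rule K.zext_compose[OF keys_face_sum Xk c, symmetric])
    finally show ?thesis by (rule sym)
  qed
  have R_X: "R q (XX q c) = c" if c: "c \<in> fin_combs K (S q)" for q c
  proof -
    have "R q (XX q c) = zext K (S q) (\<lambda>x. frag_extend (\<rho> q) (?X q x)) c"
      unfolding XX_def R_def by (rule K.zext_compose[OF Xk \<rho> c])
    also have "\<dots> = zext K (S q) frag_of c" using E2 c by (intro K.zext_cong) auto
    also have "\<dots> = c" by (rule K.zext_id[OF c])
    finally show ?thesis .
  qed
  \<comment> \<open>On a cycle, the term of the homotopy identity that applies \<open>h\<close> to
    the boundary drops out.\<close>
  have decomp: "\<exists>e\<in>fin_combs K (sing (Suc (Suc q))). c = (\<lambda>s. XX (Suc q) (R (Suc q) c) s \<oplus>\<^bsub>K\<^esub> D (Suc q) e s)"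
    if c: "c \<in> fin_combs K (sing (Suc q))" and Dc: "D q c = (\<lambda>s. \<zero>\<^bsub>K\<^esub>)" for q c
  proof -
    let ?Y = "sing (Suc q)"
    have k1: "keys (frag_extend (?X (Suc q)) (\<rho> (Suc q) \<sigma>)) \<subseteq> ?Y" if "\<sigma> \<in> ?Y" for \<sigma>
      using \<rho>[OF that] Xk by (intro keys_frag_extend_subset) blast
    have k2: "keys (frag_extend (?d (Suc (Suc q))) (h (Suc q) \<sigma>)) \<subseteq> ?Y" if "\<sigma> \<in> ?Y" for \<sigma>
      using h[OF that] dk by (intro keys_frag_extend_subset) blast
    have k3: "keys (frag_extend (h q) (?d (Suc q) \<sigma>)) \<subseteq> ?Y" if "\<sigma> \<in> ?Y" for \<sigma>
      using dk[OF that] h by (intro keys_frag_extend_subset) blast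
    have k12: "keys (frag_extend (?X (Suc q)) (\<rho> (Suc q) \<sigma>) + frag_extend (?d (Suc (Suc q))) (h (Suc q) \<sigma>)) \<subseteq> ?Y" if "\<sigma> \<in> ?Y" for \<sigma>
      using k1[OF that] k2[OF that] by (intro order_trans[OF keys_add] Un_least)
    have eq: "frag_of \<sigma> = frag_extend (?X (Suc q)) (\<rho> (Suc q) \<sigma>) + frag_extend (?d (Suc (Suc q))) (h (Suc q) \<sigma>)
        + frag_extend (h q) (?d (Suc q) \<sigma>)" if "\<sigma> \<in> ?Y" for \<sigma>
      unfolding dd using E1[OF that] by (simp only: diff_Suc_1)
    define e where "e = zext K (sing (Suc (Suc q))) (h (Suc q)) c"
    have e: "e \<in> fin_combs K (sing (Suc (Suc q)))"
      unfolding e_def using hom_in_carrier[OF K.zext_hom[of ?Y "h (Suc q)" "sing (Suc (Suc q))"], of c] h c by simp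
    have "c = zext K ?Y frag_of c" using K.zext_id[OF c] by simp
    also have "\<dots> = zext K ?Y (\<lambda>\<sigma>. (frag_extend (?X (Suc q)) (\<rho> (Suc q) \<sigma>) + frag_extend (?d (Suc (Suc q))) (h (Suc q) \<sigma>))
        + frag_extend (h q) (?d (Suc q) \<sigma>)) c"
      by (rule K.zext_cong[OF eq _ c]) (use eq in \<open>auto simp flip: eq\<close>)
    also have "\<dots> = (\<lambda>s. (zext K ?Y (\<lambda>\<sigma>. frag_extend (?X (Suc q)) (\<rho> (Suc q) \<sigma>)) c s \<oplus>\<^bsub>K\<^esub>
        zext K ?Y (\<lambda>\<sigma>. frag_extend (?d (Suc (Suc q))) (h (Suc q) \<sigma>)) c s) \<oplus>\<^bsub>K\<^esub> zext K ?Y (\<lambda>\<sigma>. frag_extend (h q) (?d (Suc q) \<sigma>)) c s)"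
      by (subst K.zext_add[OF k12 k3 c]; (assumption | subst K.zext_add[OF k1 k2 c]; (assumption | rule refl)))
    finally have c_eq: "c = (\<lambda>s. (zext K ?Y (\<lambda>\<sigma>. frag_extend (?X (Suc q)) (\<rho> (Suc q) \<sigma>)) c s \<oplus>\<^bsub>K\<^esub>
        zext K ?Y (\<lambda>\<sigma>. frag_extend (?d (Suc (Suc q))) (h (Suc q) \<sigma>)) c s) \<oplus>\<^bsub>K\<^esub> zext K ?Y (\<lambda>\<sigma>. frag_extend (h q) (?d (Suc q) \<sigma>)) c s)" .
    have 1: "zext K ?Y (\<lambda>\<sigma>. frag_extend (?X (Suc q)) (\<rho> (Suc q) \<sigma>)) c = XX (Suc q) (R (Suc q) c)"
      unfolding XX_def R_def by (rule K.zext_compose[OF \<rho> Xk c, symmetric])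
    have 2: "zext K ?Y (\<lambda>\<sigma>. frag_extend (?d (Suc (Suc q))) (h (Suc q) \<sigma>)) c = D (Suc q) e"
      unfolding D_def e_def by (rule K.zext_compose[OF h dk c, symmetric])
    have 3: "zext K ?Y (\<lambda>\<sigma>. frag_extend (h q) (?d (Suc q) \<sigma>)) c = zext K ?Y (h q) (D q c)"
      unfolding D_def by (rule K.zext_compose[OF dk h c, symmetric])
    have 4: "zext K ?Y (h q) (D q c) = (\<lambda>s. \<zero>\<^bsub>K\<^esub>)"
      unfolding Dc by (rule K.zext_0)
    have "c = (\<lambda>s. XX (Suc q) (R (Suc q) c) s \<oplus>\<^bsub>K\<^esub> D (Suc q) e s \<oplus>\<^bsub>K\<^esub> \<zero>\<^bsub>K\<^esub>)"
      by (rule trans[OF c_eq]) (simp only: 1 2 3 4)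
    moreover have fc: "XX (Suc q) (R (Suc q) c) \<in> fin_combs K (sing (Suc q))" "D (Suc q) e \<in> fin_combs K (sing (Suc q))"
      using hom_in_carrier[OF hom(3), of "R (Suc q) c" "Suc q"] hom_in_carrier[OF hom(4), of c "Suc q"] c
        hom_in_carrier[OF hom(1), of e "Suc q"] e by auto
    have "XX (Suc q) (R (Suc q) c) s \<in> carrier K" "D (Suc q) e s \<in> carrier K" for s
      by (rule K.fin_combs_closed[OF fc(1)], rule K.fin_combs_closed[OF fc(2)])
    ultimately have "c = (\<lambda>s. XX (Suc q) (R (Suc q) c) s \<oplus>\<^bsub>K\<^esub> D (Suc q) e s)"
      by (simp add: K.a_assoc)
    then show ?thesis using e by blast
  qed
  have "(\<forall>c\<in>fin_combs K (sing (Suc p)). D p c = (\<lambda>s. \<zero>\<^bsub>K\<^esub>) \<longrightarrow> c \<in> D (Suc p) ` fin_combs K (sing (Suc (Suc p)))) \<longleftrightarrow>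
    (\<forall>c\<in>fin_combs K (S (Suc p)). B p c = (\<lambda>s. \<zero>\<^bsub>K\<^esub>) \<longrightarrow> c \<in> B (Suc p) ` fin_combs K (S (Suc (Suc p))))"
  proof (intro iffI ballI impI)
    fix c assume ex: "\<forall>c\<in>fin_combs K (sing (Suc p)). D p c = (\<lambda>s. \<zero>\<^bsub>K\<^esub>) \<longrightarrow> c \<in> D (Suc p) ` fin_combs K (sing (Suc (Suc p)))"
      and c: "c \<in> fin_combs K (S (Suc p))" and Bc: "B p c = (\<lambda>s. \<zero>\<^bsub>K\<^esub>)"
    have Xc: "XX (Suc p) c \<in> fin_combs K (sing (Suc p))" using hom_in_carrier[OF hom(3)] c by simp
    have "D p (XX (Suc p) c) = XX p (\<lambda>s. \<zero>\<^bsub>K\<^esub>)" using X_B[OF c] Bc by simp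
    also have "\<dots> = (\<lambda>s. \<zero>\<^bsub>K\<^esub>)" unfolding XX_def by (rule K.zext_0)
    finally obtain e where e: "e \<in> fin_combs K (sing (Suc (Suc p)))" "XX (Suc p) c = D (Suc p) e" using ex Xc by blast
    have "c = B (Suc p) (R (Suc (Suc p)) e)" using R_X[OF c] R_D[OF e(1)] e(2) by simp
    moreover have "R (Suc (Suc p)) e \<in> fin_combs K (S (Suc (Suc p)))" using hom_in_carrier[OF hom(4)] e by simp
    ultimately show "c \<in> B (Suc p) ` fin_combs K (S (Suc (Suc p)))" by blast
  next
    fix c assume ex: "\<forall>c\<in>fin_combs K (S (Suc p)). B p c = (\<lambda>s. \<zero>\<^bsub>K\<^esub>) \<longrightarrow> c \<in> B (Suc p) ` fin_combs K (S (Suc (Suc p)))"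
      and c: "c \<in> fin_combs K (sing (Suc p))" and Dc: "D p c = (\<lambda>s. \<zero>\<^bsub>K\<^esub>)"
    have Rc: "R (Suc p) c \<in> fin_combs K (S (Suc p))" using hom_in_carrier[OF hom(4)] c by simp
    have "B p (R (Suc p) c) = R p (\<lambda>s. \<zero>\<^bsub>K\<^esub>)" using R_D[OF c] Dc by simp
    also have "\<dots> = (\<lambda>s. \<zero>\<^bsub>K\<^esub>)" unfolding R_def by (rule K.zext_0)
    finally obtain f where f: "f \<in> fin_combs K (S (Suc (Suc p)))" "R (Suc p) c = B (Suc p) f" using ex Rc by blast
    obtain e where e: "e \<in> fin_combs K (sing (Suc (Suc p)))" "c = (\<lambda>s. XX (Suc p) (R (Suc p) c) s \<oplus>\<^bsub>K\<^esub> D (Suc p) e s)"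
      using decomp[OF c Dc] by blast
    have Xf: "XX (Suc (Suc p)) f \<in> fin_combs K (sing (Suc (Suc p)))" using hom_in_carrier[OF hom(3)] f by simp
    have "c = (\<lambda>s. D (Suc p) (XX (Suc (Suc p)) f) s \<oplus>\<^bsub>K\<^esub> D (Suc p) e s)"
      using e(2) f(2) X_B[OF f(1)] by simp
    also have "\<dots> = D (Suc p) (\<lambda>s. XX (Suc (Suc p)) f s \<oplus>\<^bsub>K\<^esub> e s)"
      using hom_mult[OF hom(1), of "XX (Suc (Suc p)) f" "Suc p" e] Xf e(1) by simp
    finally show "c \<in> D (Suc p) ` fin_combs K (sing (Suc (Suc p)))"
      using K.add_fin_combs[OF Xf e(1)] by blast
  qed
  then show ?thesis unfolding D_def B_def .
qed

end

lemma (in abelian_group) finsum_product: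
  assumes "finite A" "finite B" "\<And>a b. a \<in> A \<Longrightarrow> b \<in> B \<Longrightarrow> f (a, b) \<in> carrier G"
  shows "(\<Oplus>u\<in>A \<times> B. f u) = (\<Oplus>a\<in>A. \<Oplus>b\<in>B. f (a, b))"
  using assms
proof (induction A rule: finite_induct)
  case (insert a A)
  have eq: "insert a A \<times> B = Pair a ` B \<union> A \<times> B" by auto
  have f1: "f \<in> Pair a ` B \<rightarrow> carrier G" and f2: "f \<in> A \<times> B \<rightarrow> carrier G"
    using insert.prems by auto
  have "(\<Oplus>u\<in>insert a A \<times> B. f u) = (\<Oplus>u\<in>Pair a ` B. f u) \<oplus> (\<Oplus>u\<in>A \<times> B. f u)"
    unfolding eq using insert.hyps insert.prems(1) f1 f2 by (intro finsum_Un_disjoint) auto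
  also have "(\<Oplus>u\<in>Pair a ` B. f u) = (\<Oplus>b\<in>B. f (a, b))"
    using f1 by (intro finsum_reindex) (auto simp: inj_on_def)
  also have "(\<Oplus>u\<in>A \<times> B. f u) = (\<Oplus>a\<in>A. \<Oplus>b\<in>B. f (a, b))"
    using insert by simp
  finally show ?case
    using insert.hyps insert.prems by (subst finsum_insert) (auto intro!: finsum_closed)
qed simp

lemma (in ring) minus_one_pow:
  assumes "r \<in> carrier R"
  shows "(\<ominus> \<one>) [^] k \<otimes> r = add_pow R ((-1) ^ k :: int) r"
proof -
  have m: "(\<ominus> \<one>) [^] k = (if even k then \<one> else \<ominus> \<one>)" for k :: nat
    by (induction k) (auto simp: l_minus)
  show ?thesis using assms unfolding m by (auto simp: l_minus add.int_pow_neg add_pow_int_ge)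
qed

lemma (in abelian_group) zact_sum:
  assumes "finite A" "r \<in> carrier G"
  shows "zact G (\<Sum>k\<in>A. p k) r = (\<lambda>s. \<Oplus>k\<in>A. zact G (p k) r s)"
  using assms(1)
proof (induction A rule: finite_induct)
  case empty then show ?case by (simp add: zact_0)
next
  case (insert a A)
  have c: "zact G q r s \<in> carrier G" for q s using assms(2) by (simp add: zact_def)
  have "(\<Oplus>k\<in>insert a A. zact G (p k) r s) = zact G (p a) r s \<oplus> (\<Oplus>k\<in>A. zact G (p k) r s)" for s
    using insert.hyps c by (intro finsum_insert) auto
  then show ?case using insert assms(2) by (simp add: zact_plus)
qed

text \<open>The sum over pairs of a simplex and a face is regrouped by simplices, and powers of
  \<open>-1\<close> in \<open>K\<close> become integer multiples.\<close>

lemma singular_boundary_zext: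
  assumes K: "ring K" and c: "c \<in> fin_combs K (singular_simplex_set (Suc p) X)"
  shows "singular_boundary K (Suc p) c =
    zext K (singular_simplex_set p X) (\<lambda>\<sigma>. chain_boundary (Suc p) (frag_of \<sigma>)) c"
proof -
  interpret K: ring K by fact
  let ?Y = "singular_simplex_set p X" and ?w = "\<lambda>\<sigma>. chain_boundary (Suc p) (frag_of \<sigma>)"
  have w: "keys (?w \<sigma>) \<subseteq> ?Y" if "\<sigma> \<in> singular_simplex_set (Suc p) X" for \<sigma>
    using singular_chain_boundary_alt[of p X "frag_of \<sigma>"] that by (simp add: singular_chain_of singular_chain_def)
  note s = fin_combs_supp[OF c]
  have cK: "c \<sigma> \<in> carrier K" for \<sigma> by (rule K.fin_combs_closed[OF c])
  have z: "zact K (?w \<sigma>) (c \<sigma>) \<in> fin_combs K ?Y" if "\<sigma> \<in> supp K c" for \<sigma>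
    using that s cK w by (intro K.zact_fin_combs) blast+
  have sg: "(\<ominus>\<^bsub>K\<^esub> \<one>\<^bsub>K\<^esub>) [^]\<^bsub>K\<^esub> k \<otimes>\<^bsub>K\<^esub> c \<sigma> = add_pow K ((-1) ^ k :: int) (c \<sigma>)" for k :: nat and \<sigma>
    by (rule K.minus_one_pow[OF cK])
  have cl: "add_pow K (j :: int) (c \<sigma>) \<in> carrier K" for j \<sigma> using cK by simp
  have "zext K ?Y ?w c = (\<lambda>t. \<Oplus>\<^bsub>K\<^esub>\<sigma>\<in>supp K c. zact K (?w \<sigma>) (c \<sigma>) t)"
    unfolding zext_def comb_ext_def using s z by (intro K.finprod_comb_group) auto
  also have "\<dots> = (\<lambda>t. \<Oplus>\<^bsub>K\<^esub>\<sigma>\<in>supp K c. \<Oplus>\<^bsub>K\<^esub>k\<in>{..Suc p}.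
      if singular_face (Suc p) k \<sigma> = t then add_pow K ((-1) ^ k :: int) (c \<sigma>) else \<zero>\<^bsub>K\<^esub>)"
  proof (rule ext, rule K.finsum_cong')
    fix t \<sigma>
    have "zact K (?w \<sigma>) (c \<sigma>) t = (\<Oplus>\<^bsub>K\<^esub>k\<in>{..Suc p}. zact K (frag_cmul ((-1) ^ k) (frag_of (singular_face (Suc p) k \<sigma>))) (c \<sigma>) t)"
      by (simp add: chain_boundary_of K.zact_sum[OF _ cK] del: sum.atMost_Suc)
    also have "\<dots> = (\<Oplus>\<^bsub>K\<^esub>k\<in>{..Suc p}. if singular_face (Suc p) k \<sigma> = t then add_pow K ((-1) ^ k :: int) (c \<sigma>) else \<zero>\<^bsub>K\<^esub>)"
      using cl by (intro K.finsum_cong') (auto simp: K.zact_cmul_frag_of[OF cK] single_def)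
    finally show "zact K (?w \<sigma>) (c \<sigma>) t = (\<Oplus>\<^bsub>K\<^esub>k\<in>{..Suc p}. if singular_face (Suc p) k \<sigma> = t then add_pow K ((-1) ^ k :: int) (c \<sigma>) else \<zero>\<^bsub>K\<^esub>)" .
  qed (use cl in \<open>auto intro!: K.finsum_closed\<close>)
  also have "\<dots> = (\<lambda>t. \<Oplus>\<^bsub>K\<^esub>u\<in>supp K c \<times> {..Suc p}.
      if singular_face (Suc p) (snd u) (fst u) = t then add_pow K ((-1) ^ snd u :: int) (c (fst u)) else \<zero>\<^bsub>K\<^esub>)"
  proof
    fix t
    let ?f = "\<lambda>u. if singular_face (Suc p) (snd u) (fst u) = t then add_pow K ((-1) ^ snd u :: int) (c (fst u)) else \<zero>\<^bsub>K\<^esub>"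
    have "(\<Oplus>\<^bsub>K\<^esub>u\<in>supp K c \<times> {..Suc p}. ?f u) = (\<Oplus>\<^bsub>K\<^esub>\<sigma>\<in>supp K c. \<Oplus>\<^bsub>K\<^esub>k\<in>{..Suc p}. ?f (\<sigma>, k))"
      by (rule K.finsum_product) (use s cl in auto)
    then show "(\<Oplus>\<^bsub>K\<^esub>\<sigma>\<in>supp K c. \<Oplus>\<^bsub>K\<^esub>k\<in>{..Suc p}.
        if singular_face (Suc p) k \<sigma> = t then add_pow K ((-1) ^ k :: int) (c \<sigma>) else \<zero>\<^bsub>K\<^esub>) =
      (\<Oplus>\<^bsub>K\<^esub>u\<in>supp K c \<times> {..Suc p}. ?f u)" unfolding fst_conv snd_conv by (rule sym)
  qed
  also have "\<dots> = singular_boundary K (Suc p) c"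
    unfolding singular_boundary_def sg ..
  finally show ?thesis ..
qed

lemma singular_chains_comb: "singular_chains K X p = comb_group K (singular_simplex_set p X)"
  by (simp add: singular_chains_def comb_group_def)

lemma (in cell_space) singular_homology_trivial_iff:
  assumes K: "ring K"
  shows "trivial_group (singular_homology K (Suc p) X) \<longleftrightarrow>
    (\<forall>c\<in>fin_combs K (S (Suc p)). zext K (S p) (face_sum (Suc p)) c = (\<lambda>s. \<zero>\<^bsub>K\<^esub>) \<longrightarrow>
      c \<in> zext K (S (Suc p)) (face_sum (Suc (Suc p))) ` fin_combs K (S (Suc (Suc p))))"
proof -
  interpret K: ring K by fact
  have K': "abelian_group K" by (rule K.abelian_group_axioms)
  let ?d = "\<lambda>q. zext K (sing q) (\<lambda>\<sigma>. chain_boundary (Suc q) (frag_of \<sigma>))"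
  have dk: "keys (chain_boundary (Suc q) (frag_of \<sigma>)) \<subseteq> sing q" if "\<sigma> \<in> sing (Suc q)" for q \<sigma>
    using keys_boundary_sing[OF that] by simp
  have hom: "?d q \<in> hom (comb_group K (sing (Suc q))) (comb_group K (sing q))" for q
    by (rule K.zext_hom[OF dk])
  have sb: "singular_boundary K (Suc q) c = ?d q c" if "c \<in> fin_combs K (sing (Suc q))" for q c
    by (rule singular_boundary_zext[OF K that])
  have sbh: "singular_boundary K (Suc q) \<in> hom (comb_group K (sing (Suc q))) (comb_group K (sing q))" for q
  proof (rule homI)
    fix c assume "c \<in> carrier (comb_group K (sing (Suc q)))"
    then show "singular_boundary K (Suc q) c \<in> carrier (comb_group K (sing q))"
      using hom_in_carrier[OF hom] sb by simp
  next
    fix c d assume cd: "c \<in> carrier (comb_group K (sing (Suc q)))" "d \<in> carrier (comb_group K (sing (Suc q)))"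
    then have f: "c \<in> fin_combs K (sing (Suc q))" "d \<in> fin_combs K (sing (Suc q))" by simp_all
    show "singular_boundary K (Suc q) (c \<otimes>\<^bsub>comb_group K (sing (Suc q))\<^esub> d) =
        singular_boundary K (Suc q) c \<otimes>\<^bsub>comb_group K (sing q)\<^esub> singular_boundary K (Suc q) d"
      using hom_mult[OF hom cd] sb[OF f(1)] sb[OF f(2)] sb[OF K.add_fin_combs[OF f]] by simp
  qed
  have dd: "?d q (?d (Suc q) c) = (\<lambda>s. \<zero>\<^bsub>K\<^esub>)" if c: "c \<in> fin_combs K (sing (Suc (Suc q)))" for q c
  proof -
    have eq: "frag_extend (\<lambda>\<sigma>. chain_boundary (Suc q) (frag_of \<sigma>)) (chain_boundary (Suc (Suc q)) (frag_of \<sigma>)) = 0"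
      if "\<sigma> \<in> sing (Suc (Suc q))" for \<sigma>
      using frag_extend_unique[of "chain_boundary (Suc q)" "chain_boundary (Suc (Suc q)) (frag_of \<sigma>)"]
        chain_boundary_boundary_alt[of "Suc q" X "frag_of \<sigma>"] that
      by (simp add: chain_boundary_diff singular_chain_of)
    have "?d q (?d (Suc q) c) = zext K (sing q) (\<lambda>\<sigma>. frag_extend (\<lambda>\<sigma>. chain_boundary (Suc q) (frag_of \<sigma>)) (chain_boundary (Suc (Suc q)) (frag_of \<sigma>))) c"
      by (rule K.zext_compose[OF dk dk c])
    also have "\<dots> = zext K (sing q) (\<lambda>_. 0) c" by (rule K.zext_cong[OF eq _ c]) auto
    also have "\<dots> = (\<lambda>s. \<zero>\<^bsub>K\<^esub>)" by (rule K.zext_zero[OF c])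
    finally show ?thesis .
  qed
  have "trivial_group (singular_homology K (Suc p) X) \<longleftrightarrow>
    (\<forall>x\<in>carrier (comb_group K (sing (Suc p))). singular_boundary K (Suc p) x = \<one>\<^bsub>comb_group K (sing p)\<^esub> \<longrightarrow>
      x \<in> singular_boundary K (Suc (Suc p)) ` carrier (comb_group K (sing (Suc (Suc p)))))"
    unfolding singular_homology_def singular_chains_comb[abs_def]
  proof (rule trivial_complex_homology_iff)
    fix x assume "x \<in> carrier (comb_group K (sing (Suc (Suc p))))"
    then have x: "x \<in> fin_combs K (sing (Suc (Suc p)))" by simp
    have "singular_boundary K (Suc (Suc p)) x \<in> fin_combs K (sing (Suc p))"
      using hom_in_carrier[OF sbh] x by simp
    then show "singular_boundary K (Suc p) (singular_boundary K (Suc (Suc p)) x) = \<one>\<^bsub>comb_group K (sing p)\<^esub>"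
      using dd[OF x] sb[OF x] sb by simp
  qed (auto intro: K.comm_group_comb sbh)
  also have "\<dots> \<longleftrightarrow> (\<forall>c\<in>fin_combs K (sing (Suc p)). ?d p c = (\<lambda>s. \<zero>\<^bsub>K\<^esub>) \<longrightarrow> c \<in> ?d (Suc p) ` fin_combs K (sing (Suc (Suc p))))"
    using sb by (simp add: image_iff)
  also have "\<dots> \<longleftrightarrow> (\<forall>c\<in>fin_combs K (S (Suc p)). zext K (S p) (face_sum (Suc p)) c = (\<lambda>s. \<zero>\<^bsub>K\<^esub>) \<longrightarrow>
      c \<in> zext K (S (Suc p)) (face_sum (Suc (Suc p))) ` fin_combs K (S (Suc (Suc p))))"
    by (rule exact_iff[OF K'])
  finally show ?thesis .
qed

section \<open>Free resolutions\<close>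

lemma (in abelian_group) group_comb: "group (comb_group G X)"
  by (rule comm_group.axioms(2)[OF comm_group_comb])

lemma free_right_module_simps [simp]:
  "carrier (free_right_module R X) = fin_combs R X"
  "c \<oplus>\<^bsub>free_right_module R X\<^esub> d = (\<lambda>b. c b \<oplus>\<^bsub>R\<^esub> d b)"
  "\<zero>\<^bsub>free_right_module R X\<^esub> = (\<lambda>b. \<zero>\<^bsub>R\<^esub>)"
  "r \<odot>\<^bsub>free_right_module R X\<^esub> c = (\<lambda>b. c b \<otimes>\<^bsub>R\<^esub> r)"
  by (simp_all add: free_right_module_def)

abbreviation free_map where
  "free_map R X Y \<equiv> mod_hom R (free_right_module R X) (free_right_module R Y)"

lemma mod_homI:
  "\<lbrakk>\<And>x. x \<in> carrier A \<Longrightarrow> h x \<in> carrier B;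
    \<And>x y. x \<in> carrier A \<Longrightarrow> y \<in> carrier A \<Longrightarrow> h (x \<oplus>\<^bsub>A\<^esub> y) = h x \<oplus>\<^bsub>B\<^esub> h y;
    \<And>r x. r \<in> carrier R \<Longrightarrow> x \<in> carrier A \<Longrightarrow> h (r \<odot>\<^bsub>A\<^esub> x) = r \<odot>\<^bsub>B\<^esub> h x\<rbrakk> \<Longrightarrow> h \<in> mod_hom R A B"
  by (simp add: mod_hom_def)

lemma mod_homD:
  assumes "h \<in> mod_hom R A B"
  shows "x \<in> carrier A \<Longrightarrow> h x \<in> carrier B"
    "x \<in> carrier A \<Longrightarrow> y \<in> carrier A \<Longrightarrow> h (x \<oplus>\<^bsub>A\<^esub> y) = h x \<oplus>\<^bsub>B\<^esub> h y"
    "r \<in> carrier R \<Longrightarrow> x \<in> carrier A \<Longrightarrow> h (r \<odot>\<^bsub>A\<^esub> x) = r \<odot>\<^bsub>B\<^esub> h x"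
  using assms by (auto simp: mod_hom_def)

lemma mod_hom_comp:
  "\<lbrakk>f \<in> mod_hom R A B; g \<in> mod_hom R B C\<rbrakk> \<Longrightarrow> (\<lambda>x. g (f x)) \<in> mod_hom R A C"
  by (rule mod_homI) (simp_all add: mod_homD)

lemma mod_hom_zero:
  assumes "right_module R A" "right_module R B" "h \<in> mod_hom R A B"
  shows "h \<zero>\<^bsub>A\<^esub> = \<zero>\<^bsub>B\<^esub>"
  using mod_hom_kernel(2)[OF assms] by simp

lemma mod_hom_minus:
  assumes "right_module R A" "right_module R B" "f \<in> mod_hom R A B" "g \<in> mod_hom R A B"
  shows "(\<lambda>x. f x \<ominus>\<^bsub>B\<^esub> g x) \<in> mod_hom R A B"
proof -
  interpret A: right_module R A by fact
  interpret B: right_module R B by fact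
  note f = mod_homD[OF assms(3)] and g = mod_homD[OF assms(4)]
  have neg: "r \<odot>\<^bsub>B\<^esub> (\<ominus>\<^bsub>B\<^esub> x) = \<ominus>\<^bsub>B\<^esub> (r \<odot>\<^bsub>B\<^esub> x)" if "r \<in> carrier R" "x \<in> carrier B" for r x
  proof -
    have "r \<odot>\<^bsub>B\<^esub> x \<oplus>\<^bsub>B\<^esub> r \<odot>\<^bsub>B\<^esub> (\<ominus>\<^bsub>B\<^esub> x) = \<zero>\<^bsub>B\<^esub>"
      using B.smult_add[of r x "\<ominus>\<^bsub>B\<^esub> x"] that B.smult_zero by (simp add: B.A.r_neg)
    then show ?thesis using that B.smult_closed B.A.minus_equality B.A.a_comm
      by (metis B.A.a_inv_closed)
  qed
  show ?thesis
  proof (rule mod_homI)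
    show "f x \<ominus>\<^bsub>B\<^esub> g x \<in> carrier B" if "x \<in> carrier A" for x using that f g by simp
    show "f (x \<oplus>\<^bsub>A\<^esub> y) \<ominus>\<^bsub>B\<^esub> g (x \<oplus>\<^bsub>A\<^esub> y) = f x \<ominus>\<^bsub>B\<^esub> g x \<oplus>\<^bsub>B\<^esub> (f y \<ominus>\<^bsub>B\<^esub> g y)"
      if "x \<in> carrier A" "y \<in> carrier A" for x y
      using that f g by (simp add: a_minus_def B.A.minus_add B.A.a_ac)
    show "f (r \<odot>\<^bsub>A\<^esub> x) \<ominus>\<^bsub>B\<^esub> g (r \<odot>\<^bsub>A\<^esub> x) = r \<odot>\<^bsub>B\<^esub> (f x \<ominus>\<^bsub>B\<^esub> g x)"
      if "r \<in> carrier R" "x \<in> carrier A" for r x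
      using that f g by (simp add: a_minus_def B.smult_add neg)
  qed
qed

lemma mod_hom_diff:
  assumes "right_module R M" "right_module R N" and h: "h \<in> mod_hom R M N" and xy: "x \<in> carrier M" "y \<in> carrier M"
  shows "h (x \<ominus>\<^bsub>M\<^esub> y) = h x \<ominus>\<^bsub>N\<^esub> h y"
proof -
  interpret M: right_module R M by fact
  interpret N: right_module R N by fact
  note h = mod_homD[OF h]
  have c: "x \<ominus>\<^bsub>M\<^esub> y \<in> carrier M" using xy by simp
  have "x = (x \<ominus>\<^bsub>M\<^esub> y) \<oplus>\<^bsub>M\<^esub> y" using xy by (simp add: a_minus_def M.A.a_assoc M.A.l_neg)
  then have "h x = h (x \<ominus>\<^bsub>M\<^esub> y) \<oplus>\<^bsub>N\<^esub> h y" using h(2)[OF c xy(2)] by simp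
  then show ?thesis using h(1)[OF c] h(1)[OF xy(2)] by (simp add: a_minus_def N.A.a_assoc N.A.r_neg)
qed

lemma (in ring) single_smult:
  "r \<in> carrier R \<Longrightarrow> s \<in> carrier R \<Longrightarrow> (\<lambda>b. single R x s b \<otimes> r) = single R x (s \<otimes> r)"
  by (auto simp: single_def)

lemma (in abelian_group) a_group_group: "group (add_monoid G)"
  by (rule comm_group.axioms(2)[OF a_comm_group])

context right_module
begin

lemma mod_hom_group_hom:
  "h \<in> mod_hom R (free_right_module R X) A \<Longrightarrow> h \<in> hom (comb_group R X) (add_monoid A)"
  by (rule homI) (simp_all add: mod_hom_def Pi_iff)

lemma free_ext:
  assumes e: "\<And>x. x \<in> X \<Longrightarrow> e x \<in> carrier A"
  shows "\<exists>h\<in>mod_hom R (free_right_module R X) A. \<forall>x\<in>X. h (single R x \<one>\<^bsub>R\<^esub>) = e x"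
proof -
  define h where "h = comb_ext (add_monoid A) R (\<lambda>x r. r \<odot>\<^bsub>A\<^esub> e x)"
  have H: "comm_group (add_monoid A)" by (rule A.a_comm_group)
  have c1: "x \<in> X \<Longrightarrow> r \<in> carrier R \<Longrightarrow> r \<odot>\<^bsub>A\<^esub> e x \<in> carrier (add_monoid A)" for x r
    using e smult_closed by simp
  have c2: "x \<in> X \<Longrightarrow> r \<in> carrier R \<Longrightarrow> s \<in> carrier R \<Longrightarrow>
    (r \<oplus>\<^bsub>R\<^esub> s) \<odot>\<^bsub>A\<^esub> e x = (r \<odot>\<^bsub>A\<^esub> e x) \<otimes>\<^bsub>add_monoid A\<^esub> (s \<odot>\<^bsub>A\<^esub> e x)" for x r s
    using e smult_add_scalar by simp
  have hom: "h \<in> hom (comb_group R X) (add_monoid A)" unfolding h_def by (rule R.comb_ext_hom[OF H c1 c2])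
  have s: "h (single R x r) = r \<odot>\<^bsub>A\<^esub> e x" if "x \<in> X" "r \<in> carrier R" for x r
    unfolding h_def by (rule R.comb_ext_single[OF H c1 c2 that])
  interpret F: right_module R "free_right_module R X" by (rule right_module_free_right_module) (rule R.ring_axioms)
  have "h \<in> mod_hom R (free_right_module R X) A"
  proof (rule mod_homI)
    show "h c \<in> carrier A" if "c \<in> carrier (free_right_module R X)" for c
      using hom_in_carrier[OF hom, of c] that by simp
    show "h (c \<oplus>\<^bsub>free_right_module R X\<^esub> d) = h c \<oplus>\<^bsub>A\<^esub> h d"
      if "c \<in> carrier (free_right_module R X)" "d \<in> carrier (free_right_module R X)" for c d
      using hom_mult[OF hom, of c d] that by simp
    fix r c assume r: "r \<in> carrier R" and c: "c \<in> carrier (free_right_module R X)"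
    show "h (r \<odot>\<^bsub>free_right_module R X\<^esub> c) = r \<odot>\<^bsub>A\<^esub> h c"
    proof (rule R.comb_hom_eq[where f = "\<lambda>c. h (r \<odot>\<^bsub>free_right_module R X\<^esub> c)" and g = "\<lambda>c. r \<odot>\<^bsub>A\<^esub> h c"
          and X = X, OF A.a_group_group])
      have cl: "(\<lambda>b. c b \<otimes>\<^bsub>R\<^esub> r) \<in> fin_combs R X" if "c \<in> fin_combs R X" for c
        using F.smult_closed[OF r, of c] that by simp
      show "(\<lambda>c. h (r \<odot>\<^bsub>free_right_module R X\<^esub> c)) \<in> hom (comb_group R X) (add_monoid A)"
      proof (rule homI)
        show "h (r \<odot>\<^bsub>free_right_module R X\<^esub> c) \<in> carrier (add_monoid A)" if "c \<in> carrier (comb_group R X)" for c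
          using hom_in_carrier[OF hom, of "\<lambda>b. c b \<otimes>\<^bsub>R\<^esub> r"] cl that by simp
        show "h (r \<odot>\<^bsub>free_right_module R X\<^esub> (c \<otimes>\<^bsub>comb_group R X\<^esub> d)) =
          h (r \<odot>\<^bsub>free_right_module R X\<^esub> c) \<otimes>\<^bsub>add_monoid A\<^esub> h (r \<odot>\<^bsub>free_right_module R X\<^esub> d)"
          if "c \<in> carrier (comb_group R X)" "d \<in> carrier (comb_group R X)" for c d
          using F.smult_add[OF r, of c d] hom_mult[OF hom, of "\<lambda>b. c b \<otimes>\<^bsub>R\<^esub> r" "\<lambda>b. d b \<otimes>\<^bsub>R\<^esub> r"] cl that
          by simp
      qed
      show "(\<lambda>c. r \<odot>\<^bsub>A\<^esub> h c) \<in> hom (comb_group R X) (add_monoid A)"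
      proof (rule homI)
        show "r \<odot>\<^bsub>A\<^esub> h c \<in> carrier (add_monoid A)" if "c \<in> carrier (comb_group R X)" for c
          using hom_in_carrier[OF hom that] smult_closed[OF r] by simp
        show "r \<odot>\<^bsub>A\<^esub> h (c \<otimes>\<^bsub>comb_group R X\<^esub> d) = (r \<odot>\<^bsub>A\<^esub> h c) \<otimes>\<^bsub>add_monoid A\<^esub> (r \<odot>\<^bsub>A\<^esub> h d)"
          if "c \<in> carrier (comb_group R X)" "d \<in> carrier (comb_group R X)" for c d
          using hom_in_carrier[OF hom that(1)] hom_in_carrier[OF hom that(2)] hom_mult[OF hom that] smult_add[OF r] by simp
      qed
      show "h (r \<odot>\<^bsub>free_right_module R X\<^esub> single R x t) = r \<odot>\<^bsub>A\<^esub> h (single R x t)"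
        if "x \<in> X" "t \<in> carrier R" for x t
      proof -
        have "r \<odot>\<^bsub>free_right_module R X\<^esub> single R x t = single R x (t \<otimes>\<^bsub>R\<^esub> r)"
          using R.single_smult[OF r that(2)] by simp
        then show ?thesis using s[OF that] s[of x "t \<otimes>\<^bsub>R\<^esub> r"] that r e smult_mult by simp
      qed
      show "c \<in> fin_combs R X" using c by simp
    qed
  qed
  moreover have "h (single R x \<one>\<^bsub>R\<^esub>) = e x" if "x \<in> X" for x using s[OF that] e[OF that] smult_one by simp
  ultimately show ?thesis by blast
qed

lemma mod_hom_single:
  assumes "h \<in> mod_hom R (free_right_module R X) A" "x \<in> X" "r \<in> carrier R"
  shows "h (single R x r) = r \<odot>\<^bsub>A\<^esub> h (single R x \<one>\<^bsub>R\<^esub>)"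
proof -
  have "single R x r = r \<odot>\<^bsub>free_right_module R X\<^esub> single R x \<one>\<^bsub>R\<^esub>"
    using assms(3) R.single_smult[of r "\<one>\<^bsub>R\<^esub>" x] by simp
  moreover have "single R x \<one>\<^bsub>R\<^esub> \<in> carrier (free_right_module R X)" using R.single_fin_combs[OF assms(2)] by simp
  ultimately show ?thesis using mod_homD(3)[OF assms(1,3)] by metis
qed

lemma mod_hom_eqI:
  assumes "h \<in> mod_hom R (free_right_module R X) A" "g \<in> mod_hom R (free_right_module R X) A"
    and "\<And>x. x \<in> X \<Longrightarrow> h (single R x \<one>\<^bsub>R\<^esub>) = g (single R x \<one>\<^bsub>R\<^esub>)" "c \<in> fin_combs R X"
  shows "h c = g c"
proof (rule R.comb_hom_eq[OF A.a_group_group mod_hom_group_hom[OF assms(1)] mod_hom_group_hom[OF assms(2)] _ assms(4)])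
  fix x r assume x: "x \<in> X" "r \<in> carrier R"
  show "h (single R x r) = g (single R x r)"
    unfolding mod_hom_single[OF assms(1) x] mod_hom_single[OF assms(2) x] assms(3)[OF x(1)] ..
qed

text \<open>Free modules are projective: lift the images of the basis elements and extend.\<close>

lemma free_lift:
  assumes h: "h \<in> mod_hom R (free_right_module R X) A" and B: "right_module R B" and g: "g \<in> mod_hom R B A"
    and im: "\<And>c. c \<in> fin_combs R X \<Longrightarrow> h c \<in> g ` carrier B"
  shows "\<exists>k\<in>mod_hom R (free_right_module R X) B. \<forall>c\<in>fin_combs R X. g (k c) = h c"
proof -
  interpret B: right_module R B by fact
  have "\<forall>x\<in>X. \<exists>b\<in>carrier B. g b = h (single R x \<one>\<^bsub>R\<^esub>)"
    using im R.single_fin_combs R.one_closed by (metis imageE)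
  then obtain e where e: "\<And>x. x \<in> X \<Longrightarrow> e x \<in> carrier B \<and> g (e x) = h (single R x \<one>\<^bsub>R\<^esub>)" by metis
  obtain k where k: "k \<in> mod_hom R (free_right_module R X) B" "\<And>x. x \<in> X \<Longrightarrow> k (single R x \<one>\<^bsub>R\<^esub>) = e x"
    using B.free_ext[of X e] e by blast
  have "g (k c) = h c" if "c \<in> fin_combs R X" for c
    by (rule mod_hom_eqI[OF mod_hom_comp[OF k(1) g] h _ that]) (use e k in simp)
  then show ?thesis using k(1) by blast
qed

end

text \<open>Degree 0 uses the augmentation, so that exactness of the augmented complex takes the
  same form in all degrees.\<close>

definition cycles :: "('r, 'x) ring_scheme \<Rightarrow> (nat \<Rightarrow> 'b set) \<Rightarrow> (nat \<Rightarrow> ('b \<Rightarrow> 'r) \<Rightarrow> 'b \<Rightarrow> 'r)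
    \<Rightarrow> ('r, 'a, 'y) module_scheme \<Rightarrow> (('b \<Rightarrow> 'r) \<Rightarrow> 'a) \<Rightarrow> nat \<Rightarrow> ('b \<Rightarrow> 'r) set" where
  "cycles R X d A \<epsilon> n = {c \<in> fin_combs R (X n). case n of 0 \<Rightarrow> \<epsilon> c = \<zero>\<^bsub>A\<^esub> | Suc m \<Rightarrow> d n c = (\<lambda>b. \<zero>\<^bsub>R\<^esub>)}"

lemma free_resolutionD:
  assumes "free_resolution R A X d \<epsilon>"
  shows "\<epsilon> \<in> mod_hom R (free_right_module R (X 0)) A" "\<epsilon> ` fin_combs R (X 0) = carrier A"
    "d (Suc n) \<in> free_map R (X (Suc n)) (X n)"
    "d (Suc n) ` fin_combs R (X (Suc n)) = cycles R X d A \<epsilon> n"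
proof -
  note X = assms[unfolded free_resolution_def Let_def free_right_module_simps]
  show "\<epsilon> \<in> mod_hom R (free_right_module R (X 0)) A" "\<epsilon> ` fin_combs R (X 0) = carrier A"
    "d (Suc n) \<in> free_map R (X (Suc n)) (X n)"
    using X by auto
  show "d (Suc n) ` fin_combs R (X (Suc n)) = cycles R X d A \<epsilon> n"
    using X by (cases n) (simp_all add: cycles_def)
qed

text \<open>The comparison theorem. The invariant of the recursion is that cycles go to cycles;
  exactness of the target then allows the composite with the differential to be lifted in the next
  degree.\<close>

lemma resolution_map_exists:
  assumes R: "ring R" and A: "right_module R A"
    and X: "free_resolution R A X d \<epsilon>" and Y: "free_resolution R A Y d' \<epsilon>'"
  shows "\<exists>f. (\<forall>n. f n \<in> free_map R (X n) (Y n)) \<and>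
    (\<forall>c\<in>fin_combs R (X 0). \<epsilon>' (f 0 c) = \<epsilon> c) \<and>
    (\<forall>n. \<forall>c\<in>fin_combs R (X (Suc n)). d' (Suc n) (f (Suc n) c) = f n (d (Suc n) c))"
proof -
  interpret A: right_module R A by fact
  have F: "right_module R (free_right_module R Z)" for Z :: "'z set"
    by (rule right_module_free_right_module[OF R])
  note X = free_resolutionD[OF X] and Y = free_resolutionD[OF Y]
  define P where "P n f \<longleftrightarrow> f \<in> free_map R (X n) (Y n) \<and>
    (\<forall>c\<in>cycles R X d A \<epsilon> n. f c \<in> cycles R Y d' A \<epsilon>' n) \<and> (n = 0 \<longrightarrow> (\<forall>c\<in>fin_combs R (X 0). \<epsilon>' (f c) = \<epsilon> c))" for n f
  define Q where "Q n f g \<longleftrightarrow> (\<forall>c\<in>fin_combs R (X (Suc n)). d' (Suc n) (g c) = f (d (Suc n) c))" for n f g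
  have "\<exists>f. \<forall>n. P n (f n) \<and> Q n (f n) (f (Suc n))"
  proof (rule dependent_nat_choice)
    have "\<epsilon> c \<in> \<epsilon>' ` carrier (free_right_module R (Y 0))" if "c \<in> fin_combs R (X 0)" for c
      using X(2) Y(2) that by auto
    from A.free_lift[OF X(1) F Y(1) this] obtain f where
      f: "f \<in> free_map R (X 0) (Y 0)" "\<forall>c\<in>fin_combs R (X 0). \<epsilon>' (f c) = \<epsilon> c"
      by blast
    then have "P 0 f" using mod_homD(1)[OF f(1)] by (auto simp: P_def cycles_def)
    then show "\<exists>f. P 0 f" by blast
  next
    fix f n assume "P n f"
    then have f: "f \<in> free_map R (X n) (Y n)"
      "\<And>c. c \<in> cycles R X d A \<epsilon> n \<Longrightarrow> f c \<in> cycles R Y d' A \<epsilon>' n" by (auto simp: P_def)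
    interpret FY: right_module R "free_right_module R (Y n)" by (rule F)
    have "f (d (Suc n) c) \<in> d' (Suc n) ` carrier (free_right_module R (Y (Suc n)))" if "c \<in> fin_combs R (X (Suc n))" for c
      using f(2)[of "d (Suc n) c"] X(4)[of n] Y(4)[of n] that by auto
    from FY.free_lift[OF mod_hom_comp[OF X(3) f(1)] F Y(3) this] obtain g where
      g: "g \<in> free_map R (X (Suc n)) (Y (Suc n))"
      "\<forall>c\<in>fin_combs R (X (Suc n)). d' (Suc n) (g c) = f (d (Suc n) c)" by blast
    have "f (\<lambda>b. \<zero>\<^bsub>R\<^esub>) = (\<lambda>b. \<zero>\<^bsub>R\<^esub>)" using mod_hom_zero[OF F F f(1)] by simp
    then have "P (Suc n) g" using g mod_homD(1)[OF g(1)] by (auto simp: P_def cycles_def)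
    then show "\<exists>g. P (Suc n) g \<and> Q n f g" using g(2) by (auto simp: Q_def)
  qed
  then obtain f where f: "\<And>n. P n (f n)" "\<And>n. Q n (f n) (f (Suc n))" by blast
  show ?thesis
    using f(1)[unfolded P_def] f(2)[unfolded Q_def] by (intro exI[of _ f]) simp
qed

text \<open>Both \<open>f\<close> and the identity lift the identity of \<open>A\<close>. If
  \<open>d (s c) = c - f c\<close> holds on cycles, then \<open>c - f c - s (d c)\<close> is a cycle
  one degree higher and can be lifted along the differential.\<close>

lemma resolution_homotopy_exists:
  assumes R: "ring R" and A: "right_module R A" and X: "free_resolution R A X d \<epsilon>"
    and f: "\<And>n. f n \<in> free_map R (X n) (X n)"
      "\<And>c. c \<in> fin_combs R (X 0) \<Longrightarrow> \<epsilon> (f 0 c) = \<epsilon> c"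
      "\<And>n c. c \<in> fin_combs R (X (Suc n)) \<Longrightarrow> d (Suc n) (f (Suc n) c) = f n (d (Suc n) c)"
  shows "\<exists>s. (\<forall>n. s n \<in> free_map R (X n) (X (Suc n))) \<and>
    (\<forall>n. \<forall>c\<in>fin_combs R (X (Suc n)). c = (\<lambda>b. f (Suc n) c b \<oplus>\<^bsub>R\<^esub>
      (d (Suc (Suc n)) (s (Suc n) c) b \<oplus>\<^bsub>R\<^esub> s n (d (Suc n) c) b)))"
proof -
  interpret A: right_module R A by fact
  let ?F = "\<lambda>n. free_right_module R (X n)"
  have F: "right_module R (free_right_module R Z)" for Z :: "'z set"
    by (rule right_module_free_right_module[OF R])
  interpret F: right_module R "?F n" for n by (rule F)
  note X = free_resolutionD[OF X]
  have idF: "(\<lambda>c. c) \<in> mod_hom R (?F n) (?F n)" for n by (simp add: mod_hom_def)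
  define P where "P n s \<longleftrightarrow> s \<in> mod_hom R (?F n) (?F (Suc n)) \<and>
    (\<forall>c\<in>cycles R X d A \<epsilon> n. d (Suc n) (s c) = c \<ominus>\<^bsub>?F n\<^esub> f n c)" for n s
  define Q where "Q n s t \<longleftrightarrow> (\<forall>c\<in>fin_combs R (X (Suc n)).
    d (Suc (Suc n)) (t c) = (c \<ominus>\<^bsub>?F (Suc n)\<^esub> f (Suc n) c) \<ominus>\<^bsub>?F (Suc n)\<^esub> s (d (Suc n) c))" for n s t
  have "\<exists>s. \<forall>n. P n (s n) \<and> Q n (s n) (s (Suc n))"
  proof (rule dependent_nat_choice)
    have u: "(\<lambda>c. c \<ominus>\<^bsub>?F 0\<^esub> f 0 c) \<in> mod_hom R (?F 0) (?F 0)" by (rule mod_hom_minus[OF F F idF f(1)])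
    have im: "c \<ominus>\<^bsub>?F 0\<^esub> f 0 c \<in> d (Suc 0) ` carrier (?F (Suc 0))" if c: "c \<in> fin_combs R (X 0)" for c
    proof -
      have fc: "f 0 c \<in> fin_combs R (X 0)" using mod_homD(1)[OF f(1), of c 0] c by simp
      have "\<epsilon> (c \<ominus>\<^bsub>?F 0\<^esub> f 0 c) = \<epsilon> c \<ominus>\<^bsub>A\<^esub> \<epsilon> (f 0 c)" by (rule mod_hom_diff[OF F A X(1)]) (use c fc in simp_all)
      also have "\<dots> = \<zero>\<^bsub>A\<^esub>" using f(2)[OF c] mod_homD(1)[OF X(1), of c] c by (simp add: a_minus_def A.A.r_neg)
      finally have "c \<ominus>\<^bsub>?F 0\<^esub> f 0 c \<in> cycles R X d A \<epsilon> 0"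
        using F.A.minus_closed[of c 0 "f 0 c"] c fc by (simp add: cycles_def)
      then show ?thesis using X(4)[of 0] by simp
    qed
    from F.free_lift[OF u F X(3) im] obtain s where
      "s \<in> mod_hom R (?F 0) (?F (Suc 0))" "\<forall>c\<in>fin_combs R (X 0). d (Suc 0) (s c) = c \<ominus>\<^bsub>?F 0\<^esub> f 0 c" by blast
    then have "P 0 s" by (auto simp: P_def cycles_def)
    then show "\<exists>s. P 0 s" by blast
  next
    fix s n assume "P n s"
    then have s: "s \<in> mod_hom R (?F n) (?F (Suc n))"
      "\<And>c. c \<in> cycles R X d A \<epsilon> n \<Longrightarrow> d (Suc n) (s c) = c \<ominus>\<^bsub>?F n\<^esub> f n c" by (auto simp: P_def)
    let ?u = "\<lambda>c. (c \<ominus>\<^bsub>?F (Suc n)\<^esub> f (Suc n) c) \<ominus>\<^bsub>?F (Suc n)\<^esub> s (d (Suc n) c)"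
    have u: "?u \<in> mod_hom R (?F (Suc n)) (?F (Suc n))"
      by (rule mod_hom_minus[OF F F mod_hom_minus[OF F F idF f(1)] mod_hom_comp[OF X(3) s(1)]])
    have im: "?u c \<in> d (Suc (Suc n)) ` carrier (?F (Suc (Suc n)))" if c: "c \<in> fin_combs R (X (Suc n))" for c
    proof -
      have fc: "f (Suc n) c \<in> fin_combs R (X (Suc n))" using mod_homD(1)[OF f(1), of c "Suc n"] c by simp
      have dc: "d (Suc n) c \<in> cycles R X d A \<epsilon> n" using X(4)[of n] c by blast
      then have dcF: "d (Suc n) c \<in> fin_combs R (X n)" by (simp add: cycles_def)
      have sd: "s (d (Suc n) c) \<in> fin_combs R (X (Suc n))" using mod_homD(1)[OF s(1), of "d (Suc n) c"] dcF by simp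
      have fd: "f n (d (Suc n) c) \<in> fin_combs R (X n)" using mod_homD(1)[OF f(1), of "d (Suc n) c" n] dcF by simp
      have m: "c \<ominus>\<^bsub>?F (Suc n)\<^esub> f (Suc n) c \<in> carrier (?F (Suc n))"
        using F.A.minus_closed[of c "Suc n" "f (Suc n) c"] c fc by simp
      have "d (Suc n) (?u c) = (d (Suc n) c \<ominus>\<^bsub>?F n\<^esub> d (Suc n) (f (Suc n) c)) \<ominus>\<^bsub>?F n\<^esub> d (Suc n) (s (d (Suc n) c))"
        using mod_hom_diff[OF F F X(3) m, of "s (d (Suc n) c)"] mod_hom_diff[OF F F X(3), of c n "f (Suc n) c"] c fc sd by simp
      also have "\<dots> = \<zero>\<^bsub>?F n\<^esub>"
        unfolding f(3)[OF c] s(2)[OF dc]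
        using F.A.r_neg[of "d (Suc n) c \<ominus>\<^bsub>?F n\<^esub> f n (d (Suc n) c)" n] F.A.minus_closed[of "d (Suc n) c" n "f n (d (Suc n) c)"] dcF fd
        by (simp only: a_minus_def free_right_module_simps(1))
      finally have "?u c \<in> cycles R X d A \<epsilon> (Suc n)"
        using mod_homD(1)[OF u, of c] c by (simp add: cycles_def)
      then show ?thesis using X(4)[of "Suc n"] by simp
    qed
    from F.free_lift[OF u F X(3) im] obtain t where
      t: "t \<in> mod_hom R (?F (Suc n)) (?F (Suc (Suc n)))" "\<forall>c\<in>fin_combs R (X (Suc n)). d (Suc (Suc n)) (t c) = ?u c" by blast
    have "P (Suc n) t"
      unfolding P_def
    proof (intro conjI t(1) ballI)
      fix c assume "c \<in> cycles R X d A \<epsilon> (Suc n)"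
      then have c: "c \<in> fin_combs R (X (Suc n))" "d (Suc n) c = \<zero>\<^bsub>?F n\<^esub>" by (auto simp: cycles_def)
      have fc: "f (Suc n) c \<in> fin_combs R (X (Suc n))" using mod_homD(1)[OF f(1), of c "Suc n"] c by simp
      have m: "c \<ominus>\<^bsub>?F (Suc n)\<^esub> f (Suc n) c \<in> carrier (?F (Suc n))"
        using F.A.minus_closed[of c "Suc n" "f (Suc n) c"] c fc by simp
      have nz: "\<ominus>\<^bsub>?F (Suc n)\<^esub> \<zero>\<^bsub>?F (Suc n)\<^esub> = \<zero>\<^bsub>?F (Suc n)\<^esub>"
        using F.A.r_neg[of "\<zero>\<^bsub>?F (Suc n)\<^esub>" "Suc n"] F.A.l_zero[of "\<ominus>\<^bsub>?F (Suc n)\<^esub> \<zero>\<^bsub>?F (Suc n)\<^esub>" "Suc n"]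
          F.A.zero_closed[of "Suc n"] F.A.a_inv_closed[of "\<zero>\<^bsub>?F (Suc n)\<^esub>" "Suc n"] by metis
      have "?u c = (c \<ominus>\<^bsub>?F (Suc n)\<^esub> f (Suc n) c) \<ominus>\<^bsub>?F (Suc n)\<^esub> \<zero>\<^bsub>?F (Suc n)\<^esub>"
        using mod_hom_zero[OF F F s(1)] c(2) by simp
      also have "\<dots> = c \<ominus>\<^bsub>?F (Suc n)\<^esub> f (Suc n) c"
        using m nz by (simp only: a_minus_def F.A.r_zero)
      finally show "d (Suc (Suc n)) (t c) = c \<ominus>\<^bsub>?F (Suc n)\<^esub> f (Suc n) c" using t(2) c(1) by simp
    qed
    then show "\<exists>t. P (Suc n) t \<and> Q n s t" using t(2) by (auto simp: Q_def)
  qed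
  then obtain s where s: "\<And>n. P n (s n)" "\<And>n. Q n (s n) (s (Suc n))" by blast
  have "c = (\<lambda>b. f (Suc n) c b \<oplus>\<^bsub>R\<^esub> (d (Suc (Suc n)) (s (Suc n) c) b \<oplus>\<^bsub>R\<^esub> s n (d (Suc n) c) b))"
    if c: "c \<in> fin_combs R (X (Suc n))" for n c
  proof -
    let ?G = "?F (Suc n)"
    have sn: "s n \<in> mod_hom R (?F n) ?G" using s(1)[of n] by (simp add: P_def)
    have fc: "f (Suc n) c \<in> carrier ?G" using mod_homD(1)[OF f(1), of c "Suc n"] c by simp
    have "d (Suc n) c \<in> carrier (?F n)" using mod_homD(1)[OF X(3), of c n] c by simp
    then have sd: "s n (d (Suc n) c) \<in> carrier ?G" using mod_homD(1)[OF sn] by simp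
    have c': "c \<in> carrier ?G" using c by simp
    have "f (Suc n) c \<oplus>\<^bsub>?G\<^esub> (d (Suc (Suc n)) (s (Suc n) c) \<oplus>\<^bsub>?G\<^esub> s n (d (Suc n) c)) =
      f (Suc n) c \<oplus>\<^bsub>?G\<^esub> (((c \<ominus>\<^bsub>?G\<^esub> f (Suc n) c) \<ominus>\<^bsub>?G\<^esub> s n (d (Suc n) c)) \<oplus>\<^bsub>?G\<^esub> s n (d (Suc n) c))"
      using s(2)[of n] c by (simp add: Q_def)
    also have "\<dots> = c"
      using fc sd c' F.A.a_ac[of _ "Suc n"] F.A.r_neg[of _ "Suc n"] F.A.l_neg[of _ "Suc n"] F.A.a_inv_closed[of _ "Suc n"] F.A.a_closed[of _ "Suc n"] F.A.r_zero[of _ "Suc n"]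
      by (simp only: a_minus_def F.A.a_assoc)
    finally show ?thesis by simp
  qed
  then show ?thesis using s(1) unfolding P_def by blast
qed

section \<open>Tensor products with free modules\<close>

text \<open>The image of \<open>p \<otimes> b\<close> when the tensor product of a free right module
  with \<open>B\<close> is identified with combinations of its basis with coefficients in
  \<open>B\<close>.\<close>

definition lact :: "('r, 'b, 'z) module_scheme \<Rightarrow> ('y \<Rightarrow> 'r) \<Rightarrow> 'b \<Rightarrow> 'y \<Rightarrow> 'b" where
  "lact B p b = (\<lambda>y. p y \<odot>\<^bsub>B\<^esub> b)"

text \<open>\<open>h \<otimes> id\<close> under the identification behind \<open>lact\<close>,
  prescribed by the values of \<open>h\<close> on basis elements.\<close>

definition base_change :: "('r, 'x) ring_scheme \<Rightarrow> ('r, 'b, 'z) module_scheme \<Rightarrow> 'w set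
    \<Rightarrow> (('y \<Rightarrow> 'r) \<Rightarrow> 'w \<Rightarrow> 'r) \<Rightarrow> ('y \<Rightarrow> 'b) \<Rightarrow> 'w \<Rightarrow> 'b" where
  "base_change R B Y h = comb_ext (comb_group B Y) B (\<lambda>x b. lact B (h (single R x \<one>\<^bsub>R\<^esub>)) b)"

text \<open>Exactness in degree \<open>Suc n\<close>, which is the vanishing of Tor in that degree
  once \<open>X\<close> and \<open>d\<close> come from a free resolution.\<close>

definition base_change_exact :: "('r, 'x) ring_scheme \<Rightarrow> ('r, 'b, 'z) module_scheme \<Rightarrow> (nat \<Rightarrow> 'w set)
    \<Rightarrow> (nat \<Rightarrow> ('w \<Rightarrow> 'r) \<Rightarrow> 'w \<Rightarrow> 'r) \<Rightarrow> nat \<Rightarrow> bool" where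
  "base_change_exact R B X d n \<longleftrightarrow> (\<forall>c\<in>fin_combs B (X (Suc n)).
    base_change R B (X n) (d (Suc n)) c = (\<lambda>y. \<zero>\<^bsub>B\<^esub>) \<longrightarrow>
    c \<in> base_change R B (X (Suc n)) (d (Suc (Suc n))) ` fin_combs B (X (Suc (Suc n))))"

context left_module
begin

lemma smult_zero_scalar: "x \<in> carrier A \<Longrightarrow> \<zero>\<^bsub>R\<^esub> \<odot>\<^bsub>A\<^esub> x = \<zero>\<^bsub>A\<^esub>"
  using smult_add_scalar[of "\<zero>\<^bsub>R\<^esub>" "\<zero>\<^bsub>R\<^esub>" x] smult_closed[of "\<zero>\<^bsub>R\<^esub>" x]
  by (metis A.add.l_cancel_one' R.zero_closed R.l_zero)

lemma lact_closed: "p \<in> fin_combs R Y \<Longrightarrow> b \<in> carrier A \<Longrightarrow> lact A p b \<in> fin_combs A Y"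
proof (rule A.fin_combsI)
  assume p: "p \<in> fin_combs R Y" and b: "b \<in> carrier A"
  show "finite (supp R p)" using fin_combs_supp[OF p] by blast
  show "lact A p b y = \<zero>\<^bsub>A\<^esub>" if "y \<notin> supp R p" for y
    using that b by (simp add: lact_def supp_def smult_zero_scalar)
  show "lact A p b y = \<zero>\<^bsub>A\<^esub>" if "y \<notin> Y" for y
    using fin_combs_outside[OF p that] b by (simp add: lact_def smult_zero_scalar)
  show "lact A p b y \<in> carrier A" for y
    using R.fin_combs_closed[OF p] b by (simp add: lact_def smult_closed)
qed

lemma lact_add: "p \<in> fin_combs R Y \<Longrightarrow> b \<in> carrier A \<Longrightarrow> c \<in> carrier A \<Longrightarrow>
    lact A p (b \<oplus>\<^bsub>A\<^esub> c) = (\<lambda>y. lact A p b y \<oplus>\<^bsub>A\<^esub> lact A p c y)"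
  using R.fin_combs_closed[of p Y] by (simp add: lact_def smult_add)

lemma lact_add_left: "p \<in> fin_combs R Y \<Longrightarrow> q \<in> fin_combs R Y \<Longrightarrow> b \<in> carrier A \<Longrightarrow>
    lact A (\<lambda>y. p y \<oplus>\<^bsub>R\<^esub> q y) b = (\<lambda>y. lact A p b y \<oplus>\<^bsub>A\<^esub> lact A q b y)"
  using R.fin_combs_closed[of p Y] R.fin_combs_closed[of q Y] by (simp add: lact_def smult_add_scalar)

lemma lact_single: "b \<in> carrier A \<Longrightarrow> lact A (single R x r) b = single A x (r \<odot>\<^bsub>A\<^esub> b)"
  by (auto simp: lact_def single_def smult_zero_scalar)

lemma lact_smult: "p \<in> fin_combs R Y \<Longrightarrow> r \<in> carrier R \<Longrightarrow> b \<in> carrier A \<Longrightarrow>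
    lact A (\<lambda>y. p y \<otimes>\<^bsub>R\<^esub> r) b = lact A p (r \<odot>\<^bsub>A\<^esub> b)"
  using R.fin_combs_closed[of p Y] by (simp add: lact_def smult_mult)

lemma lact_hom: "b \<in> carrier A \<Longrightarrow> (\<lambda>p. lact A p b) \<in> hom (comb_group R Y) (comb_group A Y)"
  by (rule homI) (simp_all add: lact_closed lact_add_left)

lemma free_map_single: "h \<in> free_map R X Y \<Longrightarrow> x \<in> X \<Longrightarrow> r \<in> carrier R \<Longrightarrow> h (single R x r) \<in> fin_combs R Y"
  using mod_homD(1)[of h R "free_right_module R X" "free_right_module R Y" "single R x r"] R.single_fin_combs[of x X r] by simp

lemma base_change_hom:
  assumes "h \<in> free_map R X Y"
  shows "base_change R A Y h \<in> hom (comb_group A X) (comb_group A Y)"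
  unfolding base_change_def
  by (rule A.comb_ext_hom[OF A.comm_group_comb])
    (use lact_closed[OF free_map_single[OF assms _ R.one_closed]] lact_add[OF free_map_single[OF assms _ R.one_closed]] in simp_all)

lemma base_change_single:
  assumes "h \<in> free_map R X Y" "x \<in> X" "b \<in> carrier A"
  shows "base_change R A Y h (single A x b) = lact A (h (single R x \<one>\<^bsub>R\<^esub>)) b"
  unfolding base_change_def
  by (rule A.comb_ext_single[OF A.comm_group_comb, of X])
    (use lact_closed[OF free_map_single[OF assms(1) _ R.one_closed]] lact_add[OF free_map_single[OF assms(1) _ R.one_closed]] assms in simp_all)

text \<open>It is enough to take \<open>p\<close> supported at one basis element; there linearity of
  \<open>h\<close> moves the scalar across the tensor sign to \<open>b\<close>.\<close>

lemma base_change_lact: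
  assumes h: "h \<in> free_map R X Y" and b: "b \<in> carrier A" and p: "p \<in> fin_combs R X"
  shows "base_change R A Y h (lact A p b) = lact A (h p) b"
proof -
  have F: "right_module R (free_right_module R Y)"
    by (rule right_module_free_right_module) (rule R.ring_axioms)
  interpret F: right_module R "free_right_module R Y" by (rule F)
  have hh: "h \<in> hom (comb_group R X) (comb_group R Y)"
    by (rule homI) (use mod_homD(1,2)[OF h] in simp_all)
  interpret Y: comm_group "comb_group A Y" by (rule A.comm_group_comb)
  have "(base_change R A Y h \<circ> (\<lambda>p. lact A p b)) p = ((\<lambda>p. lact A p b) \<circ> h) p"
  proof (rule R.comb_hom_eq[OF Y.is_group hom_compose[OF lact_hom[OF b] base_change_hom[OF h]] hom_compose[OF hh lact_hom[OF b]] _ p])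
    fix x r assume x: "x \<in> X" and r: "r \<in> carrier R"
    have rb: "r \<odot>\<^bsub>A\<^esub> b \<in> carrier A" using r b by (rule smult_closed)
    have "h (single R x r) = (\<lambda>y. h (single R x \<one>\<^bsub>R\<^esub>) y \<otimes>\<^bsub>R\<^esub> r)"
      using F.mod_hom_single[OF h x r] by simp
    then show "(base_change R A Y h \<circ> (\<lambda>p. lact A p b)) (single R x r) = ((\<lambda>p. lact A p b) \<circ> h) (single R x r)"
      using lact_smult[OF free_map_single[OF h x R.one_closed] r b]
      by (simp add: lact_single b base_change_single[OF h x rb])
  qed
  then show ?thesis by simp
qed

lemma base_change_eq:
  assumes f: "f \<in> hom (comb_group A X) (comb_group A Y)" and g: "g \<in> hom (comb_group A X) (comb_group A Y)"
    and "\<And>x b. x \<in> X \<Longrightarrow> b \<in> carrier A \<Longrightarrow> f (single A x b) = g (single A x b)" "c \<in> fin_combs A X"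
  shows "f c = g c"
  using A.comb_hom_eq[OF A.group_comb f g assms(3,4)] .

lemma base_change_comp:
  assumes h: "h \<in> free_map R X Y" and g: "g \<in> free_map R Y Z" and c: "c \<in> fin_combs A X"
  shows "base_change R A Z g (base_change R A Y h c) = base_change R A Z (\<lambda>x. g (h x)) c"
proof -
  have gh: "(\<lambda>x. g (h x)) \<in> free_map R X Z" by (rule mod_hom_comp[OF h g])
  have "(base_change R A Z g \<circ> base_change R A Y h) c = base_change R A Z (\<lambda>x. g (h x)) c"
    by (rule base_change_eq[OF hom_compose[OF base_change_hom[OF h] base_change_hom[OF g]] base_change_hom[OF gh] _ c])
      (use base_change_single[OF h] base_change_single[OF gh] base_change_lact[OF g] free_map_single[OF h] in simp)
  then show ?thesis by simp
qed

lemma base_change_cong: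
  assumes h: "h \<in> free_map R X Y" and g: "g \<in> free_map R X Y"
    and eq: "\<And>c. c \<in> fin_combs R X \<Longrightarrow> h c = g c" and c: "c \<in> fin_combs A X"
  shows "base_change R A Y h c = base_change R A Y g c"
  by (rule base_change_eq[OF base_change_hom[OF h] base_change_hom[OF g] _ c])
    (simp add: base_change_single[OF h] base_change_single[OF g] eq[OF R.single_fin_combs[OF _ R.one_closed]])

lemma base_change_zero: "h \<in> free_map R X Y \<Longrightarrow> base_change R A Y h (\<lambda>x. \<zero>\<^bsub>A\<^esub>) = (\<lambda>y. \<zero>\<^bsub>A\<^esub>)"
  using hom_one[OF base_change_hom A.group_comb A.group_comb] by simp

lemma base_change_zero_map:
  assumes h: "h \<in> free_map R X Y" and eq: "\<And>c. c \<in> fin_combs R X \<Longrightarrow> h c = (\<lambda>y. \<zero>\<^bsub>R\<^esub>)" and c: "c \<in> fin_combs A X"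
  shows "base_change R A Y h c = (\<lambda>y. \<zero>\<^bsub>A\<^esub>)"
proof -
  have "(\<lambda>c y. \<zero>\<^bsub>A\<^esub>) \<in> hom (comb_group A X) (comb_group A Y)"
    by (rule homI) (simp_all add: A.zero_fin_combs)
  from base_change_eq[OF base_change_hom[OF h] this _ c] show ?thesis
    by (simp add: base_change_single[OF h] eq[OF R.single_fin_combs[OF _ R.one_closed]] lact_def smult_zero_scalar)
qed

text \<open>With comparison maps \<open>f\<close> and \<open>g\<close> and a homotopy
  \<open>s\<close> from \<open>g \<circ> f\<close> to the identity: if the image under
  \<open>f\<close> of a cycle \<open>c\<close> is the boundary of \<open>y\<close>, then
  \<open>c\<close> is the boundary of \<open>g y + s c\<close>. The bases may have different types,
  as they do in the application: lists inside \<open>Tor\<close>, simplices in the bar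
  resolution.\<close>

lemma base_change_exact_transfer:
  assumes M: "right_module R M" and X: "free_resolution R M X d \<epsilon>" and Y: "free_resolution R M Y d' \<epsilon>'"
    and ex: "base_change_exact R A Y d' n"
  shows "base_change_exact R A X d n"
proof -
  have R: "ring R" by (rule R.ring_axioms)
  note dX = free_resolutionD(3)[OF X] and dY = free_resolutionD(3)[OF Y]
  obtain f where f: "\<And>n. f n \<in> free_map R (X n) (Y n)" "\<And>c. c \<in> fin_combs R (X 0) \<Longrightarrow> \<epsilon>' (f 0 c) = \<epsilon> c"
    "\<And>n c. c \<in> fin_combs R (X (Suc n)) \<Longrightarrow> d' (Suc n) (f (Suc n) c) = f n (d (Suc n) c)"
    using resolution_map_exists[OF R M X Y] by blast
  obtain g where g: "\<And>n. g n \<in> free_map R (Y n) (X n)" "\<And>c. c \<in> fin_combs R (Y 0) \<Longrightarrow> \<epsilon> (g 0 c) = \<epsilon>' c"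
    "\<And>n c. c \<in> fin_combs R (Y (Suc n)) \<Longrightarrow> d (Suc n) (g (Suc n) c) = g n (d' (Suc n) c)"
    using resolution_map_exists[OF R M Y X] by blast
  have fY: "f n c \<in> fin_combs R (Y n)" if "c \<in> fin_combs R (X n)" for n c
    using mod_homD(1)[OF f(1), of c] that by simp
  have dXc: "d (Suc n) c \<in> fin_combs R (X n)" if "c \<in> fin_combs R (X (Suc n))" for n c
    using mod_homD(1)[OF dX, of c n] that by simp
  have gf: "(\<lambda>c. g n (f n c)) \<in> free_map R (X n) (X n)" for n by (rule mod_hom_comp[OF f(1) g(1)])
  have "\<exists>s. (\<forall>n. s n \<in> free_map R (X n) (X (Suc n))) \<and>
    (\<forall>n. \<forall>c\<in>fin_combs R (X (Suc n)). c = (\<lambda>b. g (Suc n) (f (Suc n) c) b \<oplus>\<^bsub>R\<^esub>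
      (d (Suc (Suc n)) (s (Suc n) c) b \<oplus>\<^bsub>R\<^esub> s n (d (Suc n) c) b)))"
    by (rule resolution_homotopy_exists[OF R M X gf]) (use f g fY in simp_all)
  then obtain s where s: "\<And>n. s n \<in> free_map R (X n) (X (Suc n))"
    and hty: "\<And>n c. c \<in> fin_combs R (X (Suc n)) \<Longrightarrow> c = (\<lambda>b. g (Suc n) (f (Suc n) c) b \<oplus>\<^bsub>R\<^esub>
      (d (Suc (Suc n)) (s (Suc n) c) b \<oplus>\<^bsub>R\<^esub> s n (d (Suc n) c) b))" by blast
  let ?X = "\<lambda>n. base_change R A (X n)" and ?Y = "\<lambda>n. base_change R A (Y n)"
  have mem: "base_change R A V h c \<in> fin_combs A V" if "h \<in> free_map R U V" "c \<in> fin_combs A U"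
    for h c and U :: "'uu set" and V :: "'vv set"
    using hom_in_carrier[OF base_change_hom[OF that(1)], of c] that(2) by simp
  show ?thesis
    unfolding base_change_exact_def
  proof (intro ballI impI)
    fix c assume c: "c \<in> fin_combs A (X (Suc n))" and dc: "?X n (d (Suc n)) c = (\<lambda>y. \<zero>\<^bsub>A\<^esub>)"
    have fc: "?Y (Suc n) (f (Suc n)) c \<in> fin_combs A (Y (Suc n))" by (rule mem[OF f(1) c])
    have "?Y n (d' (Suc n)) (?Y (Suc n) (f (Suc n)) c) = ?Y n (\<lambda>c. d' (Suc n) (f (Suc n) c)) c"
      by (rule base_change_comp[OF f(1) dY c])
    also have "\<dots> = ?Y n (\<lambda>c. f n (d (Suc n) c)) c"
      by (rule base_change_cong[OF mod_hom_comp[OF f(1) dY] mod_hom_comp[OF dX f(1)] f(3) c])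
    also have "\<dots> = ?Y n (f n) (?X n (d (Suc n)) c)" by (rule base_change_comp[OF dX f(1) c, symmetric])
    also have "\<dots> = (\<lambda>y. \<zero>\<^bsub>A\<^esub>)" unfolding dc by (rule base_change_zero[OF f(1)])
    finally obtain y where y: "y \<in> fin_combs A (Y (Suc (Suc n)))" "?Y (Suc n) (f (Suc n)) c = ?Y (Suc n) (d' (Suc (Suc n))) y"
      using ex fc unfolding base_change_exact_def by blast
    have gy: "?X (Suc (Suc n)) (g (Suc (Suc n))) y \<in> fin_combs A (X (Suc (Suc n)))" by (rule mem[OF g(1) y(1)])
    have sc: "?X (Suc (Suc n)) (s (Suc n)) c \<in> fin_combs A (X (Suc (Suc n)))" by (rule mem[OF s c])
    have "?X (Suc n) (g (Suc n)) (?Y (Suc n) (f (Suc n)) c) = ?X (Suc n) (\<lambda>c. g (Suc n) (d' (Suc (Suc n)) c)) y"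
      unfolding y(2) by (rule base_change_comp[OF dY g(1) y(1)])
    also have "\<dots> = ?X (Suc n) (\<lambda>c. d (Suc (Suc n)) (g (Suc (Suc n)) c)) y"
      by (rule base_change_cong[OF mod_hom_comp[OF dY g(1)] mod_hom_comp[OF g(1) dX] g(3)[symmetric] y(1)])
    also have "\<dots> = ?X (Suc n) (d (Suc (Suc n))) (?X (Suc (Suc n)) (g (Suc (Suc n))) y)"
      by (rule base_change_comp[OF g(1) dX y(1), symmetric])
    finally have 1: "?X (Suc n) (g (Suc n)) (?Y (Suc n) (f (Suc n)) c) = \<dots>" .
    have 2: "?X (Suc n) (s n) (?X n (d (Suc n)) c) = (\<lambda>y. \<zero>\<^bsub>A\<^esub>)"
      unfolding dc by (rule base_change_zero[OF s])
    let ?G = "comb_group A (X (Suc n))"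
    interpret G: comm_group ?G by (rule A.comm_group_comb)
    let ?r = "\<lambda>c. ?X (Suc n) (g (Suc n)) (?Y (Suc n) (f (Suc n)) c) \<otimes>\<^bsub>?G\<^esub>
      (?X (Suc n) (d (Suc (Suc n))) (?X (Suc (Suc n)) (s (Suc n)) c) \<otimes>\<^bsub>?G\<^esub> ?X (Suc n) (s n) (?X n (d (Suc n)) c))"
    \<comment> \<open>The homotopy identity survives base change: on a one-point combination it is
      the original identity at a basis element, acting on \<open>b\<close>.\<close>
    have "c = ?r c"
    proof (rule base_change_eq[OF _ _ _ c, where f = "\<lambda>c. c" and g = ?r])
      show "(\<lambda>c. c) \<in> hom ?G ?G" by (simp add: hom_def)
      have h3: "(\<lambda>c. f1 c \<otimes>\<^bsub>?G\<^esub> (f2 c \<otimes>\<^bsub>?G\<^esub> f3 c)) \<in> hom ?G ?G"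
        if "f1 \<in> hom ?G ?G" "f2 \<in> hom ?G ?G" "f3 \<in> hom ?G ?G" for f1 f2 f3
      proof (rule homI)
        fix x y assume xy: "x \<in> carrier ?G" "y \<in> carrier ?G"
        note m = hom_mult[OF that(1) xy] hom_mult[OF that(2) xy] hom_mult[OF that(3) xy]
        note cl = hom_in_carrier[OF that(1)] hom_in_carrier[OF that(2)] hom_in_carrier[OF that(3)]
        show "f1 (x \<otimes>\<^bsub>?G\<^esub> y) \<otimes>\<^bsub>?G\<^esub> (f2 (x \<otimes>\<^bsub>?G\<^esub> y) \<otimes>\<^bsub>?G\<^esub> f3 (x \<otimes>\<^bsub>?G\<^esub> y)) =
          f1 x \<otimes>\<^bsub>?G\<^esub> (f2 x \<otimes>\<^bsub>?G\<^esub> f3 x) \<otimes>\<^bsub>?G\<^esub> (f1 y \<otimes>\<^bsub>?G\<^esub> (f2 y \<otimes>\<^bsub>?G\<^esub> f3 y))"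
          unfolding m using cl xy by (simp only: G.m_ac G.m_closed)
        show "f1 x \<otimes>\<^bsub>?G\<^esub> (f2 x \<otimes>\<^bsub>?G\<^esub> f3 x) \<in> carrier ?G"
          using cl[OF xy(1)] by (intro G.m_closed)
      qed
      show "?r \<in> hom ?G ?G"
        using hom_compose[OF base_change_hom[OF f(1)] base_change_hom[OF g(1)], of "Suc n"]
          hom_compose[OF base_change_hom[OF s] base_change_hom[OF dX], of "Suc n"]
          hom_compose[OF base_change_hom[OF dX] base_change_hom[OF s], of n]
        unfolding comp_def by (rule h3)
      fix x b assume x: "x \<in> X (Suc n)" and b: "b \<in> carrier A"
      have xs: "single R x \<one>\<^bsub>R\<^esub> \<in> fin_combs R (X (Suc n))" by (rule R.single_fin_combs[OF x R.one_closed])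
      have sm: "s n c \<in> fin_combs R (X (Suc n))" if "c \<in> fin_combs R (X n)" for n c
        using mod_homD(1)[OF s, of c n] that by simp
      have gm: "g n c \<in> fin_combs R (X n)" if "c \<in> fin_combs R (Y n)" for n c
        using mod_homD(1)[OF g(1), of c n] that by simp
      have "single A x b = lact A (single R x \<one>\<^bsub>R\<^esub>) b" by (simp add: lact_single b smult_one)
      also have "\<dots> = lact A (\<lambda>y. g (Suc n) (f (Suc n) (single R x \<one>\<^bsub>R\<^esub>)) y \<oplus>\<^bsub>R\<^esub>
        (d (Suc (Suc n)) (s (Suc n) (single R x \<one>\<^bsub>R\<^esub>)) y \<oplus>\<^bsub>R\<^esub> s n (d (Suc n) (single R x \<one>\<^bsub>R\<^esub>)) y)) b"
        using hty[OF xs] by simp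
      also have "\<dots> = ?r (single A x b)"
        using xs b by (simp add: base_change_single[OF f(1) x b] base_change_single[OF s x b] base_change_single[OF dX x b]
          base_change_lact[OF g(1) b] base_change_lact[OF dX b] base_change_lact[OF s b] fY dXc sm gm
          lact_add_left[of _ "X (Suc n)"] R.add_fin_combs)
      finally show "single A x b = ?r (single A x b)" .
    qed
    also have "\<dots> = ?X (Suc n) (d (Suc (Suc n))) (?X (Suc (Suc n)) (g (Suc (Suc n))) y) \<otimes>\<^bsub>?G\<^esub>
        ?X (Suc n) (d (Suc (Suc n))) (?X (Suc (Suc n)) (s (Suc n)) c)"
      unfolding 1 2 using hom_in_carrier[OF base_change_hom[OF dX], of "?X (Suc (Suc n)) (s (Suc n)) c" "Suc n"] sc
      using G.r_one by simp
    also have "\<dots> = ?X (Suc n) (d (Suc (Suc n))) (?X (Suc (Suc n)) (g (Suc (Suc n))) y \<otimes>\<^bsub>comb_group A (X (Suc (Suc n)))\<^esub>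
        ?X (Suc (Suc n)) (s (Suc n)) c)"
      using hom_mult[OF base_change_hom[OF dX]] gy sc by simp
    finally show "c \<in> ?X (Suc n) (d (Suc (Suc n))) ` fin_combs A (X (Suc (Suc n)))"
      using A.add_fin_combs[OF gy sc] by simp
  qed
qed

end

section \<open>Tensor products as quotients, and the vanishing of Tor\<close>

lemma (in group_hom) kernel_coset_eq_iff:
  assumes "x \<in> carrier G" "y \<in> carrier G"
  shows "kernel G H h #>\<^bsub>G\<^esub> x = kernel G H h #>\<^bsub>G\<^esub> y \<longleftrightarrow> h x = h y"
proof
  have k: "subgroup (kernel G H h) G" by (rule subgroup_kernel)
  { assume "kernel G H h #>\<^bsub>G\<^esub> x = kernel G H h #>\<^bsub>G\<^esub> y"
    then have "x \<in> kernel G H h #>\<^bsub>G\<^esub> y" using G.rcos_self[OF assms(1) k] by simp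
    then show "h x = h y" using assms by (auto simp: r_coset_def kernel_def) }
  { assume "h x = h y"
    then have "x \<otimes>\<^bsub>G\<^esub> inv\<^bsub>G\<^esub> y \<in> kernel G H h" using assms by (simp add: kernel_def)
    then have "x \<in> kernel G H h #>\<^bsub>G\<^esub> y" using subgroup.rcos_module[OF k G.is_group assms(2,1)] by blast
    then show "kernel G H h #>\<^bsub>G\<^esub> x = kernel G H h #>\<^bsub>G\<^esub> y" using G.repr_independence[OF _ assms(2) k] by blast }
qed

lemma free_Abelian_group_hom_diff:
  assumes H: "group H" and f: "f \<in> hom (free_Abelian_group S) H"
    and p: "keys p \<subseteq> S" and q: "keys q \<subseteq> S"
  shows "f (p - q) = f p \<otimes>\<^bsub>H\<^esub> inv\<^bsub>H\<^esub> f q"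
proof -
  interpret F: comm_group "free_Abelian_group S" by (rule abelian_free_Abelian_group)
  interpret H: group H by fact
  interpret f: group_hom "free_Abelian_group S" H f using f by unfold_locales
  have "p - q = p \<otimes>\<^bsub>free_Abelian_group S\<^esub> inv\<^bsub>free_Abelian_group S\<^esub> q" using q by simp
  then show ?thesis using f.hom_mult[of p "inv\<^bsub>free_Abelian_group S\<^esub> q"] f.hom_inv[of q] p q by simp
qed

lemma free_Abelian_group_hom_eq:
  assumes H: "group H" and f: "f \<in> hom (free_Abelian_group S) H" and g: "g \<in> hom (free_Abelian_group S) H"
    and eq: "\<And>a. a \<in> S \<Longrightarrow> f (frag_of a) = g (frag_of a)" and p: "keys p \<subseteq> S"
  shows "f p = g p"
proof (rule free_Abelian_group_induct[OF p])
  show "f 0 = g 0" using hom_one[OF f group_free_Abelian_group H] hom_one[OF g group_free_Abelian_group H] by simp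
  show "f (u - v) = g (u - v)" if "keys u \<subseteq> S" "keys v \<subseteq> S" "f u = g u" "f v = g v" for u v
    using that by (simp add: free_Abelian_group_hom_diff[OF H f] free_Abelian_group_hom_diff[OF H g])
qed (rule eq)

context left_module
begin

abbreviation tensor_generators :: "'c set \<Rightarrow> (('c \<Rightarrow> 'r) \<times> 'a) set" where
  "tensor_generators X \<equiv> fin_combs R X \<times> carrier A"

text \<open>The defining relations die under \<open>\<Theta>\<close>. Conversely, sending the
  one-point combination at \<open>x\<close> with value \<open>b\<close> to the class of the basis
  element \<open>x\<close> paired with \<open>b\<close> defines \<open>\<sigma>\<close>, and
  \<open>\<sigma> \<circ> \<Theta>\<close> is the quotient map; so the kernel of
  \<open>\<Theta>\<close> consists of relations.\<close>

lemma tensor_relations_eq_kernel: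
  assumes \<Theta>: "\<Theta> \<in> hom (free_Abelian_group (tensor_generators X)) (comb_group A X)"
    and \<Theta>_of: "\<And>c b. c \<in> fin_combs R X \<Longrightarrow> b \<in> carrier A \<Longrightarrow> \<Theta> (frag_of (c, b)) = lact A c b"
  shows "tensor_relations R (free_right_module R X) A = kernel (free_Abelian_group (tensor_generators X)) (comb_group A X) \<Theta>"
proof -
  let ?G = "free_Abelian_group (tensor_generators X)"
  let ?C = "comb_group A X"
  let ?N = "tensor_relations R (free_right_module R X) A"
  define E where "E =
    {frag_of (\<lambda>b. x b \<oplus>\<^bsub>R\<^esub> x' b, y) - frag_of (x, y) - frag_of (x', y) | x x' y.
        x \<in> fin_combs R X \<and> x' \<in> fin_combs R X \<and> y \<in> carrier A} \<union>
     {frag_of (x, y \<oplus>\<^bsub>A\<^esub> y') - frag_of (x, y) - frag_of (x, y') | x y y'.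
        x \<in> fin_combs R X \<and> y \<in> carrier A \<and> y' \<in> carrier A} \<union>
     {frag_of (\<lambda>b. x b \<otimes>\<^bsub>R\<^esub> r, y) - frag_of (x, r \<odot>\<^bsub>A\<^esub> y) | r x y.
        r \<in> carrier R \<and> x \<in> fin_combs R X \<and> y \<in> carrier A}"
  have N: "?N = generate ?G E" by (simp add: tensor_relations_def E_def)
  interpret F: right_module R "free_right_module R X" by (rule right_module_free_right_module) (rule R.ring_axioms)
  interpret G: comm_group ?G by (rule abelian_free_Abelian_group)
  interpret C: comm_group ?C by (rule A.comm_group_comb)
  interpret \<Theta>: group_hom ?G ?C \<Theta> using \<Theta> by unfold_locales
  have sm: "(\<lambda>b. x b \<otimes>\<^bsub>R\<^esub> r) \<in> fin_combs R X" if "x \<in> fin_combs R X" "r \<in> carrier R" for x r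
    using F.smult_closed[of r x] that by simp
  have keys_add2: "keys (frag_of u + frag_of v) \<subseteq> {u, v}" for u v :: "('d \<Rightarrow> 'r) \<times> 'a"
    using keys_add[of "frag_of u" "frag_of v"] by auto
  have \<Theta>d: "u - v \<in> kernel ?G ?C \<Theta>" if "u \<in> carrier ?G" "v \<in> carrier ?G" "\<Theta> u = \<Theta> v" for u v
  proof -
    have "\<Theta> (u - v) = \<Theta> u \<otimes>\<^bsub>?C\<^esub> inv\<^bsub>?C\<^esub> \<Theta> v" by (rule free_Abelian_group_hom_diff[OF C.is_group \<Theta>]) (use that in simp_all)
    also have "\<dots> = \<one>\<^bsub>?C\<^esub>" unfolding that(3) by (rule C.r_inv[OF \<Theta>.hom_closed[OF that(2)]])
    finally show ?thesis using order_trans[OF keys_diff[of u v]] that(1,2) by (simp add: kernel_def)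
  qed
  have \<Theta>a: "\<Theta> (u + v) = \<Theta> u \<otimes>\<^bsub>?C\<^esub> \<Theta> v" if "u \<in> carrier ?G" "v \<in> carrier ?G" for u v
    using \<Theta>.hom_mult[OF that] by simp
  have E_ker: "E \<subseteq> kernel ?G ?C \<Theta>"
  proof
    fix p assume "p \<in> E"
    then consider x x' y where "p = frag_of (\<lambda>b. x b \<oplus>\<^bsub>R\<^esub> x' b, y) - (frag_of (x, y) + frag_of (x', y))"
        "x \<in> fin_combs R X" "x' \<in> fin_combs R X" "y \<in> carrier A"
      | x y y' where "p = frag_of (x, y \<oplus>\<^bsub>A\<^esub> y') - (frag_of (x, y) + frag_of (x, y'))"
        "x \<in> fin_combs R X" "y \<in> carrier A" "y' \<in> carrier A"
      | r x y where "p = frag_of (\<lambda>b. x b \<otimes>\<^bsub>R\<^esub> r, y) - frag_of (x, r \<odot>\<^bsub>A\<^esub> y)"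
        "r \<in> carrier R" "x \<in> fin_combs R X" "y \<in> carrier A"
      unfolding E_def diff_diff_eq by blast
    then show "p \<in> kernel ?G ?C \<Theta>"
    proof cases
      case 1
      then have "\<Theta> (frag_of (\<lambda>b. x b \<oplus>\<^bsub>R\<^esub> x' b, y)) = \<Theta> (frag_of (x, y) + frag_of (x', y))"
        using \<Theta>a[of "frag_of (x, y)" "frag_of (x', y)"] R.add_fin_combs[OF 1(2,3)] by (simp add: \<Theta>_of lact_add_left)
      then show ?thesis unfolding 1(1)
        using 1 R.add_fin_combs[OF 1(2,3)] keys_add2[of "(x, y)" "(x', y)"] by (intro \<Theta>d) auto
    next
      case 2
      then have "\<Theta> (frag_of (x, y \<oplus>\<^bsub>A\<^esub> y')) = \<Theta> (frag_of (x, y) + frag_of (x, y'))"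
        using \<Theta>a[of "frag_of (x, y)" "frag_of (x, y')"] by (simp add: \<Theta>_of lact_add)
      then show ?thesis unfolding 2(1)
        using 2 keys_add2[of "(x, y)" "(x, y')"] by (intro \<Theta>d) auto
    next
      case 3
      then have "\<Theta> (frag_of (\<lambda>b. x b \<otimes>\<^bsub>R\<^esub> r, y)) = \<Theta> (frag_of (x, r \<odot>\<^bsub>A\<^esub> y))"
        using sm[OF 3(3,2)] smult_closed[OF 3(2,4)] by (simp add: \<Theta>_of lact_smult)
      then show ?thesis unfolding 3(1)
        using 3 sm[OF 3(3,2)] smult_closed[OF 3(2,4)] by (intro \<Theta>d) auto
    qed
  qed
  then have "E \<subseteq> carrier ?G" by (auto simp: kernel_def)
  then have Ng: "subgroup ?N ?G" unfolding N by (rule G.generate_is_subgroup)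
  interpret N: normal ?N ?G using Ng G.normal_iff_subgroup by blast
  interpret Q: comm_group "?G Mod ?N" by (rule G.abelian_FactGroup[OF Ng])
  let ?q = "\<lambda>p. ?N #>\<^bsub>?G\<^esub> p"
  have q: "?q \<in> hom ?G (?G Mod ?N)" by (rule N.r_coset_hom_Mod)
  have q_eq: "?q u = ?q v" if "u \<in> carrier ?G" "v \<in> carrier ?G" "u - v \<in> ?N" for u v
  proof -
    have "u \<otimes>\<^bsub>?G\<^esub> inv\<^bsub>?G\<^esub> v \<in> ?N" using that by simp
    then have "u \<in> ?q v" using subgroup.rcos_module[OF Ng G.is_group that(2,1)] by blast
    then show ?thesis using G.repr_independence[OF _ that(2) Ng] by blast
  qed
  have EN: "p \<in> ?N" if "p \<in> E" for p unfolding N using that by (rule generate.incl)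
  have q_cl: "?q p \<in> carrier (?G Mod ?N)" if "p \<in> carrier ?G" for p using hom_in_carrier[OF q that] .
  have q_add: "?q (u + v) = ?q u \<otimes>\<^bsub>?G Mod ?N\<^esub> ?q v" if "u \<in> carrier ?G" "v \<in> carrier ?G" for u v
    using hom_mult[OF q that] unfolding mult_free_Abelian_group .
  have q1: "?q (frag_of (\<lambda>b. x b \<oplus>\<^bsub>R\<^esub> x' b, y)) = ?q (frag_of (x, y)) \<otimes>\<^bsub>?G Mod ?N\<^esub> ?q (frag_of (x', y))"
    if "x \<in> fin_combs R X" "x' \<in> fin_combs R X" "y \<in> carrier A" for x x' y
  proof -
    have "frag_of (\<lambda>b. x b \<oplus>\<^bsub>R\<^esub> x' b, y) - frag_of (x, y) - frag_of (x', y) \<in> E"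
      unfolding E_def using that by blast
    then have "frag_of (\<lambda>b. x b \<oplus>\<^bsub>R\<^esub> x' b, y) - (frag_of (x, y) + frag_of (x', y)) \<in> ?N" using EN by (simp add: diff_diff_eq)
    then have "?q (frag_of (\<lambda>b. x b \<oplus>\<^bsub>R\<^esub> x' b, y)) = ?q (frag_of (x, y) + frag_of (x', y))"
      using that R.add_fin_combs[OF that(1,2)] keys_add2[of "(x, y)" "(x', y)"] by (intro q_eq) auto
    then show ?thesis using q_add[of "frag_of (x, y)" "frag_of (x', y)"] that by simp
  qed
  have q2: "?q (frag_of (x, y \<oplus>\<^bsub>A\<^esub> y')) = ?q (frag_of (x, y)) \<otimes>\<^bsub>?G Mod ?N\<^esub> ?q (frag_of (x, y'))"
    if "x \<in> fin_combs R X" "y \<in> carrier A" "y' \<in> carrier A" for x y y'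
  proof -
    have "frag_of (x, y \<oplus>\<^bsub>A\<^esub> y') - frag_of (x, y) - frag_of (x, y') \<in> E"
      unfolding E_def using that by blast
    then have "frag_of (x, y \<oplus>\<^bsub>A\<^esub> y') - (frag_of (x, y) + frag_of (x, y')) \<in> ?N" using EN by (simp add: diff_diff_eq)
    then have "?q (frag_of (x, y \<oplus>\<^bsub>A\<^esub> y')) = ?q (frag_of (x, y) + frag_of (x, y'))"
      using that keys_add2[of "(x, y)" "(x, y')"] by (intro q_eq) auto
    then show ?thesis using q_add[of "frag_of (x, y)" "frag_of (x, y')"] that by simp
  qed
  have q3: "?q (frag_of (\<lambda>b. x b \<otimes>\<^bsub>R\<^esub> r, y)) = ?q (frag_of (x, r \<odot>\<^bsub>A\<^esub> y))"
    if "r \<in> carrier R" "x \<in> fin_combs R X" "y \<in> carrier A" for r x y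
  proof (rule q_eq)
    have "frag_of (\<lambda>b. x b \<otimes>\<^bsub>R\<^esub> r, y) - frag_of (x, r \<odot>\<^bsub>A\<^esub> y) \<in> E" unfolding E_def using that by blast
    then show "frag_of (\<lambda>b. x b \<otimes>\<^bsub>R\<^esub> r, y) - frag_of (x, r \<odot>\<^bsub>A\<^esub> y) \<in> ?N" by (rule EN)
  qed (use that sm smult_closed in simp_all)
  let ?e = "\<lambda>x b. ?q (frag_of (single R x \<one>\<^bsub>R\<^esub>, b))"
  define \<sigma> where "\<sigma> = comb_ext (?G Mod ?N) A ?e"
  have e: "?e x b \<in> carrier (?G Mod ?N)" if "x \<in> X" "b \<in> carrier A" for x b
    using that R.single_fin_combs[OF that(1) R.one_closed] by (intro q_cl) simp
  have e2: "?e x (b \<oplus>\<^bsub>A\<^esub> b') = ?e x b \<otimes>\<^bsub>?G Mod ?N\<^esub> ?e x b'" if "x \<in> X" "b \<in> carrier A" "b' \<in> carrier A" for x b b'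
    by (rule q2[OF R.single_fin_combs[OF that(1) R.one_closed] that(2,3)])
  have \<sigma>: "\<sigma> \<in> hom ?C (?G Mod ?N)"
    unfolding \<sigma>_def by (rule A.comb_ext_hom[OF Q.comm_group_axioms e e2])
  have \<sigma>_single: "\<sigma> (single A x b) = ?e x b" if "x \<in> X" "b \<in> carrier A" for x b
    unfolding \<sigma>_def by (rule A.comb_ext_single[OF Q.comm_group_axioms e e2 that])
  \<comment> \<open>Additivity in \<open>c\<close> reduces to one basis element, where the scalar
    relation moves the coefficient over to \<open>b\<close>.\<close>
  have \<sigma>_lact: "\<sigma> (lact A c b) = ?q (frag_of (c, b))" if c: "c \<in> fin_combs R X" and b: "b \<in> carrier A" for c b
  proof -
    have h: "(\<lambda>c. ?q (frag_of (c, b))) \<in> hom (comb_group R X) (?G Mod ?N)"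
    proof (rule homI)
      fix c assume "c \<in> carrier (comb_group R X)"
      then show "?q (frag_of (c, b)) \<in> carrier (?G Mod ?N)" using b by (intro q_cl) simp
    next
      fix c d assume "c \<in> carrier (comb_group R X)" "d \<in> carrier (comb_group R X)"
      then show "?q (frag_of (c \<otimes>\<^bsub>comb_group R X\<^esub> d, b)) = ?q (frag_of (c, b)) \<otimes>\<^bsub>?G Mod ?N\<^esub> ?q (frag_of (d, b))"
        using q1[of c d b] b by simp
    qed
    have "(\<sigma> \<circ> (\<lambda>c. lact A c b)) c = ?q (frag_of (c, b))"
    proof (rule R.comb_hom_eq[OF Q.is_group hom_compose[OF lact_hom[OF b] \<sigma>] h _ c])
      fix x r assume x: "x \<in> X" and r: "r \<in> carrier R"
      have "\<sigma> (lact A (single R x r) b) = ?q (frag_of (single R x \<one>\<^bsub>R\<^esub>, r \<odot>\<^bsub>A\<^esub> b))"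
        unfolding lact_single[OF b] by (rule \<sigma>_single[OF x smult_closed[OF r b]])
      also have "\<dots> = ?q (frag_of (\<lambda>y. single R x \<one>\<^bsub>R\<^esub> y \<otimes>\<^bsub>R\<^esub> r, b))"
        using q3[OF r R.single_fin_combs[OF x R.one_closed] b] by simp
      also have "(\<lambda>y. single R x \<one>\<^bsub>R\<^esub> y \<otimes>\<^bsub>R\<^esub> r) = single R x r" using r by (auto simp: single_def)
      finally show "(\<sigma> \<circ> (\<lambda>c. lact A c b)) (single R x r) = ?q (frag_of (single R x r, b))" by simp
    qed
    then show ?thesis by simp
  qed
  have \<sigma>\<Theta>: "\<sigma> (\<Theta> p) = ?q p" if "p \<in> carrier ?G" for p
  proof -
    have "(\<sigma> \<circ> \<Theta>) p = ?q p"
      by (rule free_Abelian_group_hom_eq[OF Q.is_group hom_compose[OF \<Theta> \<sigma>] q])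
        (use that in \<open>auto simp: \<Theta>_of \<sigma>_lact\<close>)
    then show ?thesis by simp
  qed
  show ?thesis
  proof
    show "?N \<subseteq> kernel ?G ?C \<Theta>" unfolding N by (rule G.generate_subgroup_incl[OF E_ker \<Theta>.subgroup_kernel])
    show "kernel ?G ?C \<Theta> \<subseteq> ?N"
    proof
      fix p assume "p \<in> kernel ?G ?C \<Theta>"
      then have p: "p \<in> carrier ?G" "\<Theta> p = \<one>\<^bsub>?C\<^esub>" by (simp_all add: kernel_def)
      have "?q p = \<sigma> \<one>\<^bsub>?C\<^esub>" using \<sigma>\<Theta>[OF p(1)] p(2) by simp
      also have "\<dots> = ?N" using hom_one[OF \<sigma> C.is_group Q.is_group] by simp
      finally show "p \<in> ?N" using G.coset_join1[OF _ p(1) Ng] by blast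
    qed
  qed
qed

end

context left_module
begin

lemma tensor_eval_exists:
  "\<exists>\<Theta>. \<Theta> \<in> hom (free_Abelian_group (tensor_generators X)) (comb_group A X) \<and>
    (\<forall>c\<in>fin_combs R X. \<forall>b\<in>carrier A. \<Theta> (frag_of (c, b)) = lact A c b) \<and>
    \<Theta> ` carrier (free_Abelian_group (tensor_generators X)) = fin_combs A X"
proof -
  let ?G = "free_Abelian_group (tensor_generators X)"
  interpret C: comm_group "comb_group A X" by (rule A.comm_group_comb)
  have "(\<lambda>(c, b). lact A c b) ` tensor_generators X \<subseteq> carrier (comb_group A X)" using lact_closed by auto
  from C.free_Abelian_group_universal[OF this] obtain \<Theta> where \<Theta>: "\<Theta> \<in> hom ?G (comb_group A X)"
    and "\<And>x. x \<in> tensor_generators X \<Longrightarrow> \<Theta> (frag_of x) = (case x of (c, b) \<Rightarrow> lact A c b)" by blast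
  then have of: "\<Theta> (frag_of (c, b)) = lact A c b" if "c \<in> fin_combs R X" "b \<in> carrier A" for c b
    using that by force
  have "c \<in> \<Theta> ` carrier ?G" if "c \<in> fin_combs A X" for c
    using that
  proof (induction rule: A.fin_combs_induct)
    case zero
    have "\<Theta> 0 = (\<lambda>s. \<zero>\<^bsub>A\<^esub>)" using hom_one[OF \<Theta> group_free_Abelian_group C.is_group] by simp
    then show ?case by (metis carrier_free_Abelian_group_iff empty_subsetI image_eqI keys_zero)
  next
    case (single x b)
    have s: "single R x \<one>\<^bsub>R\<^esub> \<in> fin_combs R X" by (rule R.single_fin_combs[OF single(1) R.one_closed])
    have "\<Theta> (frag_of (single R x \<one>\<^bsub>R\<^esub>, b)) = single A x b"
      using of[OF s single(2)] single(2) by (simp add: lact_single smult_one)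
    moreover have "frag_of (single R x \<one>\<^bsub>R\<^esub>, b) \<in> carrier ?G" using s single(2) by simp
    ultimately show ?case by (metis image_eqI)
  next
    case (add c d)
    then obtain p q where pq: "p \<in> carrier ?G" "q \<in> carrier ?G" "c = \<Theta> p" "d = \<Theta> q" by blast
    have "\<Theta> (p \<otimes>\<^bsub>?G\<^esub> q) = (\<lambda>s. c s \<oplus>\<^bsub>A\<^esub> d s)" using hom_mult[OF \<Theta> pq(1,2)] pq(3,4) by simp
    moreover have "p \<otimes>\<^bsub>?G\<^esub> q \<in> carrier ?G" using pq(1,2) by (intro group.subgroup_self[THEN subgroup.m_closed] group_free_Abelian_group)
    ultimately show ?case using image_eqI[of "\<lambda>s. c s \<oplus>\<^bsub>A\<^esub> d s" \<Theta> "p \<otimes>\<^bsub>?G\<^esub> q"] by simp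
  qed
  moreover have "\<Theta> p \<in> fin_combs A X" if "p \<in> carrier ?G" for p using hom_in_carrier[OF \<Theta> that] by simp
  ultimately show ?thesis using \<Theta> of by blast
qed

text \<open>Each tensor group is the quotient of a free abelian group by the kernel of the
  surjection \<open>\<Theta> n\<close>. Equalities of cosets thus become equalities of values of
  \<open>\<Theta>\<close>, and the induced differential becomes base change.\<close>

lemma Tor_trivial_iff_chosen:
  assumes M: "right_module R M" and X: "free_resolution R M X d \<epsilon>"
  shows "trivial_group (complex_homology (\<lambda>n. tensor R (free_right_module R (X n)) A)
    (\<lambda>n. tensor_map R (free_right_module R (X (n - 1))) A (d n)) (Suc n)) \<longleftrightarrow> base_change_exact R A X d n"
proof -
  let ?G = "\<lambda>n. free_Abelian_group (tensor_generators (X n))"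
  let ?C = "\<lambda>n. comb_group A (X n)"
  let ?N = "\<lambda>n. tensor_relations R (free_right_module R (X n)) A"
  let ?q = "\<lambda>n p. ?N n #>\<^bsub>?G n\<^esub> p"
  let ?T = "\<lambda>n. tensor R (free_right_module R (X n)) A"
  let ?t = "\<lambda>n. tensor_map R (free_right_module R (X (n - 1))) A (d n)"
  let ?b = "\<lambda>n. base_change R A (X n) (d (Suc n))"
  let ?f = "\<lambda>n. frag_extend (\<lambda>(x, y). frag_of (d (Suc n) x, y))"
  note dX = free_resolutionD(3)[OF X]
  have "\<forall>n. \<exists>\<Theta>. \<Theta> \<in> hom (?G n) (?C n) \<and>
    (\<forall>c\<in>fin_combs R (X n). \<forall>b\<in>carrier A. \<Theta> (frag_of (c, b)) = lact A c b) \<and> \<Theta> ` carrier (?G n) = fin_combs A (X n)"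
    using tensor_eval_exists by blast
  from choice[OF this] obtain \<Theta> where \<Theta>: "\<And>n. \<Theta> n \<in> hom (?G n) (?C n)"
    and of: "\<And>n c b. c \<in> fin_combs R (X n) \<Longrightarrow> b \<in> carrier A \<Longrightarrow> \<Theta> n (frag_of (c, b)) = lact A c b"
    and surj: "\<And>n. \<Theta> n ` carrier (?G n) = fin_combs A (X n)" by blast
  interpret G: comm_group "?G k" for k by (rule abelian_free_Abelian_group)
  interpret C: comm_group "?C k" for k by (rule A.comm_group_comb)
  interpret \<Theta>: group_hom "?G k" "?C k" "\<Theta> k" for k using \<Theta> by unfold_locales
  have N: "?N n = kernel (?G n) (?C n) (\<Theta> n)" for n by (rule tensor_relations_eq_kernel[OF \<Theta> of])
  have Ng: "subgroup (?N n) (?G n)" for n unfolding N by (rule \<Theta>.subgroup_kernel)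
  have q_iff: "?q n p = ?q n p' \<longleftrightarrow> \<Theta> n p = \<Theta> n p'" if "p \<in> carrier (?G n)" "p' \<in> carrier (?G n)" for n p p'
    unfolding N by (rule \<Theta>.kernel_coset_eq_iff[OF that])
  have q0: "?q n p = ?N n \<longleftrightarrow> \<Theta> n p = (\<lambda>s. \<zero>\<^bsub>A\<^esub>)" if "p \<in> carrier (?G n)" for n p
    using q_iff[OF that G.one_closed] G.coset_join2[OF G.one_closed Ng subgroup.one_closed[OF Ng], of n] \<Theta>.hom_one[of n]
    by simp
  have dF: "d (Suc n) c \<in> fin_combs R (X n)" if "c \<in> fin_combs R (X (Suc n))" for n c
    using mod_homD(1)[OF dX, of c n] that by simp
  have keys: "keys (case u of (x, y) \<Rightarrow> frag_of (d (Suc n) x, y)) \<subseteq> tensor_generators (X n)"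
    if "u \<in> tensor_generators (X (Suc n))" for u n using that dF by auto
  have f_cl: "?f n p \<in> carrier (?G n)" if "p \<in> carrier (?G (Suc n))" for n p
    unfolding carrier_free_Abelian_group_iff
    by (rule keys_frag_extend_subset[OF keys]) (use that in auto)
  have f_hom: "?f n \<in> hom (?G (Suc n)) (?G n)" for n
  proof (rule homI)
    show "?f n (p \<otimes>\<^bsub>?G (Suc n)\<^esub> q) = ?f n p \<otimes>\<^bsub>?G n\<^esub> ?f n q" for p q by (simp add: frag_extend_add)
  qed (rule f_cl)
  have \<Theta>f: "\<Theta> n (?f n p) = ?b n (\<Theta> (Suc n) p)" if p: "p \<in> carrier (?G (Suc n))" for n p
  proof -
    have "(\<Theta> n \<circ> ?f n) p = (?b n \<circ> \<Theta> (Suc n)) p"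
    proof (rule free_Abelian_group_hom_eq[OF C.is_group hom_compose[OF f_hom \<Theta>] hom_compose[OF \<Theta> base_change_hom[OF dX]]])
      fix u assume "u \<in> tensor_generators (X (Suc n))"
      then obtain c b where u: "u = (c, b)" "c \<in> fin_combs R (X (Suc n))" "b \<in> carrier A" by blast
      then show "(\<Theta> n \<circ> ?f n) (frag_of u) = (?b n \<circ> \<Theta> (Suc n)) (frag_of u)"
        using of[OF u(2,3)] of[OF dF[OF u(2)] u(3)] base_change_lact[OF dX u(3,2)] by simp
    qed (use p in simp)
    then show ?thesis by simp
  qed
  have fN: "?f n p \<in> ?N n" if "p \<in> ?N (Suc n)" for n p
    using that \<Theta>f[of p n] f_cl[of p n] base_change_zero[OF dX] by (auto simp: N kernel_def)
  have t: "?t (Suc n) (?q (Suc n) p) = ?q n (?f n p)" if p: "p \<in> carrier (?G (Suc n))" for n p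
  proof -
    have *: "?q n (?f n c) = ?q n (?f n p)" if c: "c \<in> ?q (Suc n) p" for c
    proof -
      obtain m where m: "m \<in> ?N (Suc n)" "c = m + p" using c unfolding r_coset_def mult_free_Abelian_group by blast
      then have mG: "m \<in> carrier (?G (Suc n))" by (simp add: N kernel_def)
      have "\<Theta> (Suc n) c = \<Theta> (Suc n) p"
        using \<Theta>.hom_mult[OF mG p] m \<Theta>.hom_closed[OF p] C.l_one[of "\<Theta> (Suc n) p" "Suc n"] by (simp add: N kernel_def)
      moreover have "c \<in> carrier (?G (Suc n))" using G.m_closed[OF mG p] m(2) by simp
      ultimately show ?thesis using q_iff[OF f_cl f_cl, of c n p] \<Theta>f p by simp
    qed
    have "p \<in> ?q (Suc n) p" by (rule G.rcos_self[OF p Ng])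
    then have "?q (Suc n) p \<noteq> {}" by blast
    then show ?thesis unfolding tensor_map_def diff_Suc_1 free_right_module_simps(1) by (intro SUP_eq_const *)
  qed
  have T: "comm_group (?T n)" for n unfolding tensor_def using G.abelian_FactGroup[OF Ng] by simp
  have Tc: "carrier (?T n) = ?q n ` carrier (?G n)" for n by (simp add: tensor_def carrier_FactGroup)
  have T1: "\<one>\<^bsub>?T n\<^esub> = ?N n" for n by (simp add: tensor_def)
  have Tm: "?q n p \<otimes>\<^bsub>?T n\<^esub> ?q n p' = ?q n (p \<otimes>\<^bsub>?G n\<^esub> p')" if "p \<in> carrier (?G n)" "p' \<in> carrier (?G n)" for n p p'
  proof -
    interpret N: normal "?N n" "?G n" using Ng G.normal_iff_subgroup by blast
    show ?thesis using N.rcos_sum[OF that] by (simp add: tensor_def)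
  qed
  have t_hom: "?t (Suc n) \<in> hom (?T (Suc n)) (?T n)" for n
  proof (rule homI)
    fix u assume "u \<in> carrier (?T (Suc n))"
    then obtain p where p: "p \<in> carrier (?G (Suc n))" "u = ?q (Suc n) p" unfolding Tc by blast
    show "?t (Suc n) u \<in> carrier (?T n)" unfolding Tc p(2) t[OF p(1)] using f_cl[OF p(1)] by blast
  next
    fix u v assume "u \<in> carrier (?T (Suc n))" "v \<in> carrier (?T (Suc n))"
    then obtain p p' where p: "p \<in> carrier (?G (Suc n))" "u = ?q (Suc n) p" "p' \<in> carrier (?G (Suc n))" "v = ?q (Suc n) p'"
      unfolding Tc by blast
    show "?t (Suc n) (u \<otimes>\<^bsub>?T (Suc n)\<^esub> v) = ?t (Suc n) u \<otimes>\<^bsub>?T n\<^esub> ?t (Suc n) v"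
      unfolding p(2,4) Tm[OF p(1,3)] t[OF G.m_closed[OF p(1,3)]] t[OF p(1)] t[OF p(3)] Tm[OF f_cl[OF p(1)] f_cl[OF p(3)]]
        hom_mult[OF f_hom p(1,3)] ..
  qed
  have bb: "?b n (?b (Suc n) c) = (\<lambda>s. \<zero>\<^bsub>A\<^esub>)" if c: "c \<in> fin_combs A (X (Suc (Suc n)))" for n c
  proof -
    have "d (Suc n) (d (Suc (Suc n)) z) = (\<lambda>y. \<zero>\<^bsub>R\<^esub>)" if "z \<in> fin_combs R (X (Suc (Suc n)))" for z
    proof -
      have "d (Suc (Suc n)) z \<in> cycles R X d M \<epsilon> (Suc n)" using free_resolutionD(4)[OF X, of "Suc n"] that by blast
      then show ?thesis by (simp add: cycles_def)
    qed
    then show ?thesis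
      unfolding base_change_comp[OF dX dX c] using base_change_zero_map[OF mod_hom_comp[OF dX dX] _ c] by blast
  qed
  have tt: "?t (Suc n) (?t (Suc (Suc n)) u) = \<one>\<^bsub>?T n\<^esub>" if "u \<in> carrier (?T (Suc (Suc n)))" for n u
  proof -
    obtain p where p: "p \<in> carrier (?G (Suc (Suc n)))" "u = ?q (Suc (Suc n)) p" using \<open>u \<in> _\<close> unfolding Tc by blast
    have "\<Theta> n (?f n (?f (Suc n) p)) = (\<lambda>s. \<zero>\<^bsub>A\<^esub>)"
      unfolding \<Theta>f[OF f_cl[OF p(1)]] \<Theta>f[OF p(1)] using bb \<Theta>.hom_closed[OF p(1)] by simp
    then show ?thesis unfolding p(2) t[OF p(1)] t[OF f_cl[OF p(1)]] T1 q0[OF f_cl[OF f_cl[OF p(1)]]] .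
  qed
  have "trivial_group (complex_homology ?T ?t (Suc n)) \<longleftrightarrow>
    (\<forall>u\<in>carrier (?T (Suc n)). ?t (Suc n) u = \<one>\<^bsub>?T n\<^esub> \<longrightarrow> u \<in> ?t (Suc (Suc n)) ` carrier (?T (Suc (Suc n))))"
    by (rule trivial_complex_homology_iff[where d = ?t, OF T T T t_hom t_hom tt])
  also have "\<dots> \<longleftrightarrow> (\<forall>p\<in>carrier (?G (Suc n)). ?q n (?f n p) = ?N n \<longrightarrow>
      (\<exists>r\<in>carrier (?G (Suc (Suc n))). ?q (Suc n) p = ?q (Suc n) (?f (Suc n) r)))"
    unfolding Tc T1 image_image ball_simps by (simp only: t image_iff cong: ball_cong bex_cong)
  also have "\<dots> \<longleftrightarrow> (\<forall>p\<in>carrier (?G (Suc n)). ?b n (\<Theta> (Suc n) p) = (\<lambda>s. \<zero>\<^bsub>A\<^esub>) \<longrightarrow>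
      (\<exists>r\<in>carrier (?G (Suc (Suc n))). \<Theta> (Suc n) p = ?b (Suc n) (\<Theta> (Suc (Suc n)) r)))"
    by (simp only: q0[OF f_cl] q_iff[OF _ f_cl] \<Theta>f cong: ball_cong bex_cong)
  also have "\<dots> \<longleftrightarrow> base_change_exact R A X d n"
    unfolding base_change_exact_def surj[symmetric] image_image ball_simps by (auto simp: image_iff)
  finally show ?thesis .
qed

lemma Tor_trivial_iff:
  assumes M: "right_module R M" and X: "free_resolution R M X d \<epsilon>"
  shows "trivial_group (Tor R (Suc n) M A) \<longleftrightarrow> base_change_exact R A X d n"
proof -
  obtain Y d' where Y: "chosen_resolution R M = (Y, d')" by force
  have "\<exists>u. case u of (X, d) \<Rightarrow> \<exists>\<epsilon>. free_resolution R M (X :: nat \<Rightarrow> ('b + 'r) list set) d \<epsilon>"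
    using free_resolution_exists[OF M] by force
  from someI_ex[OF this] obtain \<epsilon>' where \<epsilon>': "free_resolution R M Y d' \<epsilon>'"
    using Y unfolding chosen_resolution_def by auto
  have "trivial_group (Tor R (Suc n) M A) \<longleftrightarrow> base_change_exact R A Y d' n"
    unfolding Tor_def Y Let_def prod.case by (rule Tor_trivial_iff_chosen[OF M \<epsilon>'])
  then show ?thesis using base_change_exact_transfer[OF M X \<epsilon>'] base_change_exact_transfer[OF M \<epsilon>' X] by blast
qed

end

section \<open>Monoid algebras\<close>

lemma monoid_algebra_simps [simp]:
  "carrier (monoid_algebra K M) = fin_combs K (carrier M)"
  "c \<oplus>\<^bsub>monoid_algebra K M\<^esub> d = (\<lambda>b. c b \<oplus>\<^bsub>K\<^esub> d b)"
  "\<zero>\<^bsub>monoid_algebra K M\<^esub> = (\<lambda>b. \<zero>\<^bsub>K\<^esub>)"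
  "\<one>\<^bsub>monoid_algebra K M\<^esub> = single K \<one>\<^bsub>M\<^esub> \<one>\<^bsub>K\<^esub>"
  by (simp_all add: monoid_algebra_def single_def)

locale monoid_over_ring = K?: ring K + M?: monoid M
  for K :: "('k, 'z) ring_scheme" (structure) and M :: "('m, 'x) monoid_scheme" (structure)
begin

abbreviation "KM \<equiv> monoid_algebra K M"
abbreviation "KM_group \<equiv> comb_group K (carrier M)"

text \<open>Larger common index sets make products with different factors comparable term by
  term.\<close>

lemma mult_superset:
  assumes c: "c \<in> fin_combs K (carrier M)" and d: "d \<in> fin_combs K (carrier M)"
    and T: "finite T" "supp K c \<subseteq> T" and S: "finite S" "supp K d \<subseteq> S"
  shows "(c \<otimes>\<^bsub>KM\<^esub> d) u = (\<Oplus>\<^bsub>K\<^esub>p\<in>T \<times> S. if fst p \<otimes>\<^bsub>M\<^esub> snd p = u then c (fst p) \<otimes>\<^bsub>K\<^esub> d (snd p) else \<zero>\<^bsub>K\<^esub>)"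
proof -
  have "(\<Oplus>\<^bsub>K\<^esub>p\<in>supp K c \<times> supp K d. if fst p \<otimes>\<^bsub>M\<^esub> snd p = u then c (fst p) \<otimes>\<^bsub>K\<^esub> d (snd p) else \<zero>\<^bsub>K\<^esub>) =
    (\<Oplus>\<^bsub>K\<^esub>p\<in>T \<times> S. if fst p \<otimes>\<^bsub>M\<^esub> snd p = u then c (fst p) \<otimes>\<^bsub>K\<^esub> d (snd p) else \<zero>\<^bsub>K\<^esub>)"
    by (rule K.add.finprod_mono_neutral_cong_left[folded finsum_def])
      (use T S K.fin_combs_closed[OF c] K.fin_combs_closed[OF d] in \<open>auto simp: supp_def\<close>)
  then show ?thesis by (simp add: monoid_algebra_def)
qed

lemma mult_single:
  assumes "m \<in> carrier M" "m' \<in> carrier M" "k \<in> carrier K" "k' \<in> carrier K"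
  shows "single K m k \<otimes>\<^bsub>KM\<^esub> single K m' k' = single K (m \<otimes>\<^bsub>M\<^esub> m') (k \<otimes>\<^bsub>K\<^esub> k')"
proof
  fix u
  have "(single K m k \<otimes>\<^bsub>KM\<^esub> single K m' k') u = (\<Oplus>\<^bsub>K\<^esub>p\<in>{m} \<times> {m'}.
      if fst p \<otimes>\<^bsub>M\<^esub> snd p = u then single K m k (fst p) \<otimes>\<^bsub>K\<^esub> single K m' k' (snd p) else \<zero>\<^bsub>K\<^esub>)"
    by (rule mult_superset[OF K.single_fin_combs[OF assms(1,3)] K.single_fin_combs[OF assms(2,4)]])
      (auto simp: supp_def single_def)
  also have "{m} \<times> {m'} = {(m, m')}" by simp
  finally show "(single K m k \<otimes>\<^bsub>KM\<^esub> single K m' k') u = single K (m \<otimes>\<^bsub>M\<^esub> m') (k \<otimes>\<^bsub>K\<^esub> k') u"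
    using assms by (simp add: single_def)
qed

lemma mult_closed:
  assumes c: "c \<in> fin_combs K (carrier M)" and d: "d \<in> fin_combs K (carrier M)"
  shows "c \<otimes>\<^bsub>KM\<^esub> d \<in> fin_combs K (carrier M)"
proof (rule K.fin_combsI)
  note sc = fin_combs_supp[OF c] and sd = fin_combs_supp[OF d]
  let ?T = "(\<lambda>(a, b). a \<otimes>\<^bsub>M\<^esub> b) ` (supp K c \<times> supp K d)"
  show "finite ?T" using sc sd by blast
  note eq = mult_superset[OF c d conjunct1[OF sc] order_refl conjunct1[OF sd] order_refl]
  have z: "(c \<otimes>\<^bsub>KM\<^esub> d) u = \<zero>\<^bsub>K\<^esub>" if u: "u \<notin> ?T" for u
    unfolding eq by (rule K.add.finprod_one_eqI[folded finsum_def]) (use u in force)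
  then show "(c \<otimes>\<^bsub>KM\<^esub> d) u = \<zero>\<^bsub>K\<^esub>" if "u \<notin> ?T" for u using that .
  show "(c \<otimes>\<^bsub>KM\<^esub> d) u = \<zero>\<^bsub>K\<^esub>" if "u \<notin> carrier M" for u
  proof (rule z)
    show "u \<notin> ?T" using that sc sd by auto
  qed
  show "(c \<otimes>\<^bsub>KM\<^esub> d) u \<in> carrier K" for u
    unfolding eq by (rule K.finsum_closed) (use K.fin_combs_closed[OF c] K.fin_combs_closed[OF d] in auto)
qed

lemma mult_hom_left:
  assumes d: "d \<in> fin_combs K (carrier M)"
  shows "(\<lambda>c. c \<otimes>\<^bsub>KM\<^esub> d) \<in> hom KM_group KM_group"
proof (rule homI)
  fix c c' assume "c \<in> carrier KM_group" "c' \<in> carrier KM_group"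
  then have c: "c \<in> fin_combs K (carrier M)" and c': "c' \<in> fin_combs K (carrier M)" by simp_all
  let ?T = "supp K c \<union> supp K c'"
  have T: "finite ?T" "supp K c \<subseteq> ?T" "supp K c' \<subseteq> ?T" "supp K (\<lambda>b. c b \<oplus>\<^bsub>K\<^esub> c' b) \<subseteq> ?T"
    using fin_combs_supp[OF c] fin_combs_supp[OF c'] by (auto simp: supp_def)
  have S: "finite (supp K d)" using fin_combs_supp[OF d] by blast
  note cl = K.fin_combs_closed[OF c] K.fin_combs_closed[OF c'] K.fin_combs_closed[OF d]
  have "((\<lambda>b. c b \<oplus>\<^bsub>K\<^esub> c' b) \<otimes>\<^bsub>KM\<^esub> d) u = (c \<otimes>\<^bsub>KM\<^esub> d) u \<oplus>\<^bsub>K\<^esub> (c' \<otimes>\<^bsub>KM\<^esub> d) u" for u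
    unfolding mult_superset[OF K.add_fin_combs[OF c c'] d T(1,4) S order_refl]
      mult_superset[OF c d T(1,2) S order_refl] mult_superset[OF c' d T(1,3) S order_refl]
    by (rule trans[OF K.finsum_cong'[OF refl] K.finsum_addf]) (auto simp: cl K.l_distr)
  then show "(c \<otimes>\<^bsub>KM_group\<^esub> c') \<otimes>\<^bsub>KM\<^esub> d = (c \<otimes>\<^bsub>KM\<^esub> d) \<otimes>\<^bsub>KM_group\<^esub> (c' \<otimes>\<^bsub>KM\<^esub> d)" by auto
qed (use mult_closed d in simp)

lemma mult_hom_right:
  assumes d: "d \<in> fin_combs K (carrier M)"
  shows "(\<lambda>c. d \<otimes>\<^bsub>KM\<^esub> c) \<in> hom KM_group KM_group"
proof (rule homI)
  fix c c' assume "c \<in> carrier KM_group" "c' \<in> carrier KM_group"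
  then have c: "c \<in> fin_combs K (carrier M)" and c': "c' \<in> fin_combs K (carrier M)" by simp_all
  let ?T = "supp K c \<union> supp K c'"
  have T: "finite ?T" "supp K c \<subseteq> ?T" "supp K c' \<subseteq> ?T" "supp K (\<lambda>b. c b \<oplus>\<^bsub>K\<^esub> c' b) \<subseteq> ?T"
    using fin_combs_supp[OF c] fin_combs_supp[OF c'] by (auto simp: supp_def)
  have S: "finite (supp K d)" using fin_combs_supp[OF d] by blast
  note cl = K.fin_combs_closed[OF c] K.fin_combs_closed[OF c'] K.fin_combs_closed[OF d]
  have "(d \<otimes>\<^bsub>KM\<^esub> (\<lambda>b. c b \<oplus>\<^bsub>K\<^esub> c' b)) u = (d \<otimes>\<^bsub>KM\<^esub> c) u \<oplus>\<^bsub>K\<^esub> (d \<otimes>\<^bsub>KM\<^esub> c') u" for u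
    unfolding mult_superset[OF d K.add_fin_combs[OF c c'] S order_refl T(1,4)]
      mult_superset[OF d c S order_refl T(1,2)] mult_superset[OF d c' S order_refl T(1,3)]
    by (rule trans[OF K.finsum_cong'[OF refl] K.finsum_addf]) (auto simp: cl K.r_distr)
  then show "d \<otimes>\<^bsub>KM\<^esub> (c \<otimes>\<^bsub>KM_group\<^esub> c') = (d \<otimes>\<^bsub>KM\<^esub> c) \<otimes>\<^bsub>KM_group\<^esub> (d \<otimes>\<^bsub>KM\<^esub> c')" by auto
qed (use mult_closed d in simp)

lemma KM_eqI:
  assumes "f \<in> hom KM_group KM_group" "g \<in> hom KM_group KM_group"
    and "\<And>m k. m \<in> carrier M \<Longrightarrow> k \<in> carrier K \<Longrightarrow> f (single K m k) = g (single K m k)" "c \<in> fin_combs K (carrier M)"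
  shows "f c = g c"
  by (rule K.comb_hom_eq[OF K.group_comb assms])

text \<open>Associativity is additive in each factor and is reduced to one-point combinations one
  factor at a time: first \<open>a\<close>, with the other two already one-point combinations, then
  \<open>b\<close>, then \<open>c\<close>.\<close>

lemma ring_monoid_algebra: "ring KM"
proof (rule ringI)
  have "add_monoid KM = KM_group" by (simp add: monoid_algebra_def comb_group_def)
  then have "comm_group (add_monoid KM)" using K.comm_group_comb by metis
  then show "abelian_group KM"
    by (intro abelian_group.intro abelian_monoid.intro abelian_group_axioms.intro comm_group.axioms(1))
  have assoc: "(a \<otimes>\<^bsub>KM\<^esub> b) \<otimes>\<^bsub>KM\<^esub> c = a \<otimes>\<^bsub>KM\<^esub> (b \<otimes>\<^bsub>KM\<^esub> c)"
    if a: "a \<in> fin_combs K (carrier M)" and b: "b \<in> fin_combs K (carrier M)" and c: "c \<in> fin_combs K (carrier M)" for a b c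
  proof -
    note s = K.single_fin_combs
    have 1: "((\<lambda>a. a \<otimes>\<^bsub>KM\<^esub> single K m' k') \<circ> (\<lambda>a. a \<otimes>\<^bsub>KM\<^esub> single K m k)) a = a \<otimes>\<^bsub>KM\<^esub> (single K m k \<otimes>\<^bsub>KM\<^esub> single K m' k')"
      if "m \<in> carrier M" "m' \<in> carrier M" "k \<in> carrier K" "k' \<in> carrier K" for m m' k k'
      by (rule KM_eqI[OF hom_compose[OF mult_hom_left mult_hom_left] mult_hom_left _ a])
        (use that in \<open>simp_all add: s mult_single mult_closed K.m_assoc M.m_assoc\<close>)
    have 2: "((\<lambda>a. a \<otimes>\<^bsub>KM\<^esub> single K m' k') \<circ> (\<lambda>b. a \<otimes>\<^bsub>KM\<^esub> b)) b = ((\<lambda>b. a \<otimes>\<^bsub>KM\<^esub> b) \<circ> (\<lambda>b. b \<otimes>\<^bsub>KM\<^esub> single K m' k')) b"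
      if "m' \<in> carrier M" "k' \<in> carrier K" for m' k'
      by (rule KM_eqI[OF hom_compose[OF mult_hom_right mult_hom_left] hom_compose[OF mult_hom_left mult_hom_right] _ b])
        (use that a 1 in \<open>simp_all add: s\<close>)
    have "(\<lambda>c. (a \<otimes>\<^bsub>KM\<^esub> b) \<otimes>\<^bsub>KM\<^esub> c) c = ((\<lambda>c. a \<otimes>\<^bsub>KM\<^esub> c) \<circ> (\<lambda>c. b \<otimes>\<^bsub>KM\<^esub> c)) c"
      by (rule KM_eqI[OF mult_hom_right[OF mult_closed[OF a b]] hom_compose[OF mult_hom_right[OF b] mult_hom_right[OF a]] _ c])
        (use 2 in simp)
    then show ?thesis by simp
  qed
  have one: "single K \<one>\<^bsub>M\<^esub> \<one>\<^bsub>K\<^esub> \<in> fin_combs K (carrier M)" by (rule K.single_fin_combs) simp_all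
  have id: "(\<lambda>c. c) \<in> hom KM_group KM_group" by (simp add: hom_def)
  have l1: "single K \<one>\<^bsub>M\<^esub> \<one>\<^bsub>K\<^esub> \<otimes>\<^bsub>KM\<^esub> c = c" and r1: "c \<otimes>\<^bsub>KM\<^esub> single K \<one>\<^bsub>M\<^esub> \<one>\<^bsub>K\<^esub> = c" if c: "c \<in> fin_combs K (carrier M)" for c
    by (rule KM_eqI[OF mult_hom_right[OF one] id _ c], simp add: mult_single)
      (rule KM_eqI[OF mult_hom_left[OF one] id _ c], simp add: mult_single)
  show "Group.monoid KM" by (rule monoidI) (simp_all add: mult_closed one assoc l1 r1)
  show "(a \<oplus>\<^bsub>KM\<^esub> b) \<otimes>\<^bsub>KM\<^esub> c = a \<otimes>\<^bsub>KM\<^esub> c \<oplus>\<^bsub>KM\<^esub> b \<otimes>\<^bsub>KM\<^esub> c"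
    if "a \<in> carrier KM" "b \<in> carrier KM" "c \<in> carrier KM" for a b c
    using hom_mult[OF mult_hom_left[of c], of a b] that by simp
  show "c \<otimes>\<^bsub>KM\<^esub> (a \<oplus>\<^bsub>KM\<^esub> b) = c \<otimes>\<^bsub>KM\<^esub> a \<oplus>\<^bsub>KM\<^esub> c \<otimes>\<^bsub>KM\<^esub> b"
    if "a \<in> carrier KM" "b \<in> carrier KM" "c \<in> carrier KM" for a b c
    using hom_mult[OF mult_hom_right[of c], of a b] that by simp
qed

end

context
  fixes K :: "('k, 'z) ring_scheme" and M :: "('m, 'x) monoid_scheme" and N :: "('n, 'y) monoid_scheme" and f :: "'m \<Rightarrow> 'n"
  assumes K: "ring K" and M: "monoid M" and N: "monoid N" and f: "f \<in> monoid_hom M N"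
begin

interpretation M: monoid_over_ring K M using K M by (rule monoid_over_ring.intro)
interpretation N: monoid_over_ring K N using K N by (rule monoid_over_ring.intro)

lemma monoid_algebra_map_comb_ext:
  assumes c: "c \<in> fin_combs K (carrier M)"
  shows "monoid_algebra_map K f c = comb_ext N.KM_group K (\<lambda>u. single K (f u)) c"
proof -
  have fN: "f u \<in> carrier N" if "u \<in> carrier M" for u using f that by (auto simp: monoid_hom_def hom_def)
  have "comb_ext N.KM_group K (\<lambda>u. single K (f u)) c =
      (\<lambda>v. \<Oplus>\<^bsub>K\<^esub>u\<in>supp K c. single K (f u) (c u) v)"
    unfolding comb_ext_def by (rule M.K.finprod_comb_group)
      (use fin_combs_supp[OF c] M.K.fin_combs_closed[OF c] in \<open>auto intro!: M.K.single_fin_combs fN\<close>)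
  also have "\<dots> = monoid_algebra_map K f c"
    unfolding monoid_algebra_map_def single_def by (intro ext M.K.finsum_cong') (use M.K.fin_combs_closed[OF c] in auto)
  finally show ?thesis by simp
qed

lemma monoid_algebra_map_hom: "monoid_algebra_map K f \<in> hom M.KM_group N.KM_group"
  and monoid_algebra_map_single: "m \<in> carrier M \<Longrightarrow> k \<in> carrier K \<Longrightarrow> monoid_algebra_map K f (single K m k) = single K (f m) k"
proof -
  have fN: "f u \<in> carrier N" if "u \<in> carrier M" for u using f that by (auto simp: monoid_hom_def hom_def)
  have "comb_ext N.KM_group K (\<lambda>u. single K (f u)) \<in> hom M.KM_group N.KM_group"
    by (rule M.K.comb_ext_hom[OF M.K.comm_group_comb]) (simp_all add: M.K.single_fin_combs fN M.K.single_add)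
  note h = hom_in_carrier[OF this] hom_mult[OF this]
  show "monoid_algebra_map K f \<in> hom M.KM_group N.KM_group"
  proof (rule homI)
    fix c d assume cd: "c \<in> carrier M.KM_group" "d \<in> carrier M.KM_group"
    show "monoid_algebra_map K f c \<in> carrier N.KM_group"
      using h(1)[OF cd(1)] monoid_algebra_map_comb_ext cd by simp
    show "monoid_algebra_map K f (c \<otimes>\<^bsub>M.KM_group\<^esub> d) =
        monoid_algebra_map K f c \<otimes>\<^bsub>N.KM_group\<^esub> monoid_algebra_map K f d"
      using h(2)[OF cd] monoid_algebra_map_comb_ext M.K.add_fin_combs[of c "carrier M" d] cd by simp
  qed
  show "monoid_algebra_map K f (single K m k) = single K (f m) k" if "m \<in> carrier M" "k \<in> carrier K"
    unfolding monoid_algebra_map_comb_ext[OF M.K.single_fin_combs[OF that]]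
    by (rule M.K.comb_ext_single[OF M.K.comm_group_comb _ _ that]) (simp_all add: M.K.single_fin_combs fN M.K.single_add)
qed

lemma monoid_algebra_map_ring_hom: "monoid_algebra_map K f \<in> ring_hom M.KM N.KM"
proof (rule ring_hom_memI)
  let ?F = "monoid_algebra_map K f"
  note F = monoid_algebra_map_hom and s = monoid_algebra_map_single
  have fN: "f u \<in> carrier N" if "u \<in> carrier M" for u using f that by (auto simp: monoid_hom_def hom_def)
  have fm: "f (u \<otimes>\<^bsub>M\<^esub> v) = f u \<otimes>\<^bsub>N\<^esub> f v" if "u \<in> carrier M" "v \<in> carrier M" for u v using f that by (auto simp: monoid_hom_def hom_def)
  show "?F c \<in> carrier N.KM" if "c \<in> carrier M.KM" for c
    using hom_in_carrier[OF F, of c] that by simp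
  show "?F (c \<oplus>\<^bsub>M.KM\<^esub> d) = ?F c \<oplus>\<^bsub>N.KM\<^esub> ?F d"
    if "c \<in> carrier M.KM" "d \<in> carrier M.KM" for c d
    using hom_mult[OF F, of c d] that by simp
  show "?F \<one>\<^bsub>M.KM\<^esub> = \<one>\<^bsub>N.KM\<^esub>"
    using f by (simp add: s monoid_hom_def)
  fix c d assume "c \<in> carrier M.KM" "d \<in> carrier M.KM"
  then have c: "c \<in> fin_combs K (carrier M)" and d: "d \<in> fin_combs K (carrier M)" by simp_all
  note Fc = hom_in_carrier[OF F, simplified]
  have G: "group N.KM_group" by (rule M.K.group_comb)
  have 1: "(?F \<circ> (\<lambda>c. c \<otimes>\<^bsub>M.KM\<^esub> single K m k)) c = ((\<lambda>c. c \<otimes>\<^bsub>N.KM\<^esub> single K (f m) k) \<circ> ?F) c"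
    if "m \<in> carrier M" "k \<in> carrier K" for m k
    by (rule M.K.comb_hom_eq[OF G hom_compose[OF M.mult_hom_left F] hom_compose[OF F N.mult_hom_left] _ c])
      (use that in \<open>simp_all add: M.K.single_fin_combs fN s M.mult_single N.mult_single fm\<close>)
  have "(?F \<circ> (\<lambda>d. c \<otimes>\<^bsub>M.KM\<^esub> d)) d = ((\<lambda>d. ?F c \<otimes>\<^bsub>N.KM\<^esub> d) \<circ> ?F) d"
    by (rule M.K.comb_hom_eq[OF G hom_compose[OF M.mult_hom_right[OF c] F] hom_compose[OF F N.mult_hom_right[OF Fc[OF c]]] _ d])
      (use 1 in \<open>simp_all add: s\<close>)
  then show "?F (c \<otimes>\<^bsub>M.KM\<^esub> d) = ?F c \<otimes>\<^bsub>N.KM\<^esub> ?F d" by simp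
qed

end

text \<open>Both notions of epimorphism test targets of one fixed type, and neither the monoid
  algebra of a test monoid nor the multiplicative monoid of a test ring has the type tested by the
  other notion; \<open>ring_epiD\<close> and \<open>monoid_epiD\<close> bridge this.\<close>

lemma ring_epi_monoid_algebra_iff:
  fixes K :: "('k, 'z) ring_scheme" and M :: "('m, 'x) monoid_scheme" and N :: "('n, 'y) monoid_scheme"
  assumes K: "ring K" and M: "monoid M" and N: "monoid N" and nz: "\<one>\<^bsub>K\<^esub> \<noteq> \<zero>\<^bsub>K\<^esub>" and f: "f \<in> monoid_hom M N"
  shows "ring_epi (monoid_algebra K M) (monoid_algebra K N) (monoid_algebra_map K f) \<longleftrightarrow> monoid_epi M N f"
proof
  interpret M: monoid_over_ring K M using K M by (rule monoid_over_ring.intro)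
  interpret N: monoid_over_ring K N using K N by (rule monoid_over_ring.intro)
  let ?F = "monoid_algebra_map K f"
  have fN: "f u \<in> carrier N" if "u \<in> carrier M" for u using f that by (auto simp: monoid_hom_def hom_def)
  note F = monoid_algebra_map_ring_hom[OF K M N f] and Fh = monoid_algebra_map_hom[OF K M N f] and Fs = monoid_algebra_map_single[OF K M N f]
  note s = M.K.single_fin_combs
  show "monoid_epi M N f" if epi: "ring_epi M.KM N.KM ?F"
    unfolding monoid_epi_def
  proof (intro conjI allI impI ballI f; elim conjE)
    fix T :: "'n list monoid" and g h and y
    assume T: "monoid T" and g: "g \<in> monoid_hom N T" and h: "h \<in> monoid_hom N T"
      and eq: "\<forall>x\<in>carrier M. g (f x) = h (f x)" and y: "y \<in> carrier N"
    interpret T: monoid_over_ring K T using K T by (rule monoid_over_ring.intro)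
    note G = monoid_algebra_map_hom[OF K N T g] and H = monoid_algebra_map_hom[OF K N T h]
    have "(monoid_algebra_map K g \<circ> ?F) c = (monoid_algebra_map K h \<circ> ?F) c" if "c \<in> fin_combs K (carrier M)" for c
      by (rule M.K.comb_hom_eq[OF M.K.group_comb hom_compose[OF Fh G] hom_compose[OF Fh H] _ that])
        (use eq fN in \<open>simp add: Fs monoid_algebra_map_single[OF K N T g] monoid_algebra_map_single[OF K N T h]\<close>)
    then have "\<And>c. c \<in> carrier M.KM \<Longrightarrow> monoid_algebra_map K g (?F c) = monoid_algebra_map K h (?F c)" by simp
    from ring_epiD[where f = ?F and g = "monoid_algebra_map K g" and h = "monoid_algebra_map K h", OF epi N.ring_monoid_algebra T.ring_monoid_algebra
      monoid_algebra_map_ring_hom[OF K N T g] monoid_algebra_map_ring_hom[OF K N T h] this]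
    have "monoid_algebra_map K g (single K y \<one>\<^bsub>K\<^esub>) = monoid_algebra_map K h (single K y \<one>\<^bsub>K\<^esub>)" by (simp add: s y)
    then have "single K (g y) \<one>\<^bsub>K\<^esub> (g y) = single K (h y) \<one>\<^bsub>K\<^esub> (g y)"
      by (simp add: monoid_algebra_map_single[OF K N T g y] monoid_algebra_map_single[OF K N T h y])
    \<comment> \<open>Here \<open>K\<close> has to be nonzero: otherwise one-point combinations at
      distinct points coincide.\<close>
    then show "g y = h y" using nz by (auto simp: single_def split: if_splits)
  qed
  show "ring_epi M.KM N.KM ?F" if epi: "monoid_epi M N f"
    unfolding ring_epi_def
  proof (intro conjI allI impI ballI F; elim conjE)
    fix T :: "('n \<Rightarrow> 'k) list ring" and g h and y
    assume T: "ring T" and g: "g \<in> ring_hom N.KM T" and h: "h \<in> ring_hom N.KM T"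
      and eq: "\<forall>x\<in>carrier M.KM. g (?F x) = h (?F x)" and y: "y \<in> carrier N.KM"
    interpret T: ring T by (rule T)
    have mh: "(\<lambda>n. u (single K n \<one>\<^bsub>K\<^esub>)) \<in> monoid_hom N T" if "u \<in> ring_hom N.KM T" for u
      using ring_hom_closed[OF that] ring_hom_mult[OF that] ring_hom_one[OF that]
      by (auto simp: monoid_hom_def hom_def s N.mult_single[of _ _ "\<one>\<^bsub>K\<^esub>" "\<one>\<^bsub>K\<^esub>", symmetric, simplified])
    have ah: "u \<in> hom N.KM_group (add_monoid T)" if "u \<in> ring_hom N.KM T" for u
      by (rule homI) (use ring_hom_closed[OF that] ring_hom_add[OF that] in simp_all)
    have g1: "g (?F (single K m k)) = h (?F (single K m k))" if "m \<in> carrier M" "k \<in> carrier K" for m k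
      using eq s[OF that] by simp
    show "g y = h y"
    proof (rule M.K.comb_hom_eq[OF T.a_group ah[OF g] ah[OF h]])
      fix n k assume n: "n \<in> carrier N" and k: "k \<in> carrier K"
      have "g (single K n \<one>\<^bsub>K\<^esub>) = h (single K n \<one>\<^bsub>K\<^esub>)"
        by (rule monoid_epiD[OF epi N T.monoid_axioms mh[OF g] mh[OF h] _ n])
          (use g1[of _ "\<one>\<^bsub>K\<^esub>"] in \<open>simp add: Fs\<close>)
      \<comment> \<open>Scalars come from the monoid algebra of \<open>M\<close>, because
        \<open>f\<close> preserves the unit.\<close>
      moreover have "g (single K \<one>\<^bsub>N\<^esub> k) = h (single K \<one>\<^bsub>N\<^esub> k)"
        using g1[of "\<one>\<^bsub>M\<^esub>" k] k f by (simp add: Fs monoid_hom_def)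
      moreover have "single K n k = single K \<one>\<^bsub>N\<^esub> k \<otimes>\<^bsub>N.KM\<^esub> single K n \<one>\<^bsub>K\<^esub>"
        using n k by (simp add: N.mult_single)
      moreover have "single K \<one>\<^bsub>N\<^esub> k \<in> carrier N.KM" "single K n \<one>\<^bsub>K\<^esub> \<in> carrier N.KM"
        using n k by (simp_all add: s)
      ultimately show "g (single K n k) = h (single K n k)"
        using ring_hom_mult[OF g] ring_hom_mult[OF h] by simp
    qed (use y in simp)
  qed
qed

section \<open>Simplicial sets with an extra degeneracy\<close>

lemma frag_extend_face_sum:
  "frag_extend f (\<Sum>k\<in>I. frag_cmul (z k) (frag_of (u k))) = (\<Sum>k\<in>I. frag_cmul (z k) (f (u k)))"
proof (cases "finite I")
  case True
  have "frag_extend f (\<Sum>k\<in>I. frag_cmul (z k) (frag_of (u k))) = (\<Sum>k\<in>I. frag_extend f (frag_cmul (z k) (frag_of (u k))))"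
    using frag_extend_sum[OF True, of f] by (simp add: comp_def)
  then show ?thesis by (simp add: frag_extend_cmul)
qed simp

context simplicial_set
begin

lemma face_sum_Suc: "face_sum (Suc q) x = (\<Sum>k\<le>Suc q. frag_cmul ((-1) ^ k) (frag_of (pull q (face_map k) x)))"
  by (simp add: face_sum_def del: sum.atMost_Suc)

text \<open>The terms are indexed by pairs of faces. The simplicial identity matches
  \<open>(k, j)\<close>, for \<open>j < k\<close>, with \<open>(j, k - 1)\<close>, whose sign is
  opposite.\<close>

lemma face_sum_face_sum:
  assumes x: "x \<in> S (Suc (Suc q))"
  shows "frag_extend (face_sum (Suc q)) (face_sum (Suc (Suc q)) x) = 0"
proof -
  define t where "t = (\<lambda>(k, j). frag_cmul ((-1) ^ (k + j)) (frag_of (pull q (face_map k \<circ> face_map j) x)))"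
  have "frag_extend (face_sum (Suc q)) (face_sum (Suc (Suc q)) x) =
      (\<Sum>k\<le>Suc (Suc q). frag_cmul ((-1) ^ k) (face_sum (Suc q) (pull (Suc q) (face_map k) x)))"
    unfolding face_sum_Suc[of "Suc q"] by (rule frag_extend_face_sum)
  also have "\<dots> = (\<Sum>k\<le>Suc (Suc q). \<Sum>j\<le>Suc q. t (k, j))"
    unfolding face_sum_Suc frag_cmul_sum t_def
    by (intro sum.cong refl) (use pull_pull[OF face_map_in face_map_in x] in \<open>simp add: power_add\<close>)
  also have "\<dots> = sum t ({..Suc (Suc q)} \<times> {..Suc q})" by (rule sum.cartesian_product'[symmetric])
  also have "{..Suc (Suc q)} \<times> {..Suc q} = {(k, j). k \<le> Suc (Suc q) \<and> j < k} \<union> {(k, j). k \<le> j \<and> j \<le> Suc q}" (is "_ = ?A \<union> ?B")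
    by auto
  also have "sum t (?A \<union> ?B) = sum t ?A + sum t ?B"
  proof (rule sum.union_disjoint)
    have "?A \<subseteq> {..Suc (Suc q)} \<times> {..Suc q}" "?B \<subseteq> {..Suc (Suc q)} \<times> {..Suc q}" by auto
    then show "finite ?A" "finite ?B" by (auto intro: finite_subset)
  qed auto
  also have "sum t ?A = (\<Sum>p\<in>?B. - t p)"
  proof (rule sum.reindex_bij_witness[where i = "\<lambda>(k, j). (Suc j, k)" and j = "\<lambda>(k, j). (j, k - 1)"])
    fix p assume "p \<in> ?A"
    then obtain k j where p: "p = (Suc k, j)" "j \<le> k" "k \<le> Suc q" by (cases p; cases "fst p") auto
    have "face_map j \<circ> face_map k = face_map (Suc k) \<circ> face_map j" using p(2) by (auto simp: face_map_def)
    then show "- t (case p of (k, j) \<Rightarrow> (j, k - 1)) = t p" by (simp add: p t_def add.commute)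
    show "(case case p of (k, j) \<Rightarrow> (j, k - 1) of (k, j) \<Rightarrow> (Suc j, k)) = p" "(case p of (k, j) \<Rightarrow> (j, k - 1)) \<in> ?B"
      using p by simp_all
  next
    fix p assume "p \<in> ?B"
    then show "(case case p of (k, j) \<Rightarrow> (Suc j, k) of (k, j) \<Rightarrow> (j, k - 1)) = p" "(case p of (k, j) \<Rightarrow> (Suc j, k)) \<in> ?A"
      by (cases p; simp)+
  qed
  also have "\<dots> + sum t ?B = 0" by (simp add: sum_negf)
  finally show ?thesis .
qed

lemma zext_face_sum_zero:
  assumes K: "abelian_group K" and c: "c \<in> fin_combs K (S (Suc (Suc q)))"
  shows "zext K (S q) (face_sum (Suc q)) (zext K (S (Suc q)) (face_sum (Suc (Suc q))) c) = (\<lambda>s. \<zero>\<^bsub>K\<^esub>)"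
proof -
  interpret K: abelian_group K by fact
  have "zext K (S q) (face_sum (Suc q)) (zext K (S (Suc q)) (face_sum (Suc (Suc q))) c) =
      zext K (S q) (\<lambda>s. frag_extend (face_sum (Suc q)) (face_sum (Suc (Suc q)) s)) c"
    by (rule K.zext_compose[OF keys_face_sum keys_face_sum c])
  also have "\<dots> = zext K (S q) (\<lambda>_. 0) c" by (rule K.zext_cong[OF face_sum_face_sum _ c]) auto
  finally show ?thesis using K.zext_zero[OF c] by simp
qed

end

text \<open>The splitting is an identity of integer matrices; on a \<open>c\<close> killed by
  \<open>v\<close> it reads \<open>c = D (u c)\<close>.\<close>

lemma (in abelian_group) zext_split_exact:
  assumes split: "\<And>x. x \<in> X \<Longrightarrow> frag_of x = frag_extend D (u x) + frag_extend E (v x)"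
    and u: "\<And>x. x \<in> X \<Longrightarrow> keys (u x) \<subseteq> V" and D: "\<And>x. x \<in> V \<Longrightarrow> keys (D x) \<subseteq> X"
    and v: "\<And>x. x \<in> X \<Longrightarrow> keys (v x) \<subseteq> W" and E: "\<And>x. x \<in> W \<Longrightarrow> keys (E x) \<subseteq> X"
    and c: "c \<in> fin_combs G X" and vc: "zext G W v c = (\<lambda>s. \<zero>)"
  shows "c \<in> zext G X D ` fin_combs G V"
proof -
  have k1: "keys (frag_extend D (u x)) \<subseteq> X" if "x \<in> X" for x
    by (rule keys_frag_extend_subset) (use u[OF that] D in blast)
  have k2: "keys (frag_extend E (v x)) \<subseteq> X" if "x \<in> X" for x
    by (rule keys_frag_extend_subset) (use v[OF that] E in blast)
  have uc: "zext G V u c \<in> fin_combs G V" using hom_in_carrier[OF zext_hom[of X u V]] u c by auto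
  then have Duc: "zext G X D (zext G V u c) \<in> fin_combs G X" using hom_in_carrier[OF zext_hom[of V D X]] D by auto
  have "c = zext G X frag_of c" using zext_id[OF c] by simp
  also have "\<dots> = zext G X (\<lambda>x. frag_extend D (u x) + frag_extend E (v x)) c"
    by (rule zext_cong[OF split order_trans[OF keys_add Un_least[OF k1 k2]] c])
  also have "\<dots> = (\<lambda>s. zext G X (\<lambda>x. frag_extend D (u x)) c s \<oplus> zext G X (\<lambda>x. frag_extend E (v x)) c s)"
    by (rule zext_add[OF k1 k2 c])
  also have "zext G X (\<lambda>x. frag_extend E (v x)) c = zext G X E (zext G W v c)"
    by (rule zext_compose[OF v E c, symmetric])
  also have "\<dots> = (\<lambda>s. \<zero>)" unfolding vc by (rule zext_0)
  also have "zext G X (\<lambda>x. frag_extend D (u x)) c = zext G X D (zext G V u c)"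
    by (rule zext_compose[OF u D c, symmetric])
  finally have "c = (\<lambda>s. zext G X D (zext G V u c) s \<oplus> \<zero>)" .
  then have "c = zext G X D (zext G V u c)" using fin_combs_closed[OF Duc] by simp
  then show ?thesis using uc by blast
qed

context simplicial_set
begin

text \<open>An extra degeneracy \<open>\<sigma>\<close> over an augmentation \<open>\<epsilon>\<close> with section \<open>\<eta>\<close>.\<close>

context
  fixes \<sigma> :: "nat \<Rightarrow> 'x \<Rightarrow> 'x" and \<epsilon> :: "'x \<Rightarrow> 'z" and \<eta> :: "'z \<Rightarrow> 'x" and Z :: "'z set"
  assumes \<sigma>: "\<And>n s. s \<in> S n \<Longrightarrow> \<sigma> n s \<in> S (Suc n)"
    and \<sigma>0: "\<And>n s. s \<in> S n \<Longrightarrow> pull n (face_map 0) (\<sigma> n s) = s"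
    and \<sigma>_Suc: "\<And>n s k. s \<in> S (Suc n) \<Longrightarrow> k \<le> Suc n \<Longrightarrow>
      pull (Suc n) (face_map (Suc k)) (\<sigma> (Suc n) s) = \<sigma> n (pull n (face_map k) s)"
    and \<sigma>1: "\<And>s. s \<in> S 0 \<Longrightarrow> pull 0 (face_map (Suc 0)) (\<sigma> 0 s) = \<eta> (\<epsilon> s)"
    and \<epsilon>: "\<And>s. s \<in> S 0 \<Longrightarrow> \<epsilon> s \<in> Z" and \<eta>: "\<And>z. z \<in> Z \<Longrightarrow> \<eta> z \<in> S 0"
begin

text \<open>Face \<open>0\<close> of \<open>\<sigma> x\<close> is \<open>x\<close>; the other faces
  are \<open>\<sigma>\<close> of the faces of \<open>x\<close>, with the index shifted by one and
  hence the opposite sign. So \<open>\<sigma>\<close> is a contracting homotopy.\<close>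

lemma extra_degeneracy_exact:
  assumes K: "abelian_group K" and c: "c \<in> fin_combs K (S (Suc n))"
    and dc: "zext K (S n) (face_sum (Suc n)) c = (\<lambda>s. \<zero>\<^bsub>K\<^esub>)"
  shows "c \<in> zext K (S (Suc n)) (face_sum (Suc (Suc n))) ` fin_combs K (S (Suc (Suc n)))"
proof (rule abelian_group.zext_split_exact[OF K _ _ keys_face_sum keys_face_sum _ c dc])
  fix x assume x: "x \<in> S (Suc n)"
  have "face_sum (Suc (Suc n)) (\<sigma> (Suc n) x) = frag_of x +
      (\<Sum>k\<le>Suc n. frag_cmul ((-1) ^ Suc k) (frag_of (pull (Suc n) (face_map (Suc k)) (\<sigma> (Suc n) x))))"
    unfolding face_sum_Suc sum.atMost_Suc_shift[of _ "Suc n"] by (simp add: \<sigma>0[OF x] del: sum.atMost_Suc)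
  also have "(\<Sum>k\<le>Suc n. frag_cmul ((-1) ^ Suc k) (frag_of (pull (Suc n) (face_map (Suc k)) (\<sigma> (Suc n) x)))) =
      - frag_extend (\<lambda>x. frag_of (\<sigma> n x)) (face_sum (Suc n) x)"
    unfolding face_sum_Suc frag_extend_face_sum sum_negf[symmetric]
    by (intro sum.cong refl) (simp add: \<sigma>_Suc[OF x])
  finally show "frag_of x = frag_extend (face_sum (Suc (Suc n))) (frag_of (\<sigma> (Suc n) x)) +
      frag_extend (\<lambda>x. frag_of (\<sigma> n x)) (face_sum (Suc n) x)" by simp
qed (use \<sigma> in simp_all)

text \<open>In degree 0, face \<open>1\<close> of \<open>\<sigma> x\<close> depends only on the
  augmentation of \<open>x\<close>, which takes over the role of the boundary.\<close>

lemma extra_degeneracy_exact_0: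
  assumes K: "abelian_group K" and c: "c \<in> fin_combs K (S 0)"
    and dc: "zext K Z (\<lambda>s. frag_of (\<epsilon> s)) c = (\<lambda>z. \<zero>\<^bsub>K\<^esub>)"
  shows "c \<in> zext K (S 0) (face_sum (Suc 0)) ` fin_combs K (S (Suc 0))"
proof (rule abelian_group.zext_split_exact[OF K _ _ keys_face_sum _ _ c dc])
  fix x assume x: "x \<in> S 0"
  show "frag_of x = frag_extend (face_sum (Suc 0)) (frag_of (\<sigma> 0 x)) + frag_extend (\<lambda>z. frag_of (\<eta> z)) (frag_of (\<epsilon> x))"
    unfolding frag_extend_of face_sum_Suc using \<sigma>0[OF x] \<sigma>1[OF x] by simp
qed (use \<sigma> \<epsilon> \<eta> in simp_all)

end

end

lemma simplicial_set_nerve: "simplicial_set (nerve C) nerve_pull"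
proof
  fix \<theta> m n F assume \<theta>: "\<theta> \<in> simplex_maps m n" and F: "F \<in> nerve C n"
  have mono: "\<theta> i \<le> \<theta> j" if "i \<le> j" "j \<le> m" for i j
    using \<theta> that mono_onD[of "{..m}" \<theta> i j] by (auto simp: simplex_maps_def)
  have le: "\<theta> i \<le> n" if "i \<le> m" for i using \<theta> that by (auto simp: simplex_maps_def)
  from F obtain ob where ob: "\<And>i. i \<le> n \<Longrightarrow> ob i \<in> cat_obj C \<and> F (i, i) = cat_id C (ob i)"
    "\<And>i j. i \<le> j \<Longrightarrow> j \<le> n \<Longrightarrow> F (i, j) \<in> cat_arr C \<and> cat_dom C (F (i, j)) = ob i \<and> cat_cod C (F (i, j)) = ob j"
    "\<And>i j k. i \<le> j \<Longrightarrow> j \<le> k \<Longrightarrow> k \<le> n \<Longrightarrow> F (i, k) = cat_comp C (F (j, k)) (F (i, j))"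
    unfolding nerve_def poset_arrows_def by blast
  show "nerve_pull m \<theta> F \<in> nerve C m"
    unfolding nerve_def mem_Collect_eq
  proof (intro conjI exI[of _ "\<lambda>i. ob (\<theta> i)"] allI impI ballI)
    show "nerve_pull m \<theta> F \<in> extensional (poset_arrows m)" by (simp add: nerve_pull_def)
  qed (auto simp: nerve_pull_def poset_arrows_def ob mono le)
next
  fix \<theta> \<eta> :: "nat \<Rightarrow> nat" and l m n and F
  assume "\<theta> \<in> simplex_maps m n" and \<eta>: "\<eta> \<in> simplex_maps l m" and "F \<in> nerve C n"
  have "(\<eta> i, \<eta> j) \<in> poset_arrows m" if "(i, j) \<in> poset_arrows l" for i j
    using that \<eta> mono_onD[of "{..l}" \<eta> i j] by (auto simp: simplex_maps_def poset_arrows_def)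
  then show "nerve_pull l \<eta> (nerve_pull m \<theta> F) = nerve_pull l (\<theta> \<circ> \<eta>) F"
    by (auto simp: nerve_pull_def fun_eq_iff restrict_def)
next
  fix F n assume "F \<in> nerve C n"
  then have "F \<in> extensional (poset_arrows n)" by (simp add: nerve_def)
  then show "nerve_pull n id F = F" by (auto simp: nerve_pull_def fun_eq_iff restrict_def extensional_def)
next
  fix m and \<theta> \<eta> :: "nat \<Rightarrow> nat" and F
  assume "\<And>i. i \<le> m \<Longrightarrow> \<theta> i = \<eta> i"
  then show "nerve_pull m \<theta> F = nerve_pull m \<eta> F"
    by (auto simp: nerve_pull_def fun_eq_iff restrict_def poset_arrows_def)
qed

section \<open>Currying combinations\<close>

text \<open>
  A combination of elements of \<open>B\<close> with coefficients in the combinations of \<open>Y\<close> is the same as a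
  combination of elements of \<open>S\<close>, where \<open>l\<close> identifies \<open>B \<times> Y\<close> with \<open>S\<close>.
\<close>

definition uncurry_comb :: "('k, 'x) ring_scheme \<Rightarrow> ('b \<times> 'y \<Rightarrow> 's) \<Rightarrow> 'b set \<Rightarrow> 'y set
    \<Rightarrow> ('b \<Rightarrow> 'y \<Rightarrow> 'k) \<Rightarrow> 's \<Rightarrow> 'k" where
  "uncurry_comb K l B Y c = (\<lambda>s. if s \<in> l ` (B \<times> Y)
    then case inv_into (B \<times> Y) l s of (G, y) \<Rightarrow> c G y else \<zero>\<^bsub>K\<^esub>)"

definition curry_comb :: "('k, 'x) ring_scheme \<Rightarrow> ('b \<times> 'y \<Rightarrow> 's) \<Rightarrow> 'b set \<Rightarrow> 'y set
    \<Rightarrow> ('s \<Rightarrow> 'k) \<Rightarrow> 'b \<Rightarrow> 'y \<Rightarrow> 'k" where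
  "curry_comb K l B Y e = (\<lambda>G y. if G \<in> B \<and> y \<in> Y then e (l (G, y)) else \<zero>\<^bsub>K\<^esub>)"

text \<open>\<open>L\<close> will be the monoid algebra \<open>KM\<close> and also a left module
  whose carrier is that of a monoid algebra; only the additive group counts.\<close>

locale curry = K: abelian_group K + L: abelian_group L
  for K :: "('k, 'x) ring_scheme" and L :: "('y \<Rightarrow> 'k, 'z) ring_scheme"
    and l :: "'b \<times> 'y \<Rightarrow> 's" and B :: "'b set" and Y :: "'y set" and S :: "'s set" +
  assumes carrier_L: "carrier L = fin_combs K Y" and zero_L: "\<zero>\<^bsub>L\<^esub> = (\<lambda>y. \<zero>\<^bsub>K\<^esub>)"
    and add_L: "\<And>c d. c \<oplus>\<^bsub>L\<^esub> d = (\<lambda>y. c y \<oplus>\<^bsub>K\<^esub> d y)"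
    and bij: "bij_betw l (B \<times> Y) S"
begin

abbreviation "U \<equiv> uncurry_comb K l B Y"
abbreviation "V \<equiv> curry_comb K l B Y"

lemma uncurry_comb_apply: "G \<in> B \<Longrightarrow> y \<in> Y \<Longrightarrow> U c (l (G, y)) = c G y"
  using bij by (auto simp: uncurry_comb_def bij_betw_def inv_into_f_f)

lemma uncurry_comb_outside: "s \<notin> S \<Longrightarrow> U c s = \<zero>\<^bsub>K\<^esub>"
  using bij by (simp add: uncurry_comb_def bij_betw_def)

lemma S_cases:
  assumes "s \<in> S" obtains G y where "G \<in> B" "y \<in> Y" "s = l (G, y)"
  using assms bij by (auto simp: bij_betw_def)

lemma fin_combs_L: "c \<in> fin_combs L B \<Longrightarrow> c G \<in> fin_combs K Y"
  using L.fin_combs_closed[of c B G] carrier_L by simp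

lemma uncurry_comb_in: "c \<in> fin_combs L B \<Longrightarrow> U c \<in> fin_combs K S"
proof (rule K.fin_combsI)
  assume c: "c \<in> fin_combs L B"
  note sc = fin_combs_supp[OF c]
  let ?T = "\<Union>G\<in>supp L c. (\<lambda>y. l (G, y)) ` supp K (c G)"
  show "finite ?T" using sc fin_combs_supp[OF fin_combs_L[OF c]] by blast
  show "U c s = \<zero>\<^bsub>K\<^esub>" if "s \<notin> S" for s using that by (rule uncurry_comb_outside)
  show "U c s = \<zero>\<^bsub>K\<^esub>" if s: "s \<notin> ?T" for s
  proof (cases "s \<in> S")
    case True
    then obtain G y where G: "G \<in> B" "y \<in> Y" "s = l (G, y)" by (rule S_cases)
    show ?thesis
    proof (rule ccontr)
      assume "U c s \<noteq> \<zero>\<^bsub>K\<^esub>"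
      then have "c G y \<noteq> \<zero>\<^bsub>K\<^esub>" using uncurry_comb_apply[OF G(1,2)] G(3) by simp
      then have "y \<in> supp K (c G)" "G \<in> supp L c" by (auto simp: supp_def zero_L)
      then show False using s G(3) by blast
    qed
  qed (rule uncurry_comb_outside)
  show "U c s \<in> carrier K" if "s \<in> S" for s
    using that K.fin_combs_closed[OF fin_combs_L[OF c]] by (auto elim!: S_cases simp: uncurry_comb_apply)
qed

lemma curry_comb_in: "e \<in> fin_combs K S \<Longrightarrow> V e \<in> fin_combs L B"
proof (rule L.fin_combsI)
  assume e: "e \<in> fin_combs K S"
  have fin: "finite ((inv_into (B \<times> Y) l) ` supp K e)" (is "finite ?P") using fin_combs_supp[OF e] by blast
  have P: "(G, y) \<in> ?P" if "V e G y \<noteq> \<zero>\<^bsub>K\<^esub>" for G y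
  proof -
    have G: "G \<in> B" "y \<in> Y" "e (l (G, y)) \<noteq> \<zero>\<^bsub>K\<^esub>" using that by (auto simp: curry_comb_def split: if_splits)
    then have "inv_into (B \<times> Y) l (l (G, y)) = (G, y)" "l (G, y) \<in> supp K e"
      using bij by (auto simp: bij_betw_def inv_into_f_f supp_def)
    then show ?thesis by (metis image_eqI)
  qed
  show "finite (fst ` ?P)" using fin by blast
  show "V e G = \<zero>\<^bsub>L\<^esub>" if "G \<notin> B" for G using that by (simp add: curry_comb_def zero_L)
  show "V e G = \<zero>\<^bsub>L\<^esub>" if "G \<notin> fst ` ?P" for G
    unfolding zero_L
  proof
    fix y show "V e G y = \<zero>\<^bsub>K\<^esub>" using imageI[OF P[of G y], of fst] that by auto
  qed
  show "V e G \<in> carrier L" for G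
    unfolding carrier_L
  proof (rule K.fin_combsI)
    show "finite (snd ` ?P)" using fin by blast
    show "V e G y = \<zero>\<^bsub>K\<^esub>" if "y \<notin> snd ` ?P" for y using imageI[OF P[of G y], of snd] that by auto
    show "V e G y = \<zero>\<^bsub>K\<^esub>" if "y \<notin> Y" for y using that by (simp add: curry_comb_def)
    show "V e G y \<in> carrier K" for y using K.fin_combs_closed[OF e] by (simp add: curry_comb_def)
  qed
qed

lemma curry_uncurry: "c \<in> fin_combs L B \<Longrightarrow> V (U c) = c"
  using fin_combs_outside[of c L B] fin_combs_outside[OF fin_combs_L[of c]]
  by (auto simp: fun_eq_iff curry_comb_def uncurry_comb_apply zero_L)

lemma uncurry_curry:
  assumes e: "e \<in> fin_combs K S" shows "U (V e) = e"
proof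
  fix s show "U (V e) s = e s"
  proof (cases "s \<in> S")
    case True
    then obtain G y where G: "G \<in> B" "y \<in> Y" "s = l (G, y)" by (rule S_cases)
    then show ?thesis using uncurry_comb_apply[OF G(1,2), of "V e"] by (simp add: curry_comb_def)
  qed (simp add: uncurry_comb_outside fin_combs_outside[OF e])
qed

lemma uncurry_hom: "U \<in> hom (comb_group L B) (comb_group K S)"
proof (rule homI)
  show "U (c \<otimes>\<^bsub>comb_group L B\<^esub> d) = U c \<otimes>\<^bsub>comb_group K S\<^esub> U d" for c d
    by (auto simp: uncurry_comb_def add_L fun_eq_iff split: prod.splits)
qed (simp add: uncurry_comb_in)

lemma curry_hom: "V \<in> hom (comb_group K S) (comb_group L B)"
proof (rule homI)
  show "V (c \<otimes>\<^bsub>comb_group K S\<^esub> d) = V c \<otimes>\<^bsub>comb_group L B\<^esub> V d" for c d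
    by (auto simp: curry_comb_def add_L fun_eq_iff)
qed (simp add: curry_comb_in)

lemma curry_single:
  assumes "G \<in> B" "y \<in> Y" shows "V (single K (l (G, y)) k) = single L G (single K y k)"
proof -
  have "l (G', y') = l (G, y) \<longleftrightarrow> G' = G \<and> y' = y" if "G' \<in> B" "y' \<in> Y" for G' y'
    using bij assms that by (auto simp: bij_betw_def inj_on_def)
  then show ?thesis using assms by (auto simp: curry_comb_def single_def zero_L fun_eq_iff)
qed

lemma uncurry_single:
  assumes "G \<in> B" "y \<in> Y" "k \<in> carrier K" shows "U (single L G (single K y k)) = single K (l (G, y)) k"
proof -
  have "l (G, y) \<in> S" using bij assms by (auto simp: bij_betw_def)
  then show ?thesis using uncurry_curry[of "single K (l (G, y)) k"] curry_single[OF assms(1,2)] assms(3) by (simp add: K.single_fin_combs)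
qed

lemma curry_hom_eq:
  assumes H: "group H" and f: "f \<in> hom (comb_group L B) H" and g: "g \<in> hom (comb_group L B) H"
    and eq: "\<And>G y k. G \<in> B \<Longrightarrow> y \<in> Y \<Longrightarrow> k \<in> carrier K \<Longrightarrow> f (single L G (single K y k)) = g (single L G (single K y k))"
    and c: "c \<in> fin_combs L B"
  shows "f c = g c"
proof -
  have "(f \<circ> V) (U c) = (g \<circ> V) (U c)"
    by (rule K.comb_hom_eq[OF H hom_compose[OF curry_hom f] hom_compose[OF curry_hom g] _ uncurry_comb_in[OF c]])
      (auto elim!: S_cases simp: curry_single eq)
  then show ?thesis by (simp add: curry_uncurry[OF c])
qed

end

section \<open>Nerves of two-sided categories\<close>

text \<open>An arrow \<open>(x, m, y)\<close> carries the first coordinate of its codomain and the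
  second coordinate of its domain; hence \<open>x j\<close> but \<open>y i\<close> in the entry at
  \<open>(i, j)\<close>.\<close>

definition simplex_of :: "nat \<Rightarrow> (nat \<Rightarrow> 'n) \<Rightarrow> (nat \<Rightarrow> nat \<Rightarrow> 'm) \<Rightarrow> (nat \<Rightarrow> 'p) \<Rightarrow> nat \<times> nat \<Rightarrow> 'n \<times> 'm \<times> 'p" where
  "simplex_of n x a y = (\<lambda>(i, j)\<in>poset_arrows n. (x j, a i j, y i))"

definition base_of :: "nat \<Rightarrow> (nat \<Rightarrow> 'n) \<Rightarrow> (nat \<Rightarrow> nat \<Rightarrow> 'm) \<Rightarrow> nat \<times> nat \<Rightarrow> 'n \<times> 'm" where
  "base_of n x a = (\<lambda>(i, j)\<in>poset_arrows n. (x j, a i j))"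

lemma simplex_of_apply: "i \<le> j \<Longrightarrow> j \<le> n \<Longrightarrow> simplex_of n x a y (i, j) = (x j, a i j, y i)"
  by (simp add: simplex_of_def poset_arrows_def)

lemma simplex_of_cong:
  assumes "\<And>i. i \<le> n \<Longrightarrow> x i = x' i \<and> y i = y' i" "\<And>i j. i \<le> j \<Longrightarrow> j \<le> n \<Longrightarrow> a i j = a' i j"
  shows "simplex_of n x a y = simplex_of n x' a' y'"
  using assms by (auto simp: simplex_of_def poset_arrows_def restrict_def fun_eq_iff)

lemma nerve_pull_simplex_of:
  assumes "\<theta> \<in> simplex_maps m n"
  shows "nerve_pull m \<theta> (simplex_of n x a y) = simplex_of m (\<lambda>i. x (\<theta> i)) (\<lambda>i j. a (\<theta> i) (\<theta> j)) (\<lambda>i. y (\<theta> i))"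
  using assms by (auto simp: nerve_pull_def simplex_of_def poset_arrows_def restrict_def fun_eq_iff simplex_maps_iff)

text \<open>\<open>z\<close> is the second coordinate of the initial object; the other objects
  receive theirs by acting with the arrows that start at \<open>0\<close>.\<close>

definition lift_simplex :: "('m \<Rightarrow> 'p) \<Rightarrow> ('p, 'w) monoid_scheme \<Rightarrow> nat
    \<Rightarrow> (nat \<times> nat \<Rightarrow> 'n \<times> 'm) \<times> 'p \<Rightarrow> nat \<times> nat \<Rightarrow> 'n \<times> 'm \<times> 'p" where
  "lift_simplex \<psi> P n = (\<lambda>(G, z). \<lambda>(i, j)\<in>poset_arrows n. (fst (G (i, j)), snd (G (i, j)), \<psi> (snd (G (0, i))) \<otimes>\<^bsub>P\<^esub> z))"

text \<open>Applies \<open>\<psi>\<close> to the second coordinates and translates them on the right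
  by \<open>z\<close>; right translation commutes with the left action.\<close>

definition map_simplex :: "('m \<Rightarrow> 'p) \<Rightarrow> ('p, 'w) monoid_scheme \<Rightarrow> nat \<Rightarrow> 'p
    \<Rightarrow> (nat \<times> nat \<Rightarrow> 'n \<times> 'm \<times> 'm) \<Rightarrow> nat \<times> nat \<Rightarrow> 'n \<times> 'm \<times> 'p" where
  "map_simplex \<psi> P n z F = (\<lambda>(i, j)\<in>poset_arrows n. (fst (F (i, j)), fst (snd (F (i, j))), \<psi> (snd (snd (F (i, j)))) \<otimes>\<^bsub>P\<^esub> z))"

lemma map_simplex_of: "map_simplex \<psi> P n z (simplex_of n x a y) = simplex_of n x a (\<lambda>i. \<psi> (y i) \<otimes>\<^bsub>P\<^esub> z)"
  by (auto simp: map_simplex_def simplex_of_def restrict_def fun_eq_iff)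

lemma lift_base_of: "lift_simplex \<psi> P n (base_of n x a, z) = simplex_of n x a (\<lambda>i. \<psi> (a 0 i) \<otimes>\<^bsub>P\<^esub> z)"
  by (auto simp: lift_simplex_def base_of_def simplex_of_def restrict_def fun_eq_iff poset_arrows_def)

text \<open>\<open>P = M\<close> with the identity gives the simplices behind the resolution,
  \<open>P = N\<close> with \<open>\<psi> = \<phi>\<close> those of the classifying space in the
  theorem.\<close>

locale bar_setting = M: monoid M + N: monoid N + P: monoid P
  for M :: "('m, 'x) monoid_scheme" and N :: "('n, 'y) monoid_scheme" and \<phi> :: "'m \<Rightarrow> 'n"
    and P :: "('p, 'w) monoid_scheme" and \<psi> :: "'m \<Rightarrow> 'p" +
  assumes \<phi>: "\<phi> \<in> monoid_hom M N" and \<psi>: "\<psi> \<in> monoid_hom M P"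
begin

lemma \<phi>_simps [simp]: "m \<in> carrier M \<Longrightarrow> \<phi> m \<in> carrier N" "\<phi> \<one>\<^bsub>M\<^esub> = \<one>\<^bsub>N\<^esub>"
  "m \<in> carrier M \<Longrightarrow> m' \<in> carrier M \<Longrightarrow> \<phi> (m \<otimes>\<^bsub>M\<^esub> m') = \<phi> m \<otimes>\<^bsub>N\<^esub> \<phi> m'"
  using \<phi> by (auto simp: monoid_hom_def hom_def)

lemma \<psi>_simps: "m \<in> carrier M \<Longrightarrow> \<psi> m \<in> carrier P" "\<psi> \<one>\<^bsub>M\<^esub> = \<one>\<^bsub>P\<^esub>"
  "m \<in> carrier M \<Longrightarrow> m' \<in> carrier M \<Longrightarrow> \<psi> (m \<otimes>\<^bsub>M\<^esub> m') = \<psi> m \<otimes>\<^bsub>P\<^esub> \<psi> m'"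
  using \<psi> by (auto simp: monoid_hom_def hom_def)

abbreviation "SP \<equiv> nerve (two_sided_category (carrier N) (\<lambda>n m. n \<otimes>\<^bsub>N\<^esub> \<phi> m) M (\<lambda>m y. \<psi> m \<otimes>\<^bsub>P\<^esub> y) (carrier P))"
abbreviation "SM \<equiv> nerve (two_sided_category (carrier N) (\<lambda>n m. n \<otimes>\<^bsub>N\<^esub> \<phi> m) M (\<lambda>m y. m \<otimes>\<^bsub>M\<^esub> y) (carrier M))"

text \<open>A functor from the poset to \<open>N \<rtimes> M \<ltimes> {*}\<close> in coordinates;
  \<open>act_data\<close> is what a simplex over \<open>P\<close> adds to it.\<close>

definition bar_data :: "nat \<Rightarrow> (nat \<Rightarrow> 'n) \<Rightarrow> (nat \<Rightarrow> nat \<Rightarrow> 'm) \<Rightarrow> bool" where "bar_data n x a \<longleftrightarrow> (\<forall>i\<le>n. x i \<in> carrier N \<and> a i i = \<one>\<^bsub>M\<^esub>) \<and>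
  (\<forall>i j. i \<le> j \<longrightarrow> j \<le> n \<longrightarrow> a i j \<in> carrier M \<and> x j \<otimes>\<^bsub>N\<^esub> \<phi> (a i j) = x i) \<and>
  (\<forall>i j k. i \<le> j \<longrightarrow> j \<le> k \<longrightarrow> k \<le> n \<longrightarrow> a j k \<otimes>\<^bsub>M\<^esub> a i j = a i k)"

definition act_data :: "nat \<Rightarrow> (nat \<Rightarrow> nat \<Rightarrow> 'm) \<Rightarrow> (nat \<Rightarrow> 'p) \<Rightarrow> bool" where "act_data n a y \<longleftrightarrow> (\<forall>i\<le>n. y i \<in> carrier P) \<and> (\<forall>i j. i \<le> j \<longrightarrow> j \<le> n \<longrightarrow> \<psi> (a i j) \<otimes>\<^bsub>P\<^esub> y i = y j)"

definition "bar_basis n = {base_of n x a |x a. bar_data n x a}"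

lemma bar_dataD:
  assumes "bar_data n x a"
  shows "i \<le> n \<Longrightarrow> x i \<in> carrier N" "i \<le> n \<Longrightarrow> a i i = \<one>\<^bsub>M\<^esub>" "i \<le> j \<Longrightarrow> j \<le> n \<Longrightarrow> a i j \<in> carrier M"
    "i \<le> j \<Longrightarrow> j \<le> n \<Longrightarrow> x j \<otimes>\<^bsub>N\<^esub> \<phi> (a i j) = x i"
    "i \<le> j \<Longrightarrow> j \<le> k \<Longrightarrow> k \<le> n \<Longrightarrow> a j k \<otimes>\<^bsub>M\<^esub> a i j = a i k"
  using assms by (auto simp: bar_data_def)

lemma act_dataD:
  assumes "act_data n a y"
  shows "i \<le> n \<Longrightarrow> y i \<in> carrier P" "i \<le> j \<Longrightarrow> j \<le> n \<Longrightarrow> \<psi> (a i j) \<otimes>\<^bsub>P\<^esub> y i = y j"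
  using assms by (auto simp: act_data_def)

text \<open>Conditions on domains and codomains become the equations for \<open>x\<close> and
  \<open>y\<close>, and functoriality becomes the product rule for \<open>a\<close>; the coordinates
  of objects are read off from \<open>ob\<close>.\<close>

lemma nerve_iff: "F \<in> SP n \<longleftrightarrow> (\<exists>x a y. bar_data n x a \<and> act_data n a y \<and> F = simplex_of n x a y)"
proof
  let ?C = "two_sided_category (carrier N) (\<lambda>n m. n \<otimes>\<^bsub>N\<^esub> \<phi> m) M (\<lambda>m y. \<psi> m \<otimes>\<^bsub>P\<^esub> y) (carrier P)"
  assume "F \<in> SP n"
  then obtain ob where ext: "F \<in> extensional (poset_arrows n)"
    and 1: "\<And>i. i \<le> n \<Longrightarrow> ob i \<in> cat_obj ?C \<and> F (i, i) = cat_id ?C (ob i)"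
    and 2: "\<And>i j. i \<le> j \<Longrightarrow> j \<le> n \<Longrightarrow> F (i, j) \<in> cat_arr ?C \<and> cat_dom ?C (F (i, j)) = ob i \<and> cat_cod ?C (F (i, j)) = ob j"
    and 3: "\<And>i j k. i \<le> j \<Longrightarrow> j \<le> k \<Longrightarrow> k \<le> n \<Longrightarrow> F (i, k) = cat_comp ?C (F (j, k)) (F (i, j))"
    unfolding nerve_def poset_arrows_def by blast
  define x where "x i = fst (ob i)" for i
  define y where "y i = snd (ob i)" for i
  define a where "a i j = fst (snd (F (i, j)))" for i j
  have ob: "ob i = (x i, y i)" for i by (simp add: x_def y_def)
  have F: "F (i, j) = (x j, a i j, y i)" "a i j \<in> carrier M" "x j \<otimes>\<^bsub>N\<^esub> \<phi> (a i j) = x i" "\<psi> (a i j) \<otimes>\<^bsub>P\<^esub> y i = y j"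
    if "i \<le> j" "j \<le> n" for i j
    using 2[OF that] by (cases "F (i, j)"; auto simp: two_sided_category_def ob a_def)+
  have "a i i = \<one>\<^bsub>M\<^esub>" "x i \<in> carrier N" "y i \<in> carrier P" if "i \<le> n" for i
    using 1[OF that] by (auto simp: two_sided_category_def ob a_def)
  moreover have "a j k \<otimes>\<^bsub>M\<^esub> a i j = a i k" if "i \<le> j" "j \<le> k" "k \<le> n" for i j k
    using 3[OF that] F[of i k] F[of i j] F[of j k] that by (simp add: two_sided_category_def)
  ultimately have "bar_data n x a" "act_data n a y" using F by (auto simp: bar_data_def act_data_def)
  moreover have "F = simplex_of n x a y"
    using ext F by (auto simp: simplex_of_def poset_arrows_def restrict_def fun_eq_iff extensional_def)
  ultimately show "\<exists>x a y. bar_data n x a \<and> act_data n a y \<and> F = simplex_of n x a y" by blast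
next
  assume "\<exists>x a y. bar_data n x a \<and> act_data n a y \<and> F = simplex_of n x a y"
  then obtain x a y where b: "bar_data n x a" and c: "act_data n a y" and F: "F = simplex_of n x a y" by blast
  show "F \<in> SP n"
    unfolding nerve_def mem_Collect_eq F
  proof (intro conjI exI[of _ "\<lambda>i. (x i, y i)"] allI impI ballI)
    show "simplex_of n x a y \<in> extensional (poset_arrows n)" by (simp add: simplex_of_def)
  qed (use bar_dataD[OF b] act_dataD[OF c] in \<open>auto simp: two_sided_category_def simplex_of_apply poset_arrows_def\<close>)
qed

lemma act_data_lift:
  assumes b: "bar_data n x a" and z: "z \<in> carrier P" shows "act_data n a (\<lambda>i. \<psi> (a 0 i) \<otimes>\<^bsub>P\<^esub> z)"
  unfolding act_data_def
proof (intro conjI allI impI)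
  show "\<psi> (a 0 i) \<otimes>\<^bsub>P\<^esub> z \<in> carrier P" if "i \<le> n" for i using bar_dataD(3)[OF b le0 that] z by (simp add: \<psi>_simps)
  show "\<psi> (a i j) \<otimes>\<^bsub>P\<^esub> (\<psi> (a 0 i) \<otimes>\<^bsub>P\<^esub> z) = \<psi> (a 0 j) \<otimes>\<^bsub>P\<^esub> z" if ij: "i \<le> j" "j \<le> n" for i j
  proof -
    have "a i j \<in> carrier M" "a 0 i \<in> carrier M" using bar_dataD(3)[OF b] ij by auto
    then show ?thesis using bar_dataD(5)[OF b le0 ij] z by (simp add: P.m_assoc[symmetric] \<psi>_simps(1) \<psi>_simps(3)[symmetric])
  qed
qed

text \<open>Since \<open>a 0 0\<close> is the unit, the coordinate at the initial object returns
  \<open>z\<close>; conversely it determines all others through the action.\<close>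

lemma lift_bij: "bij_betw (lift_simplex \<psi> P n) (bar_basis n \<times> carrier P) (SP n)"
proof (rule bij_betw_imageI)
  show "inj_on (lift_simplex \<psi> P n) (bar_basis n \<times> carrier P)"
  proof (rule inj_onI)
    fix u v assume u: "u \<in> bar_basis n \<times> carrier P" and v: "v \<in> bar_basis n \<times> carrier P"
      and eq: "lift_simplex \<psi> P n u = lift_simplex \<psi> P n v"
    obtain x a z where U: "u = (base_of n x a, z)" "bar_data n x a" "z \<in> carrier P" using u by (auto simp: bar_basis_def)
    obtain x' a' z' where V: "v = (base_of n x' a', z')" "bar_data n x' a'" "z' \<in> carrier P" using v by (auto simp: bar_basis_def)
    have e: "x j = x' j \<and> a i j = a' i j \<and> \<psi> (a 0 i) \<otimes>\<^bsub>P\<^esub> z = \<psi> (a' 0 i) \<otimes>\<^bsub>P\<^esub> z'" if "i \<le> j" "j \<le> n" for i j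
      using fun_cong[OF eq, of "(i, j)"] that unfolding U(1) V(1) lift_base_of by (simp add: simplex_of_apply)
    have "base_of n x a = base_of n x' a'" using e by (auto simp: base_of_def restrict_def poset_arrows_def fun_eq_iff)
    moreover have "z = z'" using e[of 0 0] bar_dataD(2)[OF U(2), of 0] bar_dataD(2)[OF V(2), of 0] U(3) V(3) by (simp add: \<psi>_simps(2))
    ultimately show "u = v" by (simp add: U(1) V(1))
  qed
  show "lift_simplex \<psi> P n ` (bar_basis n \<times> carrier P) = SP n"
  proof
    show "lift_simplex \<psi> P n ` (bar_basis n \<times> carrier P) \<subseteq> SP n"
    proof
      fix F assume "F \<in> lift_simplex \<psi> P n ` (bar_basis n \<times> carrier P)"
      then obtain x a z where "bar_data n x a" "z \<in> carrier P" "F = lift_simplex \<psi> P n (base_of n x a, z)"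
        by (auto simp: bar_basis_def)
      then show "F \<in> SP n" unfolding nerve_iff lift_base_of using act_data_lift by blast
    qed
    show "SP n \<subseteq> lift_simplex \<psi> P n ` (bar_basis n \<times> carrier P)"
    proof
      fix F assume "F \<in> SP n"
      then obtain x a y where F: "bar_data n x a" "act_data n a y" "F = simplex_of n x a y" unfolding nerve_iff by blast
      have "F = lift_simplex \<psi> P n (base_of n x a, y 0)"
        unfolding F(3) lift_base_of by (rule simplex_of_cong) (use act_dataD(2)[OF F(2) le0] in simp_all)
      moreover have "(base_of n x a, y 0) \<in> bar_basis n \<times> carrier P" using F act_dataD(1)[OF F(2)] by (auto simp: bar_basis_def)
      ultimately show "F \<in> lift_simplex \<psi> P n ` (bar_basis n \<times> carrier P)" by (metis image_eqI)
    qed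
  qed
qed

end

locale bar_setting_id = monoid_id: monoid M + bar_setting M N \<phi> M "\<lambda>m. m"
  for M :: "('m, 'x) monoid_scheme" and N :: "('n, 'y) monoid_scheme" and \<phi> :: "'m \<Rightarrow> 'n"
begin

text \<open>Prepends an object with second coordinate \<open>1\<close>. Over \<open>P = M\<close>
  the coordinates \<open>y j\<close> are themselves elements of \<open>M\<close>, so
  \<open>(x j, y j, 1)\<close> is an arrow to \<open>(x j, y j)\<close>. Its domain has first
  coordinate \<open>x j\<close> times \<open>\<phi> (y j)\<close>, which by
  \<open>augment_eq\<close> does not depend on \<open>j\<close>.\<close>

definition "cone_simplex n F = simplex_of (Suc n)
  (case_nat (fst (F (0, 0)) \<otimes>\<^bsub>N\<^esub> \<phi> (snd (snd (F (0, 0))))) (\<lambda>j. fst (F (j, j))))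
  (\<lambda>i j. case i of 0 \<Rightarrow> case_nat \<one>\<^bsub>M\<^esub> (\<lambda>j. snd (snd (F (j, j)))) j | Suc i' \<Rightarrow> fst (snd (F (i', j - 1))))
  (case_nat \<one>\<^bsub>M\<^esub> (\<lambda>i. snd (snd (F (i, i)))))"

text \<open>The first coordinate of the object that the cone prepends. \<open>point_simplex\<close>
  is the section that sends \<open>x\<close> to the object \<open>(x, 1)\<close>.\<close>

definition "augment F = fst (F (0 :: nat, 0 :: nat)) \<otimes>\<^bsub>N\<^esub> \<phi> (snd (snd (F (0, 0))))"

definition "point_simplex x = simplex_of 0 (\<lambda>_. x) (\<lambda>_ _. \<one>\<^bsub>M\<^esub>) (\<lambda>_. \<one>\<^bsub>M\<^esub>)"

lemma cone_simplex_of: "cone_simplex n (simplex_of n x a y) = simplex_of (Suc n)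
  (case_nat (x 0 \<otimes>\<^bsub>N\<^esub> \<phi> (y 0)) x) (\<lambda>i j. case i of 0 \<Rightarrow> case_nat \<one>\<^bsub>M\<^esub> y j | Suc i' \<Rightarrow> a i' (j - 1)) (case_nat \<one>\<^bsub>M\<^esub> y)"
  unfolding cone_simplex_def
proof (rule simplex_of_cong, intro conjI)
  fix i assume i: "i \<le> Suc n"
  let ?F = "simplex_of n x a y"
  show "(case i of 0 \<Rightarrow> fst (?F (0, 0)) \<otimes>\<^bsub>N\<^esub> \<phi> (snd (snd (?F (0, 0)))) | Suc j \<Rightarrow> fst (?F (j, j))) = (case i of 0 \<Rightarrow> x 0 \<otimes>\<^bsub>N\<^esub> \<phi> (y 0) | Suc j \<Rightarrow> x j)"
    "(case i of 0 \<Rightarrow> \<one>\<^bsub>M\<^esub> | Suc i \<Rightarrow> snd (snd (?F (i, i)))) = (case i of 0 \<Rightarrow> \<one>\<^bsub>M\<^esub> | Suc i \<Rightarrow> y i)"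
    using i by (cases i; simp add: simplex_of_apply)+
next
  let ?F = "simplex_of n x a y"
  fix i j assume "i \<le> j" "j \<le> Suc n"
  then show "(case i of 0 \<Rightarrow> case j of 0 \<Rightarrow> \<one>\<^bsub>M\<^esub> | Suc j \<Rightarrow> snd (snd (?F (j, j))) | Suc i' \<Rightarrow> fst (snd (?F (i', j - 1)))) =
      (case i of 0 \<Rightarrow> case j of 0 \<Rightarrow> \<one>\<^bsub>M\<^esub> | Suc j \<Rightarrow> y j | Suc i' \<Rightarrow> a i' (j - 1))"
    by (cases i; cases j; simp add: simplex_of_apply)
qed

text \<open>Moving \<open>\<phi> (a 0 i)\<close> from the first factor to the second turns
  \<open>x 0\<close> into \<open>x i\<close> and \<open>y 0\<close> into \<open>y i\<close>.\<close>

lemma augment_eq: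
  assumes b: "bar_data n x a" and c: "act_data n a y" and "i \<le> n"
  shows "x i \<otimes>\<^bsub>N\<^esub> \<phi> (y i) = x 0 \<otimes>\<^bsub>N\<^esub> \<phi> (y 0)"
proof -
  have "x 0 \<otimes>\<^bsub>N\<^esub> \<phi> (y 0) = x i \<otimes>\<^bsub>N\<^esub> \<phi> (a 0 i) \<otimes>\<^bsub>N\<^esub> \<phi> (y 0)" using bar_dataD(4)[OF b le0 assms(3)] by simp
  also have "\<dots> = x i \<otimes>\<^bsub>N\<^esub> \<phi> (a 0 i \<otimes>\<^bsub>M\<^esub> y 0)"
    using bar_dataD(1)[OF b assms(3)] bar_dataD(3)[OF b le0 assms(3)] act_dataD(1)[OF c le0] by (simp add: N.m_assoc)
  also have "a 0 i \<otimes>\<^bsub>M\<^esub> y 0 = y i" by (rule act_dataD(2)[OF c le0 assms(3)])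
  finally show ?thesis by simp
qed

lemma cone_simplex_in: "F \<in> SM n \<Longrightarrow> cone_simplex n F \<in> SM (Suc n)"
proof -
  assume "F \<in> SM n"
  then obtain x a y where b: "bar_data n x a" and c: "act_data n a y" and F: "F = simplex_of n x a y" unfolding nerve_iff by blast
  note B = bar_dataD[OF b] and C = act_dataD[OF c]
  let ?x = "case_nat (x 0 \<otimes>\<^bsub>N\<^esub> \<phi> (y 0)) x" and ?a = "\<lambda>i j. case i of 0 \<Rightarrow> case_nat \<one>\<^bsub>M\<^esub> y j | Suc i' \<Rightarrow> a i' (j - 1)"
  let ?y = "case_nat \<one>\<^bsub>M\<^esub> y"
  have "bar_data (Suc n) ?x ?a"
    unfolding bar_data_def
  proof (intro conjI allI impI)
    show "?x i \<in> carrier N" "?a i i = \<one>\<^bsub>M\<^esub>" if "i \<le> Suc n" for i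
      using that B(1)[of 0] B(1)[of "i - 1"] B(2)[of "i - 1"] C(1)[of 0] by (cases i; simp)+
    show "?a i j \<in> carrier M" if "i \<le> j" "j \<le> Suc n" for i j
      using that B(3)[of "i - 1" "j - 1"] C(1)[of "j - 1"] by (cases i; cases j; simp)
    show "?x j \<otimes>\<^bsub>N\<^esub> \<phi> (?a i j) = ?x i" if "i \<le> j" "j \<le> Suc n" for i j
      using that B(1)[of 0] C(1)[of 0] B(4)[of "i - 1" "j - 1"] augment_eq[OF b c, of "j - 1"] by (cases i; cases j; simp)
    show "?a j k \<otimes>\<^bsub>M\<^esub> ?a i j = ?a i k" if "i \<le> j" "j \<le> k" "k \<le> Suc n" for i j k
      using that C(1)[of "k - 1"] C(2)[of "j - 1" "k - 1"] B(5)[of "i - 1" "j - 1" "k - 1"] by (cases i; cases j; cases k; simp)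
  qed
  moreover have "act_data (Suc n) ?a ?y"
    unfolding act_data_def
  proof (intro conjI allI impI)
    show "?y i \<in> carrier M" if "i \<le> Suc n" for i using that C(1)[of "i - 1"] by (cases i; simp)
    show "?a i j \<otimes>\<^bsub>M\<^esub> ?y i = ?y j" if "i \<le> j" "j \<le> Suc n" for i j
      using that C(1)[of "j - 1"] C(2)[of "i - 1" "j - 1"] by (cases i; cases j; simp)
  qed
  ultimately show ?thesis unfolding F cone_simplex_of nerve_iff by blast
qed

lemma face_0_cone: "F \<in> SM n \<Longrightarrow> nerve_pull n (face_map 0) (cone_simplex n F) = F"
proof -
  assume "F \<in> SM n"
  then obtain x a y where F: "F = simplex_of n x a y" unfolding nerve_iff by blast
  show ?thesis
    unfolding F cone_simplex_of nerve_pull_simplex_of[OF face_map_in[OF le0]]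
    by (rule simplex_of_cong) (simp_all add: face_map_def)
qed

lemma face_Suc_cone:
  assumes "F \<in> SM (Suc n)" and k: "k \<le> Suc n"
  shows "nerve_pull (Suc n) (face_map (Suc k)) (cone_simplex (Suc n) F) = cone_simplex n (nerve_pull n (face_map k) F)"
proof -
  obtain x a y where b: "bar_data (Suc n) x a" and c: "act_data (Suc n) a y" and F: "F = simplex_of (Suc n) x a y"
    using assms unfolding nerve_iff by blast
  have k': "face_map (Suc k) \<in> simplex_maps (Suc n) (Suc (Suc n))" "face_map k \<in> simplex_maps n (Suc n)"
    using k by (auto intro: face_map_in)
  show ?thesis
    unfolding F cone_simplex_of nerve_pull_simplex_of[OF k'(1)] nerve_pull_simplex_of[OF k'(2)]
  proof (rule simplex_of_cong, intro conjI)
    note f = face_map_def[of "Suc k"] face_map_def[of k]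
    \<comment> \<open>For \<open>k = 0\<close> the face drops vertex \<open>0\<close>, yet the apex
      does not change, as the augmentation has the same value at all vertices.\<close>
    have 0: "x (face_map k 0) \<otimes>\<^bsub>N\<^esub> \<phi> (y (face_map k 0)) = x 0 \<otimes>\<^bsub>N\<^esub> \<phi> (y 0)"
      by (rule augment_eq[OF b c]) (simp add: face_map_def)
    fix i assume i: "i \<le> Suc n"
    show "(case face_map (Suc k) i of 0 \<Rightarrow> x 0 \<otimes>\<^bsub>N\<^esub> \<phi> (y 0) | Suc j \<Rightarrow> x j) =
        (case i of 0 \<Rightarrow> x (face_map k 0) \<otimes>\<^bsub>N\<^esub> \<phi> (y (face_map k 0)) | Suc j \<Rightarrow> x (face_map k j))"
      "(case face_map (Suc k) i of 0 \<Rightarrow> \<one>\<^bsub>M\<^esub> | Suc j \<Rightarrow> y j) = (case i of 0 \<Rightarrow> \<one>\<^bsub>M\<^esub> | Suc j \<Rightarrow> y (face_map k j))"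
      unfolding 0 by (cases i; simp add: f)+
  next
    note f = face_map_def[of "Suc k"] face_map_def[of k]
    fix i j assume "i \<le> j" "j \<le> Suc n"
    then show "(case face_map (Suc k) i of 0 \<Rightarrow> case face_map (Suc k) j of 0 \<Rightarrow> \<one>\<^bsub>M\<^esub> | Suc j \<Rightarrow> y j
          | Suc i' \<Rightarrow> a i' (face_map (Suc k) j - 1)) =
        (case i of 0 \<Rightarrow> case j of 0 \<Rightarrow> \<one>\<^bsub>M\<^esub> | Suc j \<Rightarrow> y (face_map k j) | Suc i' \<Rightarrow> a (face_map k i') (face_map k (j - 1)))"
      by (cases i; cases j; simp add: f)
  qed
qed

lemma face_1_cone: "F \<in> SM 0 \<Longrightarrow> nerve_pull 0 (face_map (Suc 0)) (cone_simplex 0 F) = point_simplex (augment F)"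
proof -
  assume "F \<in> SM 0"
  then obtain x a y where F: "F = simplex_of 0 x a y" unfolding nerve_iff by blast
  have "face_map (Suc 0) \<in> simplex_maps 0 (Suc 0)" by (rule face_map_in) simp
  then show ?thesis
    unfolding F cone_simplex_of point_simplex_def augment_def
    by (subst nerve_pull_simplex_of) (auto simp: simplex_of_apply face_map_def intro: simplex_of_cong)
qed

lemma augment_in: "F \<in> SM 0 \<Longrightarrow> augment F \<in> carrier N"
  unfolding nerve_iff augment_def by (auto simp: simplex_of_apply bar_dataD(1) act_dataD(1))

lemma point_simplex_in: "x \<in> carrier N \<Longrightarrow> point_simplex x \<in> SM 0"
  unfolding nerve_iff point_simplex_def
  by (rule exI[of _ "\<lambda>_. x"], rule exI[of _ "\<lambda>_ _. \<one>\<^bsub>M\<^esub>"], rule exI[of _ "\<lambda>_. \<one>\<^bsub>M\<^esub>"]) (simp add: bar_data_def act_data_def)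

text \<open>The value is the same for both faces, which makes the augmentation vanish on
  boundaries.\<close>

lemma augment_face: "F \<in> SM (Suc 0) \<Longrightarrow> k \<le> Suc 0 \<Longrightarrow> augment (nerve_pull 0 (face_map k) F) = fst (F (0, 0)) \<otimes>\<^bsub>N\<^esub> \<phi> (snd (snd (F (0, 0))))"
proof -
  assume "F \<in> SM (Suc 0)" and k: "k \<le> Suc 0"
  then obtain x a y where b: "bar_data (Suc 0) x a" and c: "act_data (Suc 0) a y" and F: "F = simplex_of (Suc 0) x a y"
    unfolding nerve_iff by blast
  have k': "face_map k \<in> simplex_maps 0 (Suc 0)" using k by (auto intro: face_map_in)
  show ?thesis
    unfolding F augment_def nerve_pull_simplex_of[OF k']
    using augment_eq[OF b c, of "face_map k 0"] k by (auto simp: simplex_of_apply face_map_def)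
qed

lemma augment_point: "x \<in> carrier N \<Longrightarrow> augment (point_simplex x) = x"
  by (simp add: augment_def point_simplex_def simplex_of_apply)

end

section \<open>The bar resolution\<close>

lemma (in ring) fin_combs_mult_right:
  assumes "c \<in> fin_combs R X" "k \<in> carrier R" shows "(\<lambda>s. c s \<otimes> k) \<in> fin_combs R X"
proof -
  interpret F: right_module R "free_right_module R X" by (rule right_module_free_right_module) (rule ring_axioms)
  show ?thesis using F.smult_closed[of k c] assms by simp
qed

lemma (in ring) mult_right_hom:
  "k \<in> carrier R \<Longrightarrow> (\<lambda>c s. c s \<otimes> k) \<in> hom (comb_group R X) (comb_group R X)"
  using fin_combs_closed[of _ X] by (intro homI) (simp_all add: fin_combs_mult_right l_distr)

lemma (in ring) zext_mult_right:
  assumes w: "\<And>a. a \<in> X \<Longrightarrow> keys (w a) \<subseteq> Y" and c: "c \<in> fin_combs R X" and k: "k \<in> carrier R"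
  shows "zext R Y w (\<lambda>s. c s \<otimes> k) = (\<lambda>s. zext R Y w c s \<otimes> k)"
proof -
  have "(zext R Y w \<circ> (\<lambda>c s. c s \<otimes> k)) c = ((\<lambda>c s. c s \<otimes> k) \<circ> zext R Y w) c"
  proof (rule comb_hom_eq[OF group_comb hom_compose[OF mult_right_hom[OF k] zext_hom[OF w]]
      hom_compose[OF zext_hom[OF w] mult_right_hom[OF k]] _ c])
    fix a r assume a: "a \<in> X" and r: "r \<in> carrier R"
    have "(\<lambda>s. single R a r s \<otimes> k) = single R a (r \<otimes> k)" using k by (auto simp: single_def)
    then show "(zext R Y w \<circ> (\<lambda>c s. c s \<otimes> k)) (single R a r) = ((\<lambda>c s. c s \<otimes> k) \<circ> zext R Y w) (single R a r)"
      using zext_single[OF w a] r k by (simp add: zact_def add_pow_ldistr_int)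
  qed
  then show ?thesis by simp
qed

lemma (in ring) single_mult_right: "k \<in> carrier R \<Longrightarrow> (\<lambda>s. single R a r s \<otimes> k) = single R a (r \<otimes> k)"
  by (auto simp: single_def)

abbreviation nerve_face_sum :: "nat \<Rightarrow> (nat \<times> nat \<Rightarrow> 'a) \<Rightarrow> ((nat \<times> nat \<Rightarrow> 'a) \<Rightarrow>\<^sub>0 int)" where
  "nerve_face_sum \<equiv> simplicial_set.face_sum nerve_pull"

lemma nerve_pull_map_simplex:
  "\<theta> \<in> simplex_maps m n \<Longrightarrow> nerve_pull m \<theta> (map_simplex \<psi> P n z F) = map_simplex \<psi> P m z (nerve_pull m \<theta> F)"
  by (auto simp: nerve_pull_def map_simplex_def poset_arrows_def restrict_def fun_eq_iff simplex_maps_iff)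

locale bar_ring = bar_setting M N \<phi> P \<psi> + K: ring K
  for K :: "('k, 'z) ring_scheme" and M :: "('m, 'x) monoid_scheme" and N :: "('n, 'y) monoid_scheme" and \<phi> :: "'m \<Rightarrow> 'n"
    and P :: "('p, 'w) monoid_scheme" and \<psi> :: "'m \<Rightarrow> 'p"
begin

sublocale id: bar_setting_id M N \<phi>
  by unfold_locales (use \<phi> in \<open>auto simp: monoid_hom_def hom_def\<close>)
sublocale KM: monoid_over_ring K M by unfold_locales
sublocale KP: monoid_over_ring K P by unfold_locales

abbreviation "A \<equiv> left_restrict (monoid_algebra K P) (monoid_algebra_map K \<psi>)"
abbreviation "KM \<equiv> monoid_algebra K M"

lemma A_simps [simp]: "carrier A = fin_combs K (carrier P)" "c \<oplus>\<^bsub>A\<^esub> d = (\<lambda>y. c y \<oplus>\<^bsub>K\<^esub> d y)" "\<zero>\<^bsub>A\<^esub> = (\<lambda>y. \<zero>\<^bsub>K\<^esub>)"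
  "r \<odot>\<^bsub>A\<^esub> b = monoid_algebra_map K \<psi> r \<otimes>\<^bsub>monoid_algebra K P\<^esub> b"
  by (simp_all add: left_restrict_def monoid_algebra_def)

sublocale A: left_module KM A
  by (rule left_module_left_restrict[OF KM.ring_monoid_algebra KP.ring_monoid_algebra
      monoid_algebra_map_ring_hom[OF K.ring_axioms M.monoid_axioms P.monoid_axioms \<psi>]])

text \<open>Combinations of \<open>SM n\<close> form the free right module over \<open>KM\<close> on
  \<open>bar_basis n\<close>; through \<open>CP\<close>, those of \<open>SP n\<close> form its
  tensor product with \<open>A\<close>.\<close>

sublocale CM: curry K KM "lift_simplex (\<lambda>m. m) M n" "bar_basis n" "carrier M" "SM n" for n
proof (intro curry.intro curry_axioms.intro)
  show "abelian_group KM" using KM.ring_monoid_algebra by (rule ring.is_abelian_group)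
qed (simp_all add: id.lift_bij K.abelian_group_axioms)

sublocale CP: curry K A "lift_simplex \<psi> P n" "bar_basis n" "carrier P" "SP n" for n
proof (intro curry.intro curry_axioms.intro)
  show "abelian_group A" by (rule A.A.abelian_group_axioms)
qed (simp_all add: lift_bij K.abelian_group_axioms)

text \<open>How the one-point combination at \<open>z\<close> with value \<open>k\<close> acts on
  simplices: scalars are multiplied by \<open>k\<close> and second coordinates are translated by
  \<open>z\<close>.\<close>

definition translate :: "nat \<Rightarrow> 'p \<Rightarrow> 'k \<Rightarrow> ((nat \<times> nat \<Rightarrow> 'n \<times> 'm \<times> 'm) \<Rightarrow> 'k) \<Rightarrow> (nat \<times> nat \<Rightarrow> 'n \<times> 'm \<times> 'p) \<Rightarrow> 'k" where
  "translate n z k e = zext K (SP n) (\<lambda>s. frag_of (map_simplex \<psi> P n z s)) (\<lambda>s. e s \<otimes>\<^bsub>K\<^esub> k)"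

lemma map_lift_simplex:
  assumes G: "G \<in> bar_basis n" and m: "m \<in> carrier M" and z: "z \<in> carrier P"
  shows "map_simplex \<psi> P n z (lift_simplex (\<lambda>m. m) M n (G, m)) = lift_simplex \<psi> P n (G, \<psi> m \<otimes>\<^bsub>P\<^esub> z)"
proof -
  obtain x a where b: "G = base_of n x a" "bar_data n x a" using G by (auto simp: bar_basis_def)
  show ?thesis
    unfolding b(1) lift_base_of map_simplex_of
    by (rule simplex_of_cong) (use bar_dataD(3)[OF b(2) le0] m z in \<open>simp_all add: \<psi>_simps P.m_assoc\<close>)
qed

lemma map_simplex_in:
  assumes "s \<in> SM n" "z \<in> carrier P" shows "map_simplex \<psi> P n z s \<in> SP n"
proof -
  obtain G m where G: "G \<in> bar_basis n" "m \<in> carrier M" "s = lift_simplex (\<lambda>m. m) M n (G, m)" using CM.S_cases[OF assms(1)] .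
  then show ?thesis using map_lift_simplex[OF G(1,2) assms(2)] lift_bij[of n] assms(2)
    by (auto simp: bij_betw_def \<psi>_simps)
qed

lemma keys_map_simplex: "z \<in> carrier P \<Longrightarrow> s \<in> SM n \<Longrightarrow> keys (frag_of (map_simplex \<psi> P n z s)) \<subseteq> SP n"
  using map_simplex_in by simp

lemma translate_hom:
  assumes z: "z \<in> carrier P" and k: "k \<in> carrier K"
  shows "translate n z k \<in> hom (comb_group K (SM n)) (comb_group K (SP n))"
  using hom_compose[OF K.mult_right_hom[OF k] K.zext_hom[OF keys_map_simplex[OF z]]]
  unfolding comp_def translate_def[abs_def] .

lemma translate_single:
  assumes "z \<in> carrier P" "k \<in> carrier K" "s \<in> SM n" "r \<in> carrier K"
  shows "translate n z k (single K s r) = single K (map_simplex \<psi> P n z s) (r \<otimes>\<^bsub>K\<^esub> k)"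
  unfolding translate_def K.single_mult_right[OF assms(2)]
  using K.zext_single[OF keys_map_simplex[OF assms(1)] assms(3)] assms by (simp add: K.zact_frag_of)

text \<open>On the simplex over \<open>G\<close> with initial coordinate \<open>m\<close>, both
  sides are concentrated at \<open>G\<close> and there at the product of \<open>\<psi> m\<close>
  with \<open>z\<close>. Multiplying coefficients is translating simplices.\<close>

lemma lact_curry:
  assumes e: "e \<in> fin_combs K (SM n)" and z: "z \<in> carrier P" and k: "k \<in> carrier K"
  shows "lact A (CM.V n e) (single K z k) = CP.V n (translate n z k e)"
proof -
  have zk: "single K z k \<in> carrier A" using K.single_fin_combs[OF z k] by simp
  have "((\<lambda>p. lact A p (single K z k)) \<circ> CM.V n) e = (CP.V n \<circ> translate n z k) e"
  proof (rule K.comb_hom_eq[OF A.A.group_comb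
      hom_compose[OF CM.curry_hom A.lact_hom[OF zk]] hom_compose[OF translate_hom[OF z k] CP.curry_hom] _ e])
    fix s r assume s: "s \<in> SM n" and r: "r \<in> carrier K"
    obtain G m where G: "G \<in> bar_basis n" "m \<in> carrier M" "s = lift_simplex (\<lambda>m. m) M n (G, m)" using CM.S_cases[OF s] .
    have "lact A (CM.V n (single K s r)) (single K z k) = single A G (single K (\<psi> m \<otimes>\<^bsub>P\<^esub> z) (r \<otimes>\<^bsub>K\<^esub> k))"
      unfolding G(3) CM.curry_single[OF G(1,2)] A.lact_single[OF zk] A_simps(4)
        monoid_algebra_map_single[OF K.ring_axioms M.monoid_axioms P.monoid_axioms \<psi> G(2) r]
      using KP.mult_single[OF _ z r k] G(2) by (simp add: \<psi>_simps)
    also have "\<dots> = CP.V n (translate n z k (single K s r))"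
      unfolding translate_single[OF z k s r] unfolding G(3) map_lift_simplex[OF G(1,2) z]
      using CP.curry_single[OF G(1)] G(2) z by (simp add: \<psi>_simps)
    finally show "((\<lambda>p. lact A p (single K z k)) \<circ> CM.V n) (single K s r) = (CP.V n \<circ> translate n z k) (single K s r)" by simp
  qed
  then show ?thesis by simp
qed

sublocale SM: simplicial_set SM nerve_pull by (rule simplicial_set_nerve)
sublocale SP: simplicial_set SP nerve_pull by (rule simplicial_set_nerve)

text \<open>Translation is a simplicial map, and integer matrices commute with the scalar
  \<open>k\<close>.\<close>

lemma face_sum_translate:
  assumes e: "e \<in> fin_combs K (SM (Suc n))" and z: "z \<in> carrier P" and k: "k \<in> carrier K"
  shows "zext K (SP n) (nerve_face_sum (Suc n)) (translate (Suc n) z k e) =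
    translate n z k (zext K (SM n) (nerve_face_sum (Suc n)) e)"
proof -
  have ek: "(\<lambda>s. e s \<otimes>\<^bsub>K\<^esub> k) \<in> fin_combs K (SM (Suc n))" by (rule K.fin_combs_mult_right[OF e k])
  have "zext K (SP n) (nerve_face_sum (Suc n)) (translate (Suc n) z k e) =
      zext K (SP n) (\<lambda>s. frag_extend (nerve_face_sum (Suc n)) (frag_of (map_simplex \<psi> P (Suc n) z s))) (\<lambda>s. e s \<otimes>\<^bsub>K\<^esub> k)"
    unfolding translate_def by (rule K.zext_compose[OF keys_map_simplex[OF z] SP.keys_face_sum ek])
  also have "\<dots> = zext K (SP n) (\<lambda>s. frag_extend (\<lambda>s. frag_of (map_simplex \<psi> P n z s)) (nerve_face_sum (Suc n) s)) (\<lambda>s. e s \<otimes>\<^bsub>K\<^esub> k)"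
  proof (rule K.zext_cong[OF _ _ ek])
    fix s assume s: "s \<in> SM (Suc n)"
    show "frag_extend (nerve_face_sum (Suc n)) (frag_of (map_simplex \<psi> P (Suc n) z s)) =
        frag_extend (\<lambda>s. frag_of (map_simplex \<psi> P n z s)) (nerve_face_sum (Suc n) s)"
      unfolding frag_extend_of SM.face_sum_Suc SP.face_sum_Suc frag_extend_face_sum
      by (intro sum.cong refl) (simp add: nerve_pull_map_simplex[OF face_map_in])
    show "keys (frag_extend (\<lambda>s. frag_of (map_simplex \<psi> P n z s)) (nerve_face_sum (Suc n) s)) \<subseteq> SP n"
      by (rule keys_frag_extend_subset) (use SM.keys_face_sum[OF s] keys_map_simplex[OF z] in blast)
  qed
  also have "\<dots> = zext K (SP n) (\<lambda>s. frag_of (map_simplex \<psi> P n z s)) (zext K (SM n) (nerve_face_sum (Suc n)) (\<lambda>s. e s \<otimes>\<^bsub>K\<^esub> k))"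
    by (rule K.zext_compose[OF SM.keys_face_sum keys_map_simplex[OF z] ek, symmetric])
  also have "\<dots> = translate n z k (zext K (SM n) (nerve_face_sum (Suc n)) e)"
    using K.zext_mult_right[of "SM (Suc n)" "nerve_face_sum (Suc n)" "SM n", OF SM.keys_face_sum e k] by (simp add: translate_def)
  finally show ?thesis .
qed

definition bar_d :: "nat \<Rightarrow> ((nat \<times> nat \<Rightarrow> 'n \<times> 'm) \<Rightarrow> 'm \<Rightarrow> 'k) \<Rightarrow> (nat \<times> nat \<Rightarrow> 'n \<times> 'm) \<Rightarrow> 'm \<Rightarrow> 'k" where
  "bar_d n c = CM.V (n - 1) (zext K (SM (n - 1)) (nerve_face_sum n) (CM.U n c))"

lemma bar_d_hom: "bar_d (Suc n) \<in> hom (comb_group KM (bar_basis (Suc n))) (comb_group KM (bar_basis n))"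
proof -
  have "zext K (SM n) (nerve_face_sum (Suc n)) \<in> hom (comb_group K (SM (Suc n))) (comb_group K (SM n))"
    by (rule K.zext_hom[OF SM.keys_face_sum])
  from hom_compose[OF CM.uncurry_hom hom_compose[OF this CM.curry_hom]]
  show ?thesis unfolding comp_def bar_d_def[abs_def] diff_Suc_1 .
qed

end

lemma (in abelian_group) zext_closed:
  "(\<And>a. a \<in> X \<Longrightarrow> keys (w a) \<subseteq> Y) \<Longrightarrow> c \<in> fin_combs G X \<Longrightarrow> zext G Y w c \<in> fin_combs G Y"
  using hom_in_carrier[OF zext_hom[of X w Y], of c] by simp

lemma (in simplicial_set) zext_face_sum_closed:
  "abelian_group K \<Longrightarrow> c \<in> fin_combs K (S (Suc n)) \<Longrightarrow> zext K (S n) (face_sum (Suc n)) c \<in> fin_combs K (S n)"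
  by (rule abelian_group.zext_closed[OF _ keys_face_sum])

locale bar_resolution = bar_ring K M N \<phi> M "\<lambda>m. m"
  for K :: "('k, 'z) ring_scheme" and M :: "('m, 'x) monoid_scheme" and N :: "('n, 'y) monoid_scheme" and \<phi> :: "'m \<Rightarrow> 'n"
begin

sublocale KN: monoid_over_ring K N by unfold_locales

lemma monoid_algebra_map_id:
  assumes c: "c \<in> fin_combs K (carrier M)" shows "monoid_algebra_map K (\<lambda>m. m) c = c"
proof -
  have "(\<lambda>c. c) \<in> hom (comb_group K (carrier M)) (comb_group K (carrier M))" by (simp add: hom_def)
  from KM.KM_eqI[OF monoid_algebra_map_hom[OF K.ring_axioms M.monoid_axioms M.monoid_axioms \<psi>] this _ c]
  show ?thesis by (simp add: monoid_algebra_map_single[OF K.ring_axioms M.monoid_axioms M.monoid_axioms \<psi>])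
qed

lemma lact_regular: "p \<in> fin_combs KM X \<Longrightarrow> lact A p r = (\<lambda>b. p b \<otimes>\<^bsub>KM\<^esub> r)"
  using A.R.fin_combs_closed[of p X] by (simp add: lact_def monoid_algebra_map_id)

lemma right_mult_hom:
  assumes c: "c \<in> fin_combs KM X" shows "(\<lambda>r b. c b \<otimes>\<^bsub>KM\<^esub> r) \<in> hom (comb_group K (carrier M)) (comb_group KM X)"
proof (rule homI)
  fix r r' assume r: "r \<in> carrier (comb_group K (carrier M))" "r' \<in> carrier (comb_group K (carrier M))"
  show "(\<lambda>b. c b \<otimes>\<^bsub>KM\<^esub> r) \<in> carrier (comb_group KM X)" using A.R.fin_combs_mult_right[OF c, of r] r by simp
  show "(\<lambda>b. c b \<otimes>\<^bsub>KM\<^esub> (r \<otimes>\<^bsub>comb_group K (carrier M)\<^esub> r')) =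
      (\<lambda>b. c b \<otimes>\<^bsub>KM\<^esub> r) \<otimes>\<^bsub>comb_group KM X\<^esub> (\<lambda>b. c b \<otimes>\<^bsub>KM\<^esub> r')"
    using A.R.r_distr[of r r' "c _"] A.R.fin_combs_closed[OF c] r by simp
qed

text \<open>By additivity in \<open>r\<close> it suffices to multiply by one-point combinations;
  these act by \<open>translate\<close>, with which face sums commute.\<close>

lemma bar_d_mult:
  assumes c: "c \<in> fin_combs KM (bar_basis (Suc n))" and r: "r \<in> fin_combs K (carrier M)"
  shows "bar_d (Suc n) (\<lambda>b. c b \<otimes>\<^bsub>KM\<^esub> r) = (\<lambda>b. bar_d (Suc n) c b \<otimes>\<^bsub>KM\<^esub> r)"
proof -
  have dc: "bar_d (Suc n) c \<in> fin_combs KM (bar_basis n)" using hom_in_carrier[OF bar_d_hom, of c n] c by simp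
  have "(bar_d (Suc n) \<circ> (\<lambda>r b. c b \<otimes>\<^bsub>KM\<^esub> r)) r = (\<lambda>r b. bar_d (Suc n) c b \<otimes>\<^bsub>KM\<^esub> r) r"
  proof (rule K.comb_hom_eq[OF A.R.group_comb hom_compose[OF right_mult_hom[OF c] bar_d_hom] right_mult_hom[OF dc] _ r])
    fix z k assume z: "z \<in> carrier M" and k: "k \<in> carrier K"
    have Uc: "CM.U (Suc n) c \<in> fin_combs K (SM (Suc n))" by (rule CM.uncurry_comb_in[OF c])
    have dUc: "zext K (SM n) (nerve_face_sum (Suc n)) (CM.U (Suc n) c) \<in> fin_combs K (SM n)"
      by (rule SM.zext_face_sum_closed[OF K.abelian_group_axioms Uc])
    have T: "translate (Suc n) z k (CM.U (Suc n) c) \<in> fin_combs K (SM (Suc n))"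
      using hom_in_carrier[OF translate_hom[OF z k], of "CM.U (Suc n) c" "Suc n"] Uc by simp
    have "(\<lambda>b. c b \<otimes>\<^bsub>KM\<^esub> single K z k) = lact A (CM.V (Suc n) (CM.U (Suc n) c)) (single K z k)"
      by (simp add: CM.curry_uncurry[OF c] lact_regular[OF c])
    also have "\<dots> = CM.V (Suc n) (translate (Suc n) z k (CM.U (Suc n) c))" by (rule lact_curry[OF Uc z k])
    finally have "bar_d (Suc n) (\<lambda>b. c b \<otimes>\<^bsub>KM\<^esub> single K z k) =
        CM.V n (zext K (SM n) (nerve_face_sum (Suc n)) (translate (Suc n) z k (CM.U (Suc n) c)))"
      by (simp add: bar_d_def CM.uncurry_curry[OF T])
    also have "\<dots> = CM.V n (translate n z k (zext K (SM n) (nerve_face_sum (Suc n)) (CM.U (Suc n) c)))"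
      using face_sum_translate[OF Uc z k] by simp
    also have "\<dots> = lact A (bar_d (Suc n) c) (single K z k)"
      using lact_curry[OF dUc z k] by (simp add: bar_d_def)
    also have "\<dots> = (\<lambda>b. bar_d (Suc n) c b \<otimes>\<^bsub>KM\<^esub> single K z k)" by (rule lact_regular[OF dc])
    finally show "(bar_d (Suc n) \<circ> (\<lambda>r b. c b \<otimes>\<^bsub>KM\<^esub> r)) (single K z k) = (\<lambda>r b. bar_d (Suc n) c b \<otimes>\<^bsub>KM\<^esub> r) (single K z k)"
      by simp
  qed
  then show ?thesis by simp
qed

lemma bar_d_mod_hom: "bar_d (Suc n) \<in> free_map KM (bar_basis (Suc n)) (bar_basis n)"
proof (rule mod_homI)
  show "bar_d (Suc n) (r \<odot>\<^bsub>free_right_module KM (bar_basis (Suc n))\<^esub> c) =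
      r \<odot>\<^bsub>free_right_module KM (bar_basis n)\<^esub> bar_d (Suc n) c"
    if "r \<in> carrier KM" "c \<in> carrier (free_right_module KM (bar_basis (Suc n)))" for r c
    using bar_d_mult[of c n r] that by simp
qed (use hom_in_carrier[OF bar_d_hom[of n]] hom_mult[OF bar_d_hom[of n]] in simp_all)

definition bar_eps :: "((nat \<times> nat \<Rightarrow> 'n \<times> 'm) \<Rightarrow> 'm \<Rightarrow> 'k) \<Rightarrow> 'n \<Rightarrow> 'k" where
  "bar_eps c = zext K (carrier N) (\<lambda>s. frag_of (id.augment s)) (CM.U 0 c)"

lemma augment_hom: "zext K (carrier N) (\<lambda>s. frag_of (id.augment s)) \<in> hom (comb_group K (SM 0)) (comb_group K (carrier N))"
  by (rule K.zext_hom) (simp add: id.augment_in)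

lemma bar_eps_hom: "bar_eps \<in> hom (comb_group KM (bar_basis 0)) (comb_group K (carrier N))"
  using hom_compose[OF CM.uncurry_hom augment_hom] unfolding comp_def bar_eps_def[abs_def] .

lemma augment_single: "s \<in> SM 0 \<Longrightarrow> r \<in> carrier K \<Longrightarrow>
    zext K (carrier N) (\<lambda>s. frag_of (id.augment s)) (single K s r) = single K (id.augment s) r"
  using K.zext_single[of "SM 0" "\<lambda>s. frag_of (id.augment s)" "carrier N" s r] by (simp add: id.augment_in K.zact_frag_of)

lemma augment_map_simplex:
  assumes s: "s \<in> SM 0" and z: "z \<in> carrier M"
  shows "id.augment (map_simplex (\<lambda>m. m) M 0 z s) = id.augment s \<otimes>\<^bsub>N\<^esub> \<phi> z"
proof -
  obtain x a y where b: "bar_data 0 x a" and c: "act_data 0 a y" and F: "s = simplex_of 0 x a y" using s unfolding nerve_iff by blast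
  show ?thesis
    using bar_dataD(1)[OF b le0] act_dataD(1)[OF c le0] z
    by (simp add: F map_simplex_of id.augment_def simplex_of_apply N.m_assoc)
qed

abbreviation "\<Phi> \<equiv> monoid_algebra_map K \<phi>"
abbreviation "KN \<equiv> monoid_algebra K N"

text \<open>Again one-point combinations suffice, and the augmentation turns translation by
  \<open>z\<close> into right multiplication by \<open>\<phi> z\<close>.\<close>

lemma bar_eps_mult:
  assumes c: "c \<in> fin_combs KM (bar_basis 0)" and r: "r \<in> fin_combs K (carrier M)"
  shows "bar_eps (\<lambda>b. c b \<otimes>\<^bsub>KM\<^esub> r) = bar_eps c \<otimes>\<^bsub>KN\<^esub> \<Phi> r"
proof -
  note \<Phi> = monoid_algebra_map_hom[OF K.ring_axioms M.monoid_axioms N.monoid_axioms \<phi>]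
    monoid_algebra_map_single[OF K.ring_axioms M.monoid_axioms N.monoid_axioms \<phi>]
  have ec: "bar_eps c \<in> fin_combs K (carrier N)" using hom_in_carrier[OF bar_eps_hom, of c] c by simp
  have g: "group (comb_group K (carrier N))" by (rule K.group_comb)
  have "(bar_eps \<circ> (\<lambda>r b. c b \<otimes>\<^bsub>KM\<^esub> r)) r = ((\<lambda>d. bar_eps c \<otimes>\<^bsub>KN\<^esub> d) \<circ> \<Phi>) r"
  proof (rule K.comb_hom_eq[OF g hom_compose[OF right_mult_hom[OF c] bar_eps_hom] hom_compose[OF \<Phi>(1) KN.mult_hom_right[OF ec]] _ r])
    fix z k assume z: "z \<in> carrier M" and k: "k \<in> carrier K"
    have Uc: "CM.U 0 c \<in> fin_combs K (SM 0)" by (rule CM.uncurry_comb_in[OF c])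
    have T: "translate 0 z k (CM.U 0 c) \<in> fin_combs K (SM 0)"
      using hom_in_carrier[OF translate_hom[OF z k], of "CM.U 0 c" 0] Uc by simp
    have "(\<lambda>b. c b \<otimes>\<^bsub>KM\<^esub> single K z k) = lact A (CM.V 0 (CM.U 0 c)) (single K z k)"
      by (simp add: CM.curry_uncurry[OF c] lact_regular[OF c])
    also have "\<dots> = CM.V 0 (translate 0 z k (CM.U 0 c))" by (rule lact_curry[OF Uc z k])
    finally have 1: "bar_eps (\<lambda>b. c b \<otimes>\<^bsub>KM\<^esub> single K z k) = zext K (carrier N) (\<lambda>s. frag_of (id.augment s)) (translate 0 z k (CM.U 0 c))"
      by (simp add: bar_eps_def CM.uncurry_curry[OF T])
    have zk: "single K (\<phi> z) k \<in> fin_combs K (carrier N)" using z k by (simp add: K.single_fin_combs)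
    have "(zext K (carrier N) (\<lambda>s. frag_of (id.augment s)) \<circ> translate 0 z k) (CM.U 0 c) =
        ((\<lambda>d. d \<otimes>\<^bsub>KN\<^esub> single K (\<phi> z) k) \<circ> zext K (carrier N) (\<lambda>s. frag_of (id.augment s))) (CM.U 0 c)"
      by (rule K.comb_hom_eq[OF g hom_compose[OF translate_hom[OF z k] augment_hom] hom_compose[OF augment_hom KN.mult_hom_left[OF zk]] _ Uc])
        (use z k in \<open>simp add: translate_single augment_single map_simplex_in augment_map_simplex KN.mult_single id.augment_in\<close>)
    then show "(bar_eps \<circ> (\<lambda>r b. c b \<otimes>\<^bsub>KM\<^esub> r)) (single K z k) = ((\<lambda>d. bar_eps c \<otimes>\<^bsub>KN\<^esub> d) \<circ> \<Phi>) (single K z k)"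
      using 1 z k by (simp add: \<Phi>(2) bar_eps_def)
  qed
  then show ?thesis by simp
qed

lemma right_restrict_simps: "carrier (right_restrict KN \<Phi>) = fin_combs K (carrier N)"
  "\<zero>\<^bsub>right_restrict KN \<Phi>\<^esub> = (\<lambda>v. \<zero>\<^bsub>K\<^esub>)" "c \<oplus>\<^bsub>right_restrict KN \<Phi>\<^esub> d = (\<lambda>v. c v \<oplus>\<^bsub>K\<^esub> d v)"
  "r \<odot>\<^bsub>right_restrict KN \<Phi>\<^esub> c = c \<otimes>\<^bsub>KN\<^esub> \<Phi> r"
  by (simp_all add: right_restrict_def monoid_algebra_def)

text \<open>Exactness is proved for face sums on combinations of \<open>SM n\<close>, with
  \<open>cone_simplex\<close> as extra degeneracy, and carried to the free modules by the mutually
  inverse \<open>CM.U\<close> and \<open>CM.V\<close>. The section \<open>point_simplex\<close>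
  makes the augmentation surjective.\<close>

lemma bar_free_resolution: "free_resolution KM (right_restrict KN \<Phi>) bar_basis bar_d bar_eps"
proof -
  have K: "abelian_group K" by (rule K.abelian_group_axioms)
  note fs = SM.keys_face_sum
  let ?e = "\<lambda>s. frag_of (id.augment s)"
  let ?d = "\<lambda>n. zext K (SM n) (nerve_face_sum (Suc n))"
  have ea: "keys (?e s) \<subseteq> carrier N" if "s \<in> SM 0" for s using id.augment_in[OF that] by simp
  have dV: "bar_d (Suc n) c = CM.V n (?d n (CM.U (Suc n) c))" for n c by (simp add: bar_d_def)
  have d_in: "?d n e \<in> fin_combs K (SM n)" if "e \<in> fin_combs K (SM (Suc n))" for n e
    by (rule SM.zext_face_sum_closed[OF K that])
  have Vz: "CM.V n e = (\<lambda>b. \<zero>\<^bsub>KM\<^esub>) \<longleftrightarrow> e = (\<lambda>s. \<zero>\<^bsub>K\<^esub>)" if e: "e \<in> fin_combs K (SM n)" for n e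
  proof
    assume "CM.V n e = (\<lambda>b. \<zero>\<^bsub>KM\<^esub>)"
    then have "e = CM.U n (\<lambda>b. \<zero>\<^bsub>KM\<^esub>)" using CM.uncurry_curry[OF e] by simp
    also have "\<dots> = (\<lambda>s. \<zero>\<^bsub>K\<^esub>)"
      using hom_one[OF CM.uncurry_hom A.R.group_comb K.group_comb] by simp
    finally show "e = (\<lambda>s. \<zero>\<^bsub>K\<^esub>)" .
  qed (auto simp: curry_comb_def)
  have im: "bar_d (Suc n) ` fin_combs KM (bar_basis (Suc n)) = CM.V n ` ?d n ` fin_combs K (SM (Suc n))" for n
  proof
    show "bar_d (Suc n) ` fin_combs KM (bar_basis (Suc n)) \<subseteq> CM.V n ` ?d n ` fin_combs K (SM (Suc n))"
      using CM.uncurry_comb_in by (auto simp: dV)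
    show "CM.V n ` ?d n ` fin_combs K (SM (Suc n)) \<subseteq> bar_d (Suc n) ` fin_combs KM (bar_basis (Suc n))"
    proof clarify
      fix e assume e: "e \<in> fin_combs K (SM (Suc n))"
      show "CM.V n (?d n e) \<in> bar_d (Suc n) ` fin_combs KM (bar_basis (Suc n))"
        by (rule image_eqI[OF _ CM.curry_comb_in[OF e]]) (simp add: dV CM.uncurry_curry[OF e])
    qed
  qed
  have ker: "{c \<in> fin_combs KM (bar_basis n). f (CM.U n c)} = CM.V n ` {e \<in> fin_combs K (SM n). f e}" for n f
  proof
    show "{c \<in> fin_combs KM (bar_basis n). f (CM.U n c)} \<subseteq> CM.V n ` {e \<in> fin_combs K (SM n). f e}"
    proof clarify
      fix c assume c: "c \<in> fin_combs KM (bar_basis n)" "f (CM.U n c)"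
      show "c \<in> CM.V n ` {e \<in> fin_combs K (SM n). f e}"
        by (rule image_eqI[of _ _ "CM.U n c"]) (use c CM.uncurry_comb_in CM.curry_uncurry in simp_all)
    qed
  qed (auto simp: CM.uncurry_curry CM.curry_comb_in)
  have ex: "?d (Suc n) ` fin_combs K (SM (Suc (Suc n))) = {e \<in> fin_combs K (SM (Suc n)). ?d n e = (\<lambda>s. \<zero>\<^bsub>K\<^esub>)}" for n
    using SM.extra_degeneracy_exact[where \<sigma> = id.cone_simplex and \<epsilon> = id.augment and \<eta> = id.point_simplex and Z = "carrier N", OF id.cone_simplex_in id.face_0_cone id.face_Suc_cone id.face_1_cone id.augment_in id.point_simplex_in K]
      SM.zext_face_sum_zero[OF K] d_in by blast
  have de: "zext K (carrier N) ?e (?d 0 e) = (\<lambda>v. \<zero>\<^bsub>K\<^esub>)" if e: "e \<in> fin_combs K (SM (Suc 0))" for e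
  proof -
    have "zext K (carrier N) ?e (?d 0 e) = zext K (carrier N) (\<lambda>s. frag_extend ?e (nerve_face_sum (Suc 0) s)) e"
      by (rule K.zext_compose[OF fs ea e])
    also have "\<dots> = zext K (carrier N) (\<lambda>_. 0) e"
    proof (rule K.zext_cong[OF _ _ e])
      fix s assume s: "s \<in> SM (Suc 0)"
      show "frag_extend ?e (nerve_face_sum (Suc 0) s) = 0"
        unfolding SM.face_sum_Suc frag_extend_face_sum using id.augment_face[OF s, of 0] id.augment_face[OF s, of "Suc 0"] by simp
    qed simp
    also have "\<dots> = (\<lambda>v. \<zero>\<^bsub>K\<^esub>)" by (rule K.zext_zero[OF e])
    finally show ?thesis .
  qed
  have ex0: "?d 0 ` fin_combs K (SM (Suc 0)) = {e \<in> fin_combs K (SM 0). zext K (carrier N) ?e e = (\<lambda>v. \<zero>\<^bsub>K\<^esub>)}"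
    using SM.extra_degeneracy_exact_0[where \<sigma> = id.cone_simplex and \<epsilon> = id.augment and \<eta> = id.point_simplex and Z = "carrier N", OF id.cone_simplex_in id.face_0_cone id.face_Suc_cone id.face_1_cone id.augment_in id.point_simplex_in K]
      de d_in by blast
  have "b \<in> bar_eps ` fin_combs KM (bar_basis 0)" if b: "b \<in> fin_combs K (carrier N)" for b
  proof -
    let ?p = "\<lambda>x. frag_of (id.point_simplex x)"
    have kp: "keys (?p x) \<subseteq> SM 0" if "x \<in> carrier N" for x using id.point_simplex_in[OF that] by simp
    have pb: "zext K (SM 0) ?p b \<in> fin_combs K (SM 0)" by (rule K.zext_closed[OF kp b])
    have "zext K (carrier N) ?e (zext K (SM 0) ?p b) = zext K (carrier N) (\<lambda>x. frag_extend ?e (?p x)) b"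
      by (rule K.zext_compose[OF kp ea b])
    also have "\<dots> = zext K (carrier N) frag_of b" by (rule K.zext_cong[OF _ _ b]) (simp_all add: id.augment_point)
    also have "\<dots> = b" by (rule K.zext_id[OF b])
    finally have "bar_eps (CM.V 0 (zext K (SM 0) ?p b)) = b" by (simp add: bar_eps_def CM.uncurry_curry[OF pb])
    then show ?thesis using image_eqI[OF _ CM.curry_comb_in[OF pb], of b bar_eps] by simp
  qed
  then have surj: "bar_eps ` fin_combs KM (bar_basis 0) = fin_combs K (carrier N)"
    using hom_in_carrier[OF bar_eps_hom] by auto
  have eps: "bar_eps \<in> mod_hom KM (free_right_module KM (bar_basis 0)) (right_restrict KN \<Phi>)"
    by (rule mod_homI) (use hom_in_carrier[OF bar_eps_hom] hom_mult[OF bar_eps_hom] bar_eps_mult in \<open>simp_all add: right_restrict_simps\<close>)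
  have 0: "bar_d 1 ` fin_combs KM (bar_basis 1) = {c \<in> fin_combs KM (bar_basis 0). bar_eps c = (\<lambda>v. \<zero>\<^bsub>K\<^esub>)}"
    using im[of 0] ker[of 0 "\<lambda>e. zext K (carrier N) ?e e = (\<lambda>v. \<zero>\<^bsub>K\<^esub>)"] ex0 by (simp add: bar_eps_def)
  have Suc: "bar_d (Suc (Suc n)) ` fin_combs KM (bar_basis (Suc (Suc n))) =
      {c \<in> fin_combs KM (bar_basis (Suc n)). bar_d (Suc n) c = (\<lambda>b. \<zero>\<^bsub>KM\<^esub>)}" for n
  proof -
    have "{c \<in> fin_combs KM (bar_basis (Suc n)). bar_d (Suc n) c = (\<lambda>b. \<zero>\<^bsub>KM\<^esub>)} =
        {c \<in> fin_combs KM (bar_basis (Suc n)). ?d n (CM.U (Suc n) c) = (\<lambda>s. \<zero>\<^bsub>K\<^esub>)}"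
      unfolding dV using Vz[OF d_in[OF CM.uncurry_comb_in]] by blast
    then show ?thesis using im[of "Suc n"] ker[of "Suc n" "\<lambda>e. ?d n e = (\<lambda>s. \<zero>\<^bsub>K\<^esub>)"] ex[of n] by simp
  qed
  show ?thesis
    unfolding free_resolution_def Let_def free_right_module_simps right_restrict_simps
    using eps bar_d_mod_hom surj 0 Suc by simp
qed

end

context bar_ring
begin

text \<open>The basis element \<open>G\<close> corresponds to the simplex over \<open>G\<close> with
  initial coordinate \<open>1\<close>. Tensoring with a one-point combination at \<open>y\<close>
  translates this simplex and its faces, and yields the simplex over \<open>P\<close> with initial
  coordinate \<open>y\<close>.\<close>

lemma base_change_bar_d:
  assumes d: "bar_d (Suc n) \<in> free_map KM (bar_basis (Suc n)) (bar_basis n)" and c: "c \<in> fin_combs A (bar_basis (Suc n))"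
  shows "base_change KM A (bar_basis n) (bar_d (Suc n)) c = CP.V n (zext K (SP n) (nerve_face_sum (Suc n)) (CP.U (Suc n) c))"
proof -
  note kf = SP.keys_face_sum
  have zh: "zext K (SP n) (nerve_face_sum (Suc n)) \<in> hom (comb_group K (SP (Suc n))) (comb_group K (SP n))"
    by (rule K.zext_hom[OF kf])
  have "base_change KM A (bar_basis n) (bar_d (Suc n)) c = (CP.V n \<circ> (zext K (SP n) (nerve_face_sum (Suc n)) \<circ> CP.U (Suc n))) c"
  proof (rule CP.curry_hom_eq[OF A.A.group_comb A.base_change_hom[OF d]
      hom_compose[OF hom_compose[OF CP.uncurry_hom zh] CP.curry_hom] _ c])
    fix G y k assume G: "G \<in> bar_basis (Suc n)" and y: "y \<in> carrier P" and k: "k \<in> carrier K"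
    have yk: "single K y k \<in> carrier A" using K.single_fin_combs[OF y k] by simp
    let ?s = "lift_simplex (\<lambda>m. m) M (Suc n) (G, \<one>\<^bsub>M\<^esub>)"
    have s: "?s \<in> SM (Suc n)" using G id.lift_bij[of "Suc n"] by (auto simp: bij_betw_def)
    have s1: "single K ?s \<one>\<^bsub>K\<^esub> \<in> fin_combs K (SM (Suc n))" by (rule K.single_fin_combs[OF s K.one_closed])
    have ds: "zext K (SM n) (nerve_face_sum (Suc n)) (single K ?s \<one>\<^bsub>K\<^esub>) \<in> fin_combs K (SM n)"
      by (rule SM.zext_face_sum_closed[OF K.abelian_group_axioms s1])
    have "base_change KM A (bar_basis n) (bar_d (Suc n)) (single A G (single K y k)) =
        lact A (bar_d (Suc n) (single KM G \<one>\<^bsub>KM\<^esub>)) (single K y k)"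
      by (rule A.base_change_single[OF d G yk])
    also have "bar_d (Suc n) (single KM G \<one>\<^bsub>KM\<^esub>) = CM.V n (zext K (SM n) (nerve_face_sum (Suc n)) (single K ?s \<one>\<^bsub>K\<^esub>))"
      using CM.uncurry_single[OF G M.one_closed K.one_closed] by (simp add: bar_d_def)
    also have "lact A \<dots> (single K y k) = CP.V n (translate n y k (zext K (SM n) (nerve_face_sum (Suc n)) (single K ?s \<one>\<^bsub>K\<^esub>)))"
      by (rule lact_curry[OF ds y k])
    also have "\<dots> = CP.V n (zext K (SP n) (nerve_face_sum (Suc n)) (translate (Suc n) y k (single K ?s \<one>\<^bsub>K\<^esub>)))"
      using face_sum_translate[OF s1 y k] by simp
    also have "translate (Suc n) y k (single K ?s \<one>\<^bsub>K\<^esub>) = single K (lift_simplex \<psi> P (Suc n) (G, y)) k"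
      using translate_single[OF y k s K.one_closed] map_lift_simplex[OF G M.one_closed y] y k by (simp add: \<psi>_simps)
    also have "\<dots> = CP.U (Suc n) (single A G (single K y k))"
      using CP.uncurry_single[OF G y k] by simp
    finally show "base_change KM A (bar_basis n) (bar_d (Suc n)) (single A G (single K y k)) =
        (CP.V n \<circ> (zext K (SP n) (nerve_face_sum (Suc n)) \<circ> CP.U (Suc n))) (single A G (single K y k))" by simp
  qed
  then show ?thesis by simp
qed

text \<open>Both sides express exactness of the face sums on combinations of \<open>SP\<close>: Tor
  through the bar resolution and currying, singular homology through the cells of the
  realization.\<close>

lemma Tor_bar_trivial_iff:
  "trivial_group (Tor KM (Suc n) (right_restrict (monoid_algebra K N) (monoid_algebra_map K \<phi>)) A) \<longleftrightarrow>
   trivial_group (singular_homology K (Suc n) (classifying_space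
     (two_sided_category (carrier N) (\<lambda>n m. n \<otimes>\<^bsub>N\<^esub> \<phi> m) M (\<lambda>m y. \<psi> m \<otimes>\<^bsub>P\<^esub> y) (carrier P))))"
proof -
  interpret B: bar_resolution K M N \<phi>
    by (intro bar_resolution.intro bar_ring.intro id.bar_setting_axioms K.ring_axioms)
  let ?d = "\<lambda>n. zext K (SP n) (nerve_face_sum (Suc n))"
  have M: "right_module KM (right_restrict (monoid_algebra K N) (monoid_algebra_map K \<phi>))"
    by (rule right_module_right_restrict[OF KM.ring_monoid_algebra B.KN.ring_monoid_algebra
        monoid_algebra_map_ring_hom[OF K.ring_axioms M.monoid_axioms N.monoid_axioms \<phi>]])
  note bc = base_change_bar_d[OF B.bar_d_mod_hom]
  have d_in: "?d n e \<in> fin_combs K (SP n)" if "e \<in> fin_combs K (SP (Suc n))" for n e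
    by (rule SP.zext_face_sum_closed[OF K.abelian_group_axioms that])
  have U0: "CP.U n (\<lambda>b. \<zero>\<^bsub>A\<^esub>) = (\<lambda>s. \<zero>\<^bsub>K\<^esub>)" for n
    using hom_one[OF CP.uncurry_hom A.A.group_comb K.group_comb] by simp
  have z: "CP.V n (?d n (CP.U (Suc n) c)) = (\<lambda>b. \<zero>\<^bsub>A\<^esub>) \<longleftrightarrow> ?d n (CP.U (Suc n) c) = (\<lambda>s. \<zero>\<^bsub>K\<^esub>)"
    if c: "c \<in> fin_combs A (bar_basis (Suc n))" for n c
  proof
    assume "CP.V n (?d n (CP.U (Suc n) c)) = (\<lambda>b. \<zero>\<^bsub>A\<^esub>)"
    from arg_cong[where f = "CP.U n", OF this] show "?d n (CP.U (Suc n) c) = (\<lambda>s. \<zero>\<^bsub>K\<^esub>)"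
      using CP.uncurry_curry[OF d_in[OF CP.uncurry_comb_in[OF c]]] U0 by simp
  qed (auto simp: curry_comb_def)
  have im: "c \<in> base_change KM A (bar_basis (Suc n)) (bar_d (Suc (Suc n))) ` fin_combs A (bar_basis (Suc (Suc n))) \<longleftrightarrow>
      CP.U (Suc n) c \<in> ?d (Suc n) ` fin_combs K (SP (Suc (Suc n)))" if c: "c \<in> fin_combs A (bar_basis (Suc n))" for n c
  proof
    assume "c \<in> base_change KM A (bar_basis (Suc n)) (bar_d (Suc (Suc n))) ` fin_combs A (bar_basis (Suc (Suc n)))"
    then obtain e where e: "e \<in> fin_combs A (bar_basis (Suc (Suc n)))" "c = CP.V (Suc n) (?d (Suc n) (CP.U (Suc (Suc n)) e))"
      using bc by auto
    then show "CP.U (Suc n) c \<in> ?d (Suc n) ` fin_combs K (SP (Suc (Suc n)))"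
      using CP.uncurry_curry[OF d_in[OF CP.uncurry_comb_in[OF e(1)]]] CP.uncurry_comb_in[OF e(1)] by simp
  next
    assume "CP.U (Suc n) c \<in> ?d (Suc n) ` fin_combs K (SP (Suc (Suc n)))"
    then obtain e where e: "e \<in> fin_combs K (SP (Suc (Suc n)))" "CP.U (Suc n) c = ?d (Suc n) e" by blast
    have "base_change KM A (bar_basis (Suc n)) (bar_d (Suc (Suc n))) (CP.V (Suc (Suc n)) e) = CP.V (Suc n) (CP.U (Suc n) c)"
      unfolding bc[OF CP.curry_comb_in[OF e(1)]] CP.uncurry_curry[OF e(1)] e(2) ..
    also have "\<dots> = c" by (rule CP.curry_uncurry[OF c])
    finally show "c \<in> base_change KM A (bar_basis (Suc n)) (bar_d (Suc (Suc n))) ` fin_combs A (bar_basis (Suc (Suc n)))"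
      using CP.curry_comb_in[OF e(1)] by (metis image_eqI)
  qed
  have "trivial_group (Tor KM (Suc n) (right_restrict (monoid_algebra K N) (monoid_algebra_map K \<phi>)) A) \<longleftrightarrow>
      base_change_exact KM A bar_basis bar_d n"
    by (rule A.Tor_trivial_iff[OF M B.bar_free_resolution])
  also have "\<dots> \<longleftrightarrow> (\<forall>c\<in>fin_combs A (bar_basis (Suc n)). ?d n (CP.U (Suc n) c) = (\<lambda>s. \<zero>\<^bsub>K\<^esub>) \<longrightarrow>
      CP.U (Suc n) c \<in> ?d (Suc n) ` fin_combs K (SP (Suc (Suc n))))"
    unfolding base_change_exact_def by (simp only: bc z im cong: ball_cong)
  also have "\<dots> \<longleftrightarrow> (\<forall>e\<in>fin_combs K (SP (Suc n)). ?d n e = (\<lambda>s. \<zero>\<^bsub>K\<^esub>) \<longrightarrow> e \<in> ?d (Suc n) ` fin_combs K (SP (Suc (Suc n))))"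
  proof -
    have "CP.U (Suc n) ` fin_combs A (bar_basis (Suc n)) = fin_combs K (SP (Suc n))"
    proof (intro equalityI subsetI)
      show "e \<in> CP.U (Suc n) ` fin_combs A (bar_basis (Suc n))" if e: "e \<in> fin_combs K (SP (Suc n))" for e
        by (rule image_eqI[where f = "CP.U (Suc n)", OF CP.uncurry_curry[OF e, symmetric] CP.curry_comb_in[OF e]])
    qed (use CP.uncurry_comb_in in blast)
    from this[symmetric] show ?thesis by simp
  qed
  also have "\<dots> \<longleftrightarrow> trivial_group (singular_homology K (Suc n) (classifying_space
     (two_sided_category (carrier N) (\<lambda>n m. n \<otimes>\<^bsub>N\<^esub> \<phi> m) M (\<lambda>m y. \<psi> m \<otimes>\<^bsub>P\<^esub> y) (carrier P))))"
    unfolding classifying_space_def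
    by (rule cell_space.singular_homology_trivial_iff[OF SP.cell_space_realization K.ring_axioms, symmetric])
  finally show ?thesis .
qed

end

theorem theorem3p17:
  fixes M :: "('m, 'x) monoid_scheme" and N :: "('n, 'y) monoid_scheme"
    and K :: "('k, 'z) ring_scheme" and \<phi> :: "'m \<Rightarrow> 'n"
  assumes "monoid M" and "monoid N" and "cring K" and "\<one>\<^bsub>K\<^esub> \<noteq> \<zero>\<^bsub>K\<^esub>"
    and "\<phi> \<in> monoid_hom M N"
  shows "homological_epi (monoid_algebra K M) (monoid_algebra K N) (monoid_algebra_map K \<phi>) \<longleftrightarrow>
    monoid_epi M N \<phi> \<and>
    (\<forall>i\<ge>1. trivial_group (singular_homology K i
      (two_sided_bar (carrier N) (\<lambda>n m. n \<otimes>\<^bsub>N\<^esub> \<phi> m) M (\<lambda>m n. \<phi> m \<otimes>\<^bsub>N\<^esub> n) (carrier N))))"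
proof -
  have K: "ring K" using assms(3) by (rule cring.axioms)
  \<comment> \<open>With \<open>P = N\<close> and \<open>\<psi> = \<phi>\<close>, the module
    \<open>A\<close> is the left restriction that occurs in \<open>homological_epi\<close>.\<close>
  interpret bar_ring K M N \<phi> N \<phi>
    by (intro bar_ring.intro bar_setting.intro bar_setting_axioms.intro assms(1,2,5) K)
  let ?H = "\<lambda>i. singular_homology K i
      (two_sided_bar (carrier N) (\<lambda>n m. n \<otimes>\<^bsub>N\<^esub> \<phi> m) M (\<lambda>m n. \<phi> m \<otimes>\<^bsub>N\<^esub> n) (carrier N))"
  have "trivial_group (Tor KM i (right_restrict (monoid_algebra K N) (monoid_algebra_map K \<phi>)) A) \<longleftrightarrow> trivial_group (?H i)"
    if "i \<ge> 1" for i
    using Tor_bar_trivial_iff[of "i - 1"] that by (simp add: two_sided_bar_def)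
  then show ?thesis
    unfolding homological_epi_def using ring_epi_monoid_algebra_iff[OF K assms(1,2,4,5)] by blast
qed

end
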